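(* The property of having rank one is typical in the space $(\mathbf{Mix}_\infty, r)$ of mixing automorphisms of an infinite sigma-finite measure space: the set of rank-one transformations belonging to $\mathbf{Mix}_\infty$ is a dense $G_\delta$-subset of $\mathbf{Mix}_\infty$ with respect to the topology of the metric $r$.
   Context: **Space and metrics.** Let $(X,\mathcal B,\mu)$ be a measure space isomorphic to the real line $\mathbf R$ with Lebesgue measure. $\mathbf{Aut}_\infty=\mathbf{Aut}(\mu)$ is the group of all invertible measure-preserving transformations (automorphisms) of $(X,\mathcal B,\mu)$, with transformations equal almost everywhere identified. Fix a sequence $\{A_i\}_{i\ge 1}$ of sets of finite measure, dense in the family of all measurable sets of finite measure (with respect to the pseudometric $\mu(A\Delta B)$), and such that $\sum_i 2^{-i}\mu(A_i)<\infty$, so that the sums below converge. Define $$\rho(S,T)=\sum_i 2^{-i}\left(\mu(SA_i\Delta TA_i)+\mu(S^{-1}A_i\Delta T^{-1}A_i)\right),$$ $$d_w(S,T)=\sum_{i,j=1}^\infty 2^{-i-j}\left|\mu(SA_i\cap A_j)-\mu(TA_i\cap A_j)\right|,$$ $$r(S,T)=\rho(S,T)+\sup_{n>0}d_w(S^n,T^n).$$ An automorphism $T$ is called mixing if $T^n\to_w 0$, that is, $\mu(T^nA\cap B)\to 0$ as $n\to\infty$ for all measurable $A,B$ of finite measure. Set $\mathbf{Mix}_\infty=\{T\in\mathbf{Aut}(\mu): T^n\to_w 0\}$, equipped with the metric $r$. **Rank one.** A rank-one construction is given by a natural number $h_1$, a sequence of natural numbers $r_j\to\infty$, and integer vectors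 $\bar s_j=(s_j(1),\dots,s_j(r_j))$ with $s_j(i)\ge 0$. At step $j=1$ one has disjoint half-intervals $E_1,SE_1,\dots,S^{h_1-1}E_1$ of equal measure. At step $j$ one has disjoint half-intervals $E_j,SE_j,\dots,S^{h_j-1}E_j$ (the tower of stage $j$, with union $X_j$), where $S$ acts on $E_j,\dots,S^{h_j-2}E_j$ by parallel translation onto the next half-interval. Represent $E_j$ as a disjoint union of $r_j$ half-intervals $E_j^1,\dots,E_j^{r_j}$ of equal length; the $i$-th column is $E_j^i,SE_j^i,\dots,S^{h_j-1}E_j^i$, with union denoted $X_{i,j}$. Above the $i$-th column add $s_j(i)$ new disjoint half-intervals of the same measure as $E_j^i$, obtaining the disjoint sets $E_j^i,SE_j^i,\dots,S^{h_j+s_j(i)-1}E_j^i$. Put $E_{j+1}=E_j^1$ and $S^{h_j+s_j(i)}E_j^i=E_j^{i+1}$ for $i<r_j$. This gives the tower of stage $j+1$: $E_{j+1},SE_{j+1},\dots,S^{h_{j+1}-1}E_{j+1}$, with $h_{j+1}=h_jr_j+\sum_{i=1}^{r_j}s_j(i)$. The partial definition of $S$ at stage $j$ is preserved at later stages, so one obtains an invertible (mod null sets) Lebesgue-measure-preserving transformation $S$ of $\bigcup_jX_j$. An automorphism is a rank-one transformation if it is isomorphic (via an invertible measure-preserving map, mod null sets) to some such construction. *)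

theory Defs
  imports "HOL-Analysis.Analysis"
begin

section \<open>Isomorphism modulo null sets\<close>

definition mp_isomorphism :: "'a measure \<Rightarrow> 'b measure \<Rightarrow> ('a \<Rightarrow> 'b) \<Rightarrow> bool" where
  "mp_isomorphism M N f \<longleftrightarrow>
     (\<exists>X Y. X \<in> sets M \<and> space M - X \<in> null_sets M \<and>
            Y \<in> sets N \<and> space N - Y \<in> null_sets N \<and>
            bij_betw f X Y \<and>
            f \<in> restrict_space M X \<rightarrow>\<^sub>M restrict_space N Y \<and>
            inv_into X f \<in> restrict_space N Y \<rightarrow>\<^sub>M restrict_space M X \<and>
            distr (restrict_space M X) (restrict_space N Y) f = restrict_space N Y)"

section \<open>Automorphisms and mixing\<close>

text \<open>A transformation that is invertible only modulo null sets coincides almost everywhere with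
  an everywhere bijective one (restrict it to an invariant conull set and put the identity
  elsewhere), so classes of everywhere bijective representatives suffice.\<close>

definition automorphisms :: "'a measure \<Rightarrow> ('a \<Rightarrow> 'a) set" where
  "automorphisms M = {T. T \<in> M \<rightarrow>\<^sub>M M \<and> bij_betw T (space M) (space M) \<and>
     inv_into (space M) T \<in> M \<rightarrow>\<^sub>M M \<and> distr M M T = M}"

definition ae_rel :: "'a measure \<Rightarrow> (('a \<Rightarrow> 'a) \<times> ('a \<Rightarrow> 'a)) set" where
  "ae_rel M = {(S, T). S \<in> automorphisms M \<and> T \<in> automorphisms M \<and> (AE x in M. S x = T x)}"

definition mixing :: "'a measure \<Rightarrow> ('a \<Rightarrow> 'a) \<Rightarrow> bool" where
  "mixing M T \<longleftrightarrow> (\<forall>A\<in>fmeasurable M. \<forall>B\<in>fmeasurable M.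
     (\<lambda>n. measure M ((T ^^ n) ` A \<inter> B)) \<longlonglongrightarrow> 0)"

definition Mix :: "'a measure \<Rightarrow> ('a \<Rightarrow> 'a) set set" where
  "Mix M = {T \<in> automorphisms M. mixing M T} // ae_rel M"

section \<open>The metric\<close>

text \<open>Only the members \<open>A i\<close> with \<open>i \<ge> 1\<close> are used.\<close>

definition dense_family :: "'a measure \<Rightarrow> (nat \<Rightarrow> 'a set) \<Rightarrow> bool" where
  "dense_family M A \<longleftrightarrow>
     (\<forall>i\<ge>1. A i \<in> fmeasurable M) \<and>
     (\<forall>B\<in>fmeasurable M. \<forall>\<epsilon>>0. \<exists>i\<ge>1. measure M (sym_diff (A i) B) < \<epsilon>) \<and>
     (\<lambda>i. (1/2) ^ i * measure M (A i)) summable_on {1..}"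

definition rho :: "'a measure \<Rightarrow> (nat \<Rightarrow> 'a set) \<Rightarrow> ('a \<Rightarrow> 'a) \<Rightarrow> ('a \<Rightarrow> 'a) \<Rightarrow> real" where
  "rho M A S T = (\<Sum>\<^sub>\<infinity>i\<in>{1..}. (1/2) ^ i *
     (measure M (sym_diff (S ` A i) (T ` A i)) +
      measure M (sym_diff (S -` A i \<inter> space M) (T -` A i \<inter> space M))))"

definition d_w :: "'a measure \<Rightarrow> (nat \<Rightarrow> 'a set) \<Rightarrow> ('a \<Rightarrow> 'a) \<Rightarrow> ('a \<Rightarrow> 'a) \<Rightarrow> real" where
  "d_w M A S T = (\<Sum>\<^sub>\<infinity>(i,j)\<in>{1..} \<times> {1..}. (1/2) ^ (i + j) *
     \<bar>measure M (S ` A i \<inter> A j) - measure M (T ` A i \<inter> A j)\<bar>)"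

definition r_dist :: "'a measure \<Rightarrow> (nat \<Rightarrow> 'a set) \<Rightarrow> ('a \<Rightarrow> 'a) \<Rightarrow> ('a \<Rightarrow> 'a) \<Rightarrow> real" where
  "r_dist M A S T = rho M A S T + (SUP n\<in>{0<..}. d_w M A (S ^^ n) (T ^^ n))"

text \<open>The value of \<^term>\<open>r_dist M A\<close> does not change when its arguments change on null sets, so
  it descends to classes.\<close>

definition r_metric ::
  "'a measure \<Rightarrow> (nat \<Rightarrow> 'a set) \<Rightarrow> ('a \<Rightarrow> 'a) set \<Rightarrow> ('a \<Rightarrow> 'a) set \<Rightarrow> real" where
  "r_metric M A P Q = r_dist M A (SOME S. S \<in> P) (SOME T. T \<in> Q)"

definition Mix_topology :: "'a measure \<Rightarrow> (nat \<Rightarrow> 'a set) \<Rightarrow> ('a \<Rightarrow> 'a) set topology" where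
  "Mix_topology M A = Metric_space.mtopology (Mix M) (r_metric M A)"

section \<open>Rank one\<close>

definition half_interval :: "real set \<Rightarrow> bool" where
  "half_interval I \<longleftrightarrow> (\<exists>a b. a < b \<and> I = {a..<b})"

definition tower :: "(real \<Rightarrow> real) \<Rightarrow> real set \<Rightarrow> nat \<Rightarrow> bool" where
  "tower S E h \<longleftrightarrow>
     (\<forall>k<h. half_interval ((S ^^ k) ` E)) \<and>
     disjoint_family_on (\<lambda>k. (S ^^ k) ` E) {..<h} \<and>
     (\<forall>k. Suc k < h \<longrightarrow> (\<exists>c. \<forall>x\<in>(S ^^ k) ` E. S x = x + c))"

definition tower_union :: "(real \<Rightarrow> real) \<Rightarrow> real set \<Rightarrow> nat \<Rightarrow> real set" where
  "tower_union S E h = (\<Union>k<h. (S ^^ k) ` E)"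

text \<open>Stages and columns are numbered from \<open>1\<close>; \<open>C j i\<close> is the base of the \<open>i\<close>-th column of stage
  \<open>j\<close>. The total function \<open>S\<close> is constrained only where the construction defines it, that is,
  off the top level of the tower at some stage; this is almost everywhere on the union of the
  towers, the levels of stage \<open>j\<close> having measure tending to \<open>0\<close>. That the spacers are half-intervals
  of the right length, disjoint from each other, on which \<open>S\<close> is a translation, is
  \<^const>\<open>tower\<close> at stage \<open>Suc j\<close>.\<close>

definition rank_one_construction ::
  "(nat \<Rightarrow> nat) \<Rightarrow> (nat \<Rightarrow> nat) \<Rightarrow> (nat \<Rightarrow> nat \<Rightarrow> nat) \<Rightarrow>
   (nat \<Rightarrow> real set) \<Rightarrow> (nat \<Rightarrow> nat \<Rightarrow> real set) \<Rightarrow> (real \<Rightarrow> real) \<Rightarrow> bool" where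
  "rank_one_construction h r s E C S \<longleftrightarrow>
     0 < h 1 \<and> (\<forall>j\<ge>1. 0 < r j) \<and> filterlim r at_top sequentially \<and>
     (\<forall>j\<ge>1. h (Suc j) = h j * r j + (\<Sum>i=1..r j. s j i)) \<and>
     (\<forall>j\<ge>1. tower S (E j) (h j)) \<and>
     (\<forall>j\<ge>1.
        (\<forall>i\<in>{1..r j}. half_interval (C j i) \<and>
                        measure lebesgue (C j i) = measure lebesgue (C j 1)) \<and>
        disjoint_family_on (C j) {1..r j} \<and>
        E j = (\<Union>i\<in>{1..r j}. C j i) \<and>
        (\<forall>i\<in>{1..r j}. \<forall>k<s j i. (S ^^ (h j + k)) ` C j i \<inter> tower_union S (E j) (h j) = {}) \<and>
        E (Suc j) = C j 1 \<and>
        (\<forall>i\<in>{1..<r j}. (S ^^ (h j + s j i)) ` C j i = C j (Suc i)))"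

definition rank_one :: "'a measure \<Rightarrow> ('a \<Rightarrow> 'a) \<Rightarrow> bool" where
  "rank_one M T \<longleftrightarrow>
     (\<exists>h r s E C S f. rank_one_construction h r s E C S \<and>
        mp_isomorphism M (restrict_space lebesgue (\<Union>j\<in>{1..}. tower_union S (E j) (h j))) f \<and>
        (AE x in M. f (T x) = S (f x)))"

definition rank_one_Mix :: "'a measure \<Rightarrow> ('a \<Rightarrow> 'a) set set" where
  "rank_one_Mix M = {T \<in> automorphisms M. mixing M T \<and> rank_one M T} // ae_rel M"

end

theory Submission
  imports Defs
begin

text \<open>Everything rests on one description of rank one: an automorphism \<open>T\<close> has
  rank one iff for every \<open>k\<close> there is a base \<open>B\<close> of small positive measure
  with disjoint levels B, T B, ..., T^(h-1) B such that unions of levels approximate each of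
  \<open>A 1\<close>, ..., \<open>A (k+1)\<close> within 1/(k+1). This is
  \<open>approx_tower T k\<close>. Since \<open>rho\<close> controls finitely many images of
  \<open>B\<close>, each of these conditions is open (\<open>approx_tower_open\<close>), and the
  rank-one classes form a countable intersection of open sets.

  Necessity (\<open>rank_one_imp_approx_tower\<close>): the levels of late stages are intervals
  whose lengths tend to 0, so unions of them approximate compact sets and hence all sets of finite
  measure. Sufficiency (\<open>approx_tower_imp_rank_one\<close>): \<open>ex_base_sequence\<close>
  selects towers, each almost cut and stacked into the next, with rapidly decreasing errors.
  Rewriting a base in terms of later and later towers and passing to the almost sure limit corrects
  the bases to exactly nested ones (\<open>E_cut\<close>). Two disjoint sets of finite positive
  measure are always joined by an orbit in at least one direction, so a forward invariant set that
  is not null is conull, and the nested towers exhaust the space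
  (\<open>forward_invariant_conull\<close>). The levels through a point correspond to nested
  intervals on the half-line; their limit is a coordinate that conjugates \<open>T\<close> to an
  explicit cutting and stacking map, and it is injective because the levels separate points
  (\<open>f_inj\<close>).

  Density (\<open>rank_one_dense\<close>): let \<open>T\<close> be mixing, let \<open>Y\<close> be a
  set of finite measure containing the finitely many \<open>A i\<close> that matter, and let
  \<open>Z\<close> be the union of finitely many images and preimages of \<open>Y\<close>. By
  mixing, most points of \<open>Y\<close> lie on runs of their orbit inside \<open>Z\<close> of
  bounded length. Cutting the sets of starting points of runs into pieces of one common measure
  yields finitely many columns along which \<open>T\<close> is kept (\<open>ex_run_columns\<close>).
  They are placed into a first tower at the levels \<open>gap H m\<close>, the other levels of this
  tower being taken from the rest of the space, and the map is continued by cutting and stacking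
  with columns at the positions 8 h_j (2^i - 1). A difference of two powers of 2 determines both
  powers, so as long as the orbit stays inside the next tower, only one column of a stage can reach
  a later column at a given time \<open>n\<close>. Columns are made very thin, whence the returns to
  tower \<open>j\<close> other than by climbing inside it have measure at most 2 c 2^(-j), for every
  \<open>n\<close> (\<open>ret_le\<close>).

  From time \<open>h j\<close> on, all returns to tower \<open>j\<close> are of this kind, so the
  new map \<open>S\<close> is mixing. At stage 0 the same estimate, valid for all times
  simultaneously, shows that the n-th powers of \<open>S\<close> and \<open>T\<close> agree at the
  points of \<open>Y\<close> that either of them brings back to \<open>Y\<close>, apart from a small
  set whose measure is bounded independently of \<open>n\<close> (\<open>ex_close_rank_one\<close>).
  This uniformity is what the supremum in the metric asks for.\<close>

section \<open>Lusin's theorem and Borel images\<close>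

text \<open>Lusin's theorem. The preimages of the sets \<open>U n\<close> of a countable base, and
  the complements of these preimages, are shrunk to closed sets \<open>K n\<close> and
  \<open>C n\<close>. On the intersection \<open>F\<close> of the sets
  \<open>K n \<union> C n\<close> the preimage of \<open>U n\<close> is what \<open>C n\<close>
  leaves, hence relatively open.\<close>

lemma continuous_on_large_closed:
  fixes g :: "real \<Rightarrow> real"
  assumes g: "g \<in> borel_measurable lebesgue" and e: "e > 0"
  shows "\<exists>F. closed F \<and> continuous_on F g \<and> emeasure lebesgue (- F) \<le> ennreal e"
proof -
  obtain BB :: "real set set" where BB: "countable BB" "topological_basis BB"
    using ex_countable_basis by blast
  have ne: "BB \<noteq> {}"
    using topological_basisE[OF BB(2) open_UNIV UNIV_I] by blast
  define U where "U = from_nat_into BB"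
  have Uo: "open (U n)" for n
    unfolding U_def using BB(2) from_nat_into[OF ne] topological_basis_open by blast
  have Ubase: "\<exists>n. x \<in> U n \<and> U n \<subseteq> W" if W: "open W" "x \<in> W" for x W
  proof -
    obtain b where "b \<in> BB" "x \<in> b" "b \<subseteq> W"
      using topological_basisE[OF BB(2) W] by blast
    then show ?thesis
      unfolding U_def by (metis BB(1) from_nat_into_surj)
  qed
  have gU: "g -` U n \<in> sets lebesgue" for n
    using measurable_sets[OF g, of "U n"] Uo by simp
  \<comment> \<open>Two losses of this size for every \<open>n\<close> add up to
    \<open>e\<close>.\<close>
  have pos: "e * (1/2)^(n+2) > 0" for n using e by simp
  have "\<exists>K. closed K \<and> K \<subseteq> g -` U n \<and> emeasure lebesgue (g -` U n - K) < ennreal (e * (1/2)^(n+2))" for n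
    using sets_lebesgue_inner_closed[OF gU pos] by metis
  then obtain K where K: "\<And>n. closed (K n)" "\<And>n. K n \<subseteq> g -` U n"
    "\<And>n. emeasure lebesgue (g -` U n - K n) < ennreal (e * (1/2)^(n+2))" by metis
  have "\<exists>K. closed K \<and> K \<subseteq> - (g -` U n) \<and> emeasure lebesgue (- (g -` U n) - K) < ennreal (e * (1/2)^(n+2))" for n
    using sets_lebesgue_inner_closed[OF _ pos, of "- (g -` U n)"] gU
    by (metis Compl_in_sets_lebesgue)
  then obtain C where C: "\<And>n. closed (C n)" "\<And>n. C n \<subseteq> - (g -` U n)"
    "\<And>n. emeasure lebesgue (- (g -` U n) - C n) < ennreal (e * (1/2)^(n+2))" by metis
  define F where "F = (\<Inter>n. K n \<union> C n)"
  have Fc: "closed F" unfolding F_def using K(1) C(1) by auto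
  have cont: "continuous_on F g"
    unfolding continuous_on_open_invariant
  proof (intro allI impI)
    fix B :: "real set" assume B: "open B"
    \<comment> \<open>A point of \<open>F\<close> outside \<open>C n\<close> lies in
      \<open>K n\<close> and is therefore mapped into \<open>U n\<close>.\<close>
    let ?A = "\<Union>n\<in>{n. U n \<subseteq> B}. - C n"
    have "open ?A" using C(1) by auto
    moreover have "?A \<inter> F = g -` B \<inter> F"
    proof (intro set_eqI iffI)
      fix x assume "x \<in> ?A \<inter> F"
      then obtain n where "x \<notin> C n" "x \<in> F" "U n \<subseteq> B" by blast
      then show "x \<in> g -` B \<inter> F" using K(2)[of n] unfolding F_def by blast
    next
      fix x assume x: "x \<in> g -` B \<inter> F"
      then obtain n where "g x \<in> U n" "U n \<subseteq> B" using Ubase[OF B, of "g x"] by blast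
      then show "x \<in> ?A \<inter> F" using C(2)[of n] x by blast
    qed
    ultimately show "\<exists>A. open A \<and> A \<inter> F = g -` B \<inter> F" by blast
  qed
  let ?N = "\<lambda>n. (g -` U n - K n) \<union> (- (g -` U n) - C n)"
  have Nm: "?N n \<in> sets lebesgue" for n
    using gU K(1) C(1) by (intro sets.Un sets.Diff) (auto simp: Compl_in_sets_lebesgue)
  have "- F \<subseteq> (\<Union>n. ?N n)" unfolding F_def by auto
  then have "emeasure lebesgue (- F) \<le> emeasure lebesgue (\<Union>n. ?N n)"
    using Nm by (intro emeasure_mono sets.countable_UN') auto
  also have "\<dots> \<le> (\<Sum>n. emeasure lebesgue (?N n))"
    using Nm by (intro emeasure_subadditive_countably) auto
  also have "\<dots> \<le> (\<Sum>n. ennreal (e * (1/2)^(n+1)))"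
  proof (intro suminf_le)
    fix n
    have "emeasure lebesgue (?N n) \<le> emeasure lebesgue (g -` U n - K n) + emeasure lebesgue (- (g -` U n) - C n)"
      using gU K(1) C(1) by (intro emeasure_subadditive sets.Diff) (auto simp: Compl_in_sets_lebesgue)
    also have "\<dots> \<le> ennreal (e * (1/2)^(n+2)) + ennreal (e * (1/2)^(n+2))"
      using K(3) C(3) by (intro add_mono) (auto intro: less_imp_le)
    also have "\<dots> = ennreal (e * (1/2)^(n+1))"
      using e by (subst ennreal_plus[symmetric]) (auto simp: field_simps)
    finally show "emeasure lebesgue (?N n) \<le> ennreal (e * (1/2)^(n+1))" .
  qed auto
  also have "\<dots> = ennreal (\<Sum>n. e * (1/2)^(n+1))"
    using e by (intro suminf_ennreal2) (auto intro!: summable_mult summable_geometric)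
  also have "(\<Sum>n. e * (1/2)^(n+1)) = e"
    using power_half_series by (intro sums_unique[symmetric]) (auto intro: sums_mult[where a = "1::real", simplified] dest: sums_mult[where c = e])
  finally show ?thesis using Fc cont by blast
qed

text \<open>A continuous function maps compact sets to compact sets, and countable unions of these
  are Borel. Lusin's theorem together with inner regularity fills \<open>E\<close> with such compact
  sets up to a null set.\<close>

lemma lusin_borel_image:
  fixes g :: "real \<Rightarrow> real"
  assumes g: "g \<in> borel_measurable lebesgue" and E: "E \<in> sets lebesgue"
  shows "\<exists>E'\<in>sets borel. E' \<subseteq> E \<and> E - E' \<in> null_sets lebesgue \<and> g ` E' \<in> sets borel"
proof -
  have "\<exists>F. closed F \<and> continuous_on F g \<and> emeasure lebesgue (- F) \<le> ennreal ((1/2)^k)" for k :: nat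
    by (rule continuous_on_large_closed[OF g]) simp
  then obtain F where F: "\<And>k. closed (F k)" "\<And>k. continuous_on (F k) g"
    "\<And>k::nat. emeasure lebesgue (- F k) \<le> ennreal ((1/2)^k)" by metis
  have "\<exists>C. closed C \<and> C \<subseteq> E \<and> emeasure lebesgue (E - C) < ennreal ((1/2)^k)" for k :: nat
    using sets_lebesgue_inner_closed[OF E, of "(1/2)^k"] by (metis half_gt_zero zero_less_one zero_less_power)
  then obtain C where C: "\<And>k. closed (C k)" "\<And>k. C k \<subseteq> E" 
    "\<And>k::nat. emeasure lebesgue (E - C k) < ennreal ((1/2)^k)" by metis
  define Q where "Q = (\<lambda>k (m::nat). C k \<inter> F k \<inter> cball 0 (real m))"
  have Qc: "compact (Q k m)" for k m
    unfolding Q_def using C(1) F(1) by (intro closed_Int_compact closed_Int) auto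
  define E' where "E' = (\<Union>k. \<Union>m. Q k m)"
  have E'b: "E' \<in> sets borel" unfolding E'_def
    by (intro sets.countable_UN' ) (auto intro: borel_compact Qc)
  have sub: "E' \<subseteq> E" unfolding E'_def Q_def using C(2) by auto
  have "compact (g ` Q k m)" for k m
    using Qc by (intro compact_continuous_image continuous_on_subset[OF F(2)[of k]]) (auto simp: Q_def)
  then have im: "g ` E' \<in> sets borel" unfolding E'_def image_UN
    by (intro sets.countable_UN') (auto intro: borel_compact)
  have EE: "E - E' \<in> sets lebesgue" using E E'b by auto
  have le: "emeasure lebesgue (E - E') \<le> ennreal (2 * (1/2)^k)" for k
  proof -
    \<comment> \<open>The balls cover the line, so only the two losses of index \<open>k\<close>
      remain, and \<open>k\<close> is arbitrary.\<close>
    have "E - E' \<subseteq> (E - C k) \<union> (- F k)"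
    proof
      fix x assume "x \<in> E - E'"
      obtain m where "\<bar>x\<bar> \<le> real m" using real_arch_simple by blast
      then show "x \<in> (E - C k) \<union> (- F k)" using \<open>x \<in> E - E'\<close> unfolding E'_def Q_def by auto
    qed
    then have "emeasure lebesgue (E - E') \<le> emeasure lebesgue ((E - C k) \<union> (- F k))"
      using E C(1) F(1) by (intro emeasure_mono sets.Un sets.Diff) (auto simp: Compl_in_sets_lebesgue)
    also have "\<dots> \<le> emeasure lebesgue (E - C k) + emeasure lebesgue (- F k)"
      using E C(1) F(1) by (intro emeasure_subadditive sets.Diff) (auto simp: Compl_in_sets_lebesgue)
    also have "\<dots> \<le> ennreal ((1/2)^k) + ennreal ((1/2)^k)"
      using C(3)[of k] F(3)[of k] by (intro add_mono) auto
    finally show ?thesis by (subst (asm) ennreal_plus[symmetric]) auto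
  qed
  have "(\<lambda>k. ennreal (2 * (1/2)^k)) \<longlonglongrightarrow> ennreal (2 * 0)"
    by (intro tendsto_ennrealI tendsto_mult_left LIMSEQ_power_zero) simp
  then have "emeasure lebesgue (E - E') \<le> 0"
    using le by (intro LIMSEQ_le_const[where X = "\<lambda>k. ennreal (2 * (1/2)^k)"]) auto
  then have "E - E' \<in> null_sets lebesgue" using EE by (auto simp: null_sets_def)
  then show ?thesis using E'b sub im by blast
qed

section \<open>Coordinates with values in the half-line\<close>

text \<open>The rays \<open>{..<a}\<close> are stable under intersection and generate the Borel
  sets, and their measure is finite because \<open>Y\<close> lies in the half-line; so they
  determine the pushforward.\<close>

lemma emeasure_vimage_eq_lborel_halfline:
  fixes f :: "'a \<Rightarrow> real"
  assumes f: "f \<in> borel_measurable M"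
    and eq: "\<And>a. emeasure M {x\<in>space M. f x < a} = emeasure lborel ({..<a} \<inter> Y)"
    and Y: "Y \<in> sets borel" "Y \<subseteq> {0..}"
    and G: "G \<in> sets borel"
  shows "emeasure M (f -` G \<inter> space M) = emeasure lborel (G \<inter> Y)"
proof -
  have "distr M borel f = density lborel (indicator Y)"
  proof (rule measure_eqI_generator_eq[where \<Omega> = UNIV and E = "range (\<lambda>a. {..<a})" and A = "\<lambda>n. {..<real n}"])
    show "Int_stable (range (\<lambda>a::real. {..<a}))"
    proof (rule Int_stableI)
      fix a b :: "real set" assume "a \<in> range lessThan" "b \<in> range lessThan"
      then obtain x y where "a = {..<x}" "b = {..<y}" by auto
      then have "a \<inter> b = {..<min x y}" by auto
      then show "a \<inter> b \<in> range lessThan" by blast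
    qed
    show "emeasure (distr M borel f) X = emeasure (density lborel (indicator Y)) X"
      if Xr: "X \<in> range (\<lambda>a. {..<a})" for X :: "real set"
    proof -
      obtain a where X: "X = {..<a}" using Xr by auto
      have "f -` {..<a} \<inter> space M = {x\<in>space M. f x < a}" by auto
      then have "emeasure (distr M borel f) X = emeasure lborel ({..<a} \<inter> Y)"
        using f eq by (simp add: X emeasure_distr)
      also have "\<dots> = emeasure (density lborel (indicator Y)) X"
        using Y by (simp add: X emeasure_density Int_commute flip: indicator_inter_arith)
      finally show ?thesis .
    qed
    show "sets (distr M borel f) = sigma_sets UNIV (range lessThan)"
      by (simp add: borel_Iio)
    show "sets (density lborel (indicator Y)) = sigma_sets UNIV (range lessThan)"
      by (simp add: borel_Iio)
    show "(\<Union>i. {..<real i}) = (UNIV::real set)"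
      by (auto simp: reals_Archimedean2)
    show "emeasure (distr M borel f) {..<real i} \<noteq> \<infinity>" for i
    proof -
      have "f -` {..<real i} \<inter> space M = {x\<in>space M. f x < real i}" by auto
      then have "emeasure (distr M borel f) {..<real i} = emeasure lborel ({..<real i} \<inter> Y)"
        using f eq by (simp add: emeasure_distr)
      also have "\<dots> \<le> emeasure lborel {0..real i}"
        using Y by (intro emeasure_mono) auto
      also have "\<dots> < \<infinity>" by simp
      finally show ?thesis by simp
    qed
  qed auto
  then have "emeasure (distr M borel f) G = emeasure (density lborel (indicator Y)) G" by simp
  then show ?thesis
    using f G Y by (simp add: emeasure_distr emeasure_density Int_commute flip: indicator_inter_arith)
qed

text \<open>Interleaves the unit intervals: \<open>[n, n+1)\<close> goes to
  \<open>[2n, 2n+1)\<close> for nonnegative \<open>n\<close> and to \<open>[-2n-1, -2n)\<close> for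
  negative \<open>n\<close>. This is a measure-preserving bijection of the line with the half-line;
  with values there, coordinates have sublevel sets of finite measure.\<close>

definition fold_line :: "real \<Rightarrow> real" where
  "fold_line y = (if 0 \<le> y then y + of_int \<lfloor>y\<rfloor> else y - 3 * of_int \<lfloor>y\<rfloor> - 1)"

lemma fold_line_nonneg: "0 \<le> fold_line y"
proof (cases "0 \<le> y")
  case False
  then have "\<lfloor>y\<rfloor> \<le> -1" by linarith
  then have "of_int \<lfloor>y\<rfloor> \<le> (-1::real)" by linarith
  then have "0 \<le> y - 3 * of_int \<lfloor>y\<rfloor> - 1" using of_int_floor_le[of y] by linarith
  then show ?thesis using False unfolding fold_line_def by simp
qed (simp add: fold_line_def)

lemma fold_line_measurable [measurable]: "fold_line \<in> borel_measurable borel"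
  unfolding fold_line_def by measurable

lemma floor_fold_line: "\<lfloor>fold_line y\<rfloor> = (if 0 \<le> y then 2 * \<lfloor>y\<rfloor> else - 2 * \<lfloor>y\<rfloor> - 1)"
  unfolding fold_line_def by (auto simp: floor_eq_iff)

lemma inj_fold_line: "inj fold_line"
proof (rule injI)
  fix x y assume eq: "fold_line x = fold_line y"
  then have fl: "\<lfloor>fold_line x\<rfloor> = \<lfloor>fold_line y\<rfloor>" by simp
  have s: "(0 \<le> x) = (0 \<le> y)"
    using fl unfolding floor_fold_line by (auto split: if_splits) presburger+
  then have "\<lfloor>x\<rfloor> = \<lfloor>y\<rfloor>" using fl unfolding floor_fold_line by (auto split: if_splits)
  then show "x = y" using eq s unfolding fold_line_def by (auto split: if_splits)
qed

text \<open>Let \<open>N\<close> be the floor of \<open>a\<close>. The unit intervals that fold into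
  \<open>[0, N)\<close> are consecutive around 0; the partial interval still needed lies to their
  right or to their left according to the parity of \<open>N\<close>.\<close>

lemma fold_line_halfline: "emeasure lborel {y. fold_line y < a} = emeasure lborel ({..<a} \<inter> {0..})"
proof (cases "a \<le> 0")
  case True
  then have "{y. fold_line y < a} = {}" "{..<a} \<inter> {0..} = {}" using fold_line_nonneg by (auto simp: not_less intro: order_trans)
  then show ?thesis by (simp only:)
next
  case False
  have r: "emeasure lborel ({..<a} \<inter> {0..}) = ennreal a"
  proof -
    have "{..<a} \<inter> {0..} = {0..<a}" by auto
    then show ?thesis using False by simp
  qed
  define N where "N = \<lfloor>a\<rfloor>"
  have N: "of_int N \<le> a" "a < of_int N + 1" "0 \<le> N" using False unfolding N_def by auto
  show ?thesis
  proof (cases "even N")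
    case True
    then obtain k where k: "N = 2 * k" by blast
    have k0: "0 \<le> k" using N k by auto
    \<comment> \<open>The complete intervals fill \<open>[-k, k)\<close> and the partial one is
      \<open>[k, a - k)\<close>.\<close>
    have "{y. fold_line y < a} = {- of_int k..<a - of_int k}"
    proof (intro set_eqI)
      fix y :: real
      define n where "n = \<lfloor>y\<rfloor>"
      have n: "of_int n \<le> y" "y < of_int n + 1" unfolding n_def by auto
      have c: "n < k \<or> n = k \<or> k + 1 \<le> n" "n < -k \<or> -k \<le> n" "0 \<le> y \<longleftrightarrow> 0 \<le> n"
        using n by (auto simp: n_def)
      show "y \<in> {y. fold_line y < a} \<longleftrightarrow> y \<in> {- of_int k..<a - of_int k}"
      proof (cases "0 \<le> y")
        case True
        have "y + of_int n < a \<longleftrightarrow> y < a - of_int k"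
          using c(1)
        proof (elim disjE)
          assume "n < k" then have "of_int n + 1 \<le> (of_int k::real)" by linarith
          then show ?thesis using N k n by simp
        next
          assume "k + 1 \<le> n" then have "of_int k + 1 \<le> (of_int n::real)" by linarith
          then show ?thesis using N k n by simp
        qed auto
        then show ?thesis using True k0 by (simp add: fold_line_def n_def order_trans[of _ 0])
      next
        case False
        have "y - 3 * of_int n - 1 < a \<longleftrightarrow> - of_int k \<le> y"
          using c(2)
        proof
          assume "n < -k" then have "of_int n + 1 \<le> (- of_int k::real)" by linarith
          then show ?thesis using N k n by auto
        next
          assume "-k \<le> n" then have "- of_int k \<le> (of_int n::real)" by linarith
          then show ?thesis using N k n by auto
        qed
        moreover have "y < a - of_int k" using False N k k0 by auto
        ultimately show ?thesis using False by (simp add: fold_line_def n_def)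
      qed
    qed
    then show ?thesis using r N k k0 by (simp add: False)
  next
    case False
    then obtain k where k: "N = 2 * k + 1" by (auto elim: oddE)
    have k0: "0 \<le> k" using N k by auto
    have kr: "of_int N = 2 * of_int k + (1::real)" "0 \<le> (of_int k::real)" using k k0 by auto
    \<comment> \<open>\<open>?B\<close> consists of the \<open>N\<close> complete intervals,
      \<open>?A\<close> of the part of \<open>[-k-1, -k)\<close> that folds into
      \<open>[2k+1, a)\<close>.\<close>
    let ?A = "{- of_int k - 1..<a - 3 * of_int k - 2} :: real set" and ?B = "{- of_int k..<of_int k + 1} :: real set"
    have "{y. fold_line y < a} = ?A \<union> ?B"
    proof (intro set_eqI)
      fix y :: real
      define n where "n = \<lfloor>y\<rfloor>"
      have n: "of_int n \<le> y" "y < of_int n + 1" unfolding n_def by auto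
      have c: "n \<le> k \<or> k + 1 \<le> n" "n < -k-1 \<or> n = -k-1 \<or> -k \<le> n" "0 \<le> y \<longleftrightarrow> 0 \<le> n"
        using n by (auto simp: n_def)
      show "y \<in> {y. fold_line y < a} \<longleftrightarrow> y \<in> ?A \<union> ?B"
      proof (cases "0 \<le> y")
        case True
        have "y + of_int n < a \<longleftrightarrow> y < of_int k + 1"
          using c(1)
        proof
          assume "n \<le> k" then have "of_int n \<le> (of_int k::real)" by linarith
          then show ?thesis using N kr n by auto
        next
          assume "k + 1 \<le> n" then have "of_int k + 1 \<le> (of_int n::real)" by linarith
          then show ?thesis using N kr n by auto
        qed
        moreover have "y \<notin> ?A" using True N kr by auto
        moreover have "- of_int k \<le> y" using True kr by auto
        ultimately show ?thesis using True by (auto simp add: fold_line_def n_def)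
      next
        case False
        have "y - 3 * of_int n - 1 < a \<longleftrightarrow> y \<in> ?A \<or> - of_int k \<le> y"
          using c(2)
        proof (elim disjE)
          assume "n < -k-1" then have "of_int n + 2 \<le> (- of_int k::real)" by linarith
          then show ?thesis using N kr n by auto
        next
          assume "n = -k-1" then have "of_int n = (- of_int k - 1::real)" by simp
          then show ?thesis using N kr n by auto
        next
          assume "-k \<le> n" then have "- of_int k \<le> (of_int n::real)" by linarith
          then show ?thesis using N kr n by auto
        qed
        moreover have "y < of_int k + 1" using False kr by auto
        ultimately show ?thesis using False by (auto simp add: fold_line_def n_def)
      qed
    qed
    then have "emeasure lborel {y. fold_line y < a} = emeasure lborel ?A + emeasure lborel ?B"
      using N kr by (simp, subst plus_emeasure[symmetric]) auto
    also have "\<dots> = ennreal (a - 2 * of_int k - 1) + ennreal (2 * of_int k + 1)"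
      using N kr by auto
    also have "\<dots> = ennreal a" using N kr by (subst ennreal_plus[symmetric]) auto
    finally show ?thesis using r by simp
  qed
qed

lemma emeasure_vimage_fold_line:
  assumes "G \<in> sets borel"
  shows "emeasure lborel (fold_line -` G) = emeasure lborel (G \<inter> {0..})"
  using emeasure_vimage_eq_lborel_halfline[of fold_line lborel "{0..}" G] fold_line_halfline assms by simp

text \<open>The last assumption is a form of Lusin's theorem; it replaces the fact that injective Borel
  images of Borel sets are Borel.\<close>

locale leb_space =
  fixes M :: "'a measure" and g :: "'a \<Rightarrow> real" and X0 :: "'a set"
  assumes X0 [measurable]: "X0 \<in> sets M"
    and X0_null: "space M - X0 \<in> null_sets M"
    and g_meas [measurable]: "g \<in> borel_measurable M"
    and g_inj: "inj_on g X0"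
    and g_push: "\<And>G. G \<in> sets borel \<Longrightarrow> emeasure M (g -` G \<inter> space M) = emeasure lborel (G \<inter> {0..})"
    and subset_null: "\<And>N N'. N' \<in> null_sets M \<Longrightarrow> N \<subseteq> N' \<Longrightarrow> N \<subseteq> X0 \<Longrightarrow> N \<in> sets M"
    and lusin: "\<And>D f. D \<in> sets M \<Longrightarrow> (f :: 'a \<Rightarrow> real) \<in> borel_measurable M \<Longrightarrow>
      \<exists>D'\<in>sets M. D' \<subseteq> D \<and> D - D' \<in> null_sets M \<and> f ` D' \<in> sets borel"

text \<open>The coordinate is \<open>fold_line\<close> after the isomorphism on its conull domain,
  and 0 elsewhere. Lusin's theorem and completeness are carried over from Lebesgue measure, the
  latter only for subsets of that domain, since nothing is known about \<open>M\<close> off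
  it.\<close>

lemma leb_space_of_isomorphism:
  fixes M :: "'a measure" and \<phi> :: "'a \<Rightarrow> real"
  assumes "mp_isomorphism M lebesgue \<phi>"
  shows "\<exists>g X. leb_space M g X"
proof -
  obtain X Y where X: "X \<in> sets M" "space M - X \<in> null_sets M"
    and Y: "Y \<in> sets lebesgue" "space lebesgue - Y \<in> null_sets lebesgue" and bij: "bij_betw \<phi> X Y"
    and m1: "\<phi> \<in> restrict_space M X \<rightarrow>\<^sub>M restrict_space lebesgue Y"
    and m2: "inv_into X \<phi> \<in> restrict_space lebesgue Y \<rightarrow>\<^sub>M restrict_space M X"
    and d: "distr (restrict_space M X) (restrict_space lebesgue Y) \<phi> = restrict_space lebesgue Y"
    using assms unfolding mp_isomorphism_def by blast
  have sX: "space (restrict_space M X) = X" using X sets.sets_into_space by (auto simp: space_restrict_space)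
  have sY: "space (restrict_space lebesgue Y) = Y" by (auto simp: space_restrict_space)
  have Xs: "X \<subseteq> space M" using X sets.sets_into_space by auto
  have inY: "\<phi> x \<in> Y" if "x \<in> X" for x using bij that by (auto simp: bij_betw_def)
  have F1: "\<phi> -` G \<inter> X \<in> sets M \<and> emeasure M (\<phi> -` G \<inter> X) = emeasure lebesgue G" if G: "G \<in> sets lebesgue" for G
  proof -
    have GY: "G \<inter> Y \<in> sets (restrict_space lebesgue Y)" using G Y by (auto simp: sets_restrict_space)
    have e: "\<phi> -` (G \<inter> Y) \<inter> X = \<phi> -` G \<inter> X" using inY by auto
    have 1: "\<phi> -` G \<inter> X \<in> sets (restrict_space M X)" using measurable_sets[OF m1 GY] unfolding sX e .
    then have 2: "\<phi> -` G \<inter> X \<in> sets M" using X by (simp add: sets_restrict_space_iff)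
    have "emeasure M (\<phi> -` G \<inter> X) = emeasure (restrict_space M X) (\<phi> -` G \<inter> X)"
      using X by (subst emeasure_restrict_space) auto
    also have "\<dots> = emeasure (distr (restrict_space M X) (restrict_space lebesgue Y) \<phi>) (G \<inter> Y)"
      using emeasure_distr[OF m1 GY] unfolding sX e by simp
    also have "\<dots> = emeasure lebesgue (G \<inter> Y)"
      unfolding d using Y by (subst emeasure_restrict_space) auto
    also have "\<dots> = emeasure lebesgue G"
    proof (rule emeasure_eq_AE)
      show "AE x in lebesgue. (x \<in> G \<inter> Y) = (x \<in> G)" using AE_not_in[OF Y(2)] by eventually_elim auto
    qed (use G Y in auto)
    finally show ?thesis using 2 by blast
  qed
  have F2: "\<phi> ` D \<in> sets lebesgue" if D: "D \<in> sets M" "D \<subseteq> X" for D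
  proof -
    have "D \<in> sets (restrict_space M X)" using D X by (simp add: sets_restrict_space_iff)
    from measurable_sets[OF m2 this] have "inv_into X \<phi> -` D \<inter> Y \<in> sets (restrict_space lebesgue Y)" unfolding sY .
    moreover have "inv_into X \<phi> -` D \<inter> Y = \<phi> ` D"
      using bij D(2) by (force simp: bij_betw_def inv_into_f_f image_iff)
    ultimately show ?thesis using Y by (simp add: sets_restrict_space_iff)
  qed
  have inj: "inj_on \<phi> X" using bij by (simp add: bij_betw_def)
  have vi: "\<phi> -` (\<phi> ` D) \<inter> X = D" if "D \<subseteq> X" for D using inj that by (auto dest: inj_onD)
  define h where "h = (\<lambda>x. if x \<in> X then fold_line (\<phi> x) else 0)"
  have hm: "h \<in> borel_measurable M"
  proof (rule measurableI)
    fix G :: "real set" assume G: "G \<in> sets borel"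
    have "h -` G \<inter> space M = (\<phi> -` (fold_line -` G) \<inter> X) \<union> ((space M - X) \<inter> (if 0 \<in> G then space M else {}))"
      unfolding h_def using Xs by (auto split: if_splits)
    moreover have "fold_line -` G \<in> sets lebesgue"
      using measurable_sets[OF fold_line_measurable G] by simp
    ultimately show "h -` G \<inter> space M \<in> sets M" using F1 X by auto
  qed simp
  have "leb_space M h X"
  proof
    show "inj_on h X" unfolding h_def using inj inj_fold_line by (auto simp: inj_on_def)
    show "emeasure M (h -` G \<inter> space M) = emeasure lborel (G \<inter> {0..})" if G: "G \<in> sets borel" for G
    proof -
      have L: "fold_line -` G \<in> sets lborel" using measurable_sets[OF fold_line_measurable G] by simp
      have "emeasure M (h -` G \<inter> space M) = emeasure M (\<phi> -` (fold_line -` G) \<inter> X)"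
      proof (rule emeasure_eq_AE)
        show "AE x in M. (x \<in> h -` G \<inter> space M) = (x \<in> \<phi> -` (fold_line -` G) \<inter> X)"
          using AE_not_in[OF X(2)] by (rule AE_mp) (use Xs in \<open>auto simp: h_def\<close>)
        show "h -` G \<inter> space M \<in> sets M" using hm G by (rule measurable_sets)
        show "\<phi> -` (fold_line -` G) \<inter> X \<in> sets M" using F1 L by auto
      qed
      also have "\<dots> = emeasure lborel (fold_line -` G)" using F1 L by auto
      finally show ?thesis using emeasure_vimage_fold_line[OF G] by simp
    qed
    show "N \<in> sets M" if N: "N' \<in> null_sets M" "N \<subseteq> N'" "N \<subseteq> X" for N N'
    proof -
      have N'X: "N' \<inter> X \<in> sets M" using N X by auto
      have "emeasure M (\<phi> -` (\<phi> ` (N' \<inter> X)) \<inter> X) = emeasure lebesgue (\<phi> ` (N' \<inter> X))"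
        using F1[OF F2[OF N'X]] by auto
      moreover have "\<phi> -` (\<phi> ` (N' \<inter> X)) \<inter> X = N' \<inter> X" by (rule vi) auto
      moreover have "emeasure M (N' \<inter> X) = 0" 
        using N(1) N'X by (metis Int_lower1 emeasure_mono le_zero_eq null_setsD1 null_setsD2)
      ultimately have "\<phi> ` (N' \<inter> X) \<in> null_sets lebesgue" using F2[OF N'X] by auto
      then have "\<phi> ` N \<in> null_sets lebesgue"
        by (rule null_sets_completion_subset[rotated]) (use N in auto)
      then have "\<phi> -` (\<phi> ` N) \<inter> X \<in> sets M" using F1 by blast
      then show ?thesis using vi[OF N(3)] by simp
    qed
    show "\<exists>D'\<in>sets M. D' \<subseteq> D \<and> D - D' \<in> null_sets M \<and> f ` D' \<in> sets borel"
      if D: "D \<in> sets M" and f: "f \<in> borel_measurable M" for D and f :: "'a \<Rightarrow> real"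
    proof -
      \<comment> \<open>The function is transported to the line, where
        \<open>lusin_borel_image\<close> applies.\<close>
      define k where "k = (\<lambda>y. if y \<in> Y then f (inv_into X \<phi> y) else 0)"
      have "(\<lambda>y. f (inv_into X \<phi> y)) \<in> borel_measurable (restrict_space lebesgue Y)"
        using measurable_comp[OF m2 measurable_restrict_space1[OF f]] by (simp add: comp_def)
      then have km: "k \<in> borel_measurable lebesgue"
        unfolding k_def using Y by (subst (asm) measurable_restrict_space_iff[where c = 0]) auto
      have DX: "D \<inter> X \<in> sets M" using D X by auto
      have E: "\<phi> ` (D \<inter> X) \<in> sets lebesgue" using F2[OF DX] by auto
      obtain E' where E': "E' \<in> sets borel" "E' \<subseteq> \<phi> ` (D \<inter> X)" "\<phi> ` (D \<inter> X) - E' \<in> null_sets lebesgue" "k ` E' \<in> sets borel"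
        using lusin_borel_image[OF km E] by blast
      let ?D' = "\<phi> -` E' \<inter> X"
      have sub: "?D' \<subseteq> D" using E'(2) inj by (auto dest: inj_onD)
      have D's: "?D' \<in> sets M" using F1 E'(1) by auto
      have n1: "\<phi> -` (\<phi> ` (D \<inter> X) - E') \<inter> X \<in> null_sets M" using F1[of "\<phi> ` (D \<inter> X) - E'"] E'(3) by (auto simp: null_sets_def)
      have "D - ?D' \<subseteq> (\<phi> -` (\<phi> ` (D \<inter> X) - E') \<inter> X) \<union> (space M - X)"
        using sets.sets_into_space[OF D] by auto
      then have "D - ?D' \<in> null_sets M"
        using null_sets.Un[OF n1 X(2)] D D's by (meson null_sets_subset sets.Diff)
      moreover have "f ` ?D' = k ` E'"
      proof -
        have "E' = \<phi> ` ?D'" using E'(2) by auto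
        moreover have "k (\<phi> x) = f x" if "x \<in> ?D'" for x
          using that inY inj by (auto simp: k_def inv_into_f_f)
        ultimately show ?thesis by (metis (mono_tags, lifting) image_cong image_image)
      qed
      ultimately show ?thesis using E'(4) D's sub by metis
    qed
  qed (use X hm in auto)
  then show ?thesis by blast
qed

section \<open>Automorphisms from bijections defined almost everywhere\<close>

lemma automorphismsD:
  assumes "T \<in> automorphisms M"
  shows "bij_betw T (space M) (space M)"
    and "\<And>A. A \<in> sets M \<Longrightarrow> T -` A \<inter> space M \<in> sets M"
    and "\<And>A. A \<in> sets M \<Longrightarrow> T ` A \<in> sets M"
    and "\<And>A. A \<in> sets M \<Longrightarrow> emeasure M (T -` A \<inter> space M) = emeasure M A"
    and "\<And>A. A \<in> sets M \<Longrightarrow> emeasure M (T ` A) = emeasure M A"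
proof -
  have T: "T \<in> M \<rightarrow>\<^sub>M M" "bij_betw T (space M) (space M)" "inv_into (space M) T \<in> M \<rightarrow>\<^sub>M M" "distr M M T = M"
    using assms by (auto simp: automorphisms_def)
  show "bij_betw T (space M) (space M)" by fact
  show v: "T -` A \<inter> space M \<in> sets M" if "A \<in> sets M" for A using T(1) that by (rule measurable_sets)
  show i: "T ` A \<in> sets M" if A: "A \<in> sets M" for A
  proof -
    have "inv_into (space M) T -` A \<inter> space M = T ` A"
      using T(2) sets.sets_into_space[OF A] by (force simp: bij_betw_def inv_into_f_f image_iff)
    then show ?thesis using measurable_sets[OF T(3) A] by simp
  qed
  show e: "emeasure M (T -` A \<inter> space M) = emeasure M A" if A: "A \<in> sets M" for A
    using emeasure_distr[OF T(1), of A] A T(4) by simp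
  show "emeasure M (T ` A) = emeasure M A" if A: "A \<in> sets M" for A
  proof -
    have "T -` (T ` A) \<inter> space M = A"
      using T(2) sets.sets_into_space[OF A] by (auto simp: bij_betw_def dest: inj_onD)
    then show ?thesis using e[OF i[OF A]] by simp
  qed
qed

lemma automorphismsI:
  assumes b: "bij_betw T (space M) (space M)"
    and v: "\<And>A. A \<in> sets M \<Longrightarrow> T -` A \<inter> space M \<in> sets M"
    and i: "\<And>A. A \<in> sets M \<Longrightarrow> T ` A \<in> sets M"
    and e: "\<And>A. A \<in> sets M \<Longrightarrow> emeasure M (T ` A) = emeasure M A"
  shows "T \<in> automorphisms M"
proof -
  have 1: "T \<in> M \<rightarrow>\<^sub>M M"
    using b v by (intro measurableI) (auto simp: bij_betw_def)
  have 2: "inv_into (space M) T \<in> M \<rightarrow>\<^sub>M M"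
  proof (rule measurableI)
    show "inv_into (space M) T x \<in> space M" if "x \<in> space M" for x
      using b that by (metis bij_betw_def inv_into_into)
    fix A assume A: "A \<in> sets M"
    have "inv_into (space M) T -` A \<inter> space M = T ` A"
      using b sets.sets_into_space[OF A] by (force simp: bij_betw_def inv_into_f_f image_iff)
    then show "inv_into (space M) T -` A \<inter> space M \<in> sets M" using i[OF A] by simp
  qed
  have 3: "distr M M T = M"
  proof (rule measure_eqI)
    fix A assume "A \<in> sets (distr M M T)"
    then have A: "A \<in> sets M" by simp
    have "T ` (T -` A \<inter> space M) = A"
      using b sets.sets_into_space[OF A] by (force simp: bij_betw_def image_iff)
    then show "emeasure (distr M M T) A = emeasure M A"
      using e[OF v[OF A]] emeasure_distr[OF 1 A] by simp
  qed simp
  show ?thesis using 1 2 3 b by (auto simp: automorphisms_def)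
qed

text \<open>The points whose whole forward and backward orbits under \<open>t\<close> stay in the
  two given sets form a conull set \<open>W\<close> that \<open>t\<close> maps onto itself. There
  \<open>t\<close> is kept, and elsewhere the identity is put.\<close>

lemma automorphism_of_partial:
  fixes t :: "'a \<Rightarrow> 'a"
  assumes X: "X \<in> sets M" "space M - X \<in> null_sets M" and X': "X' \<in> sets M" "space M - X' \<in> null_sets M"
    and bij: "bij_betw t X X'"
    and v: "\<And>A. A \<in> sets M \<Longrightarrow> t -` A \<inter> X \<in> sets M"
    and i: "\<And>A. A \<in> sets M \<Longrightarrow> A \<subseteq> X \<Longrightarrow> t ` A \<in> sets M"
    and e: "\<And>A. A \<in> sets M \<Longrightarrow> A \<subseteq> X \<Longrightarrow> emeasure M (t ` A) = emeasure M A"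
  shows "\<exists>T\<in>automorphisms M. AE x in M. x \<in> X \<and> T x = t x"
proof -
  have inj: "inj_on t X" and im: "t ` X = X'" using bij by (auto simp: bij_betw_def)
  \<comment> \<open>Each step discards the points whose image or preimage under \<open>t\<close> was
    discarded before; as \<open>t\<close> preserves measure, the discarded part remains
    null.\<close>
  define Z where "Z = rec_nat (X \<inter> X') (\<lambda>_ A. A \<inter> (t -` A \<inter> X) \<inter> t ` (A \<inter> X))"
  have Z0: "Z 0 = X \<inter> X'" and ZS: "Z (Suc n) = Z n \<inter> (t -` Z n \<inter> X) \<inter> t ` (Z n \<inter> X)" for n
    unfolding Z_def by auto
  have con: "Z n \<in> sets M \<and> space M - Z n \<in> null_sets M" for n
  proof (induction n)
    case 0
    have "space M - Z 0 = (space M - X) \<union> (space M - X')" unfolding Z0 by auto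
    then show ?case using X X' by (auto simp: Z0)
  next
    case (Suc n)
    then have Zn: "Z n \<in> sets M" and Zc: "space M - Z n \<in> null_sets M" by auto
    let ?D = "X - (t -` Z n \<inter> X)"
    have D: "?D \<in> sets M" using X v[OF Zn] by auto
    have "t ` ?D \<subseteq> space M - Z n" using im X'(1) sets.sets_into_space by fastforce
    then have "emeasure M (t ` ?D) = 0" using Zc
      by (metis emeasure_mono le_zero_eq null_setsD1 null_setsD2)
    then have D0: "?D \<in> null_sets M" using e[OF D] D by auto
    let ?C = "X - Z n"
    have C: "?C \<in> sets M" using X Zn by auto
    have "emeasure M ?C = 0" using Zc X(1)
      by (metis Diff_mono emeasure_mono le_zero_eq null_setsD1 null_setsD2 order_refl sets.sets_into_space)
    then have C0: "t ` ?C \<in> null_sets M" using e[OF C] i[OF C] by auto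
    have "space M - Z (Suc n) \<subseteq> (space M - Z n) \<union> (space M - X) \<union> ?D \<union> (space M - X') \<union> t ` ?C"
      unfolding ZS using im by auto
    moreover have "Z (Suc n) \<in> sets M" unfolding ZS using Zn v[OF Zn] i[of "Z n \<inter> X"] X by auto
    moreover have "(space M - Z n) \<union> (space M - X) \<union> ?D \<union> (space M - X') \<union> t ` ?C \<in> null_sets M"
      using Zc X(2) X'(2) D0 C0 by blast
    ultimately show ?case by (meson null_sets_subset sets.compl_sets)
  qed
  define W where "W = (\<Inter>n. Z n)"
  have Wm: "W \<in> sets M" unfolding W_def using con by (intro sets.countable_INT') auto
  have "space M - W = (\<Union>n. space M - Z n)" unfolding W_def by auto
  then have Wn: "space M - W \<in> null_sets M" using con by (simp only:) (intro null_sets_UN, auto)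
  have WX: "W \<subseteq> X" "W \<subseteq> X'" unfolding W_def using Z0 by blast+
  have tW: "t ` W = W"
  proof (intro equalityI subsetI)
    fix y assume "y \<in> t ` W"
    then obtain x where x: "x \<in> W" "y = t x" by blast
    have "t x \<in> Z n" for n using x(1) ZS[of n] unfolding W_def by blast
    then show "y \<in> W" unfolding W_def x(2) by blast
  next
    fix y assume y: "y \<in> W"
    then obtain x where x: "x \<in> X" "y = t x" using WX im by blast
    have "x \<in> Z n" for n
    proof -
      have "y \<in> t ` (Z n \<inter> X)" using y ZS[of n] unfolding W_def by blast
      then show ?thesis using x inj by (auto dest: inj_onD)
    qed
    then show "y \<in> t ` W" unfolding W_def x(2) by blast
  qed
  define T where "T = (\<lambda>x. if x \<in> W then t x else x)"
  have Ws: "W \<subseteq> space M" using Wm sets.sets_into_space by blast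
  have Tin: "T x \<in> W \<longleftrightarrow> x \<in> W" for x unfolding T_def using tW by auto
  have img: "T ` A = t ` (A \<inter> W) \<union> (A - W)" for A unfolding T_def by auto
  have "inj_on T (space M)"
  proof (rule inj_onI)
    fix x y assume "T x = T y"
    then show "x = y" using Tin[of x] Tin[of y] inj WX unfolding T_def
      by (auto split: if_splits dest: inj_onD)
  qed
  moreover have "T ` space M = space M" unfolding img using tW Ws by (auto simp: Int_absorb1)
  ultimately have bT: "bij_betw T (space M) (space M)" by (simp add: bij_betw_def)
  have "T \<in> automorphisms M"
  proof (rule automorphismsI[OF bT])
    fix A assume A: "A \<in> sets M"
    have "T -` A \<inter> space M = (t -` A \<inter> X \<inter> W) \<union> (A - W)"
      using WX Ws sets.sets_into_space[OF A] by (auto simp: T_def split: if_splits)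
    then show "T -` A \<inter> space M \<in> sets M" using v[OF A] A Wm by auto
    have AW: "A \<inter> W \<in> sets M" "A \<inter> W \<subseteq> X" using A Wm WX by auto
    show "T ` A \<in> sets M" unfolding img using i[OF AW] A Wm by auto
    have "emeasure M (T ` A) = emeasure M (t ` (A \<inter> W)) + emeasure M (A - W)"
      unfolding img using i[OF AW] A Wm tW by (intro plus_emeasure[symmetric]) auto
    also have "\<dots> = emeasure M (A \<inter> W) + emeasure M (A - W)" using e[OF AW] by simp
    also have "\<dots> = emeasure M ((A \<inter> W) \<union> (A - W))" using A Wm by (intro plus_emeasure) auto
    also have "(A \<inter> W) \<union> (A - W) = A" by auto
    finally show "emeasure M (T ` A) = emeasure M A" .
  qed
  moreover have "AE x in M. x \<in> X \<and> T x = t x"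
    using AE_not_in[OF Wn] by (rule AE_mp) (use WX in \<open>auto simp: T_def\<close>)
  ultimately show ?thesis by blast
qed

section \<open>Distribution functions as coordinates on a measurable set\<close>

context leb_space begin

text \<open>The map \<open>F\<close> is the distribution function of \<open>g\<close> on
  \<open>R\<close>, evaluated at \<open>g\<close> itself. As \<open>g\<close> has no atoms, such a
  variable is uniformly distributed.\<close>

lemma cumulative_map:
  assumes R: "R \<in> sets M"
  shows "\<exists>F\<in>borel_measurable M. (\<forall>x. 0 \<le> F x) \<and>
     (\<forall>a\<ge>0. emeasure M {x\<in>R. F x < a} = min (ennreal a) (emeasure M R)) \<and>
     (\<exists>N\<in>null_sets M. inj_on F (R - N))"
proof -
  have Rs: "R \<subseteq> space M" using sets.sets_into_space[OF R] .
  define c where "c = (\<lambda>s. measure M {y\<in>R. g y \<le> s})"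
  have m[measurable]: "{y\<in>R. g y \<le> s} \<in> sets M" "{y\<in>R. s < g y \<and> g y \<le> t} \<in> sets M" for s t
  proof -
    have "{y\<in>R. g y \<le> s} = R \<inter> (g -` {..s} \<inter> space M)" using Rs by auto
    then show "{y\<in>R. g y \<le> s} \<in> sets M" using R by auto
    have "{y\<in>R. s < g y \<and> g y \<le> t} = R \<inter> (g -` {s<..t} \<inter> space M)" using Rs by auto
    then show "{y\<in>R. s < g y \<and> g y \<le> t} \<in> sets M" using R by auto
  qed
  have lem: "emeasure M {y\<in>R. s < g y \<and> g y \<le> t} \<le> ennreal (t - s)" for s t
  proof -
    have "emeasure M {y\<in>R. s < g y \<and> g y \<le> t} \<le> emeasure M (g -` {s<..t} \<inter> space M)"
      using Rs by (intro emeasure_mono) auto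
    also have "\<dots> = emeasure lborel ({s<..t} \<inter> {0..})" by (rule g_push) auto
    also have "\<dots> \<le> emeasure lborel {s<..t}" by (intro emeasure_mono) auto
    also have "\<dots> \<le> ennreal (t - s)" by (cases "s \<le> t") (auto simp: emeasure_lborel_Ioc)
    finally show ?thesis .
  qed
  have fin: "emeasure M {y\<in>R. g y \<le> s} = ennreal (c s)" for s
  proof -
    have "emeasure M {y\<in>R. g y \<le> s} \<le> emeasure M (g -` {..s} \<inter> space M)"
      using Rs by (intro emeasure_mono) auto
    also have "\<dots> = emeasure lborel ({..s} \<inter> {0..})" by (rule g_push) auto
    also have "\<dots> \<le> emeasure lborel {0..s}" by (intro emeasure_mono) auto
    also have "\<dots> < \<infinity>" by (cases "0 \<le> s") auto
    finally show ?thesis unfolding c_def by (intro emeasure_eq_ennreal_measure) auto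
  qed
  have c0: "0 \<le> c s" for s unfolding c_def by simp
  have cneg: "c (-1) = 0"
  proof -
    have "emeasure M {y\<in>R. g y \<le> -1} \<le> emeasure M (g -` {..-1} \<inter> space M)"
      using Rs by (intro emeasure_mono) auto
    also have "\<dots> = emeasure lborel ({..-1} \<inter> {0..} :: real set)" by (rule g_push) auto
    also have "{..-1} \<inter> {0..} = ({}::real set)" by auto
    finally have "ennreal (c (-1)) \<le> 0" unfolding fin by simp
    then show ?thesis using c0[of "-1"] by (simp add: ennreal_eq_0_iff)
  qed
  \<comment> \<open>The image of the measure under \<open>g\<close> is dominated by Lebesgue
    measure, which makes the distribution function 1-Lipschitz.\<close>
  have lip: "c s \<le> c t \<and> c t - c s \<le> t - s" if "s \<le> t" for s t
  proof -
    have "{y\<in>R. g y \<le> t} = {y\<in>R. g y \<le> s} \<union> {y\<in>R. s < g y \<and> g y \<le> t}" using that by auto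
    then have "emeasure M {y\<in>R. g y \<le> t} = emeasure M {y\<in>R. g y \<le> s} + emeasure M {y\<in>R. s < g y \<and> g y \<le> t}"
      by (simp only:) (intro plus_emeasure[symmetric], auto intro: m)
    then have eq: "ennreal (c t) = ennreal (c s) + emeasure M {y\<in>R. s < g y \<and> g y \<le> t}" unfolding fin .
    then have "ennreal (c s) \<le> ennreal (c t)" by simp
    then have 1: "c s \<le> c t" using c0 by simp
    have "ennreal (c t) \<le> ennreal (c s) + ennreal (t - s)" unfolding eq using lem by (intro add_left_mono)
    also have "\<dots> = ennreal (c s + (t - s))" using c0 that by simp
    finally have "c t \<le> c s + (t - s)" using c0 that by (subst (asm) ennreal_le_iff) (auto intro: add_nonneg_nonneg)
    then show ?thesis using 1 by simp
  qed
  have cont: "continuous_on A c" for A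
  proof -
    have "1-lipschitz_on A c"
    proof (rule lipschitz_onI)
      fix x y show "dist (c x) (c y) \<le> 1 * dist x y"
        using lip[of x y] lip[of y x] by (cases "x \<le> y") (auto simp: dist_real_def)
    qed simp
    then show ?thesis by (rule lipschitz_on_continuous_on)
  qed
  define F where "F = (\<lambda>x. c (g x))"
  have F[measurable]: "F \<in> borel_measurable M"
    unfolding F_def using borel_measurable_continuous_onI[OF cont] by measurable
  have Fset[measurable]: "{x\<in>R. F x < a} \<in> sets M" "{x\<in>R. F x = a} \<in> sets M" for a
  proof -
    have "{x\<in>R. F x < a} = R \<inter> (F -` {..<a} \<inter> space M)" "{x\<in>R. F x = a} = R \<inter> (F -` {a} \<inter> space M)" using Rs by auto
    then show "{x\<in>R. F x < a} \<in> sets M" "{x\<in>R. F x = a} \<in> sets M" using R by auto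
  qed
  have dist: "emeasure M {x\<in>R. F x < a} = min (ennreal a) (emeasure M R)" if a: "a \<ge> 0" for a
  proof (cases "\<forall>s. c s < a")
    case True
    then have "{x\<in>R. F x < a} = R" unfolding F_def by auto
    moreover have "emeasure M R \<le> ennreal a"
    proof -
      have "R = (\<Union>n::nat. {y\<in>R. g y \<le> real n})" using real_arch_simple by auto
      then have "emeasure M R = emeasure M (\<Union>n::nat. {y\<in>R. g y \<le> real n})" by simp
      also have "\<dots> = (SUP n::nat. emeasure M {y\<in>R. g y \<le> real n})"
        by (rule SUP_emeasure_incseq[symmetric]) (auto simp: incseq_def intro: m)
      also have "\<dots> \<le> ennreal a" using True by (intro SUP_least) (simp only: fin, intro ennreal_leI less_imp_le, blast)
      finally show ?thesis .
    qed
    ultimately show ?thesis by (simp add: min_def)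
  next
    case False
    then obtain s0 where s0: "a \<le> c s0" by (auto simp: not_less)
    \<comment> \<open>\<open>g\<close> is nonnegative up to a null set, so \<open>c\<close> vanishes
      at -1 and by continuity takes every value up to \<open>a\<close>.\<close>
    have ivt: "\<exists>s. c s = b" if "0 \<le> b" "b \<le> a" for b
    proof (cases "s0 \<le> -1")
      case True
      then have "c s0 \<le> 0" using lip cneg by metis
      then show ?thesis using that s0 cneg by (intro exI[of _ "-1"]) simp
    next
      case False
      then show ?thesis using IVT'[of c "-1" b s0] cneg that s0 cont by auto
    qed
    obtain s where s: "c s = a" using ivt[of a] a by auto
    have "{x\<in>R. F x < a} \<subseteq> {y\<in>R. g y \<le> s}" unfolding F_def using lip s by (smt (verit) Collect_mono_iff)
    then have "emeasure M {x\<in>R. F x < a} \<le> emeasure M {y\<in>R. g y \<le> s}" by (intro emeasure_mono m)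
    then have up: "emeasure M {x\<in>R. F x < a} \<le> ennreal a" using fin s by simp
    then have fin2: "emeasure M {x\<in>R. F x < a} = ennreal (measure M {x\<in>R. F x < a})"
      by (intro emeasure_eq_ennreal_measure) (auto simp: top_unique)
    have lo: "b \<le> measure M {x\<in>R. F x < a}" if ba: "b < a" for b
    proof (cases "0 \<le> b")
      case True
      obtain r where r: "c r = b" using ivt[of b] True ba by auto
      have "{y\<in>R. g y \<le> r} \<subseteq> {x\<in>R. F x < a}" unfolding F_def using lip r ba by (smt (verit) Collect_mono_iff)
      then have "emeasure M {y\<in>R. g y \<le> r} \<le> emeasure M {x\<in>R. F x < a}" by (intro emeasure_mono Fset)
      then show ?thesis unfolding fin fin2 r using True by simp
    next
      case False then show ?thesis using measure_nonneg[of M "{x\<in>R. F x < a}"] by linarith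
    qed
    have "a \<le> measure M {x\<in>R. F x < a}" by (rule dense_le) (rule lo)
    then have "emeasure M {x\<in>R. F x < a} = ennreal a" using up fin2 by (metis antisym ennreal_leI)
    moreover have "ennreal a \<le> emeasure M R"
    proof -
      have "ennreal a \<le> emeasure M {y\<in>R. g y \<le> s0}" unfolding fin using s0 by (rule ennreal_leI)
      also have "\<dots> \<le> emeasure M R" using R by (intro emeasure_mono) auto
      finally show ?thesis .
    qed
    ultimately show ?thesis by (simp add: min_def)
  qed
  have F0: "0 \<le> F x" for x unfolding F_def by (rule c0)
  \<comment> \<open>The measure of a level set is at most the increment of the distribution over an
    interval of arbitrary length \<open>e\<close>.\<close>
  have atom: "{x\<in>R. F x = v} \<in> null_sets M" for v
  proof (cases "0 \<le> v")
    case True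
    have le: "emeasure M {x\<in>R. F x = v} + emeasure M {x\<in>R. F x < v} \<le> emeasure M {x\<in>R. F x < v + e}" if "e > 0" for e
    proof -
      have "emeasure M {x\<in>R. F x = v} + emeasure M {x\<in>R. F x < v} = emeasure M ({x\<in>R. F x = v} \<union> {x\<in>R. F x < v})"
        by (intro plus_emeasure Fset) auto
      also have "\<dots> \<le> emeasure M {x\<in>R. F x < v + e}" using that by (intro emeasure_mono Fset) auto
      finally show ?thesis .
    qed
    have "emeasure M {x\<in>R. F x = v} \<le> 0 + ennreal e" if e: "e > 0" for e
    proof -
      have fv: "emeasure M {x\<in>R. F x < v} = min (ennreal v) (emeasure M R)" using dist True by blast
      have ve: "ennreal (v + e) = ennreal v + ennreal e" using True e by simp
      have fve: "emeasure M {x\<in>R. F x < v + e} = min (ennreal v + ennreal e) (emeasure M R)"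
        using dist[of "v + e"] True e unfolding ve by simp
      have "min (ennreal v + ennreal e) (emeasure M R) \<le> min (ennreal v) (emeasure M R) + ennreal e"
      proof (cases "ennreal v \<le> emeasure M R")
        case False
        then have "min (ennreal v) (emeasure M R) = emeasure M R" by (simp add: min_def)
        then show ?thesis by (metis add.commute add_increasing min.cobounded2 zero_le)
      next
        case True
        then show ?thesis by (simp add: min_absorb1)
      qed
      then have "emeasure M {x\<in>R. F x = v} + min (ennreal v) (emeasure M R) \<le> min (ennreal v) (emeasure M R) + ennreal e"
        using le[OF e] unfolding fv fve by (rule order_trans[rotated])
      moreover have "min (ennreal v) (emeasure M R) \<noteq> \<infinity>" by (auto simp: min_def top_unique)
      ultimately show ?thesis by (simp add: add.commute)
    qed
    then have "emeasure M {x\<in>R. F x = v} \<le> 0" by (rule ennreal_le_epsilon)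
    then show ?thesis using Fset by (auto simp: null_sets_def)
  next
    case False
    then have "{x\<in>R. F x = v} = {}" using F0 by auto
    then show ?thesis by (simp only: null_sets.empty_sets)
  qed
  \<comment> \<open>If two points have equal \<open>F\<close> but different \<open>g\<close>, a
    rational \<open>r\<close> lies between their \<open>g\<close>-values and \<open>c r\<close> is
    the common value of \<open>F\<close>. Deleting these countably many null level sets restores
    injectivity.\<close>
  define N where "N = (\<Union>r\<in>\<rat>. {x\<in>R. F x = c r}) \<union> (space M - X0)"
  have "N \<in> null_sets M" unfolding N_def using atom X0_null
    by (intro null_sets.Un null_sets_UN') (auto simp: countable_rat)
  moreover have "inj_on F (R - N)"
  proof (rule inj_onI)
    fix x y assume x: "x \<in> R - N" and y: "y \<in> R - N" and eq: "F x = F y"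
    have xX: "x \<in> X0" "y \<in> X0" using x y Rs unfolding N_def by auto
    have key: False if lt: "g u < g v" and u: "u \<in> R - N" and e: "F u = F v" for u v
    proof -
      obtain r where r: "r \<in> \<rat>" "g u < r" "r < g v" using Rats_dense_in_real[OF lt] by blast
      have "c r = F u" using lip[of "g u" r] lip[of r "g v"] r e unfolding F_def by auto
      then show False using u r unfolding N_def by auto
    qed
    have "g x = g y" using key[of x y] key[of y x] x y eq by (metis linorder_neqE)
    then show "x = y" using g_inj xX by (auto dest: inj_onD)
  qed
  ultimately show ?thesis using F F0 dist by blast
qed

end

section \<open>Images, orbits and null sets under automorphisms\<close>

declare emeasure_completion [simp del]

lemma aut_measurable: "T \<in> automorphisms M \<Longrightarrow> T \<in> M \<rightarrow>\<^sub>M M"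
  by (simp add: automorphisms_def)

lemma aut_in_space: "T \<in> automorphisms M \<Longrightarrow> x \<in> space M \<Longrightarrow> T x \<in> space M"
  using automorphismsD(1) by (fastforce simp: bij_betw_def)

lemma aut_inj: "T \<in> automorphisms M \<Longrightarrow> inj_on T (space M)"
  using automorphismsD(1) by (auto simp: bij_betw_def)

lemma aut_surj: "T \<in> automorphisms M \<Longrightarrow> T ` space M = space M"
  using automorphismsD(1) by (auto simp: bij_betw_def)

lemma aut_null:
  assumes "T \<in> automorphisms M" "N \<in> null_sets M"
  shows "T ` N \<in> null_sets M" "T -` N \<inter> space M \<in> null_sets M"
  using automorphismsD(2-5)[OF assms(1), of N] assms(2) by (auto simp: null_sets_def)

lemma aut_measure:
  assumes "T \<in> automorphisms M" "A \<in> sets M"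
  shows "measure M (T ` A) = measure M A" "measure M (T -` A \<inter> space M) = measure M A"
  using automorphismsD(4,5)[OF assms] by (auto simp: measure_def)

lemma aut_fmeasurable:
  assumes "T \<in> automorphisms M" "A \<in> fmeasurable M"
  shows "T ` A \<in> fmeasurable M" "T -` A \<inter> space M \<in> fmeasurable M"
  using automorphismsD(2-5)[OF assms(1), of A] assms(2) by (auto simp: fmeasurable_def)

lemma aut_comp:
  assumes S: "S \<in> automorphisms M" and T: "T \<in> automorphisms M"
  shows "S \<circ> T \<in> automorphisms M"
proof (rule automorphismsI)
  show "bij_betw (S \<circ> T) (space M) (space M)"
    using automorphismsD(1)[OF S] automorphismsD(1)[OF T] by (rule bij_betw_trans[rotated])
  fix A assume A: "A \<in> sets M"
  have "(S \<circ> T) -` A \<inter> space M = T -` (S -` A \<inter> space M) \<inter> space M" using aut_in_space[OF T] by auto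
  then show "(S \<circ> T) -` A \<inter> space M \<in> sets M" using automorphismsD(2)[OF T automorphismsD(2)[OF S A]] by simp
  have e: "(S \<circ> T) ` A = S ` (T ` A)" by (simp add: image_comp)
  show "(S \<circ> T) ` A \<in> sets M" unfolding e using automorphismsD(3)[OF S automorphismsD(3)[OF T A]] .
  show "emeasure M ((S \<circ> T) ` A) = emeasure M A"
    unfolding e using automorphismsD(5)[OF S automorphismsD(3)[OF T A]] automorphismsD(5)[OF T A] by simp
qed

lemma aut_id: "id \<in> automorphisms M"
  by (rule automorphismsI) (auto simp: sets.sets_into_space)

lemma aut_funpow:
  assumes "T \<in> automorphisms M"
  shows "T ^^ n \<in> automorphisms M"
proof (induction n)
  case 0 then show ?case using aut_id by (simp add: id_def)
next
  case (Suc n) then show ?case using aut_comp[OF assms] by (simp only: funpow.simps)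
qed

lemma aut_AE:
  assumes T: "T \<in> automorphisms M" and P: "AE x in M. P x"
  shows "AE x in M. P (T x)"
proof -
  obtain N where N: "N \<in> null_sets M" "{x\<in>space M. \<not> P x} \<subseteq> N" using P by (auto elim: AE_E2 simp: eventually_ae_filter)
  have "AE x in M. x \<notin> T -` N \<inter> space M" using aut_null(2)[OF T N(1)] by (rule AE_not_in)
  moreover have "AE x in M. x \<in> space M" by (rule AE_space)
  ultimately show ?thesis by eventually_elim (use N aut_in_space[OF T] in blast)
qed

lemma aut_image_sym_diff:
  assumes "T \<in> automorphisms M" "A \<subseteq> space M" "B \<subseteq> space M"
  shows "sym_diff (T ` A) (T ` B) = T ` (sym_diff A B)"
proof -
  have "T ` A - T ` B = T ` (A - B)" "T ` B - T ` A = T ` (B - A)"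
    using inj_on_image_set_diff[OF aut_inj[OF assms(1)]] assms(2,3) by (metis Diff_subset order_trans)+
  then show ?thesis by (simp add: image_Un)
qed

lemma funpow_image_add: "(T ^^ (m + n)) ` A = (T ^^ m) ` ((T ^^ n) ` A)"
  by (auto simp: funpow_add image_image)

text \<open>Deleting all forward images and all preimages of the exceptional null set costs only a
  null set, and what remains is strictly invariant. Pointwise arguments along whole orbits are
  carried out on such sets.\<close>

lemma aut_invariant_core:
  assumes T: "T \<in> automorphisms M" and P: "AE x in M. P x"
  shows "\<exists>Z\<in>sets M. space M - Z \<in> null_sets M \<and> (\<forall>x\<in>Z. P x) \<and> (\<forall>x\<in>space M. T x \<in> Z \<longleftrightarrow> x \<in> Z)"
proof -
  obtain N where N: "N \<in> null_sets M" "{x\<in>space M. \<not> P x} \<subseteq> N" using P by (auto simp: eventually_ae_filter)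
  have Ns: "N \<subseteq> space M" using N(1) sets.sets_into_space by blast
  define W where "W = (\<Union>n. (T ^^ n) ` N \<union> ((T ^^ n) -` N \<inter> space M))"
  have W: "W \<in> null_sets M" unfolding W_def
    using aut_null[OF aut_funpow[OF T] N(1)] by (intro null_sets_UN) auto
  have NW: "N \<subseteq> W"
  proof
    fix x assume "x \<in> N"
    then have "x \<in> (T ^^ 0) ` N" by simp
    then show "x \<in> W" unfolding W_def by blast
  qed
  have "T x \<in> W \<longleftrightarrow> x \<in> W" if x: "x \<in> space M" for x
  proof
    assume "T x \<in> W"
    then obtain n where "T x \<in> (T ^^ n) ` N \<or> (T ^^ n) (T x) \<in> N" unfolding W_def by auto
    then show "x \<in> W"
    proof
      assume a: "T x \<in> (T ^^ n) ` N"
      show ?thesis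
      proof (cases n)
        case 0
        then have "(T ^^ 1) x \<in> N" using a by simp
        then show ?thesis using x unfolding W_def by blast
      next
        case (Suc m)
        then obtain z where z: "z \<in> N" "T x = T ((T ^^ m) z)" using a by auto
        then have "x = (T ^^ m) z"
          using aut_inj[OF T] x aut_in_space[OF aut_funpow[OF T]] Ns by (auto dest: inj_onD)
        then show ?thesis unfolding W_def using z(1) by blast
      qed
    next
      assume "(T ^^ n) (T x) \<in> N"
      then have "(T ^^ Suc n) x \<in> N" by (simp add: funpow_swap1)
      then show ?thesis using x unfolding W_def by blast
    qed
  next
    assume "x \<in> W"
    then obtain n where "x \<in> (T ^^ n) ` N \<or> (T ^^ n) x \<in> N" unfolding W_def by auto
    then show "T x \<in> W"
    proof
      assume "x \<in> (T ^^ n) ` N"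
      then have "T x \<in> (T ^^ Suc n) ` N" by auto
      then show ?thesis unfolding W_def by blast
    next
      assume a: "(T ^^ n) x \<in> N"
      show ?thesis
      proof (cases n)
        case 0
        then have "T x \<in> (T ^^ 1) ` N" using a by simp
        then show ?thesis unfolding W_def by blast
      next
        case (Suc m)
        then have "(T ^^ m) (T x) \<in> N" using a by (simp add: funpow_swap1)
        then show ?thesis using aut_in_space[OF T x] unfolding W_def by blast
      qed
    qed
  qed
  moreover have "space M - (space M - W) = W" using W sets.sets_into_space by blast
  ultimately show ?thesis using W N NW aut_in_space[OF T]
    by (intro bexI[of _ "space M - W"]) auto
qed

lemma invariant_funpow:
  assumes T: "T \<in> automorphisms M" and Z: "\<forall>x\<in>space M. T x \<in> Z \<longleftrightarrow> x \<in> Z" and x: "x \<in> space M"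
  shows "(T ^^ n) x \<in> Z \<longleftrightarrow> x \<in> Z"
  by (induction n) (use Z aut_in_space[OF aut_funpow[OF T] x] x in auto)

section \<open>Coordinates onto Borel sets and the automorphisms they induce\<close>

context leb_space begin

text \<open>That almost every point of \<open>Y\<close> is attained is not stated here;
  \<open>good_domain\<close> derives it from the pushforward.\<close>

definition maps_onto :: "('a \<Rightarrow> real) \<Rightarrow> real set \<Rightarrow> bool" where
  "maps_onto f Y \<longleftrightarrow> f \<in> borel_measurable M \<and> Y \<in> sets borel \<and> (\<exists>N\<in>null_sets M. inj_on f (space M - N)) \<and>
     (\<forall>G\<in>sets borel. emeasure M (f -` G \<inter> space M) = emeasure lborel (G \<inter> Y))"

text \<open>After removal of a null set, a measurable set has a Borel image. The image of the
  removed null set misses a Borel subset of full measure in \<open>Y\<close>, so it is null by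
  completeness. Hence \<open>f\<close> maps measurable sets to Lebesgue measurable sets of the same
  measure.\<close>

lemma good_domain:
  assumes "maps_onto f Y"
  obtains X where "X \<in> sets M" "X \<subseteq> X0" "space M - X \<in> null_sets M" "inj_on f X" "f ` X \<in> sets borel"
    "f ` X \<subseteq> Y" "Y - f ` X \<in> null_sets lborel"
    "\<And>D. D \<in> sets M \<Longrightarrow> D \<subseteq> X \<Longrightarrow> f ` D \<in> sets lebesgue \<and> emeasure lebesgue (f ` D) = emeasure M D"
    "\<And>G. G \<in> sets lebesgue \<Longrightarrow> f -` G \<inter> X \<in> sets M"
proof -
  obtain N where f: "f \<in> borel_measurable M" and Y: "Y \<in> sets borel" and N: "N \<in> null_sets M" "inj_on f (space M - N)"
    and push: "\<And>G. G \<in> sets borel \<Longrightarrow> emeasure M (f -` G \<inter> space M) = emeasure lborel (G \<inter> Y)"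
    using assms unfolding maps_onto_def by blast
  have fs: "f -` G \<inter> space M \<in> sets M" if "G \<in> sets borel" for G using f that by (rule measurable_sets)
  have nY: "f -` (- Y) \<inter> space M \<in> null_sets M"
    using push[of "- Y"] fs[of "- Y"] Y by (simp add: null_sets_def)
  define D0 where "D0 = (X0 - N) \<inter> (f -` Y \<inter> space M)"
  have D0: "D0 \<in> sets M" unfolding D0_def using X0 N fs[OF Y] by auto
  obtain X' where X': "X' \<in> sets M" "X' \<subseteq> D0" "D0 - X' \<in> null_sets M" "f ` X' \<in> sets borel"
    using lusin[OF D0 f] by blast
  have X's: "X' \<subseteq> space M" using X'(1) sets.sets_into_space by blast
  have "space M - X' \<subseteq> (space M - X0) \<union> N \<union> (f -` (- Y) \<inter> space M) \<union> (D0 - X')" unfolding D0_def by auto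
  moreover have "(space M - X0) \<union> N \<union> (f -` (- Y) \<inter> space M) \<union> (D0 - X') \<in> null_sets M"
    using X0_null N nY X'(3) by blast
  ultimately have X'c: "space M - X' \<in> null_sets M" using X'(1) by (meson null_sets_subset sets.compl_sets)
  have inj: "inj_on f X'" using N(2) X'(2) X's unfolding D0_def by (auto intro: inj_on_subset)
  have fX': "f ` X' \<subseteq> Y" using X'(2) unfolding D0_def by auto
  \<comment> \<open>The preimage of what the image of a set misses is disjoint from that set, hence
    null when the set is conull.\<close>
  have nullim: "Y - f ` D \<in> null_sets lborel" if "f ` D \<in> sets borel" "space M - D \<in> null_sets M" "D \<in> sets M" for D
  proof -
    have b: "Y - f ` D \<in> sets borel" using Y that by auto
    have "emeasure lborel (Y - f ` D) = emeasure M (f -` (Y - f ` D) \<inter> space M)"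
      using push[OF b] by (simp add: Int_absorb2 Diff_subset)
    also have "\<dots> \<le> emeasure M (space M - D)" using that by (intro emeasure_mono) auto
    also have "\<dots> = 0" using that by auto
    finally show ?thesis using b by (auto simp: null_sets_def)
  qed
  have img: "f ` D \<in> sets lebesgue \<and> emeasure lebesgue (f ` D) = emeasure M D" if D: "D \<in> sets M" "D \<subseteq> X'" for D
  proof -
    obtain D' where D': "D' \<in> sets M" "D' \<subseteq> D" "D - D' \<in> null_sets M" "f ` D' \<in> sets borel" using lusin[OF D(1) f] by blast
    \<comment> \<open>\<open>E\<close> will be a conull set with Borel image that avoids the null
      set \<open>D - D'\<close>; by injectivity the two images are disjoint.\<close>
    have "X' - (D - D') \<in> sets M" using X' D D' by auto
    then obtain E where E: "E \<in> sets M" "E \<subseteq> X' - (D - D')" "X' - (D - D') - E \<in> null_sets M" "f ` E \<in> sets borel"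
      using lusin f by blast
    have "space M - E \<subseteq> (space M - X') \<union> (D - D') \<union> (X' - (D - D') - E)" by auto
    then have "space M - E \<in> null_sets M"
      using null_sets.Un[OF null_sets.Un[OF X'c D'(3)] E(3)] E(1) by (meson null_sets_subset sets.compl_sets)
    then have 1: "Y - f ` E \<in> null_sets lborel" using nullim E by blast
    have "f ` (D - D') \<inter> f ` E = {}"
      using inj D(2) E(2) by (auto dest!: inj_onD)
    then have "f ` (D - D') \<subseteq> Y - f ` E" using fX' D(2) by blast
    then have n: "f ` (D - D') \<in> null_sets lebesgue"
      using 1 null_sets_completionI null_sets_completion_subset by blast
    have eq: "f ` D = f ` D' \<union> f ` (D - D')" using D'(2) by auto
    have s: "f ` D' \<in> sets lebesgue" using D'(4) by auto
    have "emeasure lebesgue (f ` D) = emeasure lebesgue (f ` D')"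
      unfolding eq using n s by (rule emeasure_Un_null_set[rotated])
    also have "\<dots> = emeasure lborel (f ` D' \<inter> Y)"
    proof -
      have "f ` D' \<inter> Y = f ` D'" using D'(2) D(2) fX' by blast
      then show ?thesis using D'(4) by (simp add: emeasure_completion)
    qed
    also have "\<dots> = emeasure M (f -` (f ` D') \<inter> space M)" using push[OF D'(4)] by simp
    also have "\<dots> = emeasure M D'"
    proof (rule emeasure_eq_AE)
      show "AE x in M. (x \<in> f -` (f ` D') \<inter> space M) = (x \<in> D')"
        using AE_not_in[OF X'c] AE_space
        by eventually_elim (use D'(2) D(2) inj in \<open>auto dest: inj_onD\<close>)
    qed (use fs[OF D'(4)] D' in auto)
    also have "\<dots> = emeasure M D"
      using emeasure_Un_null_set[OF D'(1) D'(3)] D'(2) by (simp add: Un_absorb1 Un_Diff_cancel)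
    finally show ?thesis using s n eq by auto
  qed
  have pre: "f -` G \<inter> X' \<in> sets M" if that_G: "G \<in> sets lebesgue" for G
  proof -
    obtain S K K' where G: "G = S \<union> K" "K \<subseteq> K'" "K' \<in> null_sets lborel" "S \<in> sets lborel"
      by (rule sets_completionE[OF that_G])
    have "f -` K' \<inter> space M \<in> null_sets M"
    proof -
      have b: "K' \<in> sets borel" using G(3) by auto
      have "emeasure M (f -` K' \<inter> space M) = emeasure lborel (K' \<inter> Y)" using push[OF b] .
      also have "\<dots> \<le> emeasure lborel K'" using b by (intro emeasure_mono) auto
      finally show ?thesis using fs[OF b] G(3) by (auto simp: null_sets_def)
    qed
    then have "f -` K \<inter> X' \<in> sets M"
      by (rule subset_null) (use G X's X'(2) in \<open>auto simp: D0_def\<close>)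
    moreover have "f -` S \<inter> X' = (f -` S \<inter> space M) \<inter> X'" using X's by auto
    ultimately show ?thesis using fs[of S] G X'(1) by (auto simp: G(1) vimage_Un Int_Un_distrib2)
  qed
  have "X' \<subseteq> X0" using X'(2) unfolding D0_def by auto
  then show ?thesis using that[OF X'(1) _ X'c inj X'(4) fX' nullim[OF X'(4) X'c X'(1)]] img pre by blast
qed

text \<open>The set from \<open>good_domain\<close> and its image serve as the two conull sets that
  an isomorphism requires.\<close>

lemma mp_isomorphism_of_maps_onto:
  assumes "maps_onto f Y"
  shows "mp_isomorphism M (restrict_space lebesgue Y) f"
proof -
  obtain X where X: "X \<in> sets M" "X \<subseteq> X0" "space M - X \<in> null_sets M" "inj_on f X" "f ` X \<in> sets borel"
    "f ` X \<subseteq> Y" "Y - f ` X \<in> null_sets lborel"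
    and img: "\<And>D. D \<in> sets M \<Longrightarrow> D \<subseteq> X \<Longrightarrow> f ` D \<in> sets lebesgue \<and> emeasure lebesgue (f ` D) = emeasure M D"
    and pre: "\<And>G. G \<in> sets lebesgue \<Longrightarrow> f -` G \<inter> X \<in> sets M"
    by (rule good_domain[OF assms]) (rule that; (assumption | blast))
  have Y: "Y \<in> sets borel" using assms unfolding maps_onto_def by blast
  have Xs: "X \<subseteq> space M" using X(1) sets.sets_into_space by blast
  let ?Y = "f ` X"
  have rr: "restrict_space (restrict_space lebesgue Y) ?Y = restrict_space lebesgue ?Y"
    using X(6) Y X(5) by (subst restrict_restrict_space) (auto simp: Int_absorb1)
  have sX: "space (restrict_space M X) = X" using Xs by (auto simp: space_restrict_space)
  have sY: "space (restrict_space lebesgue ?Y) = ?Y" by (simp add: space_restrict_space)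
  have setsX: "D \<in> sets (restrict_space M X) \<longleftrightarrow> D \<in> sets M \<and> D \<subseteq> X" for D
    using X(1) by (auto simp: sets_restrict_space_iff)
  have setsY: "D \<in> sets (restrict_space lebesgue ?Y) \<longleftrightarrow> D \<in> sets lebesgue \<and> D \<subseteq> ?Y" for D
    using X(5) by (auto simp: sets_restrict_space_iff)
  have bij: "bij_betw f X ?Y" using X(4) by (simp add: bij_betw_def)
  have m1: "f \<in> restrict_space M X \<rightarrow>\<^sub>M restrict_space lebesgue ?Y"
  proof (rule measurableI)
    fix A assume "A \<in> sets (restrict_space lebesgue ?Y)"
    then show "f -` A \<inter> space (restrict_space M X) \<in> sets (restrict_space M X)"
      unfolding sX setsX setsY using pre by auto
  qed (auto simp: sX sY)
  have m2: "inv_into X f \<in> restrict_space lebesgue ?Y \<rightarrow>\<^sub>M restrict_space M X"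
  proof (rule measurableI)
    fix A assume A: "A \<in> sets (restrict_space M X)"
    then have "inv_into X f -` A \<inter> ?Y = f ` A"
      unfolding setsX using X(4) by (force simp: inv_into_f_f)
    then show "inv_into X f -` A \<inter> space (restrict_space lebesgue ?Y) \<in> sets (restrict_space lebesgue ?Y)"
      unfolding sY setsY using A img unfolding setsX by auto
  qed (auto simp: sX sY inv_into_into)
  have d: "distr (restrict_space M X) (restrict_space lebesgue ?Y) f = restrict_space lebesgue ?Y"
  proof (rule measure_eqI)
    fix A assume "A \<in> sets (distr (restrict_space M X) (restrict_space lebesgue ?Y) f)"
    then have A: "A \<in> sets lebesgue" "A \<subseteq> ?Y" and A': "A \<in> sets (restrict_space lebesgue ?Y)" by (auto simp: setsY)
    have "f ` (f -` A \<inter> X) = A" using A(2) by auto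
    then have e: "emeasure lebesgue A = emeasure M (f -` A \<inter> X)" using img[OF pre[OF A(1)]] by auto
    have "emeasure (distr (restrict_space M X) (restrict_space lebesgue ?Y) f) A = emeasure (restrict_space M X) (f -` A \<inter> X)"
      using emeasure_distr[OF m1 A'] unfolding sX .
    also have "\<dots> = emeasure M (f -` A \<inter> X)" using X(1) by (subst emeasure_restrict_space) auto
    also have "\<dots> = emeasure (restrict_space lebesgue ?Y) A"
      unfolding e[symmetric] using X(5) A by (subst emeasure_restrict_space) auto
    finally show "emeasure (distr (restrict_space M X) (restrict_space lebesgue ?Y) f) A = emeasure (restrict_space lebesgue ?Y) A" .
  qed simp
  have "?Y \<in> sets (restrict_space lebesgue Y)" using X(5,6) Y by (auto simp: sets_restrict_space_iff)
  moreover have "space (restrict_space lebesgue Y) - ?Y \<in> null_sets (restrict_space lebesgue Y)"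
    using X(7) Y by (auto simp: space_restrict_space null_sets_restrict_space null_sets_completionI)
  ultimately show ?thesis unfolding mp_isomorphism_def
    using X(1,3) bij m1 m2 d by (intro exI[of _ X] exI[of _ "?Y"] conjI) (simp_all only: rr)
qed

text \<open>The automorphism is \<open>f\<close> followed by the inverse of \<open>\<psi>\<close>,
  defined where the images of both maps meet; \<open>automorphism_of_partial\<close> removes the
  exceptional points. When \<open>f\<close> is \<open>\<psi>\<close> followed by a self-map of the
  half-line, this realises the self-map on \<open>M\<close>.\<close>

lemma automorphism_between_maps:
  assumes "maps_onto \<psi> Y" "maps_onto f Y"
  shows "\<exists>T\<in>automorphisms M. AE x in M. \<psi> (T x) = f x"
proof -
  obtain X1 where X1: "X1 \<in> sets M" "space M - X1 \<in> null_sets M" "inj_on \<psi> X1" "\<psi> ` X1 \<in> sets borel"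
    "\<psi> ` X1 \<subseteq> Y" "Y - \<psi> ` X1 \<in> null_sets lborel"
    and img1: "\<And>D. D \<in> sets M \<Longrightarrow> D \<subseteq> X1 \<Longrightarrow> \<psi> ` D \<in> sets lebesgue \<and> emeasure lebesgue (\<psi> ` D) = emeasure M D"
    and pre1: "\<And>G. G \<in> sets lebesgue \<Longrightarrow> \<psi> -` G \<inter> X1 \<in> sets M"
    by (rule good_domain[OF assms(1)]) (rule that; (assumption | blast))
  obtain X2 where X2: "X2 \<in> sets M" "space M - X2 \<in> null_sets M" "inj_on f X2" "f ` X2 \<in> sets borel"
    "f ` X2 \<subseteq> Y" "Y - f ` X2 \<in> null_sets lborel"
    and img2: "\<And>D. D \<in> sets M \<Longrightarrow> D \<subseteq> X2 \<Longrightarrow> f ` D \<in> sets lebesgue \<and> emeasure lebesgue (f ` D) = emeasure M D"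
    and pre2: "\<And>G. G \<in> sets lebesgue \<Longrightarrow> f -` G \<inter> X2 \<in> sets M"
    by (rule good_domain[OF assms(2)]) (rule that; (assumption | blast))
  define K where "K = \<psi> ` X1 \<inter> f ` X2"
  have K: "K \<in> sets lebesgue" unfolding K_def using X1(4) X2(4) by auto
  define A1 where "A1 = \<psi> -` K \<inter> X1"
  define A2 where "A2 = f -` K \<inter> X2"
  have A: "A1 \<in> sets M" "A2 \<in> sets M" unfolding A1_def A2_def using pre1 pre2 K by auto
  have im: "\<psi> ` A1 = K" "f ` A2 = K" 
  proof -
    have "K \<subseteq> \<psi> ` A1"
    proof
      fix y assume y: "y \<in> K"
      then obtain x where "x \<in> X1" "y = \<psi> x" unfolding K_def by blast
      then show "y \<in> \<psi> ` A1" using y unfolding A1_def by blast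
    qed
    then show "\<psi> ` A1 = K" unfolding A1_def by blast
    have "K \<subseteq> f ` A2"
    proof
      fix y assume y: "y \<in> K"
      then obtain x where "x \<in> X2" "y = f x" unfolding K_def by blast
      then show "y \<in> f ` A2" using y unfolding A2_def by blast
    qed
    then show "f ` A2 = K" unfolding A2_def by blast
  qed
  have sub: "A1 \<subseteq> X1" "A2 \<subseteq> X2" unfolding A1_def A2_def by auto
  have c1: "space M - A1 \<in> null_sets M"
  proof -
    have "\<psi> ` (X1 - A1) \<subseteq> Y - f ` X2" unfolding A1_def K_def using X1(5) by auto
    then have "\<psi> ` (X1 - A1) \<in> null_sets lebesgue" using X2(6) null_sets_completionI null_sets_completion_subset by blast
    then have "X1 - A1 \<in> null_sets M" using img1[of "X1 - A1"] X1(1) A null_setsD1 by (intro null_setsI) fastforce+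
    moreover have "space M - A1 \<subseteq> (space M - X1) \<union> (X1 - A1)" by auto
    ultimately show ?thesis using X1(2) A by (meson null_sets.Un null_sets_subset sets.compl_sets)
  qed
  have c2: "space M - A2 \<in> null_sets M"
  proof -
    have "f ` (X2 - A2) \<subseteq> Y - \<psi> ` X1" unfolding A2_def K_def using X2(5) by auto
    then have "f ` (X2 - A2) \<in> null_sets lebesgue" using X1(6) null_sets_completionI null_sets_completion_subset by blast
    then have "X2 - A2 \<in> null_sets M" using img2[of "X2 - A2"] X2(1) A null_setsD1 by (intro null_setsI) fastforce+
    moreover have "space M - A2 \<subseteq> (space M - X2) \<union> (X2 - A2)" by auto
    ultimately show ?thesis using X2(2) A by (meson null_sets.Un null_sets_subset sets.compl_sets)
  qed
  define t where "t = (\<lambda>x. inv_into A1 \<psi> (f x))"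
  have b1: "bij_betw (inv_into A1 \<psi>) K A1"
    using X1(3) sub im by (metis bij_betw_def bij_betw_inv_into inj_on_subset)
  have b2: "bij_betw f A2 K" using X2(3) sub im by (metis bij_betw_def inj_on_subset)
  have bt: "bij_betw t A2 A1" using bij_betw_trans[OF b2 b1] by (simp add: t_def comp_def)
  have ti: "\<psi> (t x) = f x" if "x \<in> A2" for x
    unfolding t_def using im that by (intro f_inv_into_f) auto
  have tin: "t x \<in> A1" if "x \<in> A2" for x using bt that by (auto simp: bij_betw_def)
  have timg: "t ` D = \<psi> -` (f ` D) \<inter> A1" if D: "D \<subseteq> A2" for D
  proof (intro equalityI subsetI)
    fix y assume "y \<in> t ` D"
    then obtain x where "x \<in> D" "y = t x" by blast
    then show "y \<in> \<psi> -` (f ` D) \<inter> A1" using ti[of x] tin[of x] D by auto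
  next
    fix y assume y: "y \<in> \<psi> -` (f ` D) \<inter> A1"
    then have "\<psi> y \<in> f ` D" by simp
    then obtain x where x: "x \<in> D" "\<psi> y = f x" by (rule imageE) simp
    then have "\<psi> y = \<psi> (t x)" using ti[of x] D by auto
    then have "y = t x" using X1(3) sub y tin[of x] x D by (auto dest: inj_onD)
    then show "y \<in> t ` D" using x by blast
  qed
  have "\<exists>T\<in>automorphisms M. AE x in M. x \<in> A2 \<and> T x = t x"
  proof (rule automorphism_of_partial[OF A(2) c2 A(1) c1 bt])
    fix D assume D: "D \<in> sets M"
    have "t -` D \<inter> A2 = f -` (\<psi> ` (D \<inter> A1)) \<inter> A2"
    proof (intro equalityI subsetI)
      fix x assume "x \<in> t -` D \<inter> A2" then show "x \<in> f -` (\<psi> ` (D \<inter> A1)) \<inter> A2"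
        using ti tin by (metis IntD1 IntD2 IntI image_eqI vimageD vimageI)
    next
      fix x assume x: "x \<in> f -` (\<psi> ` (D \<inter> A1)) \<inter> A2"
      then obtain y where y: "y \<in> D" "y \<in> A1" "\<psi> y = f x" by auto
      then have "\<psi> y = \<psi> (t x)" using ti x by auto
      then have "y = t x" using X1(3) sub y tin x by (auto dest: inj_onD)
      then show "x \<in> t -` D \<inter> A2" using y x by auto
    qed
    also have "\<dots> = (f -` (\<psi> ` (D \<inter> A1)) \<inter> X2) \<inter> A2" using sub by auto
    also have "\<dots> \<in> sets M" using img1[of "D \<inter> A1"] pre2 D A sub by auto
    finally show "t -` D \<inter> A2 \<in> sets M" .
  next
    fix D assume D: "D \<in> sets M" "D \<subseteq> A2"
    have fD: "f ` D \<in> sets lebesgue" "emeasure lebesgue (f ` D) = emeasure M D" using img2[of D] D sub by auto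
    have e: "t ` D = \<psi> -` (f ` D) \<inter> X1" unfolding timg[OF D(2)] using D(2) im(2) unfolding A1_def by blast
    show s: "t ` D \<in> sets M" unfolding e using pre1 fD by auto
    have "(\<lambda>x. \<psi> (t x)) ` D = f ` D" by (rule image_cong) (use ti D(2) in auto)
    then have "\<psi> ` (t ` D) = f ` D" by (simp only: image_image)
    then show "emeasure M (t ` D) = emeasure M D" using img1[OF s] e fD by auto
  qed
  then obtain T where T: "T \<in> automorphisms M" "AE x in M. x \<in> A2 \<and> T x = t x" by blast
  have "AE x in M. \<psi> (T x) = f x" using T(2) by eventually_elim (use ti in auto)
  then show ?thesis using T(1) by blast
qed

end

section \<open>The sums in the metric and their uniform majorants\<close>

lemma summable_on_le_real:
  fixes f :: "'b \<Rightarrow> real"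
  assumes "h summable_on A" "\<And>x. x \<in> A \<Longrightarrow> 0 \<le> f x" "\<And>x. x \<in> A \<Longrightarrow> f x \<le> h x"
  shows "f summable_on A"
proof -
  have "bdd_above (sum f ` {F. F \<subseteq> A \<and> finite F})"
  proof (rule bdd_aboveI2)
    fix F assume "F \<in> {F. F \<subseteq> A \<and> finite F}"
    then have F: "F \<subseteq> A" "finite F" by auto
    have "sum f F \<le> sum h F" using F assms(3) by (intro sum_mono) auto
    also have "\<dots> \<le> infsum h A" using F assms by (intro finite_sum_le_infsum) (auto intro: order_trans)
    finally show "sum f F \<le> infsum h A" .
  qed
  then show ?thesis using assms(2) by (intro nonneg_bdd_above_summable_on)
qed

lemma summable_on_product_real:
  fixes f :: "'b \<Rightarrow> real" and h :: "'c \<Rightarrow> real"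
  assumes f: "f summable_on A" "\<And>x. x \<in> A \<Longrightarrow> 0 \<le> f x" and h: "h summable_on B" "\<And>x. x \<in> B \<Longrightarrow> 0 \<le> h x"
  shows "(\<lambda>(x,y). f x * h y) summable_on (A \<times> B)"
proof (rule nonneg_bdd_above_summable_on)
  show "bdd_above (sum (\<lambda>(x,y). f x * h y) ` {F. F \<subseteq> A \<times> B \<and> finite F})"
  proof (rule bdd_aboveI2)
    fix F assume "F \<in> {F. F \<subseteq> A \<times> B \<and> finite F}"
    then have F: "F \<subseteq> A \<times> B" "finite F" by auto
    let ?P = "fst ` F" and ?Q = "snd ` F"
    have PQ: "finite ?P" "finite ?Q" "?P \<subseteq> A" "?Q \<subseteq> B" "F \<subseteq> ?P \<times> ?Q" using F by force+
    have "sum (\<lambda>(x,y). f x * h y) F \<le> sum (\<lambda>(x,y). f x * h y) (?P \<times> ?Q)"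
      using PQ f(2) h(2) by (intro sum_mono2) (auto intro!: mult_nonneg_nonneg)
    also have "\<dots> = sum f ?P * sum h ?Q" by (simp add: sum_product sum.cartesian_product)
    also have "\<dots> \<le> infsum f A * infsum h B"
      using PQ f h by (intro mult_mono finite_sum_le_infsum infsum_nonneg sum_nonneg) auto
    finally show "sum (\<lambda>(x,y). f x * h y) F \<le> infsum f A * infsum h B" .
  qed
qed (use f h in \<open>auto intro!: mult_nonneg_nonneg\<close>)

text \<open>Outside the finite set \<open>F\<close> the sum is replaced by that of the
  majorant.\<close>

lemma infsum_le_split:
  fixes f b :: "'b \<Rightarrow> real"
  assumes b: "b summable_on A" and f: "\<And>x. x \<in> A \<Longrightarrow> 0 \<le> f x" "\<And>x. x \<in> A \<Longrightarrow> f x \<le> b x"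
    and F: "finite F" "F \<subseteq> A"
  shows "infsum f A \<le> sum f F + (infsum b A - sum b F)"
proof -
  have fs: "f summable_on A" using b f by (rule summable_on_le_real)
  have sub: "f summable_on (A - F)" "b summable_on (A - F)" using fs b by (auto intro: summable_on_subset_banach)
  have "infsum f A = infsum f F + infsum f (A - F)"
    using infsum_Un_disjoint[of f F "A - F"] sub F by (simp add: Un_absorb1)
  moreover have "infsum b A = infsum b F + infsum b (A - F)"
    using infsum_Un_disjoint[of b F "A - F"] sub F by (simp add: Un_absorb1)
  moreover have "infsum f (A - F) \<le> infsum b (A - F)" using sub f by (intro infsum_mono) auto
  ultimately show ?thesis using F by simp
qed

lemma share_bound:
  fixes x y e :: real
  assumes "0 \<le> x" "0 \<le> y" "0 < e"
  shows "x * (2 * (e / (8 * (1 + x + y)))) \<le> e / 4" "y * (e / (8 * (1 + x + y))) \<le> e / 8"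
proof -
  have q: "x / (1 + x + y) \<le> 1" "y / (1 + x + y) \<le> 1" using assms by auto
  have f: "x * (2 * (e / (8 * d))) = e / 4 * (x / d)" "y * (e / (8 * d)) = e / 8 * (y / d)" for d :: real by simp_all
  have "x * (2 * (e / (8 * (1 + x + y)))) = e / 4 * (x / (1 + x + y))" by (rule f)
  also have "\<dots> \<le> e / 4 * 1" using q(1) assms by (intro mult_left_mono) auto
  finally show "x * (2 * (e / (8 * (1 + x + y)))) \<le> e / 4" by simp
  have "y * (e / (8 * (1 + x + y))) = e / 8 * (y / (1 + x + y))" by (rule f)
  also have "\<dots> \<le> e / 8 * 1" using q(2) assms by (intro mult_left_mono) auto
  finally show "y * (e / (8 * (1 + x + y))) \<le> e / 8" by simp
qed

lemma dist_le_imp_diff_le: "dist (x::real) y \<le> c \<Longrightarrow> y - x \<le> c"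
  by (simp add: dist_real_def abs_le_iff)

definition mdist :: "'a measure \<Rightarrow> 'a set \<Rightarrow> 'a set \<Rightarrow> real" where
  "mdist M A B = measure M (sym_diff A B)"

lemma mdist_nonneg: "0 \<le> mdist M A B" and mdist_commute: "mdist M A B = mdist M B A"
  and mdist_self [simp]: "mdist M A A = 0"
  unfolding mdist_def by (auto simp: Un_commute)

lemma fmeasurable_sym_diff [intro]: "A \<in> fmeasurable M \<Longrightarrow> B \<in> fmeasurable M \<Longrightarrow> sym_diff A B \<in> fmeasurable M"
  by (auto intro: fmeasurable.Un fmeasurable.Diff)

lemma mdist_triangle:
  assumes "A \<in> fmeasurable M" "B \<in> fmeasurable M" "C \<in> fmeasurable M"
  shows "mdist M A C \<le> mdist M A B + mdist M B C"
proof -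
  have "mdist M A C \<le> measure M (sym_diff A B \<union> sym_diff B C)"
    unfolding mdist_def using assms by (intro measure_mono_fmeasurable) (auto dest: fmeasurableD)
  also have "\<dots> \<le> mdist M A B + mdist M B C"
    unfolding mdist_def using assms by (intro measure_Un_le) (auto dest: fmeasurableD)
  finally show ?thesis .
qed

lemma mdist_le_add:
  assumes "A \<in> fmeasurable M" "B \<in> fmeasurable M"
  shows "mdist M A B \<le> measure M A + measure M B"
proof -
  have "mdist M A B \<le> measure M (A \<union> B)"
    unfolding mdist_def using assms by (intro measure_mono_fmeasurable) (auto dest: fmeasurableD)
  also have "\<dots> \<le> measure M A + measure M B" using assms by (intro measure_Un_le) (auto dest: fmeasurableD)
  finally show ?thesis .
qed

lemma measure_le_mdist:
  assumes "A \<in> fmeasurable M" "B \<in> fmeasurable M"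
  shows "measure M A \<le> measure M B + mdist M A B"
  using mdist_triangle[of A M B "{}"] assms by (auto simp: mdist_def Un_commute)

lemma aut_mdist:
  assumes "T \<in> automorphisms M" "A \<in> sets M" "B \<in> sets M"
  shows "mdist M (T ` A) (T ` B) = mdist M A B"
    "mdist M (T -` A \<inter> space M) (T -` B \<inter> space M) = mdist M A B"
proof -
  have s: "A \<subseteq> space M" "B \<subseteq> space M" using assms sets.sets_into_space by auto
  show "mdist M (T ` A) (T ` B) = mdist M A B"
    unfolding mdist_def aut_image_sym_diff[OF assms(1) s] using assms by (intro aut_measure) auto
  have "sym_diff (T -` A \<inter> space M) (T -` B \<inter> space M) = T -` (sym_diff A B) \<inter> space M" by auto
  then show "mdist M (T -` A \<inter> space M) (T -` B \<inter> space M) = mdist M A B"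
    unfolding mdist_def using assms by (simp only:) (intro aut_measure, auto)
qed

lemma AE_eq_image_null:
  assumes S: "S \<in> automorphisms M" and T: "T \<in> automorphisms M" and eq: "AE x in M. S x = T x" and A: "A \<in> sets M"
  shows "sym_diff (S ` A) (T ` A) \<in> null_sets M"
    "sym_diff (S -` A \<inter> space M) (T -` A \<inter> space M) \<in> null_sets M"
proof -
  obtain N where N: "N \<in> null_sets M" "{x\<in>space M. S x \<noteq> T x} \<subseteq> N" using eq by (auto simp: eventually_ae_filter)
  have As: "A \<subseteq> space M" using A sets.sets_into_space by auto
  have "sym_diff (S ` A) (T ` A) \<subseteq> S ` N \<union> T ` N" using N(2) As by (auto simp: image_iff subset_iff) (metis | blast)+
  then show "sym_diff (S ` A) (T ` A) \<in> null_sets M"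
    using aut_null(1)[OF S N(1)] aut_null(1)[OF T N(1)] automorphismsD(3)[OF S A] automorphismsD(3)[OF T A]
    by (meson null_sets.Un null_sets_subset sets.Diff sets.Un)
  have "sym_diff (S -` A \<inter> space M) (T -` A \<inter> space M) \<subseteq> N" using N(2) by auto
  then show "sym_diff (S -` A \<inter> space M) (T -` A \<inter> space M) \<in> null_sets M"
    using N(1) automorphismsD(2)[OF S A] automorphismsD(2)[OF T A]
    by (meson null_sets_subset sets.Diff sets.Un)
qed

lemma AE_eq_funpow:
  assumes S: "S \<in> automorphisms M" and T: "T \<in> automorphisms M" and eq: "AE x in M. S x = T x"
  shows "AE x in M. (S ^^ n) x = (T ^^ n) x"
proof (induction n)
  case (Suc n)
  have "AE x in M. S ((T ^^ n) x) = T ((T ^^ n) x)" using aut_AE[OF aut_funpow[OF T] eq] .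
  with Suc show ?case by eventually_elim simp
qed simp

lemma mdist_null:
  assumes "sym_diff A B \<in> null_sets M" shows "mdist M A B = 0"
  using assms by (simp add: mdist_def null_sets_def measure_def)

lemma mixing_AE_eq:
  assumes S: "S \<in> automorphisms M" and T: "T \<in> automorphisms M" and eq: "AE x in M. S x = T x" and mix: "mixing M T"
  shows "mixing M S"
  unfolding mixing_def
proof (intro ballI)
  fix A B assume A: "A \<in> fmeasurable M" and B: "B \<in> fmeasurable M"
  have "measure M ((S ^^ n) ` A \<inter> B) = measure M ((T ^^ n) ` A \<inter> B)" for n
  proof -
    have "(S ^^ n) ` A \<in> fmeasurable M" "(T ^^ n) ` A \<in> fmeasurable M"
      using aut_fmeasurable(1)[OF aut_funpow] S T A by auto
    moreover have n: "sym_diff ((S ^^ n) ` A) ((T ^^ n) ` A) \<in> null_sets M"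
      using AE_eq_image_null(1)[OF aut_funpow[OF S] aut_funpow[OF T] AE_eq_funpow[OF S T eq] fmeasurableD[OF A]] .
    ultimately have s: "(S ^^ n) ` A \<inter> B \<in> sets M" "(T ^^ n) ` A \<inter> B \<in> sets M" using B by (auto dest: fmeasurableD)
    have "AE x in M. x \<in> (S ^^ n) ` A \<inter> B \<longleftrightarrow> x \<in> (T ^^ n) ` A \<inter> B" using AE_not_in[OF n] by eventually_elim auto
    then show ?thesis using s by (intro measure_eq_AE)
  qed
  then show "(\<lambda>n. measure M ((S ^^ n) ` A \<inter> B)) \<longlonglongrightarrow> 0" using mix A B unfolding mixing_def by simp
qed

locale leb_dense = leb_space M g X0 for M :: "'a measure" and g X0 +
  fixes A :: "nat \<Rightarrow> 'a set"
  assumes dense: "dense_family M A"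
begin

lemma A_fmeasurable: "i \<ge> 1 \<Longrightarrow> A i \<in> fmeasurable M" using dense by (auto simp: dense_family_def)
lemma A_sets: "i \<ge> 1 \<Longrightarrow> A i \<in> sets M" using A_fmeasurable fmeasurableD by blast

lemma A_dense: "B \<in> fmeasurable M \<Longrightarrow> e > 0 \<Longrightarrow> \<exists>i\<ge>1. mdist M (A i) B < e"
  using dense by (auto simp: dense_family_def mdist_def)

lemma A_summable: "(\<lambda>i. (1/2) ^ i * measure M (A i)) summable_on {1..}" using dense by (auto simp: dense_family_def)

abbreviation "rterm S T i \<equiv> (1/2) ^ i * (mdist M (S ` A i) (T ` A i) + mdist M (S -` A i \<inter> space M) (T -` A i \<inter> space M))"
abbreviation "dterm S T \<equiv> \<lambda>(i,j). (1/2) ^ (i + j) * \<bar>measure M (S ` A i \<inter> A j) - measure M (T ` A i \<inter> A j)\<bar>"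
text \<open>The majorants \<open>rbound\<close> and \<open>dbound\<close> involve no automorphism,
  so they bound the terms for all powers at once: the supremum over \<open>n\<close> is finite, and
  the tails of the sums are small uniformly in \<open>n\<close>.\<close>

abbreviation "rbound i \<equiv> 4 * ((1/2) ^ i * measure M (A i))"
abbreviation "dbound \<equiv> \<lambda>(i,j::nat). (1/2::real) ^ i * measure M (A i) * (1/2) ^ j"

lemma rho_eq: "rho M A S T = infsum (rterm S T) {1..}"
  by (simp add: rho_def mdist_def)

lemma rbound_summable: "rbound summable_on {1..}" using A_summable by (rule summable_on_cmult_right)

lemma half_summable: "(\<lambda>j. (1/2::real) ^ j) summable_on {1::nat..}"
proof -
  have "(\<lambda>j. (1/2::real) ^ j) summable_on UNIV" by (intro summable_nonneg_imp_summable_on summable_geometric) auto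
  then show ?thesis by (rule summable_on_subset_banach) auto
qed

lemma dbound_summable: "dbound summable_on {1..} \<times> {1..}"
  by (rule summable_on_product_real[OF A_summable _ half_summable]) auto

lemma im_fmeasurable: "T \<in> automorphisms M \<Longrightarrow> i \<ge> 1 \<Longrightarrow> T ` A i \<in> fmeasurable M"
  "T \<in> automorphisms M \<Longrightarrow> i \<ge> 1 \<Longrightarrow> T -` A i \<inter> space M \<in> fmeasurable M"
  by (simp_all add: aut_fmeasurable A_fmeasurable)

lemma rterm_nonneg: "0 \<le> rterm S T i" by (simp add: mdist_nonneg)

lemma rterm_le:
  assumes S: "S \<in> automorphisms M" and T: "T \<in> automorphisms M" and i: "i \<ge> 1"
  shows "rterm S T i \<le> rbound i"
proof -
  have "mdist M (S ` A i) (T ` A i) \<le> 2 * measure M (A i)"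
    using mdist_le_add[OF im_fmeasurable(1)[OF S i] im_fmeasurable(1)[OF T i]] aut_measure(1)[OF S A_sets[OF i]] aut_measure(1)[OF T A_sets[OF i]] by simp
  moreover have "mdist M (S -` A i \<inter> space M) (T -` A i \<inter> space M) \<le> 2 * measure M (A i)"
    using mdist_le_add[OF im_fmeasurable(2)[OF S i] im_fmeasurable(2)[OF T i]] aut_measure(2)[OF S A_sets[OF i]] aut_measure(2)[OF T A_sets[OF i]] by simp
  ultimately show ?thesis by simp
qed

lemma dterm_nonneg: "0 \<le> dterm S T p" by (auto split: prod.split)

lemma dterm_le:
  assumes S: "S \<in> automorphisms M" and T: "T \<in> automorphisms M" and p: "p \<in> {1..} \<times> {1..}"
  shows "dterm S T p \<le> dbound p"
proof -
  obtain i j where ij: "p = (i,j)" "i \<ge> 1" "j \<ge> 1" using p by (cases p) auto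
  have le: "measure M (R ` A i \<inter> A j) \<le> measure M (A i)" if R: "R \<in> automorphisms M" for R
    using measure_mono_fmeasurable[of "R ` A i \<inter> A j" "R ` A i" M] im_fmeasurable(1)[OF R ij(2)] A_sets[OF ij(3)]
      aut_measure(1)[OF R A_sets[OF ij(2)]] by (auto dest: fmeasurableD)
  have "\<bar>measure M (S ` A i \<inter> A j) - measure M (T ` A i \<inter> A j)\<bar> \<le> measure M (A i)"
    using le[OF S] le[OF T] measure_nonneg[of M "S ` A i \<inter> A j"] measure_nonneg[of M "T ` A i \<inter> A j"] by linarith
  then show ?thesis unfolding ij(1) by (simp add: power_add mult_ac)
qed

lemma rterm_summable: "S \<in> automorphisms M \<Longrightarrow> T \<in> automorphisms M \<Longrightarrow> rterm S T summable_on {1..}"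
  by (rule summable_on_le_real[OF rbound_summable]) (auto simp: rterm_nonneg rterm_le)

lemma dterm_summable: "S \<in> automorphisms M \<Longrightarrow> T \<in> automorphisms M \<Longrightarrow> dterm S T summable_on ({1..} \<times> {1..})"
  by (rule summable_on_le_real[OF dbound_summable dterm_nonneg dterm_le])

lemma d_w_nonneg: "0 \<le> d_w M A S T" unfolding d_w_def by (rule infsum_nonneg) (rule dterm_nonneg)

lemma d_w_le: "S \<in> automorphisms M \<Longrightarrow> T \<in> automorphisms M \<Longrightarrow> d_w M A S T \<le> infsum dbound ({1..} \<times> {1..})"
  unfolding d_w_def by (rule infsum_mono[OF dterm_summable dbound_summable dterm_le])

lemma d_w_bdd: "S \<in> automorphisms M \<Longrightarrow> T \<in> automorphisms M \<Longrightarrow> bdd_above ((\<lambda>n. d_w M A (S ^^ n) (T ^^ n)) ` {0<..})"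
  by (rule bdd_aboveI2[where M = "infsum dbound ({1..} \<times> {1..})"]) (intro d_w_le aut_funpow)

lemma sup_d_w_nonneg: 
  assumes "S \<in> automorphisms M" "T \<in> automorphisms M" 
  shows "0 \<le> (SUP n\<in>{0<..}. d_w M A (S ^^ n) (T ^^ n))"
  by (rule cSUP_upper2[OF d_w_bdd[OF assms], of 1]) (auto simp: d_w_nonneg)

lemma rho_nonneg: "0 \<le> rho M A S T" unfolding rho_eq by (rule infsum_nonneg) (rule rterm_nonneg)

lemma rho_le_r_dist: "S \<in> automorphisms M \<Longrightarrow> T \<in> automorphisms M \<Longrightarrow> rho M A S T \<le> r_dist M A S T"
  unfolding r_dist_def using sup_d_w_nonneg by simp

lemma r_dist_nonneg: "S \<in> automorphisms M \<Longrightarrow> T \<in> automorphisms M \<Longrightarrow> 0 \<le> r_dist M A S T"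
  using rho_le_r_dist rho_nonneg order_trans by blast

lemma r_dist_commute: "r_dist M A S T = r_dist M A T S"
proof -
  have "rho M A S T = rho M A T S" unfolding rho_eq by (simp add: mdist_commute)
  moreover have "d_w M A S T = d_w M A T S" for S T unfolding d_w_def by (simp add: abs_minus_commute)
  ultimately show ?thesis unfolding r_dist_def by simp
qed

lemma r_dist_triangle:
  assumes S: "S \<in> automorphisms M" and T: "T \<in> automorphisms M" and U: "U \<in> automorphisms M"
  shows "r_dist M A S U \<le> r_dist M A S T + r_dist M A T U"
proof -
  have "rho M A S U \<le> infsum (\<lambda>i. rterm S T i + rterm T U i) {1..}"
    unfolding rho_eq
  proof (intro infsum_mono rterm_summable summable_on_add S T U)
    fix i :: nat assume "i \<in> {1..}"
    then have i: "i \<ge> 1" by simp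
    have "mdist M (S ` A i) (U ` A i) + mdist M (S -` A i \<inter> space M) (U -` A i \<inter> space M) \<le>
      (mdist M (S ` A i) (T ` A i) + mdist M (T ` A i) (U ` A i)) +
      (mdist M (S -` A i \<inter> space M) (T -` A i \<inter> space M) + mdist M (T -` A i \<inter> space M) (U -` A i \<inter> space M))"
      by (intro add_mono mdist_triangle im_fmeasurable i S T U)
    then have "rterm S U i \<le> (1/2) ^ i * ((mdist M (S ` A i) (T ` A i) + mdist M (T ` A i) (U ` A i)) +
      (mdist M (S -` A i \<inter> space M) (T -` A i \<inter> space M) + mdist M (T -` A i \<inter> space M) (U -` A i \<inter> space M)))"
      by (intro mult_left_mono) auto
    then show "rterm S U i \<le> rterm S T i + rterm T U i" by (simp add: algebra_simps)
  qed
  also have "\<dots> = rho M A S T + rho M A T U"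
    unfolding rho_eq by (intro infsum_add rterm_summable S T U)
  finally have 1: "rho M A S U \<le> rho M A S T + rho M A T U" .
  have d: "d_w M A S U \<le> d_w M A S T + d_w M A T U" if "S \<in> automorphisms M" "T \<in> automorphisms M" "U \<in> automorphisms M" for S T U
  proof -
    have "d_w M A S U \<le> infsum (\<lambda>p. dterm S T p + dterm T U p) ({1..} \<times> {1..})"
      unfolding d_w_def
    proof (intro infsum_mono dterm_summable summable_on_add that)
      fix p :: "nat \<times> nat"
      obtain i j where p: "p = (i,j)" by (cases p)
      show "dterm S U p \<le> dterm S T p + dterm T U p"
        unfolding p prod.case distrib_left[symmetric] by (intro mult_left_mono) auto
    qed
    also have "\<dots> = d_w M A S T + d_w M A T U"
      unfolding d_w_def by (intro infsum_add dterm_summable that)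
    finally show ?thesis .
  qed
  have "(SUP n\<in>{0<..}. d_w M A (S ^^ n) (U ^^ n)) \<le> (SUP n\<in>{0<..}. d_w M A (S ^^ n) (T ^^ n)) + (SUP n\<in>{0<..}. d_w M A (T ^^ n) (U ^^ n))"
  proof (rule cSUP_least)
    fix n :: nat assume n: "n \<in> {0<..}"
    have "d_w M A (S ^^ n) (U ^^ n) \<le> d_w M A (S ^^ n) (T ^^ n) + d_w M A (T ^^ n) (U ^^ n)"
      by (intro d aut_funpow S T U)
    also have "\<dots> \<le> (SUP n\<in>{0<..}. d_w M A (S ^^ n) (T ^^ n)) + (SUP n\<in>{0<..}. d_w M A (T ^^ n) (U ^^ n))"
      using n by (intro add_mono cSUP_upper d_w_bdd S T U)
    finally show "d_w M A (S ^^ n) (U ^^ n) \<le> (SUP n\<in>{0<..}. d_w M A (S ^^ n) (T ^^ n)) + (SUP n\<in>{0<..}. d_w M A (T ^^ n) (U ^^ n))" .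
  qed auto
  with 1 show ?thesis unfolding r_dist_def by simp
qed

lemma rho_ge_term:
  assumes "S \<in> automorphisms M" "T \<in> automorphisms M" "i \<ge> 1"
  shows "mdist M (S ` A i) (T ` A i) \<le> 2 ^ i * rho M A S T"
    "mdist M (S -` A i \<inter> space M) (T -` A i \<inter> space M) \<le> 2 ^ i * rho M A S T"
proof -
  have "sum (rterm S T) {i} \<le> rho M A S T" unfolding rho_eq
    using assms rterm_summable by (intro finite_sum_le_infsum) (auto simp: rterm_nonneg)
  then have "mdist M (S ` A i) (T ` A i) + mdist M (S -` A i \<inter> space M) (T -` A i \<inter> space M) \<le> 2 ^ i * rho M A S T"
    by (simp add: field_simps power_one_over)
  then show "mdist M (S ` A i) (T ` A i) \<le> 2 ^ i * rho M A S T"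
    "mdist M (S -` A i \<inter> space M) (T -` A i \<inter> space M) \<le> 2 ^ i * rho M A S T"
    using mdist_nonneg[of M "S ` A i"  "T ` A i"] mdist_nonneg[of M "S -` A i \<inter> space M" "T -` A i \<inter> space M"] by linarith+
qed

text \<open>Induction on \<open>n\<close>: the images of the previous level under \<open>T\<close>
  and under \<open>S\<close> are compared through some \<open>A i\<close> close to that level, for
  which \<open>rho\<close> bounds the distance of the images directly.\<close>

lemma rho_close:
  assumes T: "T \<in> automorphisms M"
  shows "B \<in> fmeasurable M \<Longrightarrow> e > 0 \<Longrightarrow> \<exists>d>0. \<forall>S\<in>automorphisms M. rho M A T S < d \<longrightarrow> mdist M ((T ^^ n) ` B) ((S ^^ n) ` B) < e"
proof (induction n arbitrary: e)
  case 0 then show ?case by (auto intro!: exI[of _ 1])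
next
  case (Suc n)
  let ?C = "(T ^^ n) ` B"
  have C: "?C \<in> fmeasurable M" using aut_fmeasurable(1)[OF aut_funpow[OF T] Suc.prems(1)] .
  obtain d where d: "d > 0" "\<And>S. S \<in> automorphisms M \<Longrightarrow> rho M A T S < d \<Longrightarrow> mdist M ?C ((S ^^ n) ` B) < e / 4"
    using Suc.IH[OF Suc.prems(1), of "e/4"] Suc.prems(2) by auto
  obtain i where i: "i \<ge> 1" "mdist M (A i) ?C < e / 4" using A_dense[OF C, of "e/4"] Suc.prems by auto
  have "mdist M ((T ^^ Suc n) ` B) ((S ^^ Suc n) ` B) < e" if S: "S \<in> automorphisms M" and r: "rho M A T S < min d (e / (4 * 2 ^ i))" for S
  proof -
    let ?D = "(S ^^ n) ` B"
    have D: "?D \<in> fmeasurable M" using aut_fmeasurable(1)[OF aut_funpow[OF S] Suc.prems(1)] .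
    have e: "(T ^^ Suc n) ` B = T ` ?C" "(S ^^ Suc n) ` B = S ` ?D" by (auto simp: image_image)
    have f: "T ` ?C \<in> fmeasurable M" "S ` ?D \<in> fmeasurable M" "T ` A i \<in> fmeasurable M" "S ` A i \<in> fmeasurable M" "S ` ?C \<in> fmeasurable M"
      using aut_fmeasurable(1) S T C D A_fmeasurable[OF i(1)] by auto
    \<comment> \<open>Four errors below \<open>e/4\<close> each: twice the distance from the level
      to \<open>A i\<close>, the distance of the two images of \<open>A i\<close>, and the induction
      hypothesis.\<close>
    have "mdist M (T ` ?C) (S ` ?D) \<le> mdist M (T ` ?C) (T ` A i) + mdist M (T ` A i) (S ` ?D)" by (intro mdist_triangle f)
    also have "mdist M (T ` A i) (S ` ?D) \<le> mdist M (T ` A i) (S ` A i) + mdist M (S ` A i) (S ` ?D)" by (intro mdist_triangle f)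
    also have "mdist M (S ` A i) (S ` ?D) \<le> mdist M (S ` A i) (S ` ?C) + mdist M (S ` ?C) (S ` ?D)" by (intro mdist_triangle f)
    finally have "mdist M (T ` ?C) (S ` ?D) \<le> mdist M ?C (A i) + mdist M (T ` A i) (S ` A i) + mdist M (A i) ?C + mdist M ?C ?D"
      using aut_mdist(1)[OF S] aut_mdist(1)[OF T] C D A_sets[OF i(1)] by (simp add: fmeasurableD)
    moreover have "mdist M (T ` A i) (S ` A i) < e / 4"
    proof -
      have "2 ^ i * rho M A T S < e / 4" using r by (simp add: field_simps)
      then show ?thesis using rho_ge_term(1)[OF T S i(1)] by simp
    qed
    moreover have "mdist M ?C ?D < e / 4" using d(2)[OF S] r by simp
    ultimately show ?thesis unfolding e using i(2) by (simp add: mdist_commute)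
  qed
  then show ?case using d(1) Suc.prems(2) by (intro exI[of _ "min d (e / (4 * 2 ^ i))"]) auto
qed

text \<open>The preimages of all \<open>A i\<close> agree up to null sets, and by density so do
  those of the sets \<open>D (p,q)\<close>. Rational intervals separate the values of
  \<open>g\<close>, and \<open>g\<close> is injective on \<open>X0\<close>.\<close>

lemma rho_zero_imp_AE:
  assumes S: "S \<in> automorphisms M" and T: "T \<in> automorphisms M" and z: "rho M A S T = 0"
  shows "AE x in M. S x = T x"
proof -
  define D where "D = (\<lambda>(p,q). g -` {p..<q} \<inter> space M)"
  have D: "D pq \<in> fmeasurable M" for pq
  proof -
    obtain p q where pq: "pq = (p,q)" by (cases pq)
    have "emeasure M (D pq) = emeasure lborel ({p..<q} \<inter> {0..})" unfolding D_def pq prod.case by (rule g_push) auto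
    also have "\<dots> \<le> emeasure lborel {p..q}" by (intro emeasure_mono) auto
    also have "\<dots> < \<infinity>" by (cases "p \<le> q") auto
    finally show ?thesis unfolding fmeasurable_def using g_meas by (auto simp: D_def pq)
  qed
  have "AE x in M. S x \<in> D pq \<longleftrightarrow> T x \<in> D pq" for pq
  proof -
    let ?s = "S -` D pq \<inter> space M" and ?t = "T -` D pq \<inter> space M"
    have f: "?s \<in> fmeasurable M" "?t \<in> fmeasurable M" by (intro aut_fmeasurable(2) S T D)+
    have "mdist M ?s ?t \<le> 0 + e" if e: "e > 0" for e
    proof -
      obtain i where i: "i \<ge> 1" "mdist M (A i) (D pq) < e / 2" using A_dense[OF D[of pq], of "e/2"] e by auto
      have "mdist M ?s ?t \<le> mdist M ?s (S -` A i \<inter> space M) + mdist M (S -` A i \<inter> space M) ?t"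
        by (intro mdist_triangle f im_fmeasurable S i)
      also have "mdist M (S -` A i \<inter> space M) ?t \<le> mdist M (S -` A i \<inter> space M) (T -` A i \<inter> space M) + mdist M (T -` A i \<inter> space M) ?t"
        by (intro mdist_triangle f im_fmeasurable S T i)
      finally show ?thesis using rho_ge_term(2)[OF S T i(1)] z i(2) aut_mdist(2)[OF S] aut_mdist(2)[OF T] A_sets[OF i(1)] D[of pq]
        by (simp add: fmeasurableD mdist_commute)
    qed
    then have "mdist M ?s ?t \<le> 0" by (rule field_le_epsilon)
    then have "measure M (sym_diff ?s ?t) = 0" using mdist_nonneg[of M ?s ?t] unfolding mdist_def by simp
    then have "sym_diff ?s ?t \<in> null_sets M"
      using fmeasurable_sym_diff[OF f] by (simp add: null_sets_def emeasure_eq_measure2 fmeasurableD)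
    then have "AE x in M. x \<notin> sym_diff ?s ?t" by (rule AE_not_in)
    then show ?thesis using AE_space by eventually_elim auto
  qed
  then have "AE x in M. \<forall>pq\<in>\<rat> \<times> \<rat>. S x \<in> D pq \<longleftrightarrow> T x \<in> D pq"
    by (subst AE_ball_countable) (auto simp: countable_rat)
  moreover have "AE x in M. x \<in> X0" using AE_not_in[OF X0_null] AE_space by eventually_elim auto
  then have "AE x in M. S x \<in> X0" "AE x in M. T x \<in> X0" using aut_AE S T by blast+
  ultimately show ?thesis
  proof eventually_elim
    case (elim x)
    have sp: "S x \<in> space M" "T x \<in> space M" using elim(2,3) X0 sets.sets_into_space by blast+
    have no: False if lt: "g (P x) < g (Q x)" and PQ: "{P, Q} = {S, T}" for P Q
    proof -
      obtain q where q: "q \<in> \<rat>" "g (P x) < q" "q < g (Q x)" using Rats_dense_in_real[OF lt] by blast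
      obtain p where p: "p \<in> \<rat>" "p < g (P x)" using Rats_no_bot_less by blast
      have "P x \<in> D (p,q)" "Q x \<notin> D (p,q)" using p q sp PQ unfolding D_def by (auto simp: doubleton_eq_iff)
      then show False using elim(1) p q PQ by (auto simp: doubleton_eq_iff)
    qed
    have "g (S x) = g (T x)" using no[of S T] no[of T S] by (metis insert_commute linorder_neqE)
    then show "S x = T x" using g_inj elim by (auto dest: inj_onD)
  qed
qed

lemma r_dist_AE_eq:
  assumes S: "S \<in> automorphisms M" and T: "T \<in> automorphisms M" and eq: "AE x in M. S x = T x"
  shows "r_dist M A S T = 0"
proof -
  have "rho M A S T = 0" unfolding rho_eq
    using mdist_null AE_eq_image_null[OF S T eq] A_sets by (intro infsum_0) (auto simp: mdist_null)
  moreover have "d_w M A (S ^^ n) (T ^^ n) = 0" for n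
  proof -
    have "dterm (S ^^ n) (T ^^ n) p = 0" if pp: "p \<in> {1..} \<times> {1..}" for p
    proof -
      obtain i j where p: "p = (i,j)" "i \<ge> 1" "j \<ge> 1" using pp by (cases p) auto
      have n: "sym_diff ((S ^^ n) ` A i) ((T ^^ n) ` A i) \<in> null_sets M"
        using AE_eq_image_null(1)[OF aut_funpow[OF S] aut_funpow[OF T] AE_eq_funpow[OF S T eq] A_sets[OF p(2)]] .
      have s: "(S ^^ n) ` A i \<inter> A j \<in> sets M" "(T ^^ n) ` A i \<inter> A j \<in> sets M" 
        by (intro sets.Int automorphismsD(3) aut_funpow S T A_sets p)+
      have "AE x in M. x \<in> (S ^^ n) ` A i \<inter> A j \<longleftrightarrow> x \<in> (T ^^ n) ` A i \<inter> A j" using AE_not_in[OF n] by eventually_elim auto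
      then have "measure M ((S ^^ n) ` A i \<inter> A j) = measure M ((T ^^ n) ` A i \<inter> A j)" using s by (intro measure_eq_AE)
      then show ?thesis unfolding p(1) by simp
    qed
    then show ?thesis unfolding d_w_def by (rule infsum_0)
  qed
  ultimately show ?thesis unfolding r_dist_def by simp
qed

end

text \<open>A finite set carries the majorant up to \<open>e/2\<close>, and terms of size at most
  \<open>d\<close> on it contribute at most another \<open>e/2\<close>. The choice precedes
  \<open>f\<close>, which gives the uniformity.\<close>

lemma infsum_le_of_finite_part:
  fixes b :: "'b \<Rightarrow> real"
  assumes b: "b summable_on I" and e: "e > 0"
  obtains F d where "finite F" "F \<subseteq> I" "d > 0"
    "\<And>f. \<forall>x\<in>I. 0 \<le> f x \<and> f x \<le> b x \<Longrightarrow> \<forall>x\<in>F. f x \<le> d \<Longrightarrow> infsum f I \<le> e"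
proof -
  have e2: "e / 2 > 0" using e by simp
  obtain F where F: "finite F" "F \<subseteq> I" "dist (sum b F) (infsum b I) \<le> e / 2"
    using infsum_finite_approximation[OF b e2] by blast
  define d where "d = e / (2 * (1 + real (card F)))"
  have d: "d > 0" unfolding d_def using e by (intro divide_pos_pos) auto
  have dF: "real (card F) * d \<le> e / 2"
  proof -
    have "real (card F) * d = e / 2 * (real (card F) / (1 + real (card F)))" unfolding d_def by simp
    also have "\<dots> \<le> e / 2 * 1" using e by (intro mult_left_mono) auto
    finally show ?thesis by simp
  qed
  have "infsum f I \<le> e" if f: "\<forall>x\<in>I. 0 \<le> f x \<and> f x \<le> b x" "\<forall>x\<in>F. f x \<le> d" for f
  proof -
    have "infsum f I \<le> sum f F + (infsum b I - sum b F)" using f(1) by (intro infsum_le_split[OF b _ _ F(1,2)]) auto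
    moreover have "sum f F \<le> real (card F) * d" by (rule sum_bounded_above) (use f(2) in auto)
    ultimately show ?thesis using dF dist_le_imp_diff_le[OF F(3)] by linarith
  qed
  then show ?thesis by (rule that[OF F(1,2) d])
qed

context leb_dense begin

text \<open>The tails of both sums are bounded by those of \<open>rbound\<close> and
  \<open>dbound\<close>, which see neither the automorphisms nor the power \<open>n\<close>; only
  finitely many indices remain to be controlled.\<close>

lemma r_dist_small:
  assumes e: "e > 0"
  shows "\<exists>k d. d > 0 \<and> (\<forall>S\<in>automorphisms M. \<forall>T\<in>automorphisms M.
     (\<forall>i\<in>{1..k}. mdist M (S ` A i) (T ` A i) \<le> d \<and> mdist M (S -` A i \<inter> space M) (T -` A i \<inter> space M) \<le> d) \<longrightarrow>
     (\<forall>n>0. \<forall>i\<in>{1..k}. \<forall>j\<in>{1..k}. \<bar>measure M ((S ^^ n) ` A i \<inter> A j) - measure M ((T ^^ n) ` A i \<inter> A j)\<bar> \<le> d) \<longrightarrow>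
     r_dist M A S T < e)"
proof -
  have e4: "e / 4 > 0" using e by simp
  obtain F d1 where F: "finite F" "F \<subseteq> {1..}" "d1 > 0"
    and F': "\<And>f. \<forall>x\<in>{1..}. 0 \<le> f x \<and> f x \<le> rbound x \<Longrightarrow> \<forall>x\<in>F. f x \<le> d1 \<Longrightarrow> infsum f {1..} \<le> e / 4"
    by (rule infsum_le_of_finite_part[OF rbound_summable e4]) (rule that; (assumption | blast))
  obtain G d2 where G: "finite G" "G \<subseteq> {1..} \<times> {1..}" "d2 > 0"
    and G': "\<And>f. \<forall>x\<in>{1..} \<times> {1..}. 0 \<le> f x \<and> f x \<le> dbound x \<Longrightarrow> \<forall>x\<in>G. f x \<le> d2 \<Longrightarrow> infsum f ({1..} \<times> {1..}) \<le> e / 4"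
    by (rule infsum_le_of_finite_part[OF dbound_summable e4]) (rule that; (assumption | blast))
  \<comment> \<open>Inserting 0 makes the set nonempty, so that its maximum exists.\<close>
  define H where "H = insert 0 (F \<union> fst ` G \<union> snd ` G)"
  have fin: "finite H" unfolding H_def using F(1) G(1) by blast
  define k where "k = Max H"
  have kH: "i \<le> k" if "i \<in> H" for i unfolding k_def using fin that by (rule Max_ge)
  \<comment> \<open>A term of \<open>rho\<close> contains two distances, each at most
    \<open>d\<close>, which halves the tolerance \<open>d1\<close>.\<close>
  define d where "d = min (d1 / 2) d2"
  have d: "d > 0" unfolding d_def using F(3) G(3) by simp
  have p1: "(1/2) ^ i * x \<le> x" if "0 \<le> x" for i :: nat and x :: real
    using mult_right_mono[of "(1/2) ^ i" 1 x] that by (simp add: power_le_one)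
  have main: "r_dist M A S T < e" if S: "S \<in> automorphisms M" and T: "T \<in> automorphisms M"
    and a: "\<forall>i\<in>{1..k}. mdist M (S ` A i) (T ` A i) \<le> d \<and> mdist M (S -` A i \<inter> space M) (T -` A i \<inter> space M) \<le> d"
    and b: "\<forall>n>0. \<forall>i\<in>{1..k}. \<forall>j\<in>{1..k}. \<bar>measure M ((S ^^ n) ` A i \<inter> A j) - measure M ((T ^^ n) ` A i \<inter> A j)\<bar> \<le> d" for S T
  proof -
    have 1: "rho M A S T \<le> e / 4" unfolding rho_eq
    proof (rule F'; intro ballI)
      fix i :: nat assume "i \<in> {1..}"
      then show "0 \<le> rterm S T i \<and> rterm S T i \<le> rbound i" by (intro conjI rterm_nonneg rterm_le S T) simp
    next
      fix i assume i: "i \<in> F"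
      then have "i \<in> {1..k}" using kH[of i] F(2) by (auto simp: H_def)
      then have "mdist M (S ` A i) (T ` A i) \<le> d" "mdist M (S -` A i \<inter> space M) (T -` A i \<inter> space M) \<le> d" using a by blast+
      moreover have "rterm S T i \<le> mdist M (S ` A i) (T ` A i) + mdist M (S -` A i \<inter> space M) (T -` A i \<inter> space M)"
        by (rule p1) (intro add_nonneg_nonneg mdist_nonneg)
      moreover have "2 * d \<le> d1" unfolding d_def by simp
      ultimately show "rterm S T i \<le> d1" by linarith
    qed
    have 2: "(SUP n\<in>{0<..}. d_w M A (S ^^ n) (T ^^ n)) \<le> e / 4"
    proof (rule cSUP_least)
      fix n :: nat assume n: "n \<in> {0<..}"
      show "d_w M A (S ^^ n) (T ^^ n) \<le> e / 4" unfolding d_w_def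
      proof (rule G'; intro ballI)
        fix p :: "nat \<times> nat" assume "p \<in> {1..} \<times> {1..}"
        then show "0 \<le> dterm (S ^^ n) (T ^^ n) p \<and> dterm (S ^^ n) (T ^^ n) p \<le> dbound p"
          by (intro conjI dterm_nonneg dterm_le aut_funpow S T)
      next
        fix p assume p: "p \<in> G"
        obtain i j where ij: "p = (i,j)" by (cases p)
        have "i \<in> H" "j \<in> H" 
          using imageI[OF p, of fst] imageI[OF p, of snd] unfolding H_def ij by simp_all
        moreover have "1 \<le> i" "1 \<le> j" using p G(2) ij by auto
        ultimately have "i \<in> {1..k}" "j \<in> {1..k}" using kH by auto
        then have "\<bar>measure M ((S ^^ n) ` A i \<inter> A j) - measure M ((T ^^ n) ` A i \<inter> A j)\<bar> \<le> d" using b n by auto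
        moreover have "dterm (S ^^ n) (T ^^ n) p \<le> \<bar>measure M ((S ^^ n) ` A i \<inter> A j) - measure M ((T ^^ n) ` A i \<inter> A j)\<bar>"
          unfolding ij prod.case by (rule p1) simp
        ultimately show "dterm (S ^^ n) (T ^^ n) p \<le> d2" unfolding d_def by linarith
      qed
    qed auto
    show ?thesis using 1 2 e unfolding r_dist_def by linarith
  qed
  show ?thesis using d main by (intro exI[of _ k] exI[of _ d]) blast
qed

end

section \<open>Approximation by towers is an open condition\<close>

lemma mdist_UN_le:
  assumes "finite L" "\<And>t. t \<in> L \<Longrightarrow> X t \<in> fmeasurable M" "\<And>t. t \<in> L \<Longrightarrow> Y t \<in> fmeasurable M"
  shows "mdist M (\<Union>t\<in>L. X t) (\<Union>t\<in>L. Y t) \<le> (\<Sum>t\<in>L. mdist M (X t) (Y t))"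
proof -
  have f: "sym_diff (X t) (Y t) \<in> fmeasurable M" if "t \<in> L" for t using assms that by auto
  have "mdist M (\<Union>t\<in>L. X t) (\<Union>t\<in>L. Y t) \<le> measure M (\<Union>t\<in>L. sym_diff (X t) (Y t))"
    unfolding mdist_def
  proof (rule measure_mono_fmeasurable)
    show "sym_diff (\<Union>t\<in>L. X t) (\<Union>t\<in>L. Y t) \<subseteq> (\<Union>t\<in>L. sym_diff (X t) (Y t))" by auto
    show "sym_diff (\<Union>t\<in>L. X t) (\<Union>t\<in>L. Y t) \<in> sets M"
      using assms by (intro sets.Un sets.Diff sets.finite_UN) (auto dest: fmeasurableD)
    show "(\<Union>t\<in>L. sym_diff (X t) (Y t)) \<in> fmeasurable M" using assms(1) f by (rule fmeasurable.finite_UN)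
  qed
  also have "\<dots> \<le> (\<Sum>t\<in>L. mdist M (X t) (Y t))"
    unfolding mdist_def using assms(1) f by (intro measure_UNION_le) (auto dest: fmeasurableD)
  finally show ?thesis .
qed

lemma finite_slack:
  fixes f :: "'b \<Rightarrow> real"
  assumes "finite I" "\<And>i. i \<in> I \<Longrightarrow> f i < c"
  shows "\<exists>s>0. \<forall>i\<in>I. f i + s \<le> c"
  using assms
proof (induction I rule: finite_induct)
  case empty then show ?case by (auto intro: exI[of _ 1])
next
  case (insert j I)
  then obtain s where s: "s > 0" "\<forall>i\<in>I. f i + s \<le> c" by auto
  have j: "f j < c" using insert.prems by auto
  show ?case
  proof (intro exI[of _ "min s (c - f j)"] conjI ballI)
    show "0 < min s (c - f j)" using s j by simp
    fix i assume "i \<in> insert j I"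
    then show "f i + min s (c - f j) \<le> c" using s by (cases "i = j") (auto simp: min_def)
  qed
qed

lemma finite_common_pos:
  fixes P :: "nat \<Rightarrow> real \<Rightarrow> bool"
  assumes "\<And>t. t < h \<Longrightarrow> \<exists>d>0. P t d" "\<And>t d d'. P t d \<Longrightarrow> 0 < d' \<Longrightarrow> d' \<le> d \<Longrightarrow> P t d'"
  shows "\<exists>d>0. \<forall>t<h. P t d"
  using assms(1)
proof (induction h)
  case 0 then show ?case by (auto intro: exI[of _ 1])
next
  case (Suc h)
  then obtain d where d: "d > 0" "\<forall>t<h. P t d" by (meson less_SucI)
  obtain d' where d': "d' > 0" "P h d'" using Suc.prems by blast
  show ?case
  proof (intro exI[of _ "min d d'"] conjI allI impI)
    fix t assume "t < Suc h"
    then show "P t (min d d')" using d d' assms(2) by (cases "t = h") (auto simp: less_Suc_eq)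
  qed (use d d' in simp)
qed

text \<open>The property passes between almost everywhere equal automorphisms, so the representative
  chosen by \<open>SOME\<close> inherits it from the one that defines the class.\<close>

lemma aut_class:
  assumes "C \<in> {T \<in> automorphisms M. P T} // ae_rel M"
    and inv: "\<And>S T. S \<in> automorphisms M \<Longrightarrow> T \<in> automorphisms M \<Longrightarrow> AE x in M. S x = T x \<Longrightarrow> P T \<Longrightarrow> P S"
  shows "(SOME S. S \<in> C) \<in> automorphisms M" "P (SOME S. S \<in> C)" "C = ae_rel M `` {SOME S. S \<in> C}"
proof -
  obtain T where T: "T \<in> automorphisms M" "P T" "C = ae_rel M `` {T}" using assms(1) by (auto simp: quotient_def)
  have "T \<in> C" using T by (auto simp: ae_rel_def)
  then have S: "(SOME S. S \<in> C) \<in> C" by (rule someI[of "\<lambda>S. S \<in> C"])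
  let ?S = "SOME S. S \<in> C"
  have S': "?S \<in> automorphisms M" "AE x in M. T x = ?S x" using S unfolding T(3) by (auto simp: ae_rel_def)
  show "?S \<in> automorphisms M" by fact
  show "P ?S" using inv[OF S'(1) T(1) _ T(2)] S'(2) by (auto simp: eq_commute)
  show "C = ae_rel M `` {?S}" 
  proof (intro equalityI subsetI)
    fix U assume "U \<in> C"
    then have U: "U \<in> automorphisms M" "AE x in M. T x = U x" unfolding T(3) by (auto simp: ae_rel_def)
    have "AE x in M. ?S x = U x" using U(2) S'(2) by eventually_elim simp
    then show "U \<in> ae_rel M `` {?S}" using S' U by (auto simp: ae_rel_def)
  next
    fix U assume "U \<in> ae_rel M `` {?S}"
    then have U: "U \<in> automorphisms M" "AE x in M. ?S x = U x" by (auto simp: ae_rel_def)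
    have "AE x in M. T x = U x" using U(2) S'(2) by eventually_elim simp
    then show "U \<in> C" unfolding T(3) using T U by (auto simp: ae_rel_def)
  qed
qed

lemma ae_class_eq:
  assumes "S \<in> automorphisms M" "T \<in> automorphisms M" "AE x in M. S x = T x"
  shows "ae_rel M `` {S} = ae_rel M `` {T}"
proof -
  have "(AE x in M. S x = U x) \<longleftrightarrow> (AE x in M. T x = U x)" for U
  proof
    assume "AE x in M. S x = U x" with assms(3) show "AE x in M. T x = U x" by eventually_elim simp
  next
    assume "AE x in M. T x = U x" with assms(3) show "AE x in M. S x = U x" by eventually_elim simp
  qed
  then show ?thesis using assms(1,2) by (auto simp: ae_rel_def)
qed

lemma rank_one_AE_eq:
  assumes eq: "AE x in M. S x = T x" and "rank_one M T"
  shows "rank_one M S"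
proof -
  obtain h r s E C R f where "rank_one_construction h r s E C R"
    "mp_isomorphism M (restrict_space lebesgue (\<Union>j\<in>{1..}. tower_union R (E j) (h j))) f"
    and a: "AE x in M. f (T x) = R (f x)" using assms(2) unfolding rank_one_def by blast
  moreover have "AE x in M. f (S x) = R (f x)" using eq a by eventually_elim simp
  ultimately show ?thesis unfolding rank_one_def by blast
qed

context leb_dense begin

text \<open>The \<open>k\<close>-th of the countably many open conditions that characterise rank
  one. Small bases become compulsory as \<open>k\<close> grows, and finitely many sets with strict
  inequalities keep each condition stable under perturbation.\<close>

definition approx_tower :: "('a \<Rightarrow> 'a) \<Rightarrow> nat \<Rightarrow> bool" where
  "approx_tower T k \<longleftrightarrow> (\<exists>B\<in>fmeasurable M. \<exists>h. disjoint_family_on (\<lambda>t. (T ^^ t) ` B) {..<h} \<and>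
     0 < measure M B \<and> measure M B < 1 / real (Suc k) \<and>
     (\<forall>i\<in>{1..Suc k}. \<exists>L\<subseteq>{..<h}. mdist M (A i) (\<Union>t\<in>L. (T ^^ t) ` B) < 1 / real (Suc k)))"

text \<open>A point of \<open>B\<close> is discarded if one of its first \<open>h\<close> images
  under \<open>S\<close> misses the corresponding level of \<open>T\<close>. The levels over the
  rest lie inside those of \<open>T\<close>, so they stay disjoint, and little measure is
  lost.\<close>

lemma approx_tower_open:
  assumes T: "T \<in> automorphisms M" and "approx_tower T k"
  shows "\<exists>d>0. \<forall>S\<in>automorphisms M. r_dist M A T S < d \<longrightarrow> approx_tower S k"
proof -
  obtain B h where B: "B \<in> fmeasurable M" and dis: "disjoint_family_on (\<lambda>t. (T ^^ t) ` B) {..<h}"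
    and m: "0 < measure M B" "measure M B < 1 / real (Suc k)"
    and L0: "\<And>i. i \<in> {1..Suc k} \<Longrightarrow> \<exists>L\<subseteq>{..<h}. mdist M (A i) (\<Union>t\<in>L. (T ^^ t) ` B) < 1 / real (Suc k)"
    using assms(2) unfolding approx_tower_def by blast
  obtain L where L: "\<And>i. i \<in> {1..Suc k} \<Longrightarrow> L i \<subseteq> {..<h} \<and> mdist M (A i) (\<Union>t\<in>L i. (T ^^ t) ` B) < 1 / real (Suc k)"
    using L0 by metis
  have Bs: "B \<in> sets M" "B \<subseteq> space M" using B fmeasurableD sets.sets_into_space by blast+
  obtain s where s: "s > 0" "\<forall>i\<in>{1..Suc k}. mdist M (A i) (\<Union>t\<in>L i. (T ^^ t) ` B) + s \<le> 1 / real (Suc k)"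
    using finite_slack[of "{1..Suc k}" "\<lambda>i. mdist M (A i) (\<Union>t\<in>L i. (T ^^ t) ` B)" "1 / real (Suc k)"] L by auto
  \<comment> \<open>The base loses at most \<open>h * e\<close>, and a union of levels at most
    \<open>h\<close> times as much. Both must stay below the available slack; the 1 keeps the
    denominator positive.\<close>
  define e where "e = min (measure M B) s / (real h * real h + real h + 1)"
  have e: "e > 0" unfolding e_def using m(1) s(1) by (intro divide_pos_pos) (auto intro: add_nonneg_pos)
  have ee: "e * (real h * real h + real h + 1) = min (measure M B) s"
  proof -
    have "real h * real h + real h + 1 > 0" by (intro add_nonneg_pos) auto
    then show ?thesis unfolding e_def by simp
  qed
  have hh: "e * (real h * real h) \<ge> 0" "e * real h \<ge> 0" using e by auto
  have e1: "real h * e < measure M B" "real h * (real h * e) < s"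
  proof -
    have "e * (real h * real h) + e * real h + e = min (measure M B) s" using ee by (simp add: distrib_left)
    moreover have "real h * e = e * real h" "real h * (real h * e) = e * (real h * real h)" by simp_all
    moreover have "min (measure M B) s \<le> measure M B" "min (measure M B) s \<le> s" by simp_all
    ultimately show "real h * e < measure M B" "real h * (real h * e) < s" using hh e by linarith+
  qed
  have "\<exists>d>0. \<forall>t<h. \<forall>S\<in>automorphisms M. rho M A T S < d \<longrightarrow> mdist M ((T ^^ t) ` B) ((S ^^ t) ` B) < e"
    using rho_close[OF T B e] by (intro finite_common_pos) auto
  then obtain d where d: "d > 0" "\<And>t S. t < h \<Longrightarrow> S \<in> automorphisms M \<Longrightarrow> rho M A T S < d \<Longrightarrow> mdist M ((T ^^ t) ` B) ((S ^^ t) ` B) < e" by blast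
  have "approx_tower S k" if S: "S \<in> automorphisms M" and r: "r_dist M A T S < d" for S
  proof -
    have rho: "rho M A T S < d" using rho_le_r_dist[OF T S] r by simp
    have fT: "(T ^^ t) ` B \<in> fmeasurable M" "(S ^^ t) ` B \<in> fmeasurable M" for t
      using aut_fmeasurable(1)[OF aut_funpow[OF T] B] aut_fmeasurable(1)[OF aut_funpow[OF S] B] by auto
    define Q where "Q = (\<lambda>t. (S ^^ t) -` ((S ^^ t) ` B - (T ^^ t) ` B) \<inter> space M)"
    have Q: "Q t \<in> sets M" for t unfolding Q_def
      using automorphismsD(2)[OF aut_funpow[OF S]] fT by (auto dest: fmeasurableD)
    have Qm: "measure M (Q t) \<le> e" if "t < h" for t
    proof -
      have "measure M (Q t) = measure M ((S ^^ t) ` B - (T ^^ t) ` B)"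
        unfolding Q_def using aut_measure(2)[OF aut_funpow[OF S]] fT by (auto dest: fmeasurableD)
      also have "\<dots> \<le> mdist M ((T ^^ t) ` B) ((S ^^ t) ` B)" unfolding mdist_def
        using fT by (intro measure_mono_fmeasurable) (auto dest: fmeasurableD)
      also have "\<dots> \<le> e" using d(2)[OF that S rho] by simp
      finally show ?thesis .
    qed
    define B' where "B' = B - (\<Union>t<h. Q t)"
    have B's: "B' \<in> sets M" unfolding B'_def using Bs Q by auto
    then have B': "B' \<in> fmeasurable M" using B unfolding B'_def by (meson Diff_subset fmeasurableI2)
    have BB': "B' \<subseteq> B" unfolding B'_def by auto
    have Qf: "Q t \<in> fmeasurable M" for t
      unfolding Q_def using fT by (intro aut_fmeasurable(2)[OF aut_funpow[OF S]]) (auto intro: fmeasurable.Diff)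
    have dm: "measure M (B - B') \<le> real h * e"
    proof -
      have "measure M (B - B') \<le> measure M (\<Union>t<h. Q t)"
      proof (rule measure_mono_fmeasurable)
        show "(\<Union>t<h. Q t) \<in> fmeasurable M" using Qf by (intro fmeasurable.finite_UN) auto
      qed (use Bs B's in \<open>auto simp: B'_def\<close>)
      also have "\<dots> \<le> (\<Sum>t<h. measure M (Q t))" using Qf by (intro measure_UNION_le) (auto dest: fmeasurableD)
      also have "\<dots> \<le> (\<Sum>t<h. e)" using Qm by (intro sum_mono) auto
      finally show ?thesis by simp
    qed
    have Bm: "measure M (B - B') = measure M B - measure M B'"
      using measurable_measure_Diff[OF B B's BB'] .
    have sub: "(S ^^ t) ` B' \<subseteq> (T ^^ t) ` B" if "t < h" for t
    proof
      fix y assume "y \<in> (S ^^ t) ` B'"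
      then obtain x where x: "x \<in> B'" "y = (S ^^ t) x" by auto
      then have "x \<notin> Q t" "x \<in> B" "x \<in> space M" using that BB' Bs unfolding B'_def by auto
      then show "y \<in> (T ^^ t) ` B" unfolding Q_def x(2) by auto
    qed
    have f': "(S ^^ t) ` B' \<in> fmeasurable M" for t using aut_fmeasurable(1)[OF aut_funpow[OF S] B'] .
    have md: "mdist M ((T ^^ t) ` B) ((S ^^ t) ` B') \<le> real h * e" if "t < h" for t
    proof -
      have "sym_diff ((T ^^ t) ` B) ((S ^^ t) ` B') = (T ^^ t) ` B - (S ^^ t) ` B'" using sub[OF that] by auto
      then have "mdist M ((T ^^ t) ` B) ((S ^^ t) ` B') = measure M ((T ^^ t) ` B) - measure M ((S ^^ t) ` B')"
        unfolding mdist_def using measurable_measure_Diff[OF fT(1) fmeasurableD[OF f'] sub[OF that]] by simp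
      also have "\<dots> = measure M B - measure M B'"
        using aut_measure(1)[OF aut_funpow[OF T] Bs(1)] aut_measure(1)[OF aut_funpow[OF S] B's] by simp
      finally show ?thesis using dm Bm by simp
    qed
    have "\<exists>K\<subseteq>{..<h}. mdist M (A i) (\<Union>t\<in>K. (S ^^ t) ` B') < 1 / real (Suc k)" if i: "i \<in> {1..Suc k}" for i
    proof -
      have Li: "L i \<subseteq> {..<h}" "finite (L i)" using L[OF i] finite_subset by auto
      have U: "(\<Union>t\<in>L i. (T ^^ t) ` B) \<in> fmeasurable M" "(\<Union>t\<in>L i. (S ^^ t) ` B') \<in> fmeasurable M"
        using fT f' Li by (auto intro!: fmeasurable.finite_UN)
      have "mdist M (\<Union>t\<in>L i. (T ^^ t) ` B) (\<Union>t\<in>L i. (S ^^ t) ` B') \<le> (\<Sum>t\<in>L i. mdist M ((T ^^ t) ` B) ((S ^^ t) ` B'))"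
        using Li fT f' by (intro mdist_UN_le) auto
      also have "\<dots> \<le> real (card (L i)) * (real h * e)"
        using Li md by (intro sum_bounded_above) auto
      also have "\<dots> \<le> real h * (real h * e)"
        using card_mono[OF _ Li(1)] e by (intro mult_right_mono) auto
      finally have "mdist M (\<Union>t\<in>L i. (T ^^ t) ` B) (\<Union>t\<in>L i. (S ^^ t) ` B') < s" using e1(2) by simp
      moreover have "mdist M (A i) (\<Union>t\<in>L i. (S ^^ t) ` B') \<le> mdist M (A i) (\<Union>t\<in>L i. (T ^^ t) ` B) + mdist M (\<Union>t\<in>L i. (T ^^ t) ` B) (\<Union>t\<in>L i. (S ^^ t) ` B')"
        using U A_fmeasurable[of i] i by (intro mdist_triangle) auto
      ultimately show ?thesis using s(2) i Li(1) by (intro exI[of _ "L i"]) fastforce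
    qed
    moreover have "disjoint_family_on (\<lambda>t. (S ^^ t) ` B') {..<h}"
      using dis sub unfolding disjoint_family_on_def by (meson Int_mono disjoint_iff lessThan_iff subset_iff)
    moreover have "0 < measure M B'" using dm Bm e1 by simp
    moreover have "measure M B' < 1 / real (Suc k)"
      using m(2) Bm measure_nonneg[of M "B - B'"] by linarith
    ultimately show ?thesis unfolding approx_tower_def using B' by blast
  qed
  then show ?thesis using d(1) by blast
qed

section \<open>The metric space of mixing classes\<close>

lemma Mix_rep:
  assumes "P \<in> Mix M"
  shows "(SOME S. S \<in> P) \<in> automorphisms M" "mixing M (SOME S. S \<in> P)" "P = ae_rel M `` {SOME S. S \<in> P}"
  using aut_class[OF assms[unfolded Mix_def]] mixing_AE_eq by blast+

text \<open>\<^locale>\<open>Metric_space\<close> asks for nonnegativity everywhere; for arbitrary functions it rests on the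
  convention that non-measurable sets have measure \<open>0\<close>.\<close>

lemma r_dist_nonneg_any: "0 \<le> r_dist M A S T"
proof -
  let ?b = "\<lambda>(i::nat,j). (1/2::real) ^ i * ((1/2) ^ j * measure M (A j))"
  have b: "?b summable_on {1..} \<times> {1..}"
    by (rule summable_on_product_real[OF half_summable _ A_summable]) auto
  have le: "dterm S T p \<le> ?b p" if p: "p \<in> {1..} \<times> {1..}" for p and S T :: "'a \<Rightarrow> 'a"
  proof -
    obtain i j where ij: "p = (i,j)" "j \<ge> 1" using p by (cases p) auto
    have m: "measure M (K \<inter> A j) \<le> measure M (A j)" for K
    proof (cases "K \<inter> A j \<in> sets M")
      case True
      then show ?thesis using A_fmeasurable[OF ij(2)] by (intro measure_mono_fmeasurable) auto
    qed (simp add: measure_notin_sets)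
    have "\<bar>measure M (S ` A i \<inter> A j) - measure M (T ` A i \<inter> A j)\<bar> \<le> measure M (A j)"
      using m[of "S ` A i"] m[of "T ` A i"] measure_nonneg[of M "S ` A i \<inter> A j"] measure_nonneg[of M "T ` A i \<inter> A j"] by linarith
    then have "(1/2) ^ (i + j) * \<bar>measure M (S ` A i \<inter> A j) - measure M (T ` A i \<inter> A j)\<bar> \<le> (1/2) ^ (i + j) * measure M (A j)"
      by (intro mult_left_mono) auto
    then show ?thesis unfolding ij(1) by (simp add: power_add mult.assoc)
  qed
  have "d_w M A S T \<le> infsum ?b ({1..} \<times> {1..})" for S T :: "'a \<Rightarrow> 'a"
    unfolding d_w_def
  proof (rule infsum_mono[OF _ b le])
    show "dterm S T summable_on {1..} \<times> {1..}" using b dterm_nonneg le by (rule summable_on_le_real)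
  qed
  then have "bdd_above ((\<lambda>n. d_w M A (S ^^ n) (T ^^ n)) ` {0<..})" by (rule bdd_aboveI2)
  then have "0 \<le> (SUP n\<in>{0<..}. d_w M A (S ^^ n) (T ^^ n))"
    by (rule cSUP_upper2[of _ _ 1]) (auto simp: d_w_nonneg)
  then show ?thesis unfolding r_dist_def using rho_nonneg by simp
qed

text \<open>Distances are taken between chosen representatives. Distance 0 forces \<open>rho\<close>
  to vanish, hence equality almost everywhere and equality of the classes.\<close>

lemma Metric_space_Mix: "Metric_space (Mix M) (r_metric M A)"
proof
  show "0 \<le> r_metric M A x y" for x y unfolding r_metric_def by (rule r_dist_nonneg_any)
  show "r_metric M A x y = r_metric M A y x" for x y unfolding r_metric_def by (rule r_dist_commute)
  show "(r_metric M A P Q = 0) = (P = Q)" if P: "P \<in> Mix M" and Q: "Q \<in> Mix M" for P Q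
  proof
    let ?S = "SOME S. S \<in> P" and ?T = "SOME S. S \<in> Q"
    assume "r_metric M A P Q = 0"
    then have "r_dist M A ?S ?T = 0" unfolding r_metric_def .
    then have "rho M A ?S ?T = 0"
      using rho_le_r_dist[OF Mix_rep(1)[OF P] Mix_rep(1)[OF Q]] rho_nonneg[of ?S ?T] by linarith
    then have eq: "AE x in M. ?S x = ?T x" using rho_zero_imp_AE Mix_rep(1) P Q by blast
    show "P = Q"
      using ae_class_eq[OF Mix_rep(1)[OF P] Mix_rep(1)[OF Q] eq] Mix_rep(3)[OF P] Mix_rep(3)[OF Q] by argo
  next
    assume "P = Q"
    then show "r_metric M A P Q = 0" unfolding r_metric_def using r_dist_AE_eq[OF Mix_rep(1)[OF P] Mix_rep(1)[OF P]] by simp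
  qed
  show "r_metric M A x z \<le> r_metric M A x y + r_metric M A y z" if "x \<in> Mix M" "y \<in> Mix M" "z \<in> Mix M" for x y z
    unfolding r_metric_def using that by (intro r_dist_triangle Mix_rep)
qed

lemma rank_one_Mix_iff:
  assumes "P \<in> Mix M"
  shows "P \<in> rank_one_Mix M \<longleftrightarrow> rank_one M (SOME S. S \<in> P)"
proof
  assume "P \<in> rank_one_Mix M"
  then have "P \<in> {T \<in> automorphisms M. mixing M T \<and> rank_one M T} // ae_rel M" unfolding rank_one_Mix_def .
  from aut_class(2)[OF this] show "rank_one M (SOME S. S \<in> P)"
    using mixing_AE_eq rank_one_AE_eq by blast
next
  assume r1: "rank_one M (SOME S. S \<in> P)"
  let ?S = "SOME S. S \<in> P"
  have S: "?S \<in> {T \<in> automorphisms M. mixing M T \<and> rank_one M T}" using Mix_rep[OF assms] r1 by simp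
  have "ae_rel M `` {?S} \<in> rank_one_Mix M" unfolding rank_one_Mix_def by (rule quotientI[OF S])
  then show "P \<in> rank_one_Mix M" using Mix_rep(3)[OF assms] by argo
qed

lemma rank_one_Mix_subset: "rank_one_Mix M \<subseteq> Mix M"
  unfolding rank_one_Mix_def Mix_def by (auto simp: quotient_def)

text \<open>Typicality reduces to two statements on single automorphisms: the tower criterion makes
  the rank-one classes the intersection of the open sets from \<open>approx_tower_open\<close>, and
  density is read off on representatives.\<close>

theorem rank_one_typical_of_approximation:
  assumes iff: "\<And>T. T \<in> automorphisms M \<Longrightarrow> mixing M T \<Longrightarrow> rank_one M T \<longleftrightarrow> (\<forall>k. approx_tower T k)"
    and dens: "\<And>T e. T \<in> automorphisms M \<Longrightarrow> mixing M T \<Longrightarrow> e > 0 \<Longrightarrow>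
      \<exists>S\<in>automorphisms M. mixing M S \<and> rank_one M S \<and> r_dist M A T S < e"
  shows "gdelta_in (Mix_topology M A) (rank_one_Mix M) \<and> (Mix_topology M A) closure_of (rank_one_Mix M) = Mix M"
proof -
  interpret Metric_space "Mix M" "r_metric M A" by (rule Metric_space_Mix)
  define rep where "rep = (\<lambda>P :: ('a \<Rightarrow> 'a) set. SOME S. S \<in> P)"
  have rep: "rep P \<in> automorphisms M" "mixing M (rep P)" if "P \<in> Mix M" for P
    using Mix_rep[OF that] unfolding rep_def by auto
  define O' where "O' = (\<lambda>k. {P \<in> Mix M. approx_tower (rep P) k})"
  have op: "openin mtopology (O' k)" for k
    unfolding openin_mtopology
  proof (intro conjI allI impI)
    show "O' k \<subseteq> Mix M" unfolding O'_def by auto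
    fix P assume P: "P \<in> O' k"
    then obtain d where d: "d > 0" "\<And>S. S \<in> automorphisms M \<Longrightarrow> r_dist M A (rep P) S < d \<Longrightarrow> approx_tower S k"
      using approx_tower_open[of "rep P" k] rep unfolding O'_def by auto
    have "mball P d \<subseteq> O' k"
    proof
      fix Q assume "Q \<in> mball P d"
      then have Q: "Q \<in> Mix M" "r_metric M A P Q < d" by (auto simp: in_mball)
      then show "Q \<in> O' k" using d(2)[OF rep(1)[OF Q(1)]] unfolding O'_def r_metric_def rep_def by simp
    qed
    then show "\<exists>r>0. mball P r \<subseteq> O' k" using d(1) by blast
  qed
  have eq: "rank_one_Mix M = \<Inter>(range O')"
  proof (intro set_eqI iffI)
    fix P assume P: "P \<in> rank_one_Mix M"
    then have "P \<in> Mix M" using rank_one_Mix_subset by blast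
    then show "P \<in> \<Inter>(range O')" using P iff[OF rep] rank_one_Mix_iff unfolding O'_def rep_def by auto
  next
    fix P assume P: "P \<in> \<Inter>(range O')"
    then have "P \<in> Mix M" unfolding O'_def by auto
    then show "P \<in> rank_one_Mix M" using P iff[OF rep] rank_one_Mix_iff unfolding O'_def rep_def by auto
  qed
  have "gdelta_in mtopology (rank_one_Mix M)"
    unfolding gdelta_in_alt
  proof
    show "rank_one_Mix M \<subseteq> topspace mtopology" using rank_one_Mix_subset by simp
    show "(countable intersection_of openin mtopology) (rank_one_Mix M)"
      unfolding eq intersection_of_def using op by (intro exI[of _ "range O'"]) auto
  qed
  moreover have "mtopology closure_of (rank_one_Mix M) = Mix M"
    unfolding metric_closure_of
  proof (intro set_eqI iffI)
    fix P assume P: "P \<in> Mix M"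
    have "\<exists>Q\<in>rank_one_Mix M. Q \<in> mball P e" if e: "e > 0" for e
    proof -
      obtain S where S: "S \<in> automorphisms M" "mixing M S" "rank_one M S" "r_dist M A (rep P) S < e"
        using dens[OF rep[OF P] e] by blast
      define Q where "Q = ae_rel M `` {S}"
      have Q: "Q \<in> rank_one_Mix M" unfolding Q_def rank_one_Mix_def by (rule quotientI) (use S in simp)
      then have QM: "Q \<in> Mix M" using rank_one_Mix_subset by blast
      have "S \<in> Q" unfolding Q_def using S by (auto simp: ae_rel_def)
      then have "rep Q \<in> Q" unfolding rep_def by (rule someI[of "\<lambda>S. S \<in> Q"])
      then have "AE x in M. S x = rep Q x" unfolding Q_def by (auto simp: ae_rel_def)
      \<comment> \<open>The representative chosen in the class of \<open>S\<close> may differ from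
        \<open>S\<close>, but only on a null set, hence lies at distance 0.\<close>
      then have "r_dist M A S (rep Q) = 0" using r_dist_AE_eq[OF S(1) rep(1)[OF QM]] by blast
      then have "r_metric M A P Q < e"
        using r_dist_triangle[OF rep(1)[OF P] S(1) rep(1)[OF QM]] S(4) unfolding r_metric_def rep_def by linarith
      then show ?thesis using Q QM P by (auto simp: in_mball)
    qed
    then show "P \<in> {P \<in> Mix M. \<forall>e>0. \<exists>Q\<in>rank_one_Mix M. Q \<in> mball P e}" using P by blast
  qed auto
  ultimately show ?thesis unfolding Mix_topology_def by blast
qed

end

section \<open>An explicit cutting and stacking construction on the half-line\<close>

text \<open>Cutting parameters: column \<open>i < r j\<close> of stage \<open>j\<close> occupies the levels \<open>pos j i, \<dots>, pos j i + h j - 1\<close>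
  of the tower of stage \<open>j + 1\<close>; stages and columns are numbered from \<open>0\<close>.\<close>

locale cutting =
  fixes h r :: "nat \<Rightarrow> nat" and pos :: "nat \<Rightarrow> nat \<Rightarrow> nat" and w0 :: real and \<sigma>0 :: "nat \<Rightarrow> nat"
  assumes h0: "0 < h 0" and r_pos: "\<And>j. 0 < r j" and pos_0: "\<And>j. pos j 0 = 0"
    and pos_Suc: "\<And>j i. Suc i < r j \<Longrightarrow> pos j i + h j \<le> pos j (Suc i)"
    and pos_top: "\<And>j. pos j (r j - 1) + h j \<le> h (Suc j)"
    and w0: "0 < w0" and \<sigma>0: "bij_betw \<sigma>0 {..<h 0} {..<h 0}"
    and r_lim: "filterlim r at_top sequentially"
begin

lemma pos_less: "i < i' \<Longrightarrow> i' < r j \<Longrightarrow> pos j i + h j \<le> pos j i'"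
proof (induction i')
  case (Suc i')
  show ?case
  proof (cases "i = i'")
    case False
    then have "pos j i + h j \<le> pos j i'" using Suc by simp
    then show ?thesis using pos_Suc[OF Suc.prems(2)] by simp
  qed (use pos_Suc Suc.prems in simp)
qed simp

lemma pos_le_top: "i < r j \<Longrightarrow> pos j i + h j \<le> h (Suc j)"
proof -
  assume i: "i < r j"
  show ?thesis
  proof (cases "i = r j - 1")
    case False
    then have "pos j i + h j \<le> pos j (r j - 1)" using i by (intro pos_less) auto
    then show ?thesis using pos_top[of j] by simp
  qed (use pos_top in simp)
qed

lemma pos_add_less: "i < r j \<Longrightarrow> v < h j \<Longrightarrow> pos j i + v < h (Suc j)"
  using pos_le_top[of i j] by simp

lemma pos_inj:
  assumes "i < r j" "i' < r j" "v < h j" "v' < h j" "pos j i + v = pos j i' + v'"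
  shows "i = i' \<and> v = v'"
proof -
  have "\<not> i < i'" using pos_less[of i i' j] assms by auto
  moreover have "\<not> i' < i" using pos_less[of i' i j] assms by auto
  ultimately show ?thesis using assms by simp
qed

lemma h_pos: "0 < h j"
proof (induction j)
  case (Suc j)
  then show ?case using pos_add_less[OF r_pos, of 0 j] by simp
qed (rule h0)

lemma h_mono: "h j \<le> h (Suc j)"
  using pos_le_top[OF r_pos, of j] by simp

text \<open>Levels are numbered by their place on the line. Cutting the interval with number
  \<open>s v\<close> into \<open>r j\<close> equal parts from left to right gives part
  \<open>i\<close> the number \<open>r j * s v + i\<close> in units of the new width. Spacers
  receive the numbers from \<open>r j * h j\<close> on, so that every tower occupies an initial
  interval of the half-line.\<close>

lemma levels_extend:
  assumes s: "bij_betw s {..<h j} {..<h j}"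
  shows "\<exists>s'. bij_betw s' {..<h (Suc j)} {..<h (Suc j)} \<and> (\<forall>i<r j. \<forall>v<h j. s' (pos j i + v) = r j * s v + i)"
proof -
  let ?P = "{..<r j} \<times> {..<h j}"
  define e where "e = (\<lambda>(i,v). pos j i + v)"
  define f where "f = (\<lambda>(i,v). r j * s v + i)"
  have e: "inj_on e ?P" unfolding e_def inj_on_def using pos_inj by auto
  have eim: "e ` ?P \<subseteq> {..<h (Suc j)}" unfolding e_def using pos_add_less by auto
  have f: "inj_on f ?P"
  proof (rule inj_onI)
    fix p p' assume pp: "p \<in> ?P" "p' \<in> ?P" "f p = f p'"
    obtain i v i' v' where pv: "p = (i,v)" "p' = (i',v')" by (metis surj_pair)
    have a: "i < r j" "v < h j" "i' < r j" "v' < h j" "f (i,v) = f (i',v')" using pp pv by auto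
    then have eq: "r j * s v + i = r j * s v' + i'" unfolding f_def by simp
    then have "(r j * s v + i) mod r j = (r j * s v' + i') mod r j" by simp
    then have "i = i'" using a by simp
    then have "s v = s v'" using eq r_pos[of j] by simp
    then have "v = v'" using s a by (auto simp: bij_betw_def dest: inj_onD)
    then show "p = p'" using \<open>i = i'\<close> pv by simp
  qed
  have fim: "f ` ?P \<subseteq> {..<r j * h j}"
  proof (rule image_subsetI)
    fix p assume "p \<in> ?P"
    then obtain i v where p: "p = (i,v)" and a: "i \<in> {..<r j}" "v \<in> {..<h j}" by blast
    then have "s v < h j" using s by (auto simp: bij_betw_def)
    then have "Suc (s v) \<le> h j" by simp
    then have "r j * Suc (s v) \<le> r j * h j" by (rule mult_le_mono2)
    then show "f p \<in> {..<r j * h j}" using a unfolding f_def p by simp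
  qed
  have cP: "card ?P = r j * h j" by simp
  have fim2: "f ` ?P = {..<r j * h j}"
    by (rule card_subset_eq[OF _ fim]) (simp_all add: card_image[OF f])
  let ?R = "{..<h (Suc j)} - e ` ?P" and ?R' = "{r j * h j..<h (Suc j)}"
  have cR: "card ?R = card ?R'"
    using eim by (subst card_Diff_subset) (auto simp: card_image[OF e])
  \<comment> \<open>The spacers are placed to the right of the old tower in an arbitrary
    order.\<close>
  then obtain q where q: "bij_betw q ?R ?R'" using bij_betw_iff_card[of ?R ?R'] by auto
  have le: "r j * h j \<le> h (Suc j)"
    using card_mono[OF _ eim] by (simp add: card_image[OF e])
  define s' where "s' = (\<lambda>u. if u \<in> e ` ?P then f (inv_into ?P e u) else q u)"
  have "bij_betw (\<lambda>u. f (inv_into ?P e u)) (e ` ?P) {..<r j * h j}"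
    using bij_betw_trans[OF bij_betw_inv_into[OF inj_on_imp_bij_betw[OF e]], of f "{..<r j * h j}"] f fim2
    by (simp add: bij_betw_def comp_def)
  then have b1: "bij_betw s' (e ` ?P) {..<r j * h j}" unfolding s'_def by (subst bij_betw_cong) auto
  have b2: "bij_betw s' ?R ?R'" unfolding s'_def using q by (subst bij_betw_cong[where g = q]) auto
  have "bij_betw s' (e ` ?P \<union> ?R) ({..<r j * h j} \<union> ?R')"
    by (rule bij_betw_combine[OF b1 b2]) auto
  moreover have "e ` ?P \<union> ?R = {..<h (Suc j)}" using eim by auto
  moreover have "{..<r j * h j} \<union> ?R' = {..<h (Suc j)}" using le by auto
  moreover have "s' (pos j i + v) = r j * s v + i" if iv: "i < r j" "v < h j" for i v
  proof -
    have p: "(i,v) \<in> ?P" using iv by simp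
    then have "e (i,v) \<in> e ` ?P" by (rule imageI)
    then have "s' (e (i,v)) = f (i,v)" unfolding s'_def using inv_into_f_f[OF e p] by simp
    then show ?thesis unfolding e_def f_def by simp
  qed
  ultimately show ?thesis by auto
qed

lemma ex_levels: "\<exists>\<sigma>. \<sigma> 0 = \<sigma>0 \<and> (\<forall>j. bij_betw (\<sigma> j) {..<h j} {..<h j} \<and>
    (\<forall>i<r j. \<forall>v<h j. \<sigma> (Suc j) (pos j i + v) = r j * \<sigma> j v + i))"
proof -
  have "\<exists>f. \<forall>n. (bij_betw (f n) {..<h n} {..<h n} \<and> (n = 0 \<longrightarrow> f n = \<sigma>0)) \<and>
      (\<forall>i<r n. \<forall>v<h n. f (Suc n) (pos n i + v) = r n * f n v + i)"
    by (rule dependent_nat_choice) (use \<sigma>0 levels_extend in auto)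
  then show ?thesis by blast
qed

text \<open>Level \<open>u\<close> of stage \<open>j\<close> becomes interval number
  \<open>\<sigma> j u\<close> among the consecutive intervals of length \<open>w j\<close> that make
  up the tower.\<close>

definition \<sigma> :: "nat \<Rightarrow> nat \<Rightarrow> nat" where
  "\<sigma> = (SOME s. s 0 = \<sigma>0 \<and> (\<forall>j. bij_betw (s j) {..<h j} {..<h j} \<and>
    (\<forall>i<r j. \<forall>v<h j. s (Suc j) (pos j i + v) = r j * s j v + i)))"

lemma \<sigma>_0: "\<sigma> 0 = \<sigma>0" and \<sigma>_bij: "bij_betw (\<sigma> j) {..<h j} {..<h j}"
  and \<sigma>_Suc: "i < r j \<Longrightarrow> v < h j \<Longrightarrow> \<sigma> (Suc j) (pos j i + v) = r j * \<sigma> j v + i"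
  using someI_ex[OF ex_levels] unfolding \<sigma>_def[symmetric] by blast+

lemma \<sigma>_less: "u < h j \<Longrightarrow> \<sigma> j u < h j"
  using \<sigma>_bij[of j] by (auto simp: bij_betw_def)

lemma \<sigma>_inj: "u < h j \<Longrightarrow> u' < h j \<Longrightarrow> \<sigma> j u = \<sigma> j u' \<Longrightarrow> u = u'"
  using \<sigma>_bij[of j] by (auto simp: bij_betw_def dest: inj_onD)

lemma \<sigma>_surj: "k < h j \<Longrightarrow> \<exists>u<h j. \<sigma> j u = k"
  using \<sigma>_bij[of j] by (metis bij_betw_def image_iff lessThan_iff)

primrec w :: "nat \<Rightarrow> real" where
  "w 0 = w0" | "w (Suc j) = w j / real (r j)"

lemma w_pos: "0 < w j" by (induction j) (use w0 r_pos in auto)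

lemma w_Suc: "real (r j) * w (Suc j) = w j" using r_pos[of j] by simp

lemma w_le: "w j \<le> w0"
proof (induction j)
  case (Suc j)
  have "w (Suc j) \<le> w j / 1" using r_pos[of j] w_pos[of j] by (simp only: w.simps) (intro divide_left_mono, auto)
  then show ?case using Suc by simp
qed simp

lemma w_tendsto: "w \<longlonglongrightarrow> 0"
proof (rule LIMSEQ_imp_Suc)
  have "filterlim (\<lambda>j. real (r j)) at_top sequentially"
    using filterlim_compose[OF filterlim_real_sequentially r_lim] .
  then have lim: "(\<lambda>j. w0 / real (r j)) \<longlonglongrightarrow> 0"
    by (intro tendsto_divide_0[OF tendsto_const] filterlim_at_top_imp_at_infinity)
  show "(\<lambda>j. w (Suc j)) \<longlonglongrightarrow> 0"
  proof (rule tendsto_sandwich[OF _ _ tendsto_const lim])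
    have "w (Suc j) \<le> w0 / real (r j)" for j using w_le r_pos[of j] by (simp add: divide_right_mono)
    then show "\<forall>\<^sub>F j in sequentially. w (Suc j) \<le> w0 / real (r j)" by (rule always_eventually[OF allI])
    have "0 \<le> w (Suc j)" for j using w_pos[of "Suc j"] by (rule less_imp_le)
    then show "\<forall>\<^sub>F j in sequentially. 0 \<le> w (Suc j)" by (rule always_eventually[OF allI])
  qed
qed

definition lev :: "nat \<Rightarrow> nat \<Rightarrow> real set" where
  "lev j u = {real (\<sigma> j u) * w j..<real (\<sigma> j u) * w j + w j}"

lemma lev_Suc: "i < r j \<Longrightarrow> v < h j \<Longrightarrow>
  lev (Suc j) (pos j i + v) = {real (\<sigma> j v) * w j + real i * w (Suc j)..<real (\<sigma> j v) * w j + real i * w (Suc j) + w (Suc j)}"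
proof -
  assume iv: "i < r j" "v < h j"
  have "real (\<sigma> (Suc j) (pos j i + v)) * w (Suc j) = real (\<sigma> j v) * (real (r j) * w (Suc j)) + real i * w (Suc j)"
    unfolding \<sigma>_Suc[OF iv] by (simp add: algebra_simps del: w.simps)
  then show ?thesis unfolding lev_def w_Suc by simp
qed

lemma grid_unique:
  fixes c :: real
  assumes "0 < c" "real a * c \<le> y" "y < real a * c + c" "real b * c \<le> y" "y < real b * c + c"
  shows "a = b"
proof -
  have "real a * c < (real b + 1) * c" "real b * c < (real a + 1) * c" using assms by (auto simp: distrib_right)
  then have "real a < real b + 1" "real b < real a + 1" using assms(1) by (auto simp: mult_less_cancel_right)
  then show ?thesis by linarith
qed

lemma lev_unique: "y \<in> lev j u \<Longrightarrow> y \<in> lev j u' \<Longrightarrow> u < h j \<Longrightarrow> u' < h j \<Longrightarrow> u = u'"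
  using grid_unique[OF w_pos[of j], of "\<sigma> j u" y "\<sigma> j u'"] \<sigma>_inj unfolding lev_def by auto

lemma grid_exists:
  fixes c :: real
  assumes "0 < c" "0 \<le> y" "y < real n * c"
  shows "\<exists>k<n. real k * c \<le> y \<and> y < real k * c + c"
proof -
  define k where "k = nat \<lfloor>y / c\<rfloor>"
  have k: "real k = of_int \<lfloor>y / c\<rfloor>" unfolding k_def using assms by simp
  have 1: "real k \<le> y / c" "y / c < real k + 1" unfolding k by linarith+
  then have 2: "real k * c \<le> y" "y < (real k + 1) * c" using assms(1) by (auto simp: field_simps)
  then have "real k * c < real n * c" using assms by linarith
  then have "real k < real n" by (rule mult_less_cancel_right_pos[OF assms(1), THEN iffD1])
  then have "k < n" by simp
  then show ?thesis using 2 by (intro exI[of _ k]) (auto simp: distrib_right)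
qed

text \<open>In units of the new width, the \<open>r j\<close> numbers given to the copies of
  \<open>v\<close> fill exactly the old interval.\<close>

lemma lev_split: "v < h j \<Longrightarrow> lev j v = (\<Union>i<r j. lev (Suc j) (pos j i + v))"
proof (intro equalityI subsetI)
  fix y assume v: "v < h j" and y: "y \<in> lev j v"
  have "\<exists>i<r j. real i * w (Suc j) \<le> y - real (\<sigma> j v) * w j \<and> y - real (\<sigma> j v) * w j < real i * w (Suc j) + w (Suc j)"
    using y w_Suc[of j] unfolding lev_def by (intro grid_exists w_pos) auto
  then obtain i where i: "i < r j" "real i * w (Suc j) \<le> y - real (\<sigma> j v) * w j" "y - real (\<sigma> j v) * w j < real i * w (Suc j) + w (Suc j)" by blast
  then have "y \<in> lev (Suc j) (pos j i + v)" unfolding lev_Suc[OF i(1) v] by auto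
  then show "y \<in> (\<Union>i<r j. lev (Suc j) (pos j i + v))" using i by blast
next
  fix y assume v: "v < h j" and "y \<in> (\<Union>i<r j. lev (Suc j) (pos j i + v))"
  then obtain i where i: "i < r j" "y \<in> lev (Suc j) (pos j i + v)" by blast
  have "real i * w (Suc j) + w (Suc j) \<le> real (r j) * w (Suc j)"
  proof -
    have "(real i + 1) * w (Suc j) \<le> real (r j) * w (Suc j)" using i(1) w_pos[of "Suc j"] by (intro mult_right_mono) auto
    then show ?thesis by (simp only: distrib_right mult_1)
  qed
  moreover have "0 \<le> real i * w (Suc j)" using w_pos[of "Suc j"] by (intro mult_nonneg_nonneg) auto
  ultimately show "y \<in> lev j v" using i(2) unfolding lev_Suc[OF i(1) v] unfolding lev_def w_Suc by auto
qed

text \<open>\<open>\<sigma> j\<close> permutes the levels, so the intervals leave no holes.\<close>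

lemma lev_Union: "(\<Union>u<h j. lev j u) = {0..<real (h j) * w j}"
proof (intro equalityI subsetI)
  fix y assume "y \<in> (\<Union>u<h j. lev j u)"
  then obtain u where u: "u < h j" "y \<in> lev j u" by blast
  have a: "(real (\<sigma> j u) + 1) * w j \<le> real (h j) * w j" using \<sigma>_less[OF u(1)] w_pos[of j] by (intro mult_right_mono) auto
  have "0 \<le> real (\<sigma> j u) * w j" using w_pos[of j] by (intro mult_nonneg_nonneg) auto
  then have "0 \<le> y" by (rule order_trans) (use u(2) in \<open>simp add: lev_def\<close>)
  then show "y \<in> {0..<real (h j) * w j}" using a u(2) unfolding lev_def by (auto simp: distrib_right)
next
  fix y assume "y \<in> {0..<real (h j) * w j}"
  then obtain k where k: "k < h j" "real k * w j \<le> y" "y < real k * w j + w j" using grid_exists[OF w_pos[of j], of y "h j"] by auto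
  obtain u where "u < h j" "\<sigma> j u = k" using \<sigma>_surj[OF k(1)] by blast
  then show "y \<in> (\<Union>u<h j. lev j u)" using k unfolding lev_def by auto
qed

text \<open>The translation that carries level \<open>u\<close> of stage \<open>j\<close> to level
  \<open>u + n\<close>.\<close>

definition shift :: "nat \<Rightarrow> nat \<Rightarrow> nat \<Rightarrow> real" where
  "shift j u n = (real (\<sigma> j (u + n)) - real (\<sigma> j u)) * w j"

text \<open>Inside a column consecutive levels remain consecutive and keep their relative position
  on the line; so both the room of \<open>n\<close> levels above and the translation survive every
  cutting.\<close>

lemma lev_lift:
  assumes "j \<le> k" "y \<in> lev j u" "u + n < h j"
  shows "\<exists>v. y \<in> lev k v \<and> v + n < h k \<and> shift k v n = shift j u n"
  using assms
proof (induction k rule: dec_induct)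
  case (step k)
  then obtain v where v: "y \<in> lev k v" "v + n < h k" "shift k v n = shift j u n" by blast
  then obtain i where i: "i < r k" "y \<in> lev (Suc k) (pos k i + v)" using lev_split[of v k] by auto
  have "shift (Suc k) (pos k i + v) n = shift k v n"
    using \<sigma>_Suc[OF i(1), of v] \<sigma>_Suc[OF i(1), of "v + n"] v(2) unfolding shift_def
    by (simp add: add.assoc w_Suc[of k, symmetric] algebra_simps del: w.simps)
  then show ?case using v i pos_add_less[OF i(1) v(2)] by (intro exI[of _ "pos k i + v"]) (auto simp: add.assoc)
qed auto

text \<open>Both descriptions are lifted to the later of the two stages, where the level containing
  \<open>y\<close> is unique. This makes \<open>S\<close> well defined.\<close>

lemma shift_unique:
  assumes "y \<in> lev j u" "u + n < h j" "y \<in> lev j' u'" "u' + n < h j'"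
  shows "shift j u n = shift j' u' n"
proof -
  obtain v where v: "y \<in> lev (max j j') v" "v + n < h (max j j')" "shift (max j j') v n = shift j u n"
    using lev_lift[OF max.cobounded1[of j j'] assms(1,2)] by blast
  obtain v' where v': "y \<in> lev (max j j') v'" "v' + n < h (max j j')" "shift (max j j') v' n = shift j' u' n"
    using lev_lift[OF max.cobounded2[of j' j] assms(3,4)] by blast
  have "v = v'" using lev_unique v v' by (metis add_lessD1)
  then show ?thesis using v v' by simp
qed

text \<open>The translations of all stages, glued. Points that lie below the top level at no stage
  are fixed by convention.\<close>

definition S :: "real \<Rightarrow> real" where
  "S y = (if \<exists>j u. Suc u < h j \<and> y \<in> lev j u
     then y + (THE d. \<exists>j u. Suc u < h j \<and> y \<in> lev j u \<and> d = shift j u 1) else y)"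

lemma S_eq:
  assumes "y \<in> lev j u" "Suc u < h j"
  shows "S y = y + shift j u 1"
proof -
  have "(THE d. \<exists>j u. Suc u < h j \<and> y \<in> lev j u \<and> d = shift j u 1) = shift j u 1"
  proof (rule the_equality)
    show "\<exists>j' u'. Suc u' < h j' \<and> y \<in> lev j' u' \<and> shift j u 1 = shift j' u' 1" using assms by blast
    fix d assume "\<exists>j u. Suc u < h j \<and> y \<in> lev j u \<and> d = shift j u 1"
    then show "d = shift j u 1" using shift_unique[of y j u 1] assms by (metis Suc_eq_plus1)
  qed
  then show ?thesis unfolding S_def using assms by auto
qed

lemma shift_lev: "y \<in> lev j u \<longleftrightarrow> y + shift j u n \<in> lev j (u + n)"
  unfolding lev_def shift_def by (auto simp: algebra_simps)

lemma S_pow: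
  assumes "y \<in> lev j u" "u + n < h j"
  shows "(S ^^ n) y = y + shift j u n"
  using assms(2)
proof (induction n)
  case 0 then show ?case by (simp add: shift_def)
next
  case (Suc n)
  then have IH: "(S ^^ n) y = y + shift j u n" by simp
  then have "(S ^^ n) y \<in> lev j (u + n)" using shift_lev assms(1) by simp
  then have "S ((S ^^ n) y) = (S ^^ n) y + shift j (u + n) 1" using Suc.prems by (intro S_eq) auto
  moreover have "shift j u n + shift j (u + n) 1 = shift j u (Suc n)" by (simp add: shift_def algebra_simps)
  ultimately show ?case using IH by (simp add: add.assoc)
qed

lemma S_pow_lev: "y \<in> lev j u \<Longrightarrow> u + n < h j \<Longrightarrow> (S ^^ n) y \<in> lev j (u + n)"
  using S_pow shift_lev by simp

lemma S_pow_image: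
  assumes "u + n < h j"
  shows "(S ^^ n) ` lev j u = lev j (u + n)"
proof (intro equalityI subsetI)
  fix y assume y: "y \<in> lev j (u + n)"
  then have "y - shift j u n \<in> lev j u" using shift_lev[of "y - shift j u n" j u n] by simp
  moreover from S_pow[OF this assms] have "(S ^^ n) (y - shift j u n) = y" by simp
  ultimately show "y \<in> (S ^^ n) ` lev j u" by force
qed (use S_pow_lev assms in auto)

text \<open>The number of spacers above column \<open>i\<close>, with columns counted from 1 as in
  \<open>rank_one_construction\<close>, whereas \<open>pos\<close> counts them from 0. The last
  column carries what remains up to the top of the new tower.\<close>

definition spc :: "nat \<Rightarrow> nat \<Rightarrow> nat" where
  "spc j i = (if i < r j then pos j i - pos j (i - 1) - h j else h (Suc j) - pos j (r j - 1) - h j)"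

lemma pos_spc: "i \<ge> 1 \<Longrightarrow> i < r j \<Longrightarrow> pos j (i - 1) + h j + spc j i = pos j i"
  using pos_Suc[of "i - 1" j] unfolding spc_def by simp

lemma sum_spc: "m < r j \<Longrightarrow> pos j m = h j * m + (\<Sum>i=1..m. spc j i)"
proof (induction m)
  case (Suc m)
  then show ?case using pos_spc[of "Suc m" j] by simp
qed (simp add: pos_0)

lemma half_interval_lev: "half_interval (lev j u)"
  unfolding half_interval_def lev_def using w_pos by (intro exI conjI) auto

lemma lev_disjoint: "disjoint_family_on (lev j) {..<h j}"
  unfolding disjoint_family_on_def using lev_unique by fastforce

lemma tower_lev: "tower S (lev j 0) (h j)"
  unfolding tower_def
proof (intro conjI allI impI)
  fix k assume "k < h j"
  then show "half_interval ((S ^^ k) ` lev j 0)" using S_pow_image[of 0 k j] half_interval_lev by simp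
next
  show "disjoint_family_on (\<lambda>k. (S ^^ k) ` lev j 0) {..<h j}"
    using lev_disjoint[of j] S_pow_image[of 0 _ j] by (simp add: disjoint_family_on_def)
next
  fix k assume "Suc k < h j"
  then show "\<exists>c. \<forall>x\<in>(S ^^ k) ` lev j 0. S x = x + c" using S_pow_image[of 0 k j] S_eq[of _ j k] by auto
qed

lemma tower_union_lev: "tower_union S (lev j 0) (h j) = {0..<real (h j) * w j}"
  unfolding lev_Union[symmetric] tower_union_def using S_pow_image[of 0 _ j] by auto

lemma h_Suc_eq: "h (Suc j) = h j * r j + (\<Sum>i=1..r j. spc j i)"
proof -
  obtain m where m: "r j = Suc m" using r_pos[of j] by (cases "r j") auto
  have "pos j m = h j * m + (\<Sum>i=1..m. spc j i)" using sum_spc[of m j] m by simp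
  moreover have "spc j (Suc m) = h (Suc j) - pos j m - h j" unfolding spc_def using m by simp
  ultimately show ?thesis using pos_top[of j] unfolding m by simp
qed

lemma spacer_level:
  assumes i: "1 \<le> i" "i \<le> r j" and k: "k < spc j i"
  shows "pos j (i - 1) + (h j + k) < h (Suc j)"
    and "i' < r j \<Longrightarrow> v < h j \<Longrightarrow> pos j i' + v \<noteq> pos j (i - 1) + (h j + k)"
proof -
  have a: "pos j (i - 1) + (h j + k) < h (Suc j) \<and> (\<forall>i'. i - 1 < i' \<longrightarrow> i' < r j \<longrightarrow> pos j (i - 1) + (h j + k) < pos j i')"
  proof (cases "i < r j")
    case True
    then have a: "pos j (i - 1) + (h j + k) < pos j i" using pos_spc[of i j] i k by simp
    moreover have "pos j i \<le> pos j i'" if "i - 1 < i'" "i' < r j" for i'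
    proof (cases "i = i'")
      case False
      then have "i < i'" using that i by linarith
      then show ?thesis using that pos_less[of i i' j] by simp
    qed simp
    ultimately show ?thesis using pos_le_top[OF True] by (meson add_leD1 order_less_le_trans)
  next
    case False
    then have "i = r j" using i by simp
    then show ?thesis using k pos_top[of j] unfolding spc_def by auto
  qed
  show "pos j (i - 1) + (h j + k) < h (Suc j)" using a by simp
  assume iv: "i' < r j" "v < h j"
  show "pos j i' + v \<noteq> pos j (i - 1) + (h j + k)"
  proof (cases "i - 1 < i'")
    case True
    then have "pos j (i - 1) + (h j + k) < pos j i'" using a iv by blast
    then show ?thesis by simp
  next
    case False
    then have "pos j i' \<le> pos j (i - 1)" 
    proof (cases "i' = i - 1")
      case F2: False
      then have "i' < i - 1" "i - 1 < r j" using False i by linarith+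
      then show ?thesis using pos_less[of i' "i - 1" j] by simp
    qed simp
    then show ?thesis using iv by simp
  qed
qed

lemma spacer_disjoint:
  assumes i: "1 \<le> i" "i \<le> r j" and k: "k < spc j i"
  shows "(S ^^ (h j + k)) ` lev (Suc j) (pos j (i - 1)) \<inter> tower_union S (lev j 0) (h j) = {}"
proof -
  have "y \<notin> lev j v" if y: "y \<in> lev (Suc j) (pos j (i - 1) + (h j + k))" and v: "v < h j" for y v
  proof
    assume "y \<in> lev j v"
    then obtain i' where i': "i' < r j" "y \<in> lev (Suc j) (pos j i' + v)" using lev_split[OF v] by auto
    then show False using lev_unique[OF y i'(2) spacer_level(1)[OF assms] pos_add_less[OF i'(1) v]] spacer_level(2)[OF assms i'(1) v] by simp
  qed
  then show ?thesis unfolding tower_union_lev lev_Union[symmetric] S_pow_image[OF spacer_level(1)[OF assms]] by blast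
qed

lemma column_disjoint: "disjoint_family_on (\<lambda>i. lev (Suc j) (pos j (i - 1))) {1..r j}"
  unfolding disjoint_family_on_def
proof (intro ballI impI)
  fix m n assume "m \<in> {1..r j}" "n \<in> {1..r j}" "m \<noteq> n"
  then have mn: "m - 1 < r j" "n - 1 < r j" "m - 1 \<noteq> n - 1" by auto
  have lt: "pos j (m - 1) < h (Suc j)" "pos j (n - 1) < h (Suc j)"
    using pos_add_less[OF mn(1), of 0] pos_add_less[OF mn(2), of 0] h_pos[of j] by auto
  have "pos j (m - 1) \<noteq> pos j (n - 1)"
    using pos_inj[OF mn(1,2), of 0 0] mn h_pos[of j] by auto
  then show "lev (Suc j) (pos j (m - 1)) \<inter> lev (Suc j) (pos j (n - 1)) = {}" using lev_unique lt by blast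
qed

lemma column_Union: "lev j 0 = (\<Union>i\<in>{1..r j}. lev (Suc j) (pos j (i - 1)))"
proof -
  have "(\<lambda>i. i - 1) ` {1..r j} = {..<r j}"
  proof (intro equalityI subsetI)
    fix x assume "x \<in> {..<r j}"
    then show "x \<in> (\<lambda>i. i - 1) ` {1..r j}" by (intro image_eqI[of _ _ "Suc x"]) auto
  qed auto
  then have "(\<Union>i\<in>{1..r j}. lev (Suc j) (pos j (i - 1))) = (\<Union>i<r j. lev (Suc j) (pos j i))"
    by (metis (no_types, lifting) SUP_cong image_image)
  then show ?thesis using lev_split[OF h_pos, of j] by simp
qed

lemma column_next:
  assumes "1 \<le> i" "i < r j"
  shows "(S ^^ (h j + spc j i)) ` lev (Suc j) (pos j (i - 1)) = lev (Suc j) (pos j (Suc i - 1))"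
proof -
  have e: "pos j (i - 1) + (h j + spc j i) = pos j i" using pos_spc[OF assms] by simp
  have "pos j i < h (Suc j)" using pos_add_less[OF assms(2) h_pos[of j]] by simp
  then show ?thesis using S_pow_image[of "pos j (i - 1)" "h j + spc j i" "Suc j"] unfolding e by simp
qed

lemma rank_one_construction_lev:
  "rank_one_construction h r spc (\<lambda>j. lev j 0) (\<lambda>j i. lev (Suc j) (pos j (i - 1))) S"
proof -
  have m: "measure lebesgue (lev (Suc j) u) = w (Suc j)" for j u
    unfolding lev_def using w_pos[of "Suc j"] by (simp del: w.simps)
  show ?thesis unfolding rank_one_construction_def m
    by (intro conjI allI impI ballI h_pos r_pos r_lim h_Suc_eq tower_lev half_interval_lev column_disjoint column_Union
        spacer_disjoint column_next refl) (auto simp: pos_0)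
qed

end

section \<open>The stacked map preserves Lebesgue measure\<close>

context cutting begin

lemma lev_borel [measurable]: "lev j u \<in> sets borel"
  unfolding lev_def by simp

lemma lev_disj: "u < h j \<Longrightarrow> u' < h j \<Longrightarrow> u \<noteq> u' \<Longrightarrow> lev j u \<inter> lev j u' = {}"
  using lev_unique by blast

lemma emeasure_lev: "emeasure lborel (lev j u) = ennreal (w j)"
  unfolding lev_def using w_pos[of j] by simp

definition dom_S :: "nat \<Rightarrow> real set" where "dom_S j = (\<Union>u<h j - 1. lev j u)"
definition ran_S :: "nat \<Rightarrow> real set" where "ran_S j = (\<Union>u<h j - 1. lev j (Suc u))"

lemma dom_S_borel [measurable]: "dom_S j \<in> sets borel" and ran_S_borel [measurable]: "ran_S j \<in> sets borel"
  unfolding dom_S_def ran_S_def by (auto intro!: sets.finite_UN)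

lemma lev_lift_iter:
  assumes "y \<in> lev j u" "u + n < h j" "j \<le> k"
  shows "\<exists>v. y \<in> lev k v \<and> v + n < h k"
  using lev_lift[OF assms(3,1,2)] by blast

lemma dom_S_mono: "j \<le> k \<Longrightarrow> dom_S j \<subseteq> dom_S k"
proof
  fix y assume jk: "j \<le> k" and "y \<in> dom_S j"
  then obtain u where "u + 1 < h j" "y \<in> lev j u" unfolding dom_S_def by (auto simp: less_diff_conv)
  then obtain v where "y \<in> lev k v" "v + 1 < h k" using lev_lift_iter jk by blast
  then show "y \<in> dom_S k" unfolding dom_S_def by auto
qed

lemma ran_S_mono: "j \<le> k \<Longrightarrow> ran_S j \<subseteq> ran_S k"
proof
  fix y assume jk: "j \<le> k" and "y \<in> ran_S j"
  then obtain u where u: "u + 1 < h j" "y \<in> lev j (u + 1)" unfolding ran_S_def by (auto simp: less_diff_conv)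
  define x where "x = y - shift j u 1"
  have x: "x \<in> lev j u" using u shift_lev[of x j u 1] unfolding x_def by simp
  then obtain v where v: "x \<in> lev k v" "v + 1 < h k" "shift k v 1 = shift j u 1" using lev_lift[OF jk x u(1)] by blast
  then have "y \<in> lev k (v + 1)" using shift_lev[of x k v 1] unfolding x_def by simp
  then show "y \<in> ran_S k" using v(2) unfolding ran_S_def by auto
qed

text \<open>On a single level \<open>S\<close> is a translation onto the next one.\<close>

lemma emeasure_vimage_S_lev:
  assumes G: "G \<in> sets borel" and u: "Suc u < h j"
  shows "S -` G \<inter> lev j u \<in> sets borel"
    "emeasure lborel (S -` G \<inter> lev j u) = emeasure lborel (G \<inter> lev j (Suc u))"
proof -
  let ?c = "shift j u 1"
  have eq: "S -` G \<inter> lev j u = (\<lambda>y. ?c + y) -` (G \<inter> lev j (Suc u))"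
    using S_eq[OF _ u] shift_lev[of _ j u 1] by (auto simp: add.commute)
  have m: "(\<lambda>y. ?c + y) \<in> borel_measurable borel" by simp
  have GB: "G \<inter> lev j (Suc u) \<in> sets borel" using G by auto
  show "S -` G \<inter> lev j u \<in> sets borel" unfolding eq using measurable_sets[OF m GB] unfolding space_borel Int_UNIV_right .
  have d: "distr lborel borel (\<lambda>y. ?c + y) = (lborel :: real measure)" by (rule lborel_distr_plus)
  have "emeasure (distr lborel borel (\<lambda>y. ?c + y)) (G \<inter> lev j (Suc u)) =
    emeasure lborel ((\<lambda>y. ?c + y) -` (G \<inter> lev j (Suc u)) \<inter> space lborel)"
    by (rule emeasure_distr) (use GB in \<open>simp_all\<close>)
  then show "emeasure lborel (S -` G \<inter> lev j u) = emeasure lborel (G \<inter> lev j (Suc u))"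
    unfolding d eq space_lborel space_borel Int_UNIV_right by (rule sym)
qed

text \<open>The levels of a stage are disjoint, so the equalities for single levels add up.\<close>

lemma emeasure_vimage_S_dom:
  assumes G: "G \<in> sets borel"
  shows "S -` G \<inter> dom_S j \<in> sets borel" "emeasure lborel (S -` G \<inter> dom_S j) = emeasure lborel (G \<inter> ran_S j)"
proof -
  have u: "Suc u < h j" if "u < h j - 1" for u using that by simp
  have e1: "S -` G \<inter> dom_S j = (\<Union>u<h j - 1. S -` G \<inter> lev j u)"
    and e2: "G \<inter> ran_S j = (\<Union>u<h j - 1. G \<inter> lev j (Suc u))" unfolding dom_S_def ran_S_def by auto
  show "S -` G \<inter> dom_S j \<in> sets borel" unfolding e1
    by (rule sets.finite_UN[OF finite_lessThan]) (rule emeasure_vimage_S_lev(1)[OF G u], simp)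
  have d1: "disjoint_family_on (\<lambda>u. S -` G \<inter> lev j u) {..<h j - 1}"
    unfolding disjoint_family_on_def
  proof (intro ballI impI)
    fix m n assume "m \<in> {..<h j - 1}" "n \<in> {..<h j - 1}" "m \<noteq> n"
    then have "lev j m \<inter> lev j n = {}" using lev_disj[of m j n] by simp
    then show "S -` G \<inter> lev j m \<inter> (S -` G \<inter> lev j n) = {}" by blast
  qed
  have d2: "disjoint_family_on (\<lambda>u. G \<inter> lev j (Suc u)) {..<h j - 1}"
    unfolding disjoint_family_on_def
  proof (intro ballI impI)
    fix m n assume "m \<in> {..<h j - 1}" "n \<in> {..<h j - 1}" "m \<noteq> n"
    then have "lev j (Suc m) \<inter> lev j (Suc n) = {}" using lev_disj[of "Suc m" j "Suc n"] by simp
    then show "G \<inter> lev j (Suc m) \<inter> (G \<inter> lev j (Suc n)) = {}" by blast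
  qed
  have s1: "(\<lambda>u. S -` G \<inter> lev j u) ` {..<h j - 1} \<subseteq> sets lborel"
    by (rule image_subsetI) (use emeasure_vimage_S_lev(1)[OF G u] in simp)
  have s2: "(\<lambda>u. G \<inter> lev j (Suc u)) ` {..<h j - 1} \<subseteq> sets lborel"
    by (rule image_subsetI) (use G in simp)
  have "emeasure lborel (S -` G \<inter> dom_S j) = (\<Sum>u<h j - 1. emeasure lborel (S -` G \<inter> lev j u))"
    unfolding e1 by (rule sum_emeasure[symmetric, OF s1 d1 finite_lessThan])
  also have "\<dots> = (\<Sum>u<h j - 1. emeasure lborel (G \<inter> lev j (Suc u)))"
    by (rule sum.cong[OF refl]) (rule emeasure_vimage_S_lev(2)[OF G u], simp)
  also have "\<dots> = emeasure lborel (G \<inter> ran_S j)"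
    unfolding e2 by (rule sum_emeasure[OF s2 d2 finite_lessThan])
  finally show "emeasure lborel (S -` G \<inter> dom_S j) = emeasure lborel (G \<inter> ran_S j)" .
qed

lemma S_outside: "y \<notin> (\<Union>j. dom_S j) \<Longrightarrow> S y = y"
  unfolding S_def dom_S_def by auto

lemma S_borel [measurable]: "S \<in> borel_measurable borel"
proof (rule measurableI)
  fix G :: "real set" assume G: "G \<in> sets borel"
  have "S -` G \<inter> space borel = (\<Union>j. S -` G \<inter> dom_S j) \<union> (G - (\<Union>j. dom_S j))"
  proof (intro set_eqI)
    fix y show "y \<in> S -` G \<inter> space borel \<longleftrightarrow> y \<in> (\<Union>j. S -` G \<inter> dom_S j) \<union> (G - (\<Union>j. dom_S j))"
      using S_outside[of y] by (cases "y \<in> (\<Union>j. dom_S j)") auto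
  qed
  also have "\<dots> \<in> sets borel" using emeasure_vimage_S_dom(1)[OF G] G by (intro sets.Un sets.Diff sets.countable_UN') auto
  finally show "S -` G \<inter> space borel \<in> sets borel" .
qed simp

text \<open>At a common stage, points with equal images come from the same level and were moved by
  the same translation.\<close>

lemma inj_on_S: "inj_on S (\<Union>j. dom_S j)"
proof (rule inj_onI)
  fix x y assume "x \<in> (\<Union>j. dom_S j)" "y \<in> (\<Union>j. dom_S j)" and eq: "S x = S y"
  then obtain i k where ik: "x \<in> dom_S i" "y \<in> dom_S k" by blast
  define j where "j = max i k"
  have "x \<in> dom_S j" "y \<in> dom_S j" using ik dom_S_mono[of i j] dom_S_mono[of k j] unfolding j_def by auto
  then obtain u v where u: "u < h j - 1" "x \<in> lev j u" and v: "v < h j - 1" "y \<in> lev j v" unfolding dom_S_def by blast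
  have e: "S x = x + shift j u 1" "S y = y + shift j v 1" using S_eq u v by auto
  have "x + shift j u 1 \<in> lev j (u + 1)" "y + shift j v 1 \<in> lev j (v + 1)" using u v shift_lev by blast+
  then have "S y \<in> lev j (u + 1)" "S y \<in> lev j (v + 1)" unfolding e(1)[symmetric] e(2)[symmetric] eq by blast+
  moreover have "u + 1 < h j" "v + 1 < h j" using u(1) v(1) by simp_all
  ultimately have "u + 1 = v + 1" by (rule lev_unique)
  then have uv: "u = v" by simp
  show "x = y" using e eq unfolding uv by linarith
qed

lemma lev_top: "{0..<real (h j) * w j} - dom_S j \<subseteq> lev j (h j - 1)"
proof
  fix y assume y: "y \<in> {0..<real (h j) * w j} - dom_S j"
  then obtain u where u: "u < h j" "y \<in> lev j u" unfolding lev_Union[symmetric] by blast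
  then have "\<not> u < h j - 1" using y unfolding dom_S_def by blast
  then have "u = h j - 1" using u by simp
  then show "y \<in> lev j (h j - 1)" using u by simp
qed

lemma lev_bottom: "{0..<real (h j) * w j} - ran_S j \<subseteq> lev j 0"
proof
  fix y assume y: "y \<in> {0..<real (h j) * w j} - ran_S j"
  then obtain u where u: "u < h j" "y \<in> lev j u" unfolding lev_Union[symmetric] by blast
  show "y \<in> lev j 0"
  proof (cases u)
    case (Suc v)
    then have "y \<in> ran_S j" using u unfolding ran_S_def by auto
    then show ?thesis using y by simp
  qed (use u in simp)
qed

lemma tower_measure_mono: "j \<le> k \<Longrightarrow> real (h j) * w j \<le> real (h k) * w k"
proof (induction k rule: dec_induct)
  case (step k)
  have "{0..<real (h k) * w k} \<subseteq> {0..<real (h (Suc k)) * w (Suc k)}"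
    unfolding lev_Union[symmetric]
  proof
    fix y assume "y \<in> (\<Union>u<h k. lev k u)"
    then obtain u where "u < h k" "y \<in> lev k u" by blast
    then obtain v where "y \<in> lev (Suc k) v" "v + 0 < h (Suc k)" using lev_lift_iter[of y k u 0 "Suc k"] by auto
    then show "y \<in> (\<Union>u<h (Suc k). lev (Suc k) u)" by auto
  qed
  moreover have "0 < real (h k) * w k" using h_pos w_pos by simp
  ultimately have "real (h k) * w k \<le> real (h (Suc k)) * w (Suc k)" by (simp add: ivl_subset del: w.simps)
  then show ?case using step by simp
qed simp

text \<open>Inside a fixed tower the set has measure at most \<open>w j\<close> for all later
  \<open>j\<close>, and these widths tend to 0.\<close>

lemma null_of_thin:
  assumes Q: "Q \<in> sets borel" "\<And>y. y \<in> Q \<Longrightarrow> \<exists>k. y \<in> {0..<real (h k) * w k}"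
    and sub: "\<And>j. Q \<inter> {0..<real (h j) * w j} \<subseteq> lev j (f j)"
  shows "Q \<in> null_sets lborel"
proof -
  have "emeasure lborel (Q \<inter> {0..<real (h k) * w k}) = 0" for k
  proof -
    have "emeasure lborel (Q \<inter> {0..<real (h k) * w k}) \<le> ennreal (w j)" if "k \<le> j" for j
    proof -
      have "Q \<inter> {0..<real (h k) * w k} \<subseteq> lev j (f j)" using sub[of j] tower_measure_mono[OF that] by force
      then have "emeasure lborel (Q \<inter> {0..<real (h k) * w k}) \<le> emeasure lborel (lev j (f j))" by (intro emeasure_mono) auto
      then show ?thesis unfolding emeasure_lev .
    qed
    moreover have "(\<lambda>j. ennreal (w j)) \<longlonglongrightarrow> ennreal 0" using w_tendsto by (intro tendsto_ennrealI)
    ultimately have "emeasure lborel (Q \<inter> {0..<real (h k) * w k}) \<le> ennreal 0"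
      by (intro LIMSEQ_le_const) auto
    then show ?thesis by simp
  qed
  then have "Q \<inter> {0..<real (h k) * w k} \<in> null_sets lborel" for k using Q by auto
  then have "(\<Union>k. Q \<inter> {0..<real (h k) * w k}) \<in> null_sets lborel" by (rule null_sets_UN)
  moreover have "Q = (\<Union>k. Q \<inter> {0..<real (h k) * w k})" using Q(2) by blast
  ultimately show ?thesis by argo
qed

end

text \<open>Towers of unbounded measure exhaust the half-line, so \<open>S\<close> is determined by
  the construction almost everywhere on it.\<close>

locale cutting_inf = cutting +
  assumes tower_measure_unbounded: "\<And>c. \<exists>j. c < real (h j) * w j"
begin

lemma Union_towers: "(\<Union>j\<in>{1..}. tower_union S (lev j 0) (h j)) = {0..}"
  unfolding tower_union_lev
proof (intro equalityI subsetI)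
  fix y :: real assume y: "y \<in> {0..}"
  obtain j where j: "y < real (h j) * w j" using tower_measure_unbounded by blast
  then have "y < real (h (Suc j)) * w (Suc j)" using tower_measure_mono[of j "Suc j"] by simp
  then show "y \<in> (\<Union>j\<in>{1..}. {0..<real (h j) * w j})" using y by (intro UN_I[of "Suc j"]) (auto simp del: w.simps)
qed auto

lemma dom_S_conull: "{0..} - (\<Union>j. dom_S j) \<in> null_sets lborel"
proof (rule null_of_thin)
  show "{0..} - (\<Union>j. dom_S j) \<in> sets borel" by auto
  show "\<exists>k. y \<in> {0..<real (h k) * w k}" if "y \<in> {0..} - (\<Union>j. dom_S j)" for y using that tower_measure_unbounded[of y] by auto
  show "({0..} - (\<Union>j. dom_S j)) \<inter> {0..<real (h j) * w j} \<subseteq> lev j (h j - 1)" for j using lev_top[of j] by auto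
qed

lemma ran_S_conull: "{0..} - (\<Union>j. ran_S j) \<in> null_sets lborel"
proof (rule null_of_thin)
  show "{0..} - (\<Union>j. ran_S j) \<in> sets borel" by auto
  show "\<exists>k. y \<in> {0..<real (h k) * w k}" if "y \<in> {0..} - (\<Union>j. ran_S j)" for y using that tower_measure_unbounded[of y] by auto
  show "({0..} - (\<Union>j. ran_S j)) \<inter> {0..<real (h j) * w j} \<subseteq> lev j 0" for j using lev_bottom[of j] by auto
qed

lemma lev_nonneg: "u < h j \<Longrightarrow> lev j u \<subseteq> {0..}"
proof -
  assume "u < h j"
  then have "lev j u \<subseteq> {0..<real (h j) * w j}" unfolding lev_Union[symmetric] by blast
  then show ?thesis by auto
qed

lemma dom_ran_nonneg: "dom_S j \<subseteq> {0..}" "ran_S j \<subseteq> {0..}"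
proof -
  have "lev j u \<subseteq> {0..}" "lev j (Suc u) \<subseteq> {0..}" if "u < h j - 1" for u
    using lev_nonneg[of u j] lev_nonneg[of "Suc u" j] that by simp_all
  then show "dom_S j \<subseteq> {0..}" "ran_S j \<subseteq> {0..}" unfolding dom_S_def ran_S_def by blast+
qed

text \<open>The domains and the ranges of the stages increase to conull subsets of the half-line,
  and each stage preserves measure.\<close>

lemma emeasure_vimage_S:
  assumes G: "G \<in> sets borel"
  shows "emeasure lborel (S -` G \<inter> {0..}) = emeasure lborel (G \<inter> {0..})"
proof -
  have SG: "S -` G \<in> sets borel" using measurable_sets[OF S_borel G] by simp
  have cut: "emeasure lborel (K \<inter> {0..}) = emeasure lborel (\<Union>j. K \<inter> Q j)"
    if "K \<in> sets borel" "\<And>j. Q j \<in> sets borel" "\<And>j. Q j \<subseteq> {0..}" "{0..} - (\<Union>j. Q j) \<in> null_sets lborel" for K and Q :: "nat \<Rightarrow> real set"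
  proof (rule emeasure_eq_AE)
    show "AE x in lborel. (x \<in> K \<inter> {0..}) = (x \<in> (\<Union>j. K \<inter> Q j))"
      using AE_not_in[OF that(4)] by eventually_elim (use that(3) in auto)
  qed (use that in auto)
  have "emeasure lborel (S -` G \<inter> {0..}) = emeasure lborel (\<Union>j. S -` G \<inter> dom_S j)"
    by (rule cut[OF SG _ dom_ran_nonneg(1) dom_S_conull]) simp
  also have "\<dots> = (SUP j. emeasure lborel (S -` G \<inter> dom_S j))"
    using SG dom_S_mono by (intro SUP_emeasure_incseq[symmetric]) (auto simp: incseq_def)
  also have "\<dots> = (SUP j. emeasure lborel (G \<inter> ran_S j))" using emeasure_vimage_S_dom(2)[OF G] by simp
  also have "\<dots> = emeasure lborel (\<Union>j. G \<inter> ran_S j)"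
    using G ran_S_mono by (intro SUP_emeasure_incseq) (auto simp: incseq_def)
  also have "\<dots> = emeasure lborel (G \<inter> {0..})"
    by (rule cut[OF G _ dom_ran_nonneg(2) ran_S_conull, symmetric]) simp
  finally show ?thesis .
qed

end

section \<open>From stacked maps to rank-one automorphisms\<close>

context leb_space begin

text \<open>\<open>S\<close> is injective on a conull set and preserves measure, so composing with
  it yields a second coordinate onto the half-line; \<open>automorphism_between_maps\<close> then
  produces an automorphism conjugate to \<open>S\<close>.\<close>

lemma maps_onto_cutting:
  assumes c: "cutting_inf h r pos w0 \<sigma>0" and m: "maps_onto \<psi> {0..}"
  shows "maps_onto (\<lambda>x. cutting.S h r pos w0 \<sigma>0 (\<psi> x)) {0..}"
proof -
  interpret cutting_inf h r pos w0 \<sigma>0 by fact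
  obtain N where \<psi>: "\<psi> \<in> borel_measurable M" and N: "N \<in> null_sets M" "inj_on \<psi> (space M - N)"
    and push: "\<And>G. G \<in> sets borel \<Longrightarrow> emeasure M (\<psi> -` G \<inter> space M) = emeasure lborel (G \<inter> {0..})"
    using m unfolding maps_onto_def by blast
  let ?B = "- (\<Union>j. dom_S j)"
  define N' where "N' = N \<union> (\<psi> -` ?B \<inter> space M)"
  have "?B \<in> sets borel" by auto
  moreover have "emeasure lborel (?B \<inter> {0..}) = 0"
  proof -
    have "?B \<inter> {0..} = {0..} - (\<Union>j. dom_S j)" by auto
    then show ?thesis using dom_S_conull by auto
  qed
  ultimately have "\<psi> -` ?B \<inter> space M \<in> null_sets M" using push[of ?B] measurable_sets[OF \<psi>, of ?B] by (intro null_setsI) auto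
  then have N': "N' \<in> null_sets M" unfolding N'_def using N(1) by blast
  have i: "inj_on (\<lambda>x. S (\<psi> x)) (space M - N')"
  proof (rule inj_onI)
    fix x y assume x: "x \<in> space M - N'" "y \<in> space M - N'" "S (\<psi> x) = S (\<psi> y)"
    then have "\<psi> x \<in> (\<Union>j. dom_S j)" "\<psi> y \<in> (\<Union>j. dom_S j)" unfolding N'_def by auto
    then have "\<psi> x = \<psi> y" using inj_on_S x(3) by (auto dest: inj_onD)
    then show "x = y" using N(2) x unfolding N'_def by (auto dest: inj_onD)
  qed
  have p: "emeasure M ((\<lambda>x. S (\<psi> x)) -` G \<inter> space M) = emeasure lborel (G \<inter> {0..})" if G: "G \<in> sets borel" for G
  proof -
    have "(\<lambda>x. S (\<psi> x)) -` G \<inter> space M = \<psi> -` (S -` G) \<inter> space M" by auto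
    moreover have "S -` G \<in> sets borel" using measurable_sets[OF S_borel G] unfolding space_borel Int_UNIV_right .
    ultimately show ?thesis using push[of "S -` G"] emeasure_vimage_S[OF G] by argo
  qed
  have b: "(\<lambda>x. S (\<psi> x)) \<in> borel_measurable M" by (rule measurable_compose[OF \<psi> S_borel])
  show ?thesis unfolding maps_onto_def
    using b p bexI[where x = N' and P = "\<lambda>N. inj_on (\<lambda>x. S (\<psi> x)) (space M - N)", OF i N'] by simp
qed

lemma rank_one_of_cutting:
  assumes c: "cutting_inf h r pos w0 \<sigma>0" and m: "maps_onto \<psi> {0..}"
    and eq: "AE x in M. \<psi> (T x) = cutting.S h r pos w0 \<sigma>0 (\<psi> x)"
  shows "rank_one M T"
proof -
  interpret cutting_inf h r pos w0 \<sigma>0 by fact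
  have "mp_isomorphism M (restrict_space lebesgue (\<Union>j\<in>{1..}. tower_union S (lev j 0) (h j))) \<psi>"
    unfolding Union_towers by (rule mp_isomorphism_of_maps_onto[OF m])
  then show ?thesis unfolding rank_one_def
    by - (rule exI[of _ h], rule exI[of _ r], rule exI[of _ spc], rule exI[of _ "\<lambda>j. lev j 0"],
        rule exI[of _ "\<lambda>j i. lev (Suc j) (pos j (i - 1))"], rule exI[of _ S], rule exI[of _ \<psi>],
        intro conjI rank_one_construction_lev eq)
qed

end

section \<open>Rank one implies approximation by towers\<close>

lemma mp_isomorphism_lebesgueE:
  assumes iso: "mp_isomorphism M (restrict_space lebesgue Y) f" and Y: "Y \<in> sets lebesgue"
  obtains X where "X \<in> sets M" "space M - X \<in> null_sets M" "inj_on f X" "f ` X \<subseteq> Y"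
    "\<And>G. G \<in> sets lebesgue \<Longrightarrow> f -` G \<inter> X \<in> sets M"
    "\<And>G. G \<in> sets lebesgue \<Longrightarrow> emeasure M (f -` G \<inter> X) = emeasure lebesgue (G \<inter> Y)"
    "\<And>D. D \<in> sets M \<Longrightarrow> D \<subseteq> X \<Longrightarrow> f ` D \<in> sets lebesgue"
proof -
  let ?N = "restrict_space lebesgue Y"
  obtain X Y' where X: "X \<in> sets M" "space M - X \<in> null_sets M"
    and Y': "Y' \<in> sets ?N" "space ?N - Y' \<in> null_sets ?N" and bij: "bij_betw f X Y'"
    and m1: "f \<in> restrict_space M X \<rightarrow>\<^sub>M restrict_space ?N Y'"
    and m2: "inv_into X f \<in> restrict_space ?N Y' \<rightarrow>\<^sub>M restrict_space M X"
    and d: "distr (restrict_space M X) (restrict_space ?N Y') f = restrict_space ?N Y'"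
    using iso unfolding mp_isomorphism_def by blast
  have Y'Y: "Y' \<subseteq> Y" "Y' \<in> sets lebesgue" using Y'(1) Y by (auto simp: sets_restrict_space_iff)
  have rr: "restrict_space ?N Y' = restrict_space lebesgue Y'"
    using Y'Y Y by (subst restrict_restrict_space) (auto simp: Int_absorb1)
  have n: "Y - Y' \<in> null_sets lebesgue"
    using Y'(2) Y by (auto simp: space_restrict_space null_sets_restrict_space)
  have Xs: "X \<subseteq> space M" using X(1) sets.sets_into_space by auto
  have sX: "space (restrict_space M X) = X" using Xs by (auto simp: space_restrict_space)
  have sY: "space (restrict_space lebesgue Y') = Y'" by (auto simp: space_restrict_space)
  have inY: "f x \<in> Y'" if "x \<in> X" for x using bij that by (auto simp: bij_betw_def)
  have inj: "inj_on f X" using bij by (simp add: bij_betw_def)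
  have F1: "f -` G \<inter> X \<in> sets M" "emeasure M (f -` G \<inter> X) = emeasure lebesgue (G \<inter> Y)" if G: "G \<in> sets lebesgue" for G
  proof -
    have GY: "G \<inter> Y' \<in> sets (restrict_space lebesgue Y')" using G Y'Y by (auto simp: sets_restrict_space)
    have e: "f -` (G \<inter> Y') \<inter> X = f -` G \<inter> X" using inY by auto
    have 1: "f -` G \<inter> X \<in> sets (restrict_space M X)" using measurable_sets[OF m1[unfolded rr] GY] unfolding sX e .
    then show "f -` G \<inter> X \<in> sets M" using X by (simp add: sets_restrict_space_iff)
    have "emeasure M (f -` G \<inter> X) = emeasure (restrict_space M X) (f -` G \<inter> X)"
      using X by (subst emeasure_restrict_space) auto
    also have "\<dots> = emeasure (distr (restrict_space M X) (restrict_space lebesgue Y') f) (G \<inter> Y')"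
      using emeasure_distr[OF m1[unfolded rr] GY] unfolding sX e by simp
    also have "\<dots> = emeasure lebesgue (G \<inter> Y')"
      unfolding d[unfolded rr] using Y'Y by (subst emeasure_restrict_space) auto
    also have "\<dots> = emeasure lebesgue (G \<inter> Y)"
    proof (rule emeasure_eq_AE)
      show "AE x in lebesgue. (x \<in> G \<inter> Y') = (x \<in> G \<inter> Y)" using AE_not_in[OF n] by eventually_elim (use Y'Y in auto)
    qed (use G Y Y'Y in auto)
    finally show "emeasure M (f -` G \<inter> X) = emeasure lebesgue (G \<inter> Y)" .
  qed
  have F2: "f ` D \<in> sets lebesgue" if D: "D \<in> sets M" "D \<subseteq> X" for D
  proof -
    have "D \<in> sets (restrict_space M X)" using D X by (simp add: sets_restrict_space_iff)
    from measurable_sets[OF m2[unfolded rr] this] have "inv_into X f -` D \<inter> Y' \<in> sets (restrict_space lebesgue Y')" unfolding sY .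
    moreover have "inv_into X f -` D \<inter> Y' = f ` D"
      using bij D(2) by (force simp: bij_betw_def inv_into_f_f image_iff)
    ultimately show ?thesis using Y'Y by (simp add: sets_restrict_space_iff)
  qed
  have fX: "f ` X \<subseteq> Y" using inY Y'Y by auto
  show ?thesis by (rule that[OF X inj fX F1 F2])
qed

locale rank_one_model =
  fixes h r :: "nat \<Rightarrow> nat" and s :: "nat \<Rightarrow> nat \<Rightarrow> nat" and E :: "nat \<Rightarrow> real set"
    and C :: "nat \<Rightarrow> nat \<Rightarrow> real set" and S :: "real \<Rightarrow> real"
  assumes roc: "rank_one_construction h r s E C S"
begin

lemma
  shows h1: "0 < h 1" and r_pos: "\<And>j. j \<ge> 1 \<Longrightarrow> 0 < r j" and r_lim: "filterlim r at_top sequentially"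
    and h_Suc: "\<And>j. j \<ge> 1 \<Longrightarrow> h (Suc j) = h j * r j + (\<Sum>i=1..r j. s j i)"
    and tow: "\<And>j. j \<ge> 1 \<Longrightarrow> tower S (E j) (h j)"
    and C_half: "\<And>j i. j \<ge> 1 \<Longrightarrow> i \<in> {1..r j} \<Longrightarrow> half_interval (C j i)"
    and C_meas: "\<And>j i. j \<ge> 1 \<Longrightarrow> i \<in> {1..r j} \<Longrightarrow> measure lebesgue (C j i) = measure lebesgue (C j 1)"
    and C_disj: "\<And>j. j \<ge> 1 \<Longrightarrow> disjoint_family_on (C j) {1..r j}"
    and E_Un: "\<And>j. j \<ge> 1 \<Longrightarrow> E j = (\<Union>i\<in>{1..r j}. C j i)"
    and E_Suc: "\<And>j. j \<ge> 1 \<Longrightarrow> E (Suc j) = C j 1"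
    and C_next: "\<And>j i. j \<ge> 1 \<Longrightarrow> i \<in> {1..<r j} \<Longrightarrow> (S ^^ (h j + s j i)) ` C j i = C j (Suc i)"
proof -
  note R = roc[unfolded rank_one_construction_def]
  show "0 < h 1" using R by (rule conjunct1)
  note R2 = R[THEN conjunct2]
  show "0 < r j" if "j \<ge> 1" for j using R2[THEN conjunct1] that by simp
  note R3 = R2[THEN conjunct2]
  show "filterlim r at_top sequentially" using R3 by (rule conjunct1)
  note R4 = R3[THEN conjunct2]
  show "h (Suc j) = h j * r j + (\<Sum>i=1..r j. s j i)" if "j \<ge> 1" for j using R4[THEN conjunct1] that by simp
  note R5 = R4[THEN conjunct2]
  show "tower S (E j) (h j)" if "j \<ge> 1" for j using R5[THEN conjunct1] that by simp
  note R6 = R5[THEN conjunct2, rule_format]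
  show "half_interval (C j i)" if "j \<ge> 1" "i \<in> {1..r j}" for j i using R6[OF that(1)] that(2) by simp
  show "measure lebesgue (C j i) = measure lebesgue (C j 1)" if "j \<ge> 1" "i \<in> {1..r j}" for j i
    using R6[OF that(1), THEN conjunct1] that(2) by blast
  show "disjoint_family_on (C j) {1..r j}" if "j \<ge> 1" for j using R6[OF that] by simp
  show "E j = (\<Union>i\<in>{1..r j}. C j i)" if "j \<ge> 1" for j using R6[OF that, THEN conjunct2, THEN conjunct2, THEN conjunct1] .
  show "E (Suc j) = C j 1" if "j \<ge> 1" for j
    using R6[OF that, THEN conjunct2, THEN conjunct2, THEN conjunct2, THEN conjunct2, THEN conjunct1] .
  show "(S ^^ (h j + s j i)) ` C j i = C j (Suc i)" if "j \<ge> 1" "i \<in> {1..<r j}" for j i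
    using R6[OF that(1), THEN conjunct2, THEN conjunct2, THEN conjunct2, THEN conjunct2, THEN conjunct2] that(2) by blast
qed

lemma h_pos: "j \<ge> 1 \<Longrightarrow> 0 < h j"
proof (induction j rule: dec_induct)
  case (step j)
  then show ?case using h_Suc[of j] r_pos[of j] by simp
qed (rule h1)

abbreviation "level j k \<equiv> (S ^^ k) ` E j"
abbreviation "len j \<equiv> measure lebesgue (E j)"

lemma level_half: "j \<ge> 1 \<Longrightarrow> k < h j \<Longrightarrow> half_interval (level j k)"
  using tow[of j] unfolding tower_def by blast

lemma level_translate:
  assumes j: "j \<ge> 1"
  shows "k < h j \<Longrightarrow> \<exists>c. level j k = (\<lambda>x. x + c) ` E j"
proof (induction k)
  case 0
  then show ?case by (intro exI[of _ 0]) simp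
next
  case (Suc k)
  then obtain c where c: "level j k = (\<lambda>x. x + c) ` E j" by auto
  obtain d where d: "\<forall>x\<in>level j k. S x = x + d" using tow[OF j] Suc.prems unfolding tower_def by blast
  have "level j (Suc k) = S ` level j k" by (simp add: image_image)
  also have "\<dots> = (\<lambda>x. x + d) ` level j k" by (rule image_cong) (use d in auto)
  also have "\<dots> = (\<lambda>x. x + (c + d)) ` E j" unfolding c by (simp add: image_image add.assoc)
  finally show ?case by blast
qed

lemma half_interval_lmeasurable: "half_interval I \<Longrightarrow> I \<in> lmeasurable \<and> 0 < measure lebesgue I"
  unfolding half_interval_def by (auto intro!: bounded_set_imp_lmeasurable)

lemma level_meas: "j \<ge> 1 \<Longrightarrow> k < h j \<Longrightarrow> level j k \<in> lmeasurable"
  using level_half half_interval_lmeasurable by blast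

lemma level_len: "j \<ge> 1 \<Longrightarrow> k < h j \<Longrightarrow> measure lebesgue (level j k) = len j"
proof -
  assume j: "j \<ge> 1" and k: "k < h j"
  obtain c where c: "level j k = (\<lambda>x. x + c) ` E j" using level_translate[OF j k] by blast
  have "(\<lambda>x. x + c) ` E j = (+) c ` E j" by (rule image_cong) auto
  then show ?thesis unfolding c using measure_translation[of c "E j"] by simp
qed

lemma level_diam:
  assumes j: "j \<ge> 1" and k: "k < h j" and x: "x \<in> level j k" "y \<in> level j k"
  shows "dist x y \<le> len j"
proof -
  obtain a b where ab: "a < b" "level j k = {a..<b}" using level_half[OF j k] unfolding half_interval_def by blast
  have "len j = b - a" using level_len[OF j k] ab by simp
  then show ?thesis using x unfolding ab(2) by (auto simp: dist_real_def)
qed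

lemma len_pos: "j \<ge> 1 \<Longrightarrow> 0 < len j"
  using half_interval_lmeasurable[OF level_half[of j 0]] h_pos by simp

lemma len_Suc:
  assumes j: "j \<ge> 1"
  shows "len j = real (r j) * len (Suc j)"
proof -
  have "len j = (\<Sum>i\<in>{1..r j}. measure lebesgue (C j i))"
    unfolding E_Un[OF j]
  proof (rule measure_finite_Union)
    have Cm: "C j i \<in> lmeasurable" if "i \<in> {1..r j}" for i
      using half_interval_lmeasurable[OF C_half[OF j that]] by blast
    show "C j ` {1..r j} \<subseteq> sets lebesgue" using Cm fmeasurableD by blast
    show "emeasure lebesgue (C j i) \<noteq> \<infinity>" if "i \<in> {1..r j}" for i using fmeasurableD2[OF Cm[OF that]] by simp
    show "disjoint_family_on (C j) {1..r j}" by (rule C_disj[OF j])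
  qed simp
  also have "\<dots> = (\<Sum>i\<in>{1..r j}. len (Suc j))"
  proof (rule sum.cong[OF refl])
    fix i assume "i \<in> {1..r j}"
    then show "measure lebesgue (C j i) = len (Suc j)" unfolding E_Suc[OF j] by (rule C_meas[OF j])
  qed
  also have "\<dots> = real (r j) * len (Suc j)" by (simp only: sum_constant card_atLeastAtMost) simp
  finally show ?thesis .
qed

lemma len_le: "j \<ge> 1 \<Longrightarrow> len j \<le> len 1"
proof (induction j rule: dec_induct)
  case (step j)
  have "1 * len (Suc j) \<le> real (r j) * len (Suc j)"
    using r_pos[of j] step(1) len_pos[of "Suc j"] by (intro mult_right_mono) auto
  then show ?case using step len_Suc[of j] by simp
qed simp

text \<open>Each width is the preceding one divided by \<open>r j\<close>, and \<open>r j\<close>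
  tends to infinity.\<close>

lemma len_tendsto: "len \<longlonglongrightarrow> 0"
proof (rule LIMSEQ_imp_Suc)
  have "filterlim (\<lambda>j. real (r j)) at_top sequentially"
    using filterlim_compose[OF filterlim_real_sequentially r_lim] .
  then have lim: "(\<lambda>j. len 1 / real (r j)) \<longlonglongrightarrow> 0"
    by (intro tendsto_divide_0[OF tendsto_const] filterlim_at_top_imp_at_infinity)
  show "(\<lambda>j. len (Suc j)) \<longlonglongrightarrow> 0"
  proof (rule tendsto_sandwich[OF _ _ tendsto_const lim])
    have "len (Suc j) \<le> len 1 / real (r j)" if "j \<ge> 1" for j
      using len_le[OF that] len_Suc[OF that] r_pos[OF that] by (simp add: pos_le_divide_eq mult.commute)
    then show "\<forall>\<^sub>F j in sequentially. len (Suc j) \<le> len 1 / real (r j)" by (rule eventually_sequentiallyI)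
    show "\<forall>\<^sub>F j in sequentially. 0 \<le> len (Suc j)" by (intro always_eventually allI measure_nonneg)
  qed
qed

text \<open>Passing from one column to the next climbs one tower height and the spacers above it.
  Adding this up from the first column, whose base is the base of the new tower, locates every
  column.\<close>

lemma column_shift:
  assumes j: "j \<ge> 1"
  shows "1 \<le> i \<Longrightarrow> i \<le> r j \<Longrightarrow> C j i = (S ^^ (h j * (i - 1) + (\<Sum>m=1..i - 1. s j m))) ` E (Suc j)"
proof (induction i rule: dec_induct)
  case base then show ?case using E_Suc[OF j] by simp
next
  case (step i)
  have e: "h j * (Suc i - 1) + (\<Sum>m=1..Suc i - 1. s j m) = (h j + s j i) + (h j * (i - 1) + (\<Sum>m=1..i - 1. s j m))"
  proof -
    obtain m where m: "i = Suc m" using step(1) by (cases i) auto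
    show ?thesis unfolding m by simp
  qed
  have "C j (Suc i) = (S ^^ (h j + s j i)) ` C j i" using C_next[OF j, of i] step by simp
  also have "\<dots> = (S ^^ (h j + s j i)) ` ((S ^^ (h j * (i - 1) + (\<Sum>m=1..i - 1. s j m))) ` E (Suc j))" using step by simp
  also have "\<dots> = (S ^^ (h j * (Suc i - 1) + (\<Sum>m=1..Suc i - 1. s j m))) ` E (Suc j)"
    unfolding e by (simp only: funpow_image_add)
  finally show ?case .
qed

text \<open>Every column of stage \<open>j\<close> reappears inside tower \<open>j + 1\<close> at
  the place given by \<open>column_shift\<close>.\<close>

lemma tower_union_Suc:
  assumes j: "j \<ge> 1"
  shows "tower_union S (E j) (h j) \<subseteq> tower_union S (E (Suc j)) (h (Suc j))"
proof
  fix y assume "y \<in> tower_union S (E j) (h j)"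
  then obtain k where k: "k < h j" "y \<in> level j k" unfolding tower_union_def by blast
  have "level j k = (\<Union>i\<in>{1..r j}. (S ^^ k) ` C j i)" unfolding E_Un[OF j] image_UN ..
  then obtain i where i: "1 \<le> i" "i \<le> r j" "y \<in> (S ^^ k) ` C j i" using k(2) by auto
  let ?t = "h j * (i - 1) + (\<Sum>m=1..i - 1. s j m)"
  have "y \<in> level (Suc j) (k + ?t)" using i(3) unfolding column_shift[OF j i(1,2)] funpow_image_add .
  moreover have "k + ?t < h (Suc j)"
  proof -
    have "h j * (i - 1) + h j \<le> h j * r j"
    proof -
      have "h j * (i - 1) + h j = h j * i" using i(1) by (cases i) auto
      then show ?thesis using i(2) by simp
    qed
    moreover have "(\<Sum>m=1..i - 1. s j m) \<le> (\<Sum>m=1..r j. s j m)" using i(2) by (intro sum_mono2) auto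
    ultimately show ?thesis using k(1) h_Suc[OF j] by linarith
  qed
  ultimately show "y \<in> tower_union S (E (Suc j)) (h (Suc j))" unfolding tower_union_def by blast
qed

abbreviation "X j \<equiv> tower_union S (E j) (h j)"

lemma X_mono: "1 \<le> j \<Longrightarrow> j \<le> k \<Longrightarrow> X j \<subseteq> X k"
proof (induction k)
  case (Suc k)
  then show ?case using tower_union_Suc[of k] by (cases "j = Suc k") auto
qed simp

lemma X_meas: "j \<ge> 1 \<Longrightarrow> X j \<in> lmeasurable"
  unfolding tower_union_def using level_meas by (intro fmeasurable.finite_UN) auto

lemma X_Un_meas: "(\<Union>j\<in>{1..}. X j) \<in> sets lebesgue"
  using X_meas fmeasurableD by (intro sets.countable_UN') auto

lemma compact_inner_approx:
  assumes F: "F \<in> lmeasurable" and e: "e > 0"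
  shows "\<exists>K. compact K \<and> K \<subseteq> F \<and> measure lebesgue (F - K) < e"
proof -
  have e2: "e / 2 > 0" using e by simp
  obtain K0 where K0: "closed K0" "K0 \<subseteq> F" "F - K0 \<in> lmeasurable" "emeasure lebesgue (F - K0) < ennreal (e / 2)"
    using sets_lebesgue_inner_closed[OF fmeasurableD[OF F] e2] by blast
  have m0: "measure lebesgue (F - K0) < e / 2"
    using K0(3,4) e by (simp add: emeasure_eq_measure2 ennreal_less_iff)
  have "K0 \<in> sets lebesgue" using K0(1) by auto
  then have K0m: "K0 \<in> lmeasurable" by (rule fmeasurableI2[OF F K0(2)])
  define Q where "Q = (\<lambda>n::nat. K0 - cball 0 (real n))"
  have Qm: "Q n \<in> sets lebesgue" for n unfolding Q_def using K0m by (auto dest: fmeasurableD)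
  have "(\<lambda>n. measure lebesgue (Q n)) \<longlonglongrightarrow> measure lebesgue (\<Inter>n. Q n)"
  proof (rule Lim_measure_decseq)
    show "range Q \<subseteq> sets lebesgue" using Qm by auto
    show "decseq Q" unfolding decseq_def Q_def by (auto intro: order_trans)
    show "emeasure lebesgue (Q i) \<noteq> \<infinity>" for i
      using K0m by (metis Diff_subset Q_def Qm fmeasurableI2 fmeasurableD2 infinity_ennreal_def)
  qed
  moreover have "(\<Inter>n. Q n) = {}" unfolding Q_def using real_arch_simple by fastforce
  ultimately have "(\<lambda>n. measure lebesgue (Q n)) \<longlonglongrightarrow> 0" by simp
  then obtain n where n: "measure lebesgue (Q n) < e / 2"
    using order_tendstoD(2)[OF _ e2] eventually_sequentially by (metis (mono_tags, lifting) order_refl)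
  let ?K = "K0 \<inter> cball 0 (real n)"
  have "F - ?K \<subseteq> (F - K0) \<union> Q n" unfolding Q_def by auto
  moreover have "Q n \<in> lmeasurable" using K0m Qm unfolding Q_def by (meson Diff_subset fmeasurableI2)
  ultimately have "measure lebesgue (F - ?K) \<le> measure lebesgue ((F - K0) \<union> Q n)"
    using K0 F K0m by (intro measure_mono_fmeasurable fmeasurable.Un) (auto dest: fmeasurableD)
  also have "\<dots> \<le> measure lebesgue (F - K0) + measure lebesgue (Q n)"
    using K0(3) Qm by (intro measure_Un_le) (auto dest: fmeasurableD)
  finally have "measure lebesgue (F - ?K) < e" using m0 n by linarith
  then show ?thesis using K0 by (intro exI[of _ ?K]) (auto intro: closed_Int_compact)
qed

text \<open>\<open>F\<close> is filled by a compact \<open>K\<close>, and \<open>K\<close> is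
  surrounded by an open \<open>U\<close> of nearly the same measure. Once the levels are short
  enough, those meeting \<open>K\<close> stay inside \<open>U\<close>, and they cover the part of
  \<open>K\<close> that lies in the tower.\<close>

lemma levels_approximate:
  assumes F: "F \<in> lmeasurable" "F \<subseteq> (\<Union>j\<in>{1..}. X j)" and e: "e > 0"
  shows "\<forall>\<^sub>F j in sequentially. \<exists>L\<subseteq>{..<h j}. measure lebesgue (sym_diff F (\<Union>k\<in>L. level j k)) < e"
proof -
  have e3: "e / 3 > 0" using e by simp
  obtain K where K: "compact K" "K \<subseteq> F" "measure lebesgue (F - K) < e / 3" using compact_inner_approx[OF F(1) e3] by blast
  have Km: "K \<in> lmeasurable" using K(1) by (rule lmeasurable_compact)
  obtain U where U: "open U" "K \<subseteq> U" "U - K \<in> lmeasurable" "emeasure lebesgue (U - K) < ennreal (e / 3)"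
    using sets_lebesgue_outer_open[OF fmeasurableD[OF Km] e3] by blast
  have Um: "measure lebesgue (U - K) < e / 3" using U(3,4) e3 by (simp add: emeasure_eq_measure2 ennreal_less_iff)
  obtain d where d: "d > 0" "(\<Union>x\<in>K. ball x d) \<subseteq> U"
    using compact_subset_open_imp_ball_epsilon_subset[OF K(1) U(1,2)] by blast
  \<comment> \<open>Stages are numbered from 1, hence the shifted index; the towers increase to a
    set that contains \<open>K\<close>.\<close>
  have "(\<lambda>j. measure lebesgue (K - X (Suc j))) \<longlonglongrightarrow> measure lebesgue (\<Inter>j. K - X (Suc j))"
  proof (rule Lim_measure_decseq)
    have m: "K - X (Suc j) \<in> lmeasurable" for j using Km X_meas[of "Suc j"] by (intro fmeasurable.Diff) auto
    show "range (\<lambda>j. K - X (Suc j)) \<subseteq> sets lebesgue" using m by (auto dest: fmeasurableD)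
    show "decseq (\<lambda>j. K - X (Suc j))" unfolding decseq_def using X_mono by force
    show "emeasure lebesgue (K - X (Suc i)) \<noteq> \<infinity>" for i using fmeasurableD2[OF m] by simp
  qed
  moreover have "(\<Inter>j. K - X (Suc j)) = {}"
  proof -
    have "\<exists>j. x \<in> X (Suc j)" if xK: "x \<in> K" for x
    proof -
      obtain j where "j \<ge> 1" "x \<in> X j" using xK K(2) F(2) by blast
      then show ?thesis by (cases j) auto
    qed
    then show ?thesis by auto
  qed
  ultimately have "(\<lambda>j. measure lebesgue (K - X (Suc j))) \<longlonglongrightarrow> 0" by (simp only: measure_empty)
  then have "(\<lambda>j. measure lebesgue (K - X j)) \<longlonglongrightarrow> 0" by (rule LIMSEQ_imp_Suc)
  then have "\<forall>\<^sub>F j in sequentially. measure lebesgue (K - X j) < e / 3" using e3 by (rule order_tendstoD)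
  moreover have "\<forall>\<^sub>F j in sequentially. len j < d" using len_tendsto d(1) by (rule order_tendstoD)
  moreover have "\<forall>\<^sub>F j in sequentially. 1 \<le> j" by (rule eventually_ge_at_top)
  ultimately show ?thesis
  proof eventually_elim
    case (elim j)
    define L where "L = {k. k < h j \<and> level j k \<inter> K \<noteq> {}}"
    let ?V = "\<Union>k\<in>L. level j k"
    have VU: "?V \<subseteq> U"
    proof
      fix y assume "y \<in> ?V"
      then obtain k where k: "k < h j" "y \<in> level j k" "level j k \<inter> K \<noteq> {}" unfolding L_def by blast
      then obtain x where x: "x \<in> level j k" "x \<in> K" by blast
      have "dist x y < d" using level_diam[OF elim(3) k(1) x(1) k(2)] elim(2) by simp
      then have "y \<in> ball x d" by simp
      then show "y \<in> U" using d(2) x(2) by blast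
    qed
    have KV: "K \<inter> X j \<subseteq> ?V" unfolding tower_union_def L_def by blast
    have sub: "sym_diff F ?V \<subseteq> (F - K) \<union> (K - X j) \<union> (U - K)" using VU KV K(2) by blast
    have m: "F - K \<in> lmeasurable" "K - X j \<in> lmeasurable" using F Km X_meas[OF elim(3)] by (auto intro: fmeasurable.Diff)
    have Vm: "?V \<in> lmeasurable" using level_meas[OF elim(3)] by (intro fmeasurable.finite_UN) (auto simp: L_def)
    have "measure lebesgue (sym_diff F ?V) \<le> measure lebesgue ((F - K) \<union> (K - X j) \<union> (U - K))"
      using sub m U(3) F(1) Vm by (intro measure_mono_fmeasurable) (auto dest: fmeasurableD)
    also have "\<dots> \<le> measure lebesgue ((F - K) \<union> (K - X j)) + measure lebesgue (U - K)"
      using m U(3) by (intro measure_Un_le) (auto dest: fmeasurableD)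
    also have "measure lebesgue ((F - K) \<union> (K - X j)) \<le> measure lebesgue (F - K) + measure lebesgue (K - X j)"
      using m by (intro measure_Un_le) (auto dest: fmeasurableD)
    finally have "measure lebesgue (sym_diff F ?V) < e" using K(3) elim(1) Um by linarith
    then show ?case by (intro exI[of _ L]) (auto simp: L_def)
  qed
qed

end

context leb_dense begin

text \<open>The base is the preimage of the interval \<open>E j\<close>. On an invariant conull set
  \<open>Z\<close> where the conjugacy holds at every point, \<open>T ^^ k\<close> maps this base
  into the preimage of level \<open>k\<close>, and equality of the measures makes both agree up to a
  null set.\<close>

lemma rank_one_imp_approx_tower:
  assumes T: "T \<in> automorphisms M" and r1: "rank_one M T"
  shows "approx_tower T n"
proof -
  obtain h r s E C S f where roc: "rank_one_construction h r s E C S"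
    and iso: "mp_isomorphism M (restrict_space lebesgue (\<Union>j\<in>{1..}. tower_union S (E j) (h j))) f"
    and conj: "AE x in M. f (T x) = S (f x)"
    using r1 unfolding rank_one_def by blast
  interpret R: rank_one_model h r s E C S by standard (rule roc)
  let ?Y = "\<Union>j\<in>{1..}. R.X j"
  obtain X where X: "X \<in> sets M" "space M - X \<in> null_sets M" "inj_on f X" "f ` X \<subseteq> ?Y"
    and pre: "\<And>G. G \<in> sets lebesgue \<Longrightarrow> f -` G \<inter> X \<in> sets M"
    and em: "\<And>G. G \<in> sets lebesgue \<Longrightarrow> emeasure M (f -` G \<inter> X) = emeasure lebesgue (G \<inter> ?Y)"
    and img: "\<And>D. D \<in> sets M \<Longrightarrow> D \<subseteq> X \<Longrightarrow> f ` D \<in> sets lebesgue"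
    by (rule mp_isomorphism_lebesgueE[OF iso R.X_Un_meas]) (rule that; (assumption | blast))
  have "AE x in M. x \<in> X" using AE_not_in[OF X(2)] AE_space by eventually_elim auto
  with conj have "AE x in M. x \<in> X \<and> f (T x) = S (f x)" by eventually_elim auto
  from aut_invariant_core[OF T this] obtain Z where Z: "Z \<in> sets M" "space M - Z \<in> null_sets M"
    "\<And>x. x \<in> Z \<Longrightarrow> x \<in> X \<and> f (T x) = S (f x)" and Zinv: "\<forall>x\<in>space M. T x \<in> Z \<longleftrightarrow> x \<in> Z" by blast
  have Zs: "Z \<subseteq> space M" using Z(1) sets.sets_into_space by auto
  have fpow: "(T ^^ k) x \<in> Z \<and> f ((T ^^ k) x) = (S ^^ k) (f x)" if "x \<in> Z" for x k
  proof (induction k)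
    case 0 then show ?case using that by simp
  next
    case (Suc k)
    then have a: "(T ^^ k) x \<in> Z" "f ((T ^^ k) x) = (S ^^ k) (f x)" by auto
    have "T ((T ^^ k) x) \<in> Z" using Zinv a(1) Zs by blast
    moreover have "f (T ((T ^^ k) x)) = S (f ((T ^^ k) x))" using Z(3)[OF a(1)] by blast
    ultimately show ?case using a(2) by simp
  qed
  have preZ: "f -` G \<inter> Z \<in> sets M" "emeasure M (f -` G \<inter> Z) = emeasure lebesgue (G \<inter> ?Y)" if G: "G \<in> sets lebesgue" for G
  proof -
    have e: "f -` G \<inter> Z = (f -` G \<inter> X) \<inter> Z" using Z(3) by auto
    show s: "f -` G \<inter> Z \<in> sets M" unfolding e using pre[OF G] Z(1) by auto
    have "emeasure M (f -` G \<inter> Z) = emeasure M (f -` G \<inter> X)"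
    proof (rule emeasure_eq_AE)
      show "AE x in M. (x \<in> f -` G \<inter> Z) = (x \<in> f -` G \<inter> X)"
        using AE_not_in[OF Z(2)] AE_space by eventually_elim (use Z(3) in auto)
    qed (use s pre[OF G] in auto)
    then show "emeasure M (f -` G \<inter> Z) = emeasure lebesgue (G \<inter> ?Y)" using em[OF G] by simp
  qed
  let ?e = "1 / real (Suc n)"
  \<comment> \<open>The sets \<open>A i\<close> are carried to the line, where
    \<open>levels_approximate\<close> applies.\<close>
  define F where "F = (\<lambda>i. f ` (A i \<inter> Z))"
  have AZ: "A i \<inter> Z \<in> sets M" "A i \<inter> Z \<subseteq> X" if "i \<ge> 1" for i using A_sets[OF that] Z(1,3) by auto
  have FY: "F i \<subseteq> ?Y" if "i \<ge> 1" for i unfolding F_def using X(4) AZ(2)[OF that] by blast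
  have Fpre: "f -` F i \<inter> Z = A i \<inter> Z" if "i \<ge> 1" for i
    unfolding F_def using X(3) Z(3) by (auto dest: inj_onD)
  have Fm: "F i \<in> lmeasurable" if i: "i \<ge> 1" for i
  proof -
    have s: "F i \<in> sets lebesgue" unfolding F_def using img AZ[OF i] by blast
    have "emeasure lebesgue (F i) = emeasure lebesgue (F i \<inter> ?Y)" using FY[OF i] by (simp add: Int_absorb2)
    also have "\<dots> = emeasure M (A i \<inter> Z)" using preZ(2)[OF s] Fpre[OF i] by simp
    also have "\<dots> \<le> emeasure M (A i)" using A_sets[OF i] by (intro emeasure_mono) auto
    also have "\<dots> < \<infinity>" using A_fmeasurable[OF i] by (auto simp: fmeasurable_def)
    finally show ?thesis using s by (auto simp: fmeasurable_def)
  qed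
  have "\<forall>\<^sub>F j in sequentially. \<forall>i\<in>{1..Suc n}. \<exists>L\<subseteq>{..<h j}. measure lebesgue (sym_diff (F i) (\<Union>k\<in>L. R.level j k)) < ?e"
    using R.levels_approximate[OF Fm FY, of _ ?e] by (intro eventually_ball_finite) auto
  moreover have "\<forall>\<^sub>F j in sequentially. R.len j < ?e" using R.len_tendsto by (rule order_tendstoD) simp
  moreover have "\<forall>\<^sub>F j in sequentially. 1 \<le> j" by (rule eventually_ge_at_top)
  ultimately have "\<forall>\<^sub>F j in sequentially. 1 \<le> j \<and> R.len j < ?e \<and> (\<forall>i\<in>{1..Suc n}. \<exists>L\<subseteq>{..<h j}. measure lebesgue (sym_diff (F i) (\<Union>k\<in>L. R.level j k)) < ?e)"
    by eventually_elim blast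
  then obtain j where j: "1 \<le> j" "R.len j < ?e"
    and L0: "\<And>i. i \<in> {1..Suc n} \<Longrightarrow> \<exists>L\<subseteq>{..<h j}. measure lebesgue (sym_diff (F i) (\<Union>k\<in>L. R.level j k)) < ?e"
    unfolding eventually_sequentially by blast
  define B where "B = f -` E j \<inter> Z"
  have lev: "R.level j k \<in> sets lebesgue" "R.level j k \<subseteq> ?Y" if "k < h j" for k
    using R.level_meas[OF j(1) that] that j(1) unfolding tower_union_def by (auto dest: fmeasurableD)
  have levm: "f -` R.level j k \<inter> Z \<in> fmeasurable M" "measure M (f -` R.level j k \<inter> Z) = R.len j" if k: "k < h j" for k
  proof -
    have "emeasure M (f -` R.level j k \<inter> Z) = emeasure lebesgue (R.level j k)"
      using preZ(2)[OF lev(1)[OF k]] lev(2)[OF k] by (simp add: Int_absorb2)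
    also have "\<dots> = ennreal (R.len j)" using R.level_meas[OF j(1) k] R.level_len[OF j(1) k] by (simp add: emeasure_eq_measure2)
    finally have e: "emeasure M (f -` R.level j k \<inter> Z) = ennreal (R.len j)" .
    show "f -` R.level j k \<inter> Z \<in> fmeasurable M" using preZ(1)[OF lev(1)[OF k]] e by (auto simp: fmeasurable_def)
    show "measure M (f -` R.level j k \<inter> Z) = R.len j" using e by (simp add: measure_def)
  qed
  have B: "B \<in> fmeasurable M" "measure M B = R.len j" using levm[OF R.h_pos[OF j(1)]] unfolding B_def by simp_all
  have TB: "(T ^^ k) ` B \<subseteq> f -` R.level j k \<inter> Z" for k unfolding B_def using fpow by auto
  have TBf: "(T ^^ k) ` B \<in> fmeasurable M" for k using aut_fmeasurable(1)[OF aut_funpow[OF T] B(1)] .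
  have near: "mdist M (f -` R.level j k \<inter> Z) ((T ^^ k) ` B) = 0" if k: "k < h j" for k
  proof -
    have "sym_diff (f -` R.level j k \<inter> Z) ((T ^^ k) ` B) = (f -` R.level j k \<inter> Z) - (T ^^ k) ` B" using TB[of k] by blast
    then have "mdist M (f -` R.level j k \<inter> Z) ((T ^^ k) ` B) = measure M (f -` R.level j k \<inter> Z) - measure M ((T ^^ k) ` B)"
      unfolding mdist_def using measurable_measure_Diff[OF levm(1)[OF k] fmeasurableD[OF TBf] TB] by simp
    also have "measure M ((T ^^ k) ` B) = R.len j" using aut_measure(1)[OF aut_funpow[OF T] fmeasurableD[OF B(1)]] B(2) by simp
    finally show ?thesis using levm(2)[OF k] by simp
  qed
  have "disjoint_family_on (\<lambda>t. (T ^^ t) ` B) {..<h j}"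
  proof -
    have d: "disjoint_family_on (R.level j) {..<h j}" using R.tow[OF j(1)] by (simp add: tower_def)
    show ?thesis unfolding disjoint_family_on_def
    proof (intro ballI impI)
      fix m n assume "m \<in> {..<h j}" "n \<in> {..<h j}" "m \<noteq> n"
      then have "R.level j m \<inter> R.level j n = {}" by (rule disjoint_family_onD[OF d])
      then show "(T ^^ m) ` B \<inter> (T ^^ n) ` B = {}" using TB[of m] TB[of n] by blast
    qed
  qed
  moreover have "\<exists>L\<subseteq>{..<h j}. mdist M (A i) (\<Union>t\<in>L. (T ^^ t) ` B) < ?e" if i: "i \<in> {1..Suc n}" for i
  proof -
    obtain L where L: "L \<subseteq> {..<h j}" "measure lebesgue (sym_diff (F i) (\<Union>k\<in>L. R.level j k)) < ?e" using L0[OF i] by blast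
    have i1: "i \<ge> 1" using i by simp
    have fin: "finite L" using L(1) finite_subset by blast
    let ?V = "\<Union>k\<in>L. R.level j k"
    let ?W = "\<Union>k\<in>L. f -` R.level j k \<inter> Z"
    have Vm: "?V \<in> lmeasurable" using fin L(1) R.level_meas[OF j(1)] by (intro fmeasurable.finite_UN) auto
    have Wm: "?W \<in> fmeasurable M" using fin L(1) levm(1) by (intro fmeasurable.finite_UN) auto
    have AZf: "A i \<inter> Z \<in> fmeasurable M" using A_fmeasurable[OF i1] AZ(1)[OF i1] by (meson Int_lower1 fmeasurableI2)
    have TU: "(\<Union>t\<in>L. (T ^^ t) ` B) \<in> fmeasurable M" using fin TBf by (intro fmeasurable.finite_UN) auto
    have "mdist M ?W (\<Union>t\<in>L. (T ^^ t) ` B) \<le> (\<Sum>t\<in>L. mdist M (f -` R.level j t \<inter> Z) ((T ^^ t) ` B))"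
      using fin L(1) levm(1) TBf by (intro mdist_UN_le) auto
    also have "\<dots> = 0" using near L(1) by (intro sum.neutral) auto
    finally have 1: "mdist M ?W (\<Union>t\<in>L. (T ^^ t) ` B) \<le> 0" .
    have "sym_diff (A i) (A i \<inter> Z) \<in> null_sets M"
    proof -
      have "sym_diff (A i) (A i \<inter> Z) \<subseteq> space M - Z" using sets.sets_into_space[OF A_sets[OF i1]] by auto
      then show ?thesis using Z(2) A_sets[OF i1] AZ(1)[OF i1] by (meson null_sets_subset sets.Diff sets.Un)
    qed
    then have 2: "mdist M (A i) (A i \<inter> Z) = 0" by (rule mdist_null)
    have W: "?W = f -` ?V \<inter> Z" by (simp only: vimage_UN UN_simps)
    have "sym_diff (A i \<inter> Z) ?W = f -` (sym_diff (F i) ?V) \<inter> Z"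
      unfolding W Fpre[OF i1, symmetric] by (simp only: vimage_Diff vimage_Un Int_Un_distrib2 Diff_Int_distrib2)
    then have "mdist M (A i \<inter> Z) ?W = measure M (f -` (sym_diff (F i) ?V) \<inter> Z)" unfolding mdist_def by simp
    also have "\<dots> \<le> measure lebesgue (sym_diff (F i) ?V)"
    proof -
      have sm: "sym_diff (F i) ?V \<in> lmeasurable" using Fm[OF i1] Vm by auto
      have "emeasure M (f -` (sym_diff (F i) ?V) \<inter> Z) \<le> emeasure lebesgue (sym_diff (F i) ?V)"
        unfolding preZ(2)[OF fmeasurableD[OF sm]] using sm by (intro emeasure_mono) (auto dest: fmeasurableD)
      then show ?thesis unfolding measure_def using sm by (intro enn2real_mono) (auto simp: fmeasurable_def)
    qed
    finally have 3: "mdist M (A i \<inter> Z) ?W < ?e" using L(2) by linarith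
    have "mdist M (A i) (\<Union>t\<in>L. (T ^^ t) ` B) \<le> mdist M (A i) (A i \<inter> Z) + mdist M (A i \<inter> Z) (\<Union>t\<in>L. (T ^^ t) ` B)"
      by (intro mdist_triangle A_fmeasurable i1 AZf TU)
    moreover have "mdist M (A i \<inter> Z) (\<Union>t\<in>L. (T ^^ t) ` B) \<le> mdist M (A i \<inter> Z) ?W + mdist M ?W (\<Union>t\<in>L. (T ^^ t) ` B)"
      by (intro mdist_triangle Wm AZf TU)
    ultimately have "mdist M (A i) (\<Union>t\<in>L. (T ^^ t) ` B) < ?e" using 1 2 3 by linarith
    then show ?thesis using L(1) by blast
  qed
  ultimately show ?thesis unfolding approx_tower_def using B R.len_pos[OF j(1)] j(2)
    by (intro bexI[of _ B] exI[of _ "h j"]) auto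
qed

end

section \<open>Approximating towers force ergodicity\<close>

definition tower_set :: "('a \<Rightarrow> 'a) \<Rightarrow> 'a set \<Rightarrow> nat set \<Rightarrow> 'a set" where
  "tower_set T B L = (\<Union>t\<in>L. (T ^^ t) ` B)"

definition base :: "'a measure \<Rightarrow> ('a \<Rightarrow> 'a) \<Rightarrow> 'a set \<Rightarrow> nat \<Rightarrow> bool" where
  "base M T B h \<longleftrightarrow> B \<in> fmeasurable M \<and> 0 < measure M B \<and> disjoint_family_on (\<lambda>t. (T ^^ t) ` B) {..<h}"

lemma level_fmeasurable:
  "T \<in> automorphisms M \<Longrightarrow> B \<in> fmeasurable M \<Longrightarrow> (T ^^ t) ` B \<in> fmeasurable M"
  by (rule aut_fmeasurable(1)[OF aut_funpow])

lemma level_measure: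
  "T \<in> automorphisms M \<Longrightarrow> B \<in> fmeasurable M \<Longrightarrow> measure M ((T ^^ t) ` B) = measure M B"
  by (rule aut_measure(1)[OF aut_funpow fmeasurableD])

lemma tower_set_fmeasurable:
  "T \<in> automorphisms M \<Longrightarrow> B \<in> fmeasurable M \<Longrightarrow> finite L \<Longrightarrow> tower_set T B L \<in> fmeasurable M"
  unfolding tower_set_def by (intro fmeasurable.finite_UN level_fmeasurable)

lemma tower_set_measure:
  assumes T: "T \<in> automorphisms M" and b: "base M T B h" and L: "L \<subseteq> {..<h}"
  shows "measure M (tower_set T B L) = real (card L) * measure M B"
proof -
  have B: "B \<in> fmeasurable M" using b by (simp add: base_def)
  have fin: "finite L" using L finite_subset by blast
  have "disjoint_family_on (\<lambda>t. (T ^^ t) ` B) L"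
    using b L unfolding base_def by (meson disjoint_family_on_mono)
  then have "measure M (tower_set T B L) = (\<Sum>t\<in>L. measure M ((T ^^ t) ` B))"
    unfolding tower_set_def using fin level_fmeasurable[OF T B]
    by (intro measure_finite_Union) (auto simp: fmeasurableD fmeasurableD2 image_subset_iff)
  then show ?thesis by (simp add: level_measure[OF T B])
qed

lemma tower_set_diff:
  assumes b: "base M T B h" and L: "L \<subseteq> {..<h}" and K: "K \<subseteq> {..<h}"
  shows "tower_set T B L - tower_set T B K = tower_set T B (L - K)"
proof -
  have gen: "(\<Union>t\<in>L. X t) - (\<Union>t\<in>K. X t) = (\<Union>t\<in>L - K. X t)"
    if "\<And>s t. s \<in> L \<Longrightarrow> t \<in> K \<Longrightarrow> s \<noteq> t \<Longrightarrow> X s \<inter> X t = {}" for X :: "nat \<Rightarrow> 'a set"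
    using that by blast
  show ?thesis unfolding tower_set_def
  proof (rule gen)
    fix s t assume "s \<in> L" "t \<in> K" "s \<noteq> t"
    moreover have "disjoint_family_on (\<lambda>t. (T ^^ t) ` B) {..<h}" using b by (simp add: base_def)
    ultimately show "(T ^^ s) ` B \<inter> (T ^^ t) ` B = {}" using L K by (meson disjoint_family_onD subsetD)
  qed
qed

lemma measure_Diff_le_mdist:
  assumes "P \<in> fmeasurable M" "Q \<in> fmeasurable M"
  shows "measure M (P - Q) \<le> mdist M P Q" "measure M (Q - P) \<le> mdist M P Q"
  unfolding mdist_def using assms by (auto intro!: measure_mono_fmeasurable dest: fmeasurableD)

lemma measure_Un_fmeasurable:
  "P \<in> fmeasurable M \<Longrightarrow> Q \<in> fmeasurable M \<Longrightarrow> P \<inter> Q = {} \<Longrightarrow> measure M (P \<union> Q) = measure M P + measure M Q"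
  by (intro measure_Union fmeasurableD fmeasurableD2[unfolded infinity_ennreal_def[symmetric]])

lemma measure_split:
  assumes "P \<in> fmeasurable M" "Q \<in> sets M"
  shows "measure M P = measure M (P \<inter> Q) + measure M (P - Q)"
proof -
  have "P \<inter> Q \<in> fmeasurable M" "P - Q \<in> fmeasurable M"
    using assms by (auto intro: fmeasurable_Int_fmeasurable fmeasurable.Diff fmeasurable_Diff)
  then have "measure M ((P \<inter> Q) \<union> (P - Q)) = measure M (P \<inter> Q) + measure M (P - Q)"
    by (intro measure_Un_fmeasurable) auto
  moreover have "(P \<inter> Q) \<union> (P - Q) = P" by auto
  ultimately show ?thesis by simp
qed

text \<open>Otherwise at least half of the union of the levels would lie outside \<open>D\<close>.
  But the union has more than three quarters of the measure of \<open>D\<close>, and its part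
  outside \<open>D\<close> has less than one quarter of that measure.\<close>

lemma mostly_level:
  assumes T: "T \<in> automorphisms M" and b: "base M T B h" and D: "D \<in> fmeasurable M" "0 < measure M D"
    and L: "L \<subseteq> {..<h}" "mdist M D (tower_set T B L) < measure M D / 4"
  shows "\<exists>t<h. measure M B / 2 < measure M ((T ^^ t) ` B \<inter> D)"
proof (rule ccontr)
  assume "\<not> ?thesis"
  then have le: "measure M ((T ^^ t) ` B \<inter> D) \<le> measure M B / 2" if "t \<in> L" for t using that L(1) by force
  have B: "B \<in> fmeasurable M" using b by (simp add: base_def)
  have fin: "finite L" using L(1) finite_subset by blast
  let ?V = "tower_set T B L"
  have V: "?V \<in> fmeasurable M" using tower_set_fmeasurable[OF T B fin] .
  have "measure M (?V \<inter> D) \<le> (\<Sum>t\<in>L. measure M ((T ^^ t) ` B \<inter> D))"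
  proof -
    have "?V \<inter> D = (\<Union>t\<in>L. (T ^^ t) ` B \<inter> D)" unfolding tower_set_def by auto
    then show ?thesis using fin level_fmeasurable[OF T B] D(1)
      by (simp only:) (intro measure_UNION_le, auto dest: fmeasurableD)
  qed
  also have "\<dots> \<le> real (card L) * (measure M B / 2)" using le by (intro sum_bounded_above) auto
  finally have 1: "measure M (?V \<inter> D) \<le> measure M ?V / 2" using tower_set_measure[OF T b L(1)] by simp
  have "measure M ?V = measure M (?V \<inter> D) + measure M (?V - D)" by (rule measure_split[OF V fmeasurableD[OF D(1)]])
  moreover have "measure M (?V - D) \<le> mdist M D ?V" by (rule measure_Diff_le_mdist(2)[OF D(1) V])
  moreover have "measure M D \<le> measure M ?V + mdist M D ?V" by (rule measure_le_mdist[OF D(1) V])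
  ultimately show False using 1 L(2) D(2) by linarith
qed

context leb_dense begin

text \<open>By density each member of the finite collection is within \<open>e/2\<close> of some
  \<open>A i\<close>; \<open>k\<close> is chosen beyond all the indices that occur and with
  \<open>1/(k+1)\<close> below \<open>e/2\<close>.\<close>

lemma approx_tower_finite:
  assumes T: "T \<in> automorphisms M" and at: "\<And>k. approx_tower T k" and FF: "finite FF" "FF \<subseteq> fmeasurable M" and e: "e > 0"
  shows "\<exists>B h. base M T B h \<and> measure M B < e \<and> (\<forall>D\<in>FF. \<exists>L\<subseteq>{..<h}. mdist M D (tower_set T B L) < e)"
proof -
  have "\<forall>D\<in>FF. \<exists>i\<ge>1. mdist M (A i) D < e / 2" using A_dense FF(2) e by (meson half_gt_zero subsetD)
  then obtain I where I: "\<And>D. D \<in> FF \<Longrightarrow> I D \<ge> 1 \<and> mdist M (A (I D)) D < e / 2" by metis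
  obtain m where m: "1 / real (Suc m) < e / 2" using e nat_approx_posE[of "e / 2"] by auto
  define k where "k = Max (insert m (I ` FF))"
  have fin: "finite (insert m (I ` FF))" using FF(1) by simp
  have km: "m \<le> k" unfolding k_def using fin by (intro Max_ge) auto
  have kI: "I D \<le> k" if "D \<in> FF" for D unfolding k_def using fin that by (intro Max_ge) auto
  have ke: "1 / real (Suc k) < e / 2"
  proof -
    have "1 / real (Suc k) \<le> 1 / real (Suc m)" using km by (intro divide_left_mono) auto
    then show ?thesis using m by linarith
  qed
  obtain B h where B: "B \<in> fmeasurable M" "disjoint_family_on (\<lambda>t. (T ^^ t) ` B) {..<h}"
    "0 < measure M B" "measure M B < 1 / real (Suc k)"
    and L: "\<And>i. i \<in> {1..Suc k} \<Longrightarrow> \<exists>L\<subseteq>{..<h}. mdist M (A i) (\<Union>t\<in>L. (T ^^ t) ` B) < 1 / real (Suc k)"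
    using at[of k] unfolding approx_tower_def by blast
  have "\<exists>L\<subseteq>{..<h}. mdist M D (tower_set T B L) < e" if D: "D \<in> FF" for D
  proof -
    have "I D \<in> {1..Suc k}" using I[OF D] kI[OF D] by simp
    then obtain L where L: "L \<subseteq> {..<h}" "mdist M (A (I D)) (\<Union>t\<in>L. (T ^^ t) ` B) < 1 / real (Suc k)" using L by blast
    have V: "tower_set T B L \<in> fmeasurable M" using tower_set_fmeasurable[OF T B(1)] L(1) finite_subset by blast
    have "mdist M D (tower_set T B L) \<le> mdist M D (A (I D)) + mdist M (A (I D)) (tower_set T B L)"
      using A_fmeasurable I[OF D] D FF(2) V by (intro mdist_triangle) auto
    then have "mdist M D (tower_set T B L) < e"
      using I[OF D] L(2) ke unfolding tower_set_def by (simp add: mdist_commute[of M D])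
    then show ?thesis using L(1) by blast
  qed
  then show ?thesis using B ke e unfolding base_def by (intro exI[of _ B] exI[of _ h]) auto
qed

text \<open>A uniformly distributed coordinate on \<open>R\<close> cuts off parts of any measure up
  to that of \<open>R\<close>; the cuts at \<open>a\<close> and \<open>2 * a\<close> give two pieces
  of measure \<open>a\<close>.\<close>

lemma ex_disjoint_finite_parts:
  assumes R: "R \<in> sets M" "R \<notin> null_sets M"
  shows "\<exists>P Q. P \<in> fmeasurable M \<and> Q \<in> fmeasurable M \<and> P \<subseteq> R \<and> Q \<subseteq> R \<and> P \<inter> Q = {} \<and> 0 < measure M P \<and> 0 < measure M Q"
proof -
  have Rs: "R \<subseteq> space M" using R(1) sets.sets_into_space by blast
  obtain F where F: "F \<in> borel_measurable M" 
    and em: "\<And>a. a \<ge> 0 \<Longrightarrow> emeasure M {x\<in>R. F x < a} = min (ennreal a) (emeasure M R)"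
    using cumulative_map[OF R(1)] by blast
  have pos: "emeasure M R > 0" using R by (simp add: null_sets_def zero_less_iff_neq_zero)
  obtain a :: real where a: "a > 0" "ennreal (2 * a) \<le> emeasure M R"
  proof (cases "emeasure M R = \<infinity>")
    case True
    then show ?thesis using that[of 1] by simp
  next
    case False
    then have e: "emeasure M R = ennreal (measure M R)" by (simp add: emeasure_eq_ennreal_measure)
    then have "measure M R > 0" using pos by simp
    then show ?thesis using that[of "measure M R / 2"] e by simp
  qed
  have aR: "ennreal a \<le> emeasure M R" using a(1) by (intro order_trans[OF ennreal_leI a(2)]) simp
  define P where "P = {x\<in>R. F x < a}"
  define P2 where "P2 = {x\<in>R. F x < 2 * a}"
  have m: "{x\<in>R. F x < b} \<in> sets M" for b
  proof -
    have "{x\<in>R. F x < b} = R \<inter> (F -` {..<b} \<inter> space M)" using Rs by auto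
    then show ?thesis using R(1) F by auto
  qed
  have eP: "emeasure M P = ennreal a" "emeasure M P2 = ennreal (2 * a)"
    unfolding P_def P2_def using em[of a] em[of "2*a"] a aR by (auto simp: min_absorb1)
  have f: "P \<in> fmeasurable M" "P2 \<in> fmeasurable M" using m eP unfolding P_def P2_def by (auto simp: fmeasurable_def)
  have me: "measure M P = a" "measure M P2 = 2 * a" using eP a(1) by (auto simp: measure_def)
  have sub: "P \<subseteq> P2" unfolding P_def P2_def using a(1) by auto
  have "measure M (P2 - P) = a" using measurable_measure_Diff[OF f(2) fmeasurableD[OF f(1)] sub] me by simp
  then show ?thesis using f me a(1) by (intro exI[of _ P] exI[of _ "P2 - P"]) (auto simp: P_def P2_def intro: fmeasurable.Diff)
qed

text \<open>\<open>T ^^ (b - a)\<close> moves a part of \<open>P\<close> into level \<open>b\<close>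
  that fills more than half of it, and more than half of that level belongs to \<open>Q\<close>. Two
  such parts overlap.\<close>

lemma overlap_of_levels:
  assumes T: "T \<in> automorphisms M" and B: "B \<in> fmeasurable M" and P: "P \<in> fmeasurable M" and Q: "Q \<in> fmeasurable M"
    and a: "measure M B / 2 < measure M ((T ^^ a) ` B \<inter> P)" and b: "measure M B / 2 < measure M ((T ^^ b) ` B \<inter> Q)"
    and lt: "a < b"
  shows "\<exists>n\<ge>1. \<not> (AE x in M. x \<in> P \<longrightarrow> (T ^^ n) x \<notin> Q)"
proof (intro exI[of _ "b - a"] conjI notI)
  show "b - a \<ge> 1" using lt by simp
  assume ae: "AE x in M. x \<in> P \<longrightarrow> (T ^^ (b - a)) x \<notin> Q"
  let ?U = "(T ^^ (b - a)) ` ((T ^^ a) ` B \<inter> P)"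
  let ?W = "(T ^^ b) ` B \<inter> Q"
  have f1: "(T ^^ a) ` B \<inter> P \<in> fmeasurable M" "?W \<in> fmeasurable M"
    using level_fmeasurable[OF T B] P Q by (auto intro: fmeasurable_Int_fmeasurable dest: fmeasurableD)
  have U: "?U \<in> fmeasurable M" using level_fmeasurable[OF T f1(1)] .
  have Ub: "?U \<subseteq> (T ^^ b) ` B"
  proof -
    have "(T ^^ b) ` B = (T ^^ (b - a)) ` ((T ^^ a) ` B)" using lt by (subst funpow_image_add[symmetric]) simp
    then show ?thesis by blast
  qed
  have "measure M (?U \<union> ?W) \<le> measure M ((T ^^ b) ` B)"
    using Ub U f1 level_fmeasurable[OF T B] by (intro measure_mono_fmeasurable) (auto dest: fmeasurableD)
  moreover have "measure M (?U \<inter> ?W) = 0"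
  proof -
    obtain N where N: "N \<in> null_sets M" "{x\<in>space M. \<not> (x \<in> P \<longrightarrow> (T ^^ (b - a)) x \<notin> Q)} \<subseteq> N"
      using ae by (auto simp: eventually_ae_filter)
    have Ps: "P \<subseteq> space M" using P fmeasurableD sets.sets_into_space by blast
    have "?U \<inter> ?W \<subseteq> (T ^^ (b - a)) ` N" using N(2) Ps by auto
    moreover have "(T ^^ (b - a)) ` N \<in> null_sets M" using aut_null(1)[OF aut_funpow[OF T] N(1)] .
    ultimately have "?U \<inter> ?W \<in> null_sets M" using U f1 by (meson fmeasurableD null_sets_subset sets.Int)
    then show ?thesis by (simp add: null_sets_def measure_def)
  qed
  moreover have "measure M (?U \<union> ?W) + measure M (?U \<inter> ?W) = measure M ?U + measure M ?W"
    using measure_Un3[OF U f1(2)] by linarith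
  moreover have "measure M ?U = measure M ((T ^^ a) ` B \<inter> P)" by (rule level_measure[OF T f1(1)])
  ultimately show False using a b level_measure[OF T B, of b] by linarith
qed

text \<open>Some level lies mostly in \<open>P\<close> and some level mostly in \<open>Q\<close>.
  They are different because the sets are disjoint, and the lower one is carried onto the higher
  one; which is lower decides the direction.\<close>

lemma hit_of_approx_tower:
  assumes T: "T \<in> automorphisms M" and at: "\<And>k. approx_tower T k"
    and P: "P \<in> fmeasurable M" "0 < measure M P" and Q: "Q \<in> fmeasurable M" "0 < measure M Q" and PQ: "P \<inter> Q = {}"
  shows "(\<exists>n\<ge>1. \<not> (AE x in M. x \<in> P \<longrightarrow> (T ^^ n) x \<notin> Q)) \<or> (\<exists>n\<ge>1. \<not> (AE x in M. x \<in> Q \<longrightarrow> (T ^^ n) x \<notin> P))"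
proof -
  have e: "min (measure M P) (measure M Q) / 4 > 0" using P Q by simp
  obtain B h where b: "base M T B h"
    and app: "\<And>D. D \<in> {P, Q} \<Longrightarrow> \<exists>L\<subseteq>{..<h}. mdist M D (tower_set T B L) < min (measure M P) (measure M Q) / 4"
    using approx_tower_finite[OF T at, of "{P,Q}", OF _ _ e] P Q by blast
  have B: "B \<in> fmeasurable M" using b by (simp add: base_def)
  obtain L where L: "L \<subseteq> {..<h}" "mdist M P (tower_set T B L) < measure M P / 4" using app[of P] by fastforce
  obtain K where K: "K \<subseteq> {..<h}" "mdist M Q (tower_set T B K) < measure M Q / 4" using app[of Q] by fastforce
  obtain a where a: "measure M B / 2 < measure M ((T ^^ a) ` B \<inter> P)" using mostly_level[OF T b P L] by blast
  obtain c where c: "measure M B / 2 < measure M ((T ^^ c) ` B \<inter> Q)" using mostly_level[OF T b Q K] by blast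
  have "a \<noteq> c"
  proof
    assume "a = c"
    let ?X = "(T ^^ a) ` B"
    have X: "?X \<in> fmeasurable M" using level_fmeasurable[OF T B] .
    have f: "?X \<inter> P \<in> fmeasurable M" "?X \<inter> Q \<in> fmeasurable M" using X P Q by (auto intro: fmeasurable_Int_fmeasurable dest: fmeasurableD)
    have "measure M (?X \<inter> P) + measure M (?X \<inter> Q) = measure M ((?X \<inter> P) \<union> (?X \<inter> Q))"
      using f PQ by (intro measure_Un_fmeasurable[symmetric]) auto
    also have "\<dots> \<le> measure M ?X" using X f by (intro measure_mono_fmeasurable) (auto dest: fmeasurableD)
    finally show False using a c \<open>a = c\<close> level_measure[OF T B, of a] by simp
  qed
  then show ?thesis
    using overlap_of_levels[OF T B P(1) Q(1) a c] overlap_of_levels[OF T B Q(1) P(1) c a] by (meson nat_neq_iff)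
qed

text \<open>The points that enter a forward invariant set for the first time form a wandering set, and two
  disjoint parts of a wandering set cannot both be filled by levels of one tower.\<close>

lemma forward_invariant_conull:
  assumes T: "T \<in> automorphisms M" and at: "\<And>k. approx_tower T k"
    and X: "X \<in> sets M" "X \<notin> null_sets M" and inv: "AE x in M. x \<in> X \<longrightarrow> T x \<in> X"
  shows "AE x in M. x \<in> X"
proof (rule ccontr)
  assume notX: "\<not> (AE x in M. x \<in> X)"
  let ?Z = "space M - X"
  have Z: "?Z \<in> sets M" using X(1) by auto
  have Zn: "?Z \<notin> null_sets M"
  proof
    assume "?Z \<in> null_sets M"
    then have "AE x in M. x \<in> X" using AE_not_in[of ?Z M] AE_space by (auto elim: AE_mp)
    then show False using notX by blast
  qed
  have fwd: "AE x in M. x \<in> Y \<longrightarrow> (T ^^ n) x \<in> Y" if "AE x in M. x \<in> Y \<longrightarrow> T x \<in> Y" for Y n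
  proof (induction n)
    case (Suc n)
    have "AE x in M. (T ^^ n) x \<in> Y \<longrightarrow> T ((T ^^ n) x) \<in> Y" using aut_AE[OF aut_funpow[OF T] that] .
    with Suc show ?case by eventually_elim simp
  qed simp
  have fX: "AE x in M. x \<in> X \<longrightarrow> (T ^^ n) x \<in> X" for n by (rule fwd[OF inv])
  define W where "W = ?Z \<inter> (T -` X \<inter> space M)"
  have W: "W \<in> sets M" unfolding W_def using Z automorphismsD(2)[OF T X(1)] by auto
  show False
  proof (cases "W \<in> null_sets M")
    case False
    obtain P Q where PQ: "P \<in> fmeasurable M" "Q \<in> fmeasurable M" "P \<subseteq> W" "Q \<subseteq> W" "P \<inter> Q = {}" "0 < measure M P" "0 < measure M Q"
      using ex_disjoint_finite_parts[OF W False] by blast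
    have no: "AE x in M. x \<in> W \<longrightarrow> (T ^^ n) x \<notin> W" if n1: "n \<ge> 1" for n
    proof -
      obtain m where m: "n = Suc m" using n1 by (cases n) auto
      have "AE x in M. T x \<in> X \<longrightarrow> (T ^^ m) (T x) \<in> X" using aut_AE[OF T fX] .
      then show ?thesis unfolding m by eventually_elim (auto simp: W_def funpow_swap1)
    qed
    have no2: "AE x in M. x \<in> P' \<longrightarrow> (T ^^ n) x \<notin> Q'" if "n \<ge> 1" "P' \<subseteq> W" "Q' \<subseteq> W" for n P' Q'
      using no[OF that(1)] by eventually_elim (use that in auto)
    show False using hit_of_approx_tower[OF T at PQ(1,6) PQ(2,7) PQ(5)] no2 PQ(3,4) by blast
  next
    case True
    \<comment> \<open>If almost nothing enters \<open>X\<close> from outside, the complement is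
      forward invariant too, and no orbit joins the two sets.\<close>
    have "AE x in M. x \<in> ?Z \<longrightarrow> T x \<in> ?Z"
      using AE_not_in[OF True] AE_space by eventually_elim (auto simp: W_def aut_in_space[OF T])
    then have fZ: "AE x in M. x \<in> ?Z \<longrightarrow> (T ^^ n) x \<in> ?Z" for n by (rule fwd)
    obtain P where P: "P \<in> fmeasurable M" "P \<subseteq> X" "0 < measure M P" using ex_disjoint_finite_parts[OF X] by blast
    obtain Q where Q: "Q \<in> fmeasurable M" "Q \<subseteq> ?Z" "0 < measure M Q" using ex_disjoint_finite_parts[OF Z Zn] by blast
    have dis: "P \<inter> Q = {}" using P(2) Q(2) by blast
    have "AE x in M. x \<in> P \<longrightarrow> (T ^^ n) x \<notin> Q" for n using fX[of n] by eventually_elim (use P(2) Q(2) in auto)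
    moreover have "AE x in M. x \<in> Q \<longrightarrow> (T ^^ n) x \<notin> P" for n using fZ[of n] by eventually_elim (use P(2) Q(2) in auto)
    ultimately show False using hit_of_approx_tower[OF T at P(1,3) Q(1,3) dis] by blast
  qed
qed

end

section \<open>A sequence of approximately nested towers\<close>

context leb_dense begin

text \<open>A much thinner tower approximates \<open>B\<close>, and \<open>J0\<close> collects those
  of its levels that lie mostly in \<open>B\<close>. Disjointness of the first \<open>h\<close>
  images of \<open>B\<close> keeps these levels at least \<open>h\<close> apart, the other levels
  used carry little measure, and a new base that is small against \<open>B\<close> forces the number
  of levels to be large.\<close>

lemma refine_base:
  assumes T: "T \<in> automorphisms M" and at: "\<And>k. approx_tower T k"
    and b: "base M T B h" and FF: "finite FF" "FF \<subseteq> fmeasurable M" and e: "e > 0" and h: "h \<ge> 1"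
  shows "\<exists>B' h' J. base M T B' h' \<and> measure M B' < e \<and> J \<subseteq> {..<h'} \<and> (\<forall>t\<in>J. t + h \<le> h') \<and>
    (\<forall>t\<in>J. \<forall>t'\<in>J. t < t' \<longrightarrow> t + h \<le> t') \<and> mdist M B (tower_set T B' J) < e \<and> N \<le> card J \<and>
    (\<forall>D\<in>FF. \<exists>L\<subseteq>{..<h'}. mdist M D (tower_set T B' L) < e)"
proof -
  have B: "B \<in> fmeasurable M" "0 < measure M B" using b by (auto simp: base_def)
  \<comment> \<open>The first bound covers a total error of \<open>4 * e0\<close>; the second makes
    fewer than \<open>N\<close> levels too small to fill \<open>B\<close>, which yields the lower
    bound on \<open>card J\<close>.\<close>
  define e0 where "e0 = min (e / 8) (measure M B / (8 * (real N + 1)))"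
  have e0: "e0 > 0" unfolding e0_def using e B(2) by (auto intro!: divide_pos_pos mult_pos_pos add_nonneg_pos)
  have e0a: "8 * e0 \<le> e" unfolding e0_def by (simp add: min_le_iff_disj)
  have e0b: "8 * (real N + 1) * e0 \<le> measure M B"
  proof -
    have "e0 \<le> measure M B / (8 * (real N + 1))" unfolding e0_def by simp
    moreover have "8 * (real N + 1) > 0" by simp
    ultimately show ?thesis by (simp add: pos_le_divide_eq mult.commute)
  qed
  have e0c: "8 * e0 \<le> measure M B"
  proof -
    have "8 * e0 \<le> 8 * (real N + 1) * e0" using e0 by (simp add: algebra_simps)
    then show ?thesis using e0b by simp
  qed
  have F': "finite (insert B FF)" "insert B FF \<subseteq> fmeasurable M" using FF B by auto
  obtain B' h' where b': "base M T B' h'" and small: "measure M B' < e0"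
    and app: "\<And>D. D \<in> insert B FF \<Longrightarrow> \<exists>L\<subseteq>{..<h'}. mdist M D (tower_set T B' L) < e0"
    using approx_tower_finite[OF T at F' e0] by blast
  have B': "B' \<in> fmeasurable M" "0 < measure M B'" using b' by (auto simp: base_def)
  obtain L where L: "L \<subseteq> {..<h'}" "mdist M B (tower_set T B' L) < e0" using app[of B] by blast
  have finL: "finite L" using L(1) finite_subset by blast
  let ?lv = "\<lambda>t. (T ^^ t) ` B'"
  define J0 where "J0 = {t\<in>L. measure M B' / 2 < measure M (?lv t \<inter> B)}"
  define J where "J = {t\<in>J0. t + h \<le> h'}"
  have JJ: "J \<subseteq> J0" "J0 \<subseteq> L" unfolding J_def J0_def by auto
  have lvf: "?lv t \<in> fmeasurable M" for t using level_fmeasurable[OF T B'(1)] .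
  have lvm: "measure M (?lv t) = measure M B'" for t using level_measure[OF T B'(1)] .
  \<comment> \<open>Otherwise more than half of level \<open>t'\<close> would come from
    \<open>B\<close> moved up by \<open>t' - t\<close>, and more than half of it would lie in
    \<open>B\<close> itself, although these two parts are disjoint.\<close>
  have sep: "t + h \<le> t'" if tt: "t \<in> J0" "t' \<in> J0" "t < t'" for t t'
  proof (rule ccontr)
    assume "\<not> t + h \<le> t'"
    then have d: "0 < t' - t" "t' - t < h" using tt(3) by auto
    let ?U = "(T ^^ (t' - t)) ` (?lv t \<inter> B)" and ?W = "?lv t' \<inter> B"
    have f: "?lv t \<inter> B \<in> fmeasurable M" "?W \<in> fmeasurable M"
      by (rule fmeasurable_Int_fmeasurable[OF lvf fmeasurableD[OF B(1)]])+
    have U: "?U \<in> fmeasurable M" using level_fmeasurable[OF T f(1)] .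
    have "(T ^^ (t' - t)) ` B \<inter> (T ^^ 0) ` B = {}"
      using b d h by (intro disjoint_family_onD[of "\<lambda>t. (T ^^ t) ` B" "{..<h}"]) (auto simp: base_def)
    moreover have "?U \<subseteq> (T ^^ (t' - t)) ` B" by (rule image_mono) (rule Int_lower2)
    moreover have "?W \<subseteq> (T ^^ 0) ` B" by simp
    ultimately have dis: "?U \<inter> ?W = {}" by (meson disjoint_iff subsetD)
    have "?lv t' = (T ^^ (t' - t)) ` ?lv t" using tt(3) by (subst funpow_image_add[symmetric]) simp
    then have sub: "?U \<union> ?W \<subseteq> ?lv t'" by blast
    have "measure M ?U + measure M ?W = measure M (?U \<union> ?W)"
      using U f(2) dis by (intro measure_Un_fmeasurable[symmetric]) auto
    also have "\<dots> \<le> measure M (?lv t')" using sub U f lvf by (intro measure_mono_fmeasurable) (auto dest: fmeasurableD)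
    finally have "measure M (?lv t \<inter> B) + measure M ?W \<le> measure M B'"
      using level_measure[OF T f(1)] lvm by simp
    then show False using tt(1,2) unfolding J0_def by simp
  qed
  \<comment> \<open>A level outside \<open>J0\<close> has at least half of its measure outside
    \<open>B\<close>, and all of that counts in the distance from \<open>B\<close> to the
    union.\<close>
  have bad: "real (card (L - J0)) * measure M B' \<le> 2 * e0"
  proof -
    have "measure M (?lv t - B) \<ge> measure M B' / 2" if "t \<in> L - J0" for t
      using that measure_split[OF lvf[of t] fmeasurableD[OF B(1)]] lvm[of t] unfolding J0_def by auto
    then have "real (card (L - J0)) * (measure M B' / 2) \<le> (\<Sum>t\<in>L - J0. measure M (?lv t - B))"
      by (intro sum_bounded_below) auto
    also have "\<dots> = measure M (\<Union>t\<in>L - J0. ?lv t - B)"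
    proof (rule measure_finite_Union[symmetric])
      show "(\<lambda>t. ?lv t - B) ` (L - J0) \<subseteq> sets M" using lvf B(1) by (auto dest: fmeasurableD)
      have "disjoint_family_on ?lv {..<h'}" using b' unfolding base_def by blast
      then show "disjoint_family_on (\<lambda>t. ?lv t - B) (L - J0)"
        using L(1) unfolding disjoint_family_on_def by blast
      show "emeasure M (?lv t - B) \<noteq> \<infinity>" for t
        using fmeasurableD2[OF fmeasurable_Diff[OF lvf fmeasurableD[OF B(1)]]] by simp
    qed (use finL in simp)
    also have "\<dots> \<le> measure M (tower_set T B' L - B)"
      using tower_set_fmeasurable[OF T B'(1) finL] B(1) lvf finL
      by (intro measure_mono_fmeasurable fmeasurable_Diff sets.finite_UN sets.Diff) (auto simp: tower_set_def dest: fmeasurableD)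
    also have "\<dots> \<le> mdist M B (tower_set T B' L)"
      by (rule measure_Diff_le_mdist(2)[OF B(1) tower_set_fmeasurable[OF T B'(1) finL]])
    finally show ?thesis using L(2) by simp
  qed
  \<comment> \<open>Two levels within \<open>h\<close> of the top would be less than
    \<open>h\<close> apart.\<close>
  have top: "card (J0 - J) \<le> 1"
  proof (rule ccontr)
    assume "\<not> card (J0 - J) \<le> 1"
    then obtain t t' where tt: "t \<in> J0 - J" "t' \<in> J0 - J" "t \<noteq> t'"
      by (metis card_le_Suc0_iff_eq One_nat_def card.infinite zero_le_one)
    have no: False if "s \<in> J0 - J" "s' \<in> J0 - J" "s < s'" for s s'
      using sep[of s s'] that JJ L(1) unfolding J_def by fastforce
    show False using no tt by (metis nat_neq_iff)
  qed
  have JL: "J \<subseteq> L" "J \<subseteq> {..<h'}" using JJ L(1) by auto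
  have finJ: "finite J" using JL(1) finL finite_subset by blast
  have cLJ: "card (L - J) \<le> card (L - J0) + 1"
  proof -
    have "L - J = (L - J0) \<union> (J0 - J)" using JJ by auto
    then have "card (L - J) \<le> card (L - J0) + card (J0 - J)" by (metis card_Un_le)
    then show ?thesis using top by simp
  qed
  have "mdist M (tower_set T B' L) (tower_set T B' J) = real (card (L - J)) * measure M B'"
  proof -
    have s: "sym_diff (tower_set T B' L) (tower_set T B' J) = tower_set T B' (L - J)"
      using tower_set_diff[OF b' L(1) JL(2)] JL(1) unfolding tower_set_def by auto
    show ?thesis unfolding mdist_def s using L(1) by (intro tower_set_measure[OF T b']) auto
  qed
  also have "\<dots> \<le> (real (card (L - J0)) + 1) * measure M B'" using cLJ B'(2) by (intro mult_right_mono) auto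
  also have "\<dots> = real (card (L - J0)) * measure M B' + measure M B'" by (simp add: distrib_right)
  finally have 1: "mdist M (tower_set T B' L) (tower_set T B' J) \<le> 3 * e0" using bad small by simp
  have 2: "mdist M B (tower_set T B' J) \<le> mdist M B (tower_set T B' L) + mdist M (tower_set T B' L) (tower_set T B' J)"
    by (intro mdist_triangle B tower_set_fmeasurable T B' finL finJ)
  have 3: "mdist M B (tower_set T B' J) < 4 * e0" using 1 2 L(2) by linarith
  have card: "N \<le> card J"
  proof (rule ccontr)
    assume "\<not> N \<le> card J"
    then have "real (card J) \<le> real N" by simp
    then have "real (card J) * measure M B' \<le> real N * e0" using small B'(2) by (intro mult_mono) auto
    moreover have "measure M B \<le> measure M (tower_set T B' J) + mdist M B (tower_set T B' J)"
      by (intro measure_le_mdist B tower_set_fmeasurable T B' finJ)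
    moreover have "measure M (tower_set T B' J) = real (card J) * measure M B'" by (rule tower_set_measure[OF T b' JL(2)])
    ultimately have "measure M B < real N * e0 + 4 * e0" using 3 by linarith
    moreover have "8 * (real N + 1) * e0 = 8 * (real N * e0) + 8 * e0" by (simp add: algebra_simps)
    moreover have "0 \<le> real N * e0" using e0 by simp
    ultimately show False using e0b e0 by linarith
  qed
  have e0e: "e0 < e" "4 * e0 < e" using e0a e0 by linarith+
  show ?thesis
  proof (rule exI[of _ B'], rule exI[of _ h'], rule exI[of _ J], intro conjI ballI impI)
    show "base M T B' h'" by (rule b')
    show "measure M B' < e" using small e0e by simp
    show "J \<subseteq> {..<h'}" by (rule JL(2))
    show "t + h \<le> h'" if "t \<in> J" for t using that unfolding J_def by simp
    show "t + h \<le> t'" if "t \<in> J" "t' \<in> J" "t < t'" for t t' using sep that JJ by blast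
    show "mdist M B (tower_set T B' J) < e" using 3 e0e by simp
    show "N \<le> card J" by (rule card)
    show "\<exists>L\<subseteq>{..<h'}. mdist M D (tower_set T B' L) < e" if "D \<in> FF" for D
      using app[of D] that e0e by (meson insertCI order.strict_trans)
  qed
qed

text \<open>A sequence of towers, each approximately cut and stacked into the next; the errors are small
  enough for the bases to be corrected to exactly nested ones.\<close>

lemma ex_base_sequence:
  assumes T: "T \<in> automorphisms M" and at: "\<And>k. approx_tower T k"
    and D: "\<And>n::nat. D n \<in> fmeasurable M"
  shows "\<exists>B h J. h 0 = (1::nat) \<and> (\<forall>n. base M T (B n) (h n) \<and> h n \<ge> 1 \<and> finite (J n) \<and> n < card (J n) \<and>
    (\<forall>t\<in>J n. t + h n \<le> h (Suc n)) \<and> (\<forall>t\<in>J n. \<forall>t'\<in>J n. t < t' \<longrightarrow> t + h n \<le> t') \<and>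
    measure M (B (Suc n)) \<le> measure M (B n) \<and>
    real (h n) * mdist M (B n) (tower_set T (B (Suc n)) (J n)) \<le> (1/2) ^ (n + 2) * min 1 (measure M (B n)) / real (h n) \<and>
    (\<forall>i\<le>n. \<exists>L\<subseteq>{..<h (Suc n)}. mdist M (D i) (tower_set T (B (Suc n)) L) \<le> (1/2) ^ n))"
proof -
  define P where "P = (\<lambda>(n::nat) (B,h). base M T B h \<and> h \<ge> 1 \<and> (n = 0 \<longrightarrow> h = (1::nat)))"
  define Q where "Q = (\<lambda>n (B,h) (B',h'). \<exists>J. finite J \<and> n < card J \<and>
    (\<forall>t\<in>J. t + h \<le> h') \<and> (\<forall>t\<in>J. \<forall>t'\<in>J. t < t' \<longrightarrow> t + h \<le> t') \<and>
    measure M B' \<le> measure M B \<and>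
    real h * mdist M B (tower_set T B' J) \<le> (1/2) ^ (n + 2) * min 1 (measure M B) / real (h::nat) \<and>
    (\<forall>i\<le>n. \<exists>L\<subseteq>{..<h'}. mdist M (D i) (tower_set T B' L) \<le> (1/2) ^ n))"
  have "\<exists>f. \<forall>n. P n (f n) \<and> Q n (f n) (f (Suc n))"
  proof (rule dependent_nat_choice)
    obtain B h where b: "base M T B h" using approx_tower_finite[OF T at, of "{}" 1] by auto
    \<comment> \<open>Only the bottom level is kept, so that the sequence starts from height
      1.\<close>
    then have "base M T B 1" unfolding base_def by (auto simp: disjoint_family_on_def)
    then show "\<exists>x. P 0 x" unfolding P_def by (intro exI[of _ "(B,1)"]) auto
  next
    fix x and n :: nat assume "P n x"
    then obtain B h where x: "x = (B,h)" and b: "base M T B h" and h: "h \<ge> 1" unfolding P_def by (cases x) auto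
    have mB: "0 < measure M B" using b by (simp add: base_def)
    have hr: "real h > 0" using h by simp
    \<comment> \<open>One factor \<open>1/h\<close> pays for the up to \<open>h\<close> places at
      which this error is repeated when an earlier base is rewritten, the other for exchanging the
      base by its correction in a union of up to \<open>h\<close> levels. The powers of 1/2 make the
      errors summable.\<close>
    define e where "e = min ((1/2) ^ (n + 2) * min 1 (measure M B) / real h / real h) (min (measure M B) ((1/2) ^ n))"
    have e: "e > 0" unfolding e_def using mB hr by (auto intro!: divide_pos_pos mult_pos_pos)
    have FF: "finite (D ` {..n})" "D ` {..n} \<subseteq> fmeasurable M" using D by auto
    obtain B' h' J where r: "base M T B' h'" "measure M B' < e" "J \<subseteq> {..<h'}" "\<forall>t\<in>J. t + h \<le> h'"
      "\<forall>t\<in>J. \<forall>t'\<in>J. t < t' \<longrightarrow> t + h \<le> t'" "mdist M B (tower_set T B' J) < e" "Suc n \<le> card J"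
      and app: "\<forall>E\<in>D ` {..n}. \<exists>L\<subseteq>{..<h'}. mdist M E (tower_set T B' L) < e"
      using refine_base[OF T at b FF e h, of "Suc n"] by blast
    have J: "finite J" using r(3) finite_subset by blast
    have "J \<noteq> {}" using r(7) by auto
    then have h': "h' \<ge> 1" using r(3) by auto
    have eB: "e \<le> measure M B" "e \<le> (1/2) ^ n" "e \<le> (1/2) ^ (n + 2) * min 1 (measure M B) / real h / real h"
      unfolding e_def by auto
    have m: "real h * mdist M B (tower_set T B' J) \<le> (1/2) ^ (n + 2) * min 1 (measure M B) / real h"
    proof -
      have "mdist M B (tower_set T B' J) \<le> (1/2) ^ (n + 2) * min 1 (measure M B) / real h / real h" using r(6) eB(3) by linarith
      then show ?thesis using hr by (simp add: pos_le_divide_eq ac_simps)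
    qed
    have "\<exists>L\<subseteq>{..<h'}. mdist M (D i) (tower_set T B' L) \<le> (1/2) ^ n" if i: "i \<le> n" for i
    proof -
      obtain L where "L \<subseteq> {..<h'}" "mdist M (D i) (tower_set T B' L) < e" using app i by blast
      then show ?thesis using eB(2) by (intro exI[of _ L]) auto
    qed
    then have "Q n x (B',h')" unfolding Q_def x prod.case using J r m eB(1)
      by (intro exI[of _ J]) auto
    moreover have "P (Suc n) (B',h')" unfolding P_def using r(1) h' by simp
    ultimately show "\<exists>y. P (Suc n) y \<and> Q n x y" by blast
  qed
  then obtain f where f: "\<And>n. P n (f n)" "\<And>n. Q n (f n) (f (Suc n))" by blast
  define B where "B = (\<lambda>n. fst (f n))"
  define h where "h = (\<lambda>n. snd (f n))"
  have fe: "f n = (B n, h n)" for n unfolding B_def h_def by simp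
  have P: "base M T (B n) (h n)" "h n \<ge> 1" "h 0 = 1" for n
    using f(1)[of n] f(1)[of 0] unfolding fe P_def by auto
  have "\<forall>n. \<exists>J. finite J \<and> n < card J \<and>
    (\<forall>t\<in>J. t + h n \<le> h (Suc n)) \<and> (\<forall>t\<in>J. \<forall>t'\<in>J. t < t' \<longrightarrow> t + h n \<le> t') \<and>
    measure M (B (Suc n)) \<le> measure M (B n) \<and>
    real (h n) * mdist M (B n) (tower_set T (B (Suc n)) J) \<le> (1/2) ^ (n + 2) * min 1 (measure M (B n)) / real (h n) \<and>
    (\<forall>i\<le>n. \<exists>L\<subseteq>{..<h (Suc n)}. mdist M (D i) (tower_set T (B (Suc n)) L) \<le> (1/2) ^ n)"
    using f(2) unfolding fe Q_def prod.case by blast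
  from choice[OF this] obtain J where J: "\<forall>n. finite (J n) \<and> n < card (J n) \<and>
    (\<forall>t\<in>J n. t + h n \<le> h (Suc n)) \<and> (\<forall>t\<in>J n. \<forall>t'\<in>J n. t < t' \<longrightarrow> t + h n \<le> t') \<and>
    measure M (B (Suc n)) \<le> measure M (B n) \<and>
    real (h n) * mdist M (B n) (tower_set T (B (Suc n)) (J n)) \<le> (1/2) ^ (n + 2) * min 1 (measure M (B n)) / real (h n) \<and>
    (\<forall>i\<le>n. \<exists>L\<subseteq>{..<h (Suc n)}. mdist M (D i) (tower_set T (B (Suc n)) L) \<le> (1/2) ^ n)" ..
  show ?thesis
    by (rule exI[of _ B], rule exI[of _ h], rule exI[of _ J]) (use P J in simp)
qed

end

section \<open>The coordinate defined by exactly nested towers\<close>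

locale nested_towers = leb_space M g X0 + cutting h r pos w0 \<sigma>0
  for M :: "'a measure" and g X0 h r pos w0 \<sigma>0 +
  fixes T :: "'a \<Rightarrow> 'a" and E :: "nat \<Rightarrow> 'a set"
  assumes T: "T \<in> automorphisms M"
    and E_fm: "\<And>j. E j \<in> fmeasurable M"
    and E_disj: "\<And>j. disjoint_family_on (\<lambda>t. (T ^^ t) ` E j) {..<h j}"
    and E_cut: "\<And>j. E j = (\<Union>i<r j. (T ^^ pos j i) ` E (Suc j))"
    and E_0: "measure M (E 0) = w0"
begin

abbreviation "lv j t \<equiv> (T ^^ t) ` E j"

definition XX :: "nat \<Rightarrow> 'a set" where "XX j = (\<Union>t<h j. lv j t)"

lemma lv_fm: "lv j t \<in> fmeasurable M"
  by (rule level_fmeasurable[OF T E_fm])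

lemma lv_sets [measurable]: "lv j t \<in> sets M" using lv_fm fmeasurableD by blast

lemma XX_sets [measurable]: "XX j \<in> sets M" unfolding XX_def by (intro sets.finite_UN) auto

lemma XX_fm: "XX j \<in> fmeasurable M" unfolding XX_def by (intro fmeasurable.finite_UN lv_fm) auto

lemma lv_unique: "x \<in> lv j t \<Longrightarrow> x \<in> lv j t' \<Longrightarrow> t < h j \<Longrightarrow> t' < h j \<Longrightarrow> t = t'"
  using E_disj[of j] unfolding disjoint_family_on_def by blast

lemma lv_split: "lv j t = (\<Union>i<r j. lv (Suc j) (pos j i + t))"
proof -
  have "lv j t = (\<Union>i<r j. (T ^^ t) ` ((T ^^ pos j i) ` E (Suc j)))" by (subst E_cut) (simp add: image_UN)
  also have "\<dots> = (\<Union>i<r j. lv (Suc j) (pos j i + t))" by (simp only: funpow_image_add[symmetric] add.commute)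
  finally show ?thesis .
qed

lemma lv_sub_space: "lv j t \<subseteq> space M" using lv_sets sets.sets_into_space by blast

text \<open>\<open>E j\<close> is a disjoint union of \<open>r j\<close> images of
  \<open>E (Suc j)\<close>, so the measures are divided just as the widths are.\<close>

lemma measure_E: "measure M (E j) = w j"
proof (induction j)
  case (Suc j)
  have "measure M (E j) = (\<Sum>i<r j. measure M (lv (Suc j) (pos j i)))"
  proof (subst E_cut, rule measure_finite_Union)
    show "disjoint_family_on (\<lambda>i. lv (Suc j) (pos j i)) {..<r j}"
      unfolding disjoint_family_on_def
    proof (intro ballI impI)
      fix m n assume mn: "m \<in> {..<r j}" "n \<in> {..<r j}" "m \<noteq> n"
      have lt: "pos j m < h (Suc j)" "pos j n < h (Suc j)" using pos_add_less[of m j 0] pos_add_less[of n j 0] mn h_pos[of j] by auto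
      have "pos j m \<noteq> pos j n" using pos_inj[of m j n 0 0] mn h_pos[of j] by auto
      then show "lv (Suc j) (pos j m) \<inter> lv (Suc j) (pos j n) = {}" using lv_unique lt by blast
    qed
    show "emeasure M (lv (Suc j) (pos j i)) \<noteq> \<infinity>" for i using fmeasurableD2[OF lv_fm] by simp
  qed auto
  also have "\<dots> = real (r j) * measure M (E (Suc j))" by (simp add: level_measure[OF T E_fm])
  finally have "real (r j) * measure M (E (Suc j)) = w j" using Suc by simp
  then show ?case using r_pos[of j] by (simp add: field_simps)
qed (simp add: E_0)

lemma measure_lv: "measure M (lv j t) = w j"
  using level_measure[OF T E_fm] measure_E by simp

text \<open>The counterpart of \<open>lev_lift\<close> for orbits: the levels in \<open>M\<close>
  and the intervals on the line are subdivided by the same positions, so a common index describes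
  both.\<close>

lemma lv_lift:
  assumes "j \<le> k" "x \<in> lv j u" "u + n < h j"
  shows "\<exists>v. x \<in> lv k v \<and> v + n < h k \<and> shift k v n = shift j u n \<and> lev k v \<subseteq> lev j u"
  using assms
proof (induction k rule: dec_induct)
  case (step k)
  then obtain v where v: "x \<in> lv k v" "v + n < h k" "shift k v n = shift j u n" "lev k v \<subseteq> lev j u" by blast
  then obtain i where i: "i < r k" "x \<in> lv (Suc k) (pos k i + v)" using lv_split[of v k] by blast
  have s: "shift (Suc k) (pos k i + v) n = shift k v n"
  proof -
    have "\<sigma> (Suc k) (pos k i + v + n) = r k * \<sigma> k (v + n) + i" using \<sigma>_Suc[OF i(1), of "v + n"] v(2) by (simp add: add.assoc)
    moreover have "\<sigma> (Suc k) (pos k i + v) = r k * \<sigma> k v + i" using \<sigma>_Suc[OF i(1), of v] v(2) by simp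
    ultimately have "shift (Suc k) (pos k i + v) n = (real (\<sigma> k (v + n)) - real (\<sigma> k v)) * (real (r k) * w (Suc k))"
      unfolding shift_def by (simp add: algebra_simps del: w.simps)
    then show ?thesis unfolding w_Suc shift_def .
  qed
  have "lev (Suc k) (pos k i + v) \<subseteq> lev k v" using lev_split[of v k] v(2) i(1) by auto
  then show ?case using v i s pos_add_less[OF i(1) v(2)]
    by (intro exI[of _ "pos k i + v"]) (auto simp: add.assoc)
qed auto

lemma XX_mono: "j \<le> k \<Longrightarrow> XX j \<subseteq> XX k"
proof
  fix x assume jk: "j \<le> k" and "x \<in> XX j"
  then obtain t where "t < h j" "x \<in> lv j t" unfolding XX_def by blast
  then obtain v where "x \<in> lv k v" "v + 0 < h k" using lv_lift[OF jk, of x t 0] by auto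
  then show "x \<in> XX k" unfolding XX_def by auto
qed

lemma measure_XX: "measure M (XX j) = real (h j) * w j"
proof -
  have "measure M (XX j) = (\<Sum>t<h j. measure M (lv j t))"
    unfolding XX_def using E_disj fmeasurableD2[OF lv_fm] by (intro measure_finite_Union) auto
  then show ?thesis by (simp add: measure_lv)
qed

text \<open>A point of the union whose image leaves it lies in the top level of every tower that
  contains it, and top levels have measure \<open>w j\<close>, which tends to 0.\<close>

lemma XX_forward: "AE x in M. x \<in> (\<Union>j. XX j) \<longrightarrow> T x \<in> (\<Union>j. XX j)"
proof -
  define Q where "Q = {x \<in> (\<Union>j. XX j). T x \<notin> (\<Union>j. XX j)}"
  have Us: "(\<Union>j. XX j) \<in> sets M" by auto
  have Usp: "(\<Union>j. XX j) \<subseteq> space M" using Us sets.sets_into_space by blast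
  have "Q = (\<Union>j. XX j) - (T -` (\<Union>j. XX j) \<inter> space M)" unfolding Q_def using Usp by auto
  then have Qs: "Q \<in> sets M" using Us automorphismsD(2)[OF T Us] by auto
  have top: "Q \<inter> XX j \<subseteq> lv j (h j - 1)" for j
  proof
    fix x assume x: "x \<in> Q \<inter> XX j"
    then obtain t where t: "t < h j" "x \<in> lv j t" unfolding XX_def by blast
    have "\<not> Suc t < h j"
    proof
      assume "Suc t < h j"
      moreover have "T x \<in> lv j (Suc t)" using t(2) by auto
      ultimately have "T x \<in> XX j" unfolding XX_def by blast
      then show False using x unfolding Q_def by blast
    qed
    then have "t = h j - 1" using t(1) by simp
    then show "x \<in> lv j (h j - 1)" using t(2) by simp
  qed
  have "Q \<inter> XX k \<in> null_sets M" for k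
  proof -
    have "emeasure M (Q \<inter> XX k) \<le> ennreal (w j)" if "k \<le> j" for j
    proof -
      have "Q \<inter> XX k \<subseteq> lv j (h j - 1)" using top[of j] XX_mono[OF that] by blast
      then have "emeasure M (Q \<inter> XX k) \<le> emeasure M (lv j (h j - 1))" by (intro emeasure_mono lv_sets)
      then show ?thesis using emeasure_eq_measure2[OF lv_fm] measure_lv by simp
    qed
    moreover have "(\<lambda>j. ennreal (w j)) \<longlonglongrightarrow> ennreal 0" using w_tendsto by (intro tendsto_ennrealI)
    ultimately have "emeasure M (Q \<inter> XX k) \<le> ennreal 0"
      by (intro LIMSEQ_le_const[of "\<lambda>j. ennreal (w j)"]) blast+
    then show ?thesis using Qs by (intro null_setsI) auto
  qed
  then have "(\<Union>k. Q \<inter> XX k) \<in> null_sets M" by (rule null_sets_UN)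
  moreover have "(\<Union>k. Q \<inter> XX k) = Q" unfolding Q_def by blast
  ultimately have "Q \<in> null_sets M" by simp
  from AE_not_in[OF this] show ?thesis by eventually_elim (auto simp: Q_def)
qed

end

text \<open>The additional data say that the towers exhaust \<open>M\<close> and that almost every
  point eventually sees each \<open>D n\<close> as a union of levels. As the sets \<open>D n\<close>
  separate points, the levels do so too, up to a null set.\<close>

locale tower_system = nested_towers M g X0 h r pos w0 \<sigma>0 T E
  for M :: "'a measure" and g X0 h r pos w0 \<sigma>0 T E +
  fixes D :: "nat \<Rightarrow> 'a set" and L :: "nat \<Rightarrow> nat \<Rightarrow> nat set"
  assumes E_all: "AE x in M. \<exists>j. \<exists>t<h j. x \<in> (T ^^ t) ` E j"
    and E_gen: "AE x in M. \<forall>n. \<exists>N. \<forall>j\<ge>N. x \<in> D n \<longleftrightarrow> (\<exists>t\<in>L n j. t < h j \<and> x \<in> (T ^^ t) ` E j)"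
    and D_sep: "\<And>x y. x \<in> X0 \<Longrightarrow> y \<in> X0 \<Longrightarrow> (\<forall>n. x \<in> D n \<longleftrightarrow> y \<in> D n) \<Longrightarrow> x = y"
begin

text \<open>Follows a point of the line through the subdivisions; the levels in \<open>M\<close>
  with the same indices are nested in the same way.\<close>

lemma lv_descend:
  assumes "j \<le> k" "v < h j" "y \<in> lev j v"
  shows "\<exists>u<h k. y \<in> lev k u \<and> lv k u \<subseteq> lv j v"
  using assms
proof (induction k rule: dec_induct)
  case (step k)
  then obtain u where u: "u < h k" "y \<in> lev k u" "lv k u \<subseteq> lv j v" by blast
  then obtain i where i: "i < r k" "y \<in> lev (Suc k) (pos k i + u)" using lev_split[of u k] by blast
  have "lv (Suc k) (pos k i + u) \<subseteq> lv k u" using lv_split[of u k] i(1) by blast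
  then show ?case using u i pos_add_less[OF i(1) u(1)] by blast
qed auto

text \<open>The left end point of the interval that belongs to the level of \<open>x\<close>; the
  sum is empty of nonzero terms, hence 0, outside the tower.\<close>

definition F :: "nat \<Rightarrow> 'a \<Rightarrow> real" where
  "F j x = (\<Sum>t<h j. indicat_real (lv j t) x * (real (\<sigma> j t) * w j))"

lemma F_measurable [measurable]: "F j \<in> borel_measurable M" unfolding F_def by measurable

lemma F_eq: "x \<in> lv j t \<Longrightarrow> t < h j \<Longrightarrow> F j x = real (\<sigma> j t) * w j"
proof -
  assume x: "x \<in> lv j t" and t: "t < h j"
  have "x \<notin> lv j s" if "s < h j" "s \<noteq> t" for s using lv_unique[OF x _ t that(1)] that(2) by blast
  then have "F j x = (\<Sum>s<h j. if s = t then real (\<sigma> j t) * w j else 0)"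
    unfolding F_def using x by (intro sum.cong) (auto simp del: image_iff)
  then show ?thesis using t by simp
qed

lemma F_out: "x \<notin> XX j \<Longrightarrow> F j x = 0"
  unfolding F_def XX_def by (intro sum.neutral) auto

lemma F_in_lev: "x \<in> lv j t \<Longrightarrow> t < h j \<Longrightarrow> F j x \<in> lev j t"
  using w_pos[of j] by (simp add: F_eq lev_def)

lemma F_nonneg: "0 \<le> F j x"
  unfolding F_def using w_pos[of j] by (intro sum_nonneg mult_nonneg_nonneg) (auto intro: less_imp_le)

text \<open>The interval of a later stage is contained in that of the earlier one.\<close>

lemma F_bounds:
  assumes x: "x \<in> XX j" and jk: "j \<le> k"
  shows "F j x \<le> F k x \<and> F k x + w k \<le> F j x + w j"
proof -
  obtain t where t: "t < h j" "x \<in> lv j t" using x unfolding XX_def by blast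
  then obtain v where v: "x \<in> lv k v" "v < h k" "lev k v \<subseteq> lev j t" using lv_lift[OF jk, of x t 0] by auto
  have k0: "0 < w k" "0 < w j" by (rule w_pos)+
  have "{F k x..<F k x + w k} \<subseteq> {F j x..<F j x + w j}"
    using v(3) unfolding lev_def F_eq[OF t(2,1)] F_eq[OF v(1,2)] .
  then show ?thesis using k0 by (simp add: ivl_subset)
qed

definition f :: "'a \<Rightarrow> real" where "f x = lim (\<lambda>j. F j x)"

lemma f_measurable [measurable]: "f \<in> borel_measurable M"
  unfolding f_def by (rule borel_measurable_lim_metric) auto

lemma F_tendsto: "x \<in> XX j \<Longrightarrow> (\<lambda>k. F k x) \<longlonglongrightarrow> f x"
proof -
  assume x: "x \<in> XX j"
  have "incseq (\<lambda>k. F (k + j) x)"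
    unfolding incseq_def
  proof (intro allI impI)
    fix m n :: nat assume "m \<le> n"
    then show "F (m + j) x \<le> F (n + j) x" using F_bounds[of x "m + j" "n + j"] XX_mono[of j "m + j"] x by auto
  qed
  moreover have "F (k + j) x \<le> F j x + w j" for k
    using F_bounds[OF x, of "k + j"] w_pos[of "k + j"] by linarith
  ultimately obtain l where "(\<lambda>k. F (k + j) x) \<longlonglongrightarrow> l" using incseq_convergent by blast
  then have "(\<lambda>k. F k x) \<longlonglongrightarrow> l" by (rule LIMSEQ_offset)
  then show ?thesis unfolding f_def by (simp add: convergent_LIMSEQ_iff[symmetric] limI)
qed

lemma f_bounds:
  assumes x: "x \<in> XX j"
  shows "F j x \<le> f x" "f x \<le> F j x + w j"
proof -
  show "F j x \<le> f x"
    by (rule LIMSEQ_le_const[OF F_tendsto[OF x]]) (use F_bounds[OF x] in blast)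
  have "F k x \<le> F j x + w j" if "j \<le> k" for k using F_bounds[OF x that] w_pos[of k] by linarith
  then show "f x \<le> F j x + w j" by (intro LIMSEQ_le_const2[OF F_tendsto[OF x]]) blast
qed

lemma f_nonneg: "0 \<le> f x"
proof (cases "\<exists>j. x \<in> XX j")
  case True
  then show ?thesis using f_bounds(1) F_nonneg order_trans by blast
next
  case False
  then have "F j x = 0" for j using F_out by blast
  then show ?thesis unfolding f_def by simp
qed

text \<open>If the value fell into the interval occupied by tower \<open>j\<close>, the level of
  \<open>x\<close> at stage \<open>k\<close> would be a piece of a level of stage
  \<open>j\<close>.\<close>

lemma F_ge_outside:
  assumes "x \<in> XX k" "x \<notin> XX j" "j \<le> k"
  shows "real (h j) * w j \<le> F k x"
proof (rule ccontr)
  assume "\<not> ?thesis"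
  then have "F k x \<in> {0..<real (h j) * w j}" using F_nonneg[of k x] by simp
  then obtain v where v: "v < h j" "F k x \<in> lev j v" unfolding lev_Union[symmetric] by blast
  then obtain u where u: "u < h k" "F k x \<in> lev k u" "lv k u \<subseteq> lv j v" using lv_descend assms(3) by blast
  obtain t where t: "t < h k" "x \<in> lv k t" using assms(1) unfolding XX_def by blast
  have "t = u" using lev_unique[OF F_in_lev[OF t(2,1)] u(2) t(1) u(1)] .
  then show False using t u v assms(2) unfolding XX_def by blast
qed

lemma f_ge_outside:
  assumes "x \<in> XX k" "x \<notin> XX j"
  shows "real (h j) * w j \<le> f x"
proof -
  have "x \<in> XX (max j k)" using assms(1) XX_mono[of k "max j k"] by auto
  then show ?thesis using F_ge_outside[of x "max j k" j] f_bounds(1)[of x "max j k"] assms(2) by auto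
qed

lemma XX_conull: "AE x in M. \<exists>j. x \<in> XX j"
  using E_all by eventually_elim (auto simp: XX_def)

lemma emeasure_space_inf: "emeasure M (space M) = \<infinity>"
proof -
  have "emeasure M (space M) = emeasure lborel ({0..} :: real set)" using g_push[of UNIV] by simp
  also have "\<dots> = \<infinity>"
  proof (rule ccontr)
    assume "emeasure lborel ({0..} :: real set) \<noteq> \<infinity>"
    then obtain c where c: "emeasure lborel ({0..} :: real set) = ennreal c" "0 \<le> c" by (cases "emeasure lborel ({0..} :: real set)") auto
    have "ennreal (c + 1) = emeasure lborel {0..c + 1}" using c(2) by simp
    also have "\<dots> \<le> ennreal c" unfolding c(1)[symmetric] by (intro emeasure_mono) auto
    finally show False using c(2) by simp
  qed
  finally show ?thesis .
qed

text \<open>The towers exhaust a space of infinite measure.\<close>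

lemma unbounded: "\<exists>j. c < real (h j) * w j"
proof (rule ccontr)
  assume "\<not> ?thesis"
  then have le: "real (h j) * w j \<le> c" for j by (simp add: not_less)
  have "emeasure M (space M) = emeasure M (\<Union>j. XX j)"
  proof (rule emeasure_eq_AE)
    show "AE x in M. (x \<in> space M) = (x \<in> (\<Union>j. XX j))" using XX_conull AE_space by eventually_elim auto
  qed auto
  also have "\<dots> = (SUP j. emeasure M (XX j))"
    using XX_mono by (intro SUP_emeasure_incseq[symmetric]) (auto simp: incseq_def)
  also have "\<dots> \<le> ennreal c"
    using le by (intro SUP_least) (simp add: emeasure_eq_measure2[OF XX_fm] measure_XX ennreal_leI)
  finally show False unfolding emeasure_space_inf by (simp add: top_unique)
qed

lemma cutting_inf: "cutting_inf h r pos w0 \<sigma>0"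
  by unfold_locales (rule unbounded)

lemma measure_levels_below:
  "measure M {x \<in> XX j. F j x < b} = real (card {t. t < h j \<and> real (\<sigma> j t) * w j < b}) * w j"
proof -
  let ?I = "{t. t < h j \<and> real (\<sigma> j t) * w j < b}"
  have "{x \<in> XX j. F j x < b} = (\<Union>t\<in>?I. lv j t)" unfolding XX_def using F_eq by force
  moreover have "measure M (\<Union>t\<in>?I. lv j t) = (\<Sum>t\<in>?I. measure M (lv j t))"
    using E_disj[of j] fmeasurableD2[OF lv_fm]
    by (intro measure_finite_Union) (auto simp: disjoint_family_on_def)
  ultimately show ?thesis by (simp add: measure_lv)
qed

lemma card_levels_below: "card {t. t < h j \<and> real (\<sigma> j t) * w j < b} = card {k. k < h j \<and> real k * w j < b}"
proof -
  have "bij_betw (\<sigma> j) {t. t < h j \<and> real (\<sigma> j t) * w j < b} {k. k < h j \<and> real k * w j < b}"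
    unfolding bij_betw_def
  proof
    show "inj_on (\<sigma> j) {t. t < h j \<and> real (\<sigma> j t) * w j < b}" using \<sigma>_inj by (auto simp: inj_on_def)
    show "\<sigma> j ` {t. t < h j \<and> real (\<sigma> j t) * w j < b} = {k. k < h j \<and> real k * w j < b}"
    proof (intro equalityI subsetI)
      fix k assume k: "k \<in> {k. k < h j \<and> real k * w j < b}"
      then obtain u where "u < h j" "\<sigma> j u = k" using \<sigma>_surj by blast
      then show "k \<in> \<sigma> j ` {t. t < h j \<and> real (\<sigma> j t) * w j < b}" using k by blast
    qed (use \<sigma>_less in auto)
  qed
  then show ?thesis by (rule bij_betw_same_card)
qed

lemma card_grid:
  fixes c :: real
  assumes "c > 0" "b \<le> real n * c" "0 \<le> b"
  shows "b \<le> real (card {k. k < n \<and> real k * c < b}) * c" "real (card {k. k < n \<and> real k * c < b}) * c \<le> b + c"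
proof -
  define m where "m = nat \<lceil>b / c\<rceil>"
  have m: "real m = of_int \<lceil>b / c\<rceil>" unfolding m_def using assms by simp
  have mb: "b / c \<le> real m" "real m < b / c + 1" unfolding m by linarith+
  then have mc: "b \<le> real m * c" "real m * c < b + c" using assms(1) by (auto simp: field_simps)
  have eq: "{k. k < n \<and> real k * c < b} = {..<m}"
  proof (intro set_eqI)
    fix k
    have "real k * c < b \<longleftrightarrow> k < m"
    proof
      assume "real k * c < b"
      then have "real k < b / c" using assms(1) by (simp add: pos_less_divide_eq)
      then show "k < m" using mb(1) by linarith
    next
      assume "k < m"
      then have "real k < b / c" using mb(2) by linarith
      then show "real k * c < b" using assms(1) by (simp add: pos_less_divide_eq)
    qed
    moreover have "k < n" if "k < m"
    proof -
      have "b / c \<le> real n" using assms by (simp add: pos_divide_le_eq)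
      then have "\<lceil>b / c\<rceil> \<le> int n" by (simp add: ceiling_le_iff)
      then have "m \<le> n" unfolding m_def by linarith
      then show ?thesis using that by simp
    qed
    ultimately show "k \<in> {k. k < n \<and> real k * c < b} \<longleftrightarrow> k \<in> {..<m}" by auto
  qed
  show "b \<le> real (card {k. k < n \<and> real k * c < b}) * c" "real (card {k. k < n \<and> real k * c < b}) * c \<le> b + c"
    unfolding eq using mc by auto
qed

text \<open>Each level has measure \<open>w j\<close> and the levels are numbered bijectively, so
  the measure on which \<open>F j\<close> stays below a bound is found by counting grid points, with
  an error of at most \<open>w j\<close>. As \<open>f\<close> differs from \<open>F j\<close> by at
  most \<open>w j\<close>, the limit over \<open>j\<close> gives the distribution of Lebesgue
  measure.\<close>

lemma f_halfline: "emeasure M {x\<in>space M. f x < a} = emeasure lborel ({..<a} \<inter> {0..})"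
proof (cases "a \<le> 0")
  case True
  then have "{x\<in>space M. f x < a} = {}" "{..<a} \<inter> {0..} = {}" using f_nonneg by (auto simp: not_less intro: order_trans)
  then show ?thesis by (simp only: emeasure_empty)
next
  case False
  have r: "emeasure lborel ({..<a} \<inter> {0..}) = ennreal a"
  proof -
    have "{..<a} \<inter> {0..} = {0..<a}" by auto
    then show ?thesis using False by simp
  qed
  let ?A = "{x\<in>space M. f x < a}"
  have Am: "?A \<in> sets M" by measurable
  obtain j0 where j0: "a < real (h j0) * w j0" using unbounded by blast
  have XXs: "XX j \<subseteq> space M" for j using XX_sets sets.sets_into_space by blast
  have Fm: "{x \<in> XX j. F j x < b} \<in> fmeasurable M" for j b
  proof -
    have "{x \<in> XX j. F j x < b} = XX j \<inter> (F j -` {..<b} \<inter> space M)" using XXs by auto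
    then have "{x \<in> XX j. F j x < b} \<in> sets M" by auto
    then show ?thesis using XX_fm by (rule fmeasurableI2[rotated 2]) auto
  qed
  \<comment> \<open>Points outside tower \<open>j\<close> have large values of \<open>f\<close>, so
    for late stages only the tower contributes.\<close>
  have up: "emeasure M ?A \<le> ennreal (a + w j)" if j: "j0 \<le> j" for j
  proof -
    have aj: "a \<le> real (h j) * w j" using j0 tower_measure_mono[OF j] by simp
    have "emeasure M ?A \<le> emeasure M {x \<in> XX j. F j x < a}"
    proof (rule emeasure_mono_AE)
      show "AE x in M. x \<in> ?A \<longrightarrow> x \<in> {x \<in> XX j. F j x < a}"
        using XX_conull
      proof eventually_elim
        case (elim x)
        show ?case
        proof
          assume x: "x \<in> ?A"
          have "x \<in> XX j"
          proof (rule ccontr)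
            assume "x \<notin> XX j"
            then have "real (h j) * w j \<le> f x" using elim f_ge_outside by blast
            then show False using x aj by simp
          qed
          then show "x \<in> {x \<in> XX j. F j x < a}" using f_bounds(1)[of x j] x by auto
        qed
      qed
    qed (use Fm in \<open>auto dest: fmeasurableD\<close>)
    also have "\<dots> = ennreal (measure M {x \<in> XX j. F j x < a})" by (rule emeasure_eq_measure2[OF Fm])
    also have "\<dots> \<le> ennreal (a + w j)"
      unfolding measure_levels_below card_levels_below using card_grid(2)[OF w_pos aj] False by (intro ennreal_leI) auto
    finally show ?thesis .
  qed
  have fin: "emeasure M ?A = ennreal (measure M ?A)"
    using up[of j0] by (intro emeasure_eq_ennreal_measure) (auto simp: top_unique)
  have lo: "a - w j \<le> measure M ?A" if j: "j0 \<le> j" for j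
  proof (cases "0 \<le> a - w j")
    case True
    have aj: "a - w j \<le> real (h j) * w j" using j0 tower_measure_mono[OF j] w_pos[of j] by simp
    have "a - w j \<le> measure M {x \<in> XX j. F j x < a - w j}"
      unfolding measure_levels_below card_levels_below using card_grid(1)[OF w_pos aj True] .
    also have "\<dots> \<le> measure M ?A"
    proof (rule measure_mono_fmeasurable)
      show "{x \<in> XX j. F j x < a - w j} \<subseteq> ?A" using f_bounds(2)[of _ j] XXs[of j] by force
      show "?A \<in> fmeasurable M" using Am fin by (auto simp: fmeasurable_def)
    qed (use Fm in \<open>auto dest: fmeasurableD\<close>)
    finally show ?thesis .
  next
    case False
    then show ?thesis using measure_nonneg[of M ?A] by linarith
  qed
  have up': "measure M ?A \<le> a + w j" if "j0 \<le> j" for j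
    using up[OF that] False w_pos[of j] unfolding fin by (subst (asm) ennreal_le_iff) auto
  have l1: "(\<lambda>j. a + w j) \<longlonglongrightarrow> a + 0" and l2: "(\<lambda>j. a - w j) \<longlonglongrightarrow> a - 0"
    by (intro tendsto_add tendsto_diff tendsto_const w_tendsto)+
  have "measure M ?A \<le> a" using LIMSEQ_le_const[OF l1, of "measure M ?A"] up' by auto
  moreover have "a \<le> measure M ?A" using LIMSEQ_le_const2[OF l2, of "measure M ?A"] lo by auto
  ultimately show ?thesis using fin r by simp
qed

lemma f_push: "G \<in> sets borel \<Longrightarrow> emeasure M (f -` G \<inter> space M) = emeasure lborel (G \<inter> {0..})"
  by (rule emeasure_vimage_eq_lborel_halfline[OF f_measurable f_halfline]) auto

text \<open>Contains all end points of the level intervals. Being a limit of left end points,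
  \<open>f x\<close> can be the right end point of a half-open interval; outside this countable set
  it lies in the interval of its level.\<close>

definition grid :: "real set" where "grid = (\<Union>j. \<Union>k. {real k * w j})"

lemma f_not_grid: "AE x in M. f x \<notin> grid"
proof -
  have c: "countable grid" unfolding grid_def by auto
  have gb: "grid \<in> sets borel" unfolding grid_def by (intro sets.countable_UN) auto
  have "emeasure lborel (grid \<inter> {0..}) = 0"
    using c by (intro emeasure_lborel_countable countable_Int1)
  then have "f -` grid \<inter> space M \<in> null_sets M" using f_push[OF gb] measurable_sets[OF f_measurable gb] by (intro null_setsI) auto
  from AE_not_in[OF this] AE_space show ?thesis by eventually_elim auto
qed

lemma f_in_lev:
  assumes x: "x \<in> lv j t" "t < h j" and g: "f x \<notin> grid"
  shows "f x \<in> lev j t"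
proof -
  have X: "x \<in> XX j" using x unfolding XX_def by blast
  have "real (\<sigma> j t) * w j + w j = real (Suc (\<sigma> j t)) * w j" by (simp add: distrib_right)
  then have "real (\<sigma> j t) * w j + w j \<in> grid" unfolding grid_def by blast
  then have "f x \<noteq> F j x + w j" using g unfolding F_eq[OF x] by metis
  then show ?thesis using f_bounds[OF X] unfolding lev_def F_eq[OF x] by auto
qed

lemma lev_imp_lv:
  assumes x: "x \<in> XX k" and g: "f x \<notin> grid" and y: "f x \<in> lev j t" "t < h j"
  shows "x \<in> lv j t"
proof -
  have "x \<in> XX j"
  proof (rule ccontr)
    assume "x \<notin> XX j"
    then have "real (h j) * w j \<le> f x" using x f_ge_outside by blast
    moreover have "f x \<in> {0..<real (h j) * w j}" unfolding lev_Union[symmetric] using y by blast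
    ultimately show False by simp
  qed
  then obtain s where s: "s < h j" "x \<in> lv j s" unfolding XX_def by blast
  then have "s = t" using lev_unique[OF f_in_lev[OF s(2,1) g] y(1) s(1) y(2)] by blast
  then show ?thesis using s by simp
qed

text \<open>Off the grid, points with equal values of \<open>f\<close> share their level at every
  stage, hence belong to the same sets \<open>D n\<close>.\<close>

lemma f_inj: "\<exists>N\<in>null_sets M. inj_on f (space M - N)"
proof -
  have "AE x in M. x \<in> X0" using AE_not_in[OF X0_null] AE_space by eventually_elim auto
  moreover define G where "G x \<longleftrightarrow> (\<forall>n. \<exists>N. \<forall>j\<ge>N. x \<in> D n \<longleftrightarrow> (\<exists>t\<in>L n j. t < h j \<and> x \<in> lv j t))" for x
  moreover have "AE x in M. G x" using E_gen unfolding G_def .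
  ultimately have "AE x in M. ((\<exists>j. x \<in> XX j) \<and> f x \<notin> grid \<and> x \<in> X0) \<and> G x"
    using XX_conull f_not_grid by (intro AE_conjI) simp_all
  then obtain N where N: "N \<in> null_sets M" "{x\<in>space M. \<not> (((\<exists>j. x \<in> XX j) \<and> f x \<notin> grid \<and> x \<in> X0) \<and> G x)} \<subseteq> N"
    unfolding eventually_ae_filter by blast
  have good0: "((\<exists>j. x \<in> XX j) \<and> f x \<notin> grid \<and> x \<in> X0) \<and> G x" if "x \<in> space M - N" for x
    using N(2) that by blast
  have good: "(\<exists>j. x \<in> XX j) \<and> f x \<notin> grid \<and> x \<in> X0 \<and>
      (\<forall>n. \<exists>N. \<forall>j\<ge>N. x \<in> D n \<longleftrightarrow> (\<exists>t\<in>L n j. t < h j \<and> x \<in> lv j t))" if "x \<in> space M - N" for x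
    using good0[OF that] unfolding G_def by (elim conjE) (intro conjI)
  have "inj_on f (space M - N)"
  proof (rule inj_onI)
    fix x y assume x: "x \<in> space M - N" and y: "y \<in> space M - N" and eq: "f x = f y"
    have same: "x \<in> lv j t \<longleftrightarrow> y \<in> lv j t" if t: "t < h j" for j t
    proof
      assume "x \<in> lv j t"
      then have "f y \<in> lev j t" using f_in_lev t good[OF x] eq by metis
      then show "y \<in> lv j t" using lev_imp_lv t good[OF y] by blast
    next
      assume "y \<in> lv j t"
      then have "f x \<in> lev j t" using f_in_lev t good[OF y] eq by metis
      then show "x \<in> lv j t" using lev_imp_lv t good[OF x] by blast
    qed
    have "x \<in> D n \<longleftrightarrow> y \<in> D n" for n
    proof -
      obtain N1 where N1: "\<And>j. j \<ge> N1 \<Longrightarrow> x \<in> D n \<longleftrightarrow> (\<exists>t\<in>L n j. t < h j \<and> x \<in> lv j t)" using good[OF x] by blast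
      obtain N2 where N2: "\<And>j. j \<ge> N2 \<Longrightarrow> y \<in> D n \<longleftrightarrow> (\<exists>t\<in>L n j. t < h j \<and> y \<in> lv j t)" using good[OF y] by blast
      have "(\<exists>t\<in>L n (max N1 N2). t < h (max N1 N2) \<and> x \<in> lv (max N1 N2) t) \<longleftrightarrow> (\<exists>t\<in>L n (max N1 N2). t < h (max N1 N2) \<and> y \<in> lv (max N1 N2) t)"
        using same by blast
      then show ?thesis using N1[of "max N1 N2"] N2[of "max N1 N2"] by simp
    qed
    then show "x = y" using D_sep good[OF x] good[OF y] by blast
  qed
  then show ?thesis using N by blast
qed

lemma maps_onto_f: "maps_onto f {0..}"
  unfolding maps_onto_def using f_inj f_push by simp

text \<open>\<open>T\<close> raises a point by one level, which changes all late \<open>F i\<close>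
  by the same translation; the limit inherits it.\<close>

lemma f_conj: "AE x in M. f (T x) = S (f x)"
proof -
  interpret cutting_inf h r pos w0 \<sigma>0 by (rule cutting_inf)
  let ?B = "- (\<Union>j. dom_S j)"
  have "?B \<in> sets borel" by auto
  moreover have "emeasure lborel (?B \<inter> {0..}) = 0"
  proof -
    have "?B \<inter> {0..} = {0..} - (\<Union>j. dom_S j)" by auto
    then show ?thesis using dom_S_conull by auto
  qed
  ultimately have "f -` ?B \<inter> space M \<in> null_sets M"
    using f_push[of ?B] measurable_sets[OF f_measurable, of ?B] by (intro null_setsI) auto
  from AE_not_in[OF this] have "AE x in M. x \<notin> f -` ?B \<inter> space M" .
  with XX_conull f_not_grid AE_space show ?thesis
  proof eventually_elim
    case (elim x)
    then obtain j where "f x \<in> dom_S j" by auto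
    then obtain u where u: "u < h j - 1" "f x \<in> lev j u" unfolding dom_S_def by blast
    then have u1: "u + 1 < h j" "u < h j" by auto
    obtain k where k: "x \<in> XX k" using elim by blast
    have xu: "x \<in> lv j u" using lev_imp_lv[OF k elim(2) u(2) u1(2)] .
    have "F i (T x) = F i x + shift j u 1" if i: "j \<le> i" for i
    proof -
      obtain v where v: "x \<in> lv i v" "v + 1 < h i" "shift i v 1 = shift j u 1" using lv_lift[OF i xu u1(1)] by blast
      have "T x \<in> lv i (Suc v)" using v(1) by auto
      then have "F i (T x) = real (\<sigma> i (Suc v)) * w i" using v(2) by (intro F_eq) auto
      moreover have "F i x = real (\<sigma> i v) * w i" using v by (intro F_eq) auto
      ultimately show ?thesis using v(3) unfolding shift_def by (simp add: algebra_simps)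
    qed
    then have "\<forall>\<^sub>F i in sequentially. F i x + shift j u 1 = F i (T x)"
      unfolding eventually_sequentially by (metis)
    moreover have "(\<lambda>i. F i x + shift j u 1) \<longlonglongrightarrow> f x + shift j u 1"
      by (intro tendsto_add tendsto_const F_tendsto[OF k])
    ultimately have "(\<lambda>i. F i (T x)) \<longlonglongrightarrow> f x + shift j u 1" by (rule Lim_transform_eventually[rotated])
    moreover have "T x \<in> XX j" using xu u1 unfolding XX_def by (intro UN_I[of "Suc u"]) auto
    ultimately have "f (T x) = f x + shift j u 1" using F_tendsto LIMSEQ_unique by blast
    then show ?case using S_eq[OF u(2)] u1 by simp
  qed
qed

theorem rank_one: "rank_one M T"
  by (rule rank_one_of_cutting[OF cutting_inf maps_onto_f f_conj])

end

section \<open>Correcting approximately nested bases to exactly nested ones\<close>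

text \<open>The sets are preimages under \<open>g\<close> of intervals with rational end points; a
  short interval around \<open>g x\<close> avoids the finitely many other values.\<close>

lemma (in leb_space) ex_separating_family:
  "\<exists>D. (\<forall>n::nat. D n \<in> fmeasurable M) \<and> (\<forall>x\<in>X0. \<forall>K. finite K \<longrightarrow> K \<subseteq> X0 \<longrightarrow> x \<notin> K \<longrightarrow> (\<exists>n. x \<in> D n \<and> K \<inter> D n = {}))"
proof -
  define D where "D = (\<lambda>n. case from_nat_into (\<rat> \<times> \<rat>) n of (p,q) \<Rightarrow> g -` {p..<q} \<inter> space M)"
  have ne: "(\<rat> \<times> \<rat> :: (real \<times> real) set) \<noteq> {}" by auto
  have c: "countable (\<rat> \<times> \<rat> :: (real \<times> real) set)" by (intro countable_SIGMA countable_rat)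
  have fm: "g -` {p..<q} \<inter> space M \<in> fmeasurable M" for p q :: real
  proof -
    have "emeasure M (g -` {p..<q} \<inter> space M) = emeasure lborel ({p..<q} \<inter> {0..})" by (rule g_push) auto
    also have "\<dots> \<le> emeasure lborel {p..q}" by (intro emeasure_mono) auto
    also have "\<dots> < \<infinity>" by (cases "p \<le> q") auto
    finally show ?thesis unfolding fmeasurable_def using measurable_sets[OF g_meas, of "{p..<q}"] by auto
  qed
  have "D n \<in> fmeasurable M" for n unfolding D_def by (cases "from_nat_into (\<rat> \<times> \<rat>) n :: real \<times> real") (simp add: fm)
  moreover have "\<exists>n. x \<in> D n \<and> K \<inter> D n = {}" if x: "x \<in> X0" and K: "finite K" "K \<subseteq> X0" "x \<notin> K" for x K
  proof -
    have "g x \<notin> g ` K" using g_inj x K(2,3) by (auto dest: inj_onD)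
    moreover have "open (- (g ` K))" using K(1) by (intro open_Compl finite_imp_closed) auto
    ultimately obtain e where e: "e > 0" "ball (g x) e \<subseteq> - (g ` K)" by (meson ComplI openE)
    obtain p where p: "p \<in> \<rat>" "g x - e < p" "p < g x" using Rats_dense_in_real[of "g x - e" "g x"] e(1) by auto
    obtain q where q: "q \<in> \<rat>" "g x < q" "q < g x + e" using Rats_dense_in_real[of "g x" "g x + e"] e(1) by auto
    obtain n where n: "from_nat_into (\<rat> \<times> \<rat>) n = (p,q)" using from_nat_into_surj[OF c, of "(p,q)"] p q by auto
    have Dn: "D n = g -` {p..<q} \<inter> space M" unfolding D_def n by simp
    have "x \<in> space M" using x X0 sets.sets_into_space by blast
    then have "x \<in> D n" unfolding Dn using p q by auto
    moreover have "K \<inter> D n = {}"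
    proof -
      have "y \<notin> D n" if "y \<in> K" for y
      proof
        assume "y \<in> D n"
        then have "g y \<in> ball (g x) e" unfolding Dn using p q by (auto simp: dist_real_def)
        then show False using e(2) that by auto
      qed
      then show ?thesis by auto
    qed
    ultimately show ?thesis by blast
  qed
  ultimately show ?thesis by blast
qed

locale base_sequence = leb_space M g X0 for M :: "'a measure" and g X0 +
  fixes T :: "'a \<Rightarrow> 'a" and B :: "nat \<Rightarrow> 'a set" and h :: "nat \<Rightarrow> nat" and J :: "nat \<Rightarrow> nat set" and D :: "nat \<Rightarrow> 'a set"
  assumes T: "T \<in> automorphisms M" and h_0: "h 0 = 1" and bs: "\<And>n. base M T (B n) (h n)" and h_ge: "\<And>n. h n \<ge> 1"
    and J_fin: "\<And>n. finite (J n)" and J_card: "\<And>n. n < card (J n)"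
    and J_top: "\<And>n t. t \<in> J n \<Longrightarrow> t + h n \<le> h (Suc n)"
    and J_sep: "\<And>n t t'. t \<in> J n \<Longrightarrow> t' \<in> J n \<Longrightarrow> t < t' \<Longrightarrow> t + h n \<le> t'"
    and B_dec: "\<And>n. measure M (B (Suc n)) \<le> measure M (B n)"
    and err: "\<And>n. real (h n) * mdist M (B n) (tower_set T (B (Suc n)) (J n)) \<le> (1/2) ^ (n + 2) * min 1 (measure M (B n)) / real (h n)"
    and D_fm: "\<And>n. D n \<in> fmeasurable M"
    and D_app: "\<And>n i. i \<le> n \<Longrightarrow> \<exists>L\<subseteq>{..<h (Suc n)}. mdist M (D i) (tower_set T (B (Suc n)) L) \<le> (1/2) ^ n"
begin

lemma B_fm: "B n \<in> fmeasurable M" and B_pos: "0 < measure M (B n)"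
  using bs[of n] by (auto simp: base_def)

lemma J_ne: "J n \<noteq> {}" using J_card[of n] by auto

lemma h_le_Suc: "h n \<le> h (Suc n)" using J_top[of _ n] J_ne[of n] by force

lemma h_mono: "n \<le> m \<Longrightarrow> h n \<le> h m" using h_le_Suc by (rule lift_Suc_mono_le)

lemma B_antimono: "n \<le> m \<Longrightarrow> measure M (B m) \<le> measure M (B n)" using B_dec by (rule lift_Suc_antimono_le)

text \<open>The levels of tower \<open>j + d\<close> at which copies of tower \<open>j\<close> start
  if all stages in between are cut at the positions \<open>J\<close>.\<close>

primrec P :: "nat \<Rightarrow> nat \<Rightarrow> nat set" where
  "P j 0 = {0}" | "P j (Suc d) = (\<lambda>(t,u). t + u) ` (P j d \<times> J (j + d))"

lemma P_fin: "finite (P j d)" by (induction d) (auto simp: J_fin)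

lemma P_bound: "t \<in> P j d \<Longrightarrow> t + h j \<le> h (j + d)"
proof (induction d arbitrary: t)
  case (Suc d)
  then obtain a u where "t = a + u" "a \<in> P j d" "u \<in> J (j + d)" by auto
  then show ?case using Suc.IH[of a] J_top[of u "j + d"] by simp
qed simp

lemma P_sep: "t \<in> P j d \<Longrightarrow> t' \<in> P j d \<Longrightarrow> t < t' \<Longrightarrow> t + h j \<le> t'"
proof (induction d arbitrary: t t')
  case (Suc d)
  from Suc.prems(1) obtain a u where t: "t = a + u" "a \<in> P j d" "u \<in> J (j + d)" by auto
  from Suc.prems(2) obtain a' u' where t': "t' = a' + u'" "a' \<in> P j d" "u' \<in> J (j + d)" by auto
  have b: "a + h j \<le> h (j + d)" "a' + h j \<le> h (j + d)" using P_bound t t' by blast+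
  consider "u = u'" | "u < u'" | "u' < u" by linarith
  then show ?case
  proof cases
    case 1
    then show ?thesis using Suc.IH[of a a'] t t' Suc.prems(3) by simp
  next
    case 2
    then show ?thesis using J_sep[OF t(3) t'(3)] b t t' by simp
  next
    case 3
    then show ?thesis using J_sep[OF t'(3) t(3)] b t t' Suc.prems(3) by simp
  qed
qed simp

text \<open>Peels off the first stage of cutting instead of the last; in this form the recursion
  passes to the limit bases.\<close>

lemma P_shift: "P j (Suc d) = (\<lambda>(u,t). u + t) ` (J j \<times> P (Suc j) d)"
proof (induction d)
  case 0 then show ?case by (auto simp: image_iff)
next
  case (Suc d)
  have "P j (Suc (Suc d)) = (\<lambda>(t,u). t + u) ` ((\<lambda>(u,t). u + t) ` (J j \<times> P (Suc j) d) \<times> J (Suc j + d))"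
    by (subst P.simps(2)) (simp only: Suc.IH add_Suc_right add_Suc)
  also have "\<dots> = (\<lambda>(u,t). u + t) ` (J j \<times> P (Suc j) (Suc d))"
  proof (intro equalityI subsetI)
    fix x assume "x \<in> (\<lambda>(t,u). t + u) ` ((\<lambda>(u,t). u + t) ` (J j \<times> P (Suc j) d) \<times> J (Suc j + d))"
    then obtain u t v where x: "x = (u + t) + v" "u \<in> J j" "t \<in> P (Suc j) d" "v \<in> J (Suc j + d)" by auto
    then have "t + v \<in> P (Suc j) (Suc d)" by auto
    then have "(u, t + v) \<in> J j \<times> P (Suc j) (Suc d)" using x(2) by blast
    then show "x \<in> (\<lambda>(u,t). u + t) ` (J j \<times> P (Suc j) (Suc d))" using x(1) by (intro image_eqI[of _ _ "(u, t + v)"]) auto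
  next
    fix x assume "x \<in> (\<lambda>(u,t). u + t) ` (J j \<times> P (Suc j) (Suc d))"
    then obtain u t v where x: "x = u + (t + v)" "u \<in> J j" "t \<in> P (Suc j) d" "v \<in> J (Suc j + d)" by auto
    then have "((u + t), v) \<in> (\<lambda>(u,t). u + t) ` (J j \<times> P (Suc j) d) \<times> J (Suc j + d)" by force
    then show "x \<in> (\<lambda>(t,u). t + u) ` ((\<lambda>(u,t). u + t) ` (J j \<times> P (Suc j) d) \<times> J (Suc j + d))"
      using x(1) by (intro image_eqI[of _ _ "(u + t, v)"]) auto
  qed
  finally show ?case .
qed

lemma P_card: "real (card (P j d)) \<le> real (h (j + d))"
proof -
  have "P j d \<subseteq> {..<h (j + d)}" using P_bound h_ge[of j] by fastforce
  then show ?thesis using card_mono[of "{..<h (j + d)}" "P j d"] by simp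
qed

text \<open>Base \<open>j\<close> rebuilt from levels of tower \<open>j + d\<close>. For growing
  \<open>d\<close> these sets converge to the corrected base \<open>E j\<close>.\<close>

definition V :: "nat \<Rightarrow> nat \<Rightarrow> 'a set" where "V j d = tower_set T (B (j + d)) (P j d)"

lemma V_fm: "V j d \<in> fmeasurable M" unfolding V_def by (rule tower_set_fmeasurable[OF T B_fm P_fin])

lemma V_0: "V j 0 = B j" unfolding V_def tower_set_def by simp

lemma V_Suc: "V j (Suc d) = (\<Union>t\<in>P j d. (T ^^ t) ` tower_set T (B (Suc (j + d))) (J (j + d)))"
  unfolding V_def tower_set_def by (auto simp: image_UN funpow_image_add[symmetric] simp del: image_image)

lemma V_shift: "V j (Suc d) = (\<Union>u\<in>J j. (T ^^ u) ` V (Suc j) d)"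
proof -
  have gen: "(\<Union>p\<in>X \<times> Y. f (fst p) (snd p)) = (\<Union>u\<in>X. \<Union>t\<in>Y. f u t)"
    for X Y :: "nat set" and f :: "nat \<Rightarrow> nat \<Rightarrow> 'a set" by fastforce
  have "V j (Suc d) = (\<Union>p\<in>J j \<times> P (Suc j) d. (T ^^ (fst p + snd p)) ` B (Suc j + d))"
    unfolding V_def tower_set_def P_shift by (simp add: case_prod_unfold)
  also have "\<dots> = (\<Union>u\<in>J j. \<Union>t\<in>P (Suc j) d. (T ^^ u) ` ((T ^^ t) ` B (Suc j + d)))"
    unfolding funpow_image_add
    by (rule gen[where X = "J j" and Y = "P (Suc j) d" and f = "\<lambda>u t. (T ^^ u) ` ((T ^^ t) ` B (Suc j + d))"])
  also have "\<dots> = (\<Union>u\<in>J j. (T ^^ u) ` V (Suc j) d)"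
    unfolding V_def tower_set_def image_UN ..
  finally show ?thesis .
qed

text \<open>By \<open>P_sep\<close> the copies of tower \<open>j\<close> start at least
  \<open>h j\<close> levels apart, so distinct levels of the rebuilt tower use distinct levels of
  tower \<open>j + d\<close>.\<close>

lemma V_disj:
  assumes "t < t'" "t' < h j"
  shows "(T ^^ t) ` V j d \<inter> (T ^^ t') ` V j d = {}"
proof -
  have "(T ^^ (t + p)) ` B (j + d) \<inter> (T ^^ (t' + p')) ` B (j + d) = {}" if p: "p \<in> P j d" "p' \<in> P j d" for p p'
  proof -
    have lt: "t + p < h (j + d)" "t' + p' < h (j + d)" using P_bound[OF p(1)] P_bound[OF p(2)] assms by auto
    have "t + p \<noteq> t' + p'"
    proof
      assume e: "t + p = t' + p'"
      then have "p' < p" using assms by simp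
      then show False using P_sep[OF p(2) p(1)] e assms by simp
    qed
    then show ?thesis using bs[of "j + d"] lt unfolding base_def disjoint_family_on_def by blast
  qed
  then show ?thesis unfolding V_def tower_set_def image_UN funpow_image_add[symmetric] by blast
qed

definition c :: "nat \<Rightarrow> real" where "c j = min 1 (measure M (B j)) / real (h j)"

lemma c_pos: "0 < c j" unfolding c_def using B_pos[of j] h_ge[of j] by (intro divide_pos_pos) auto

lemma c_mono: "c (j + d) \<le> c j"
proof -
  have "min 1 (measure M (B (j + d))) \<le> min 1 (measure M (B j))" using B_antimono[of j "j + d"] by auto
  moreover have "real (h j) \<le> real (h (j + d))" using h_mono[of j "j + d"] by simp
  ultimately show ?thesis unfolding c_def using h_ge[of j] B_pos[of j] by (intro frac_le) auto
qed

text \<open>One more stage replaces \<open>B (j + d)\<close> by its approximation at each position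
  in \<open>P j d\<close>. There are at most \<open>h (j + d)\<close> positions, and each
  contributes the same distance.\<close>

lemma V_err: "mdist M (V j d) (V j (Suc d)) \<le> (1/2) ^ (j + d + 2) * c j"
proof -
  let ?U = "tower_set T (B (Suc (j + d))) (J (j + d))"
  have U: "?U \<in> fmeasurable M" by (rule tower_set_fmeasurable[OF T B_fm J_fin])
  have "mdist M (V j d) (V j (Suc d)) \<le> (\<Sum>t\<in>P j d. mdist M ((T ^^ t) ` B (j + d)) ((T ^^ t) ` ?U))"
    unfolding V_Suc unfolding V_def tower_set_def[of T "B (j + d)"]
    using level_fmeasurable[OF T B_fm] level_fmeasurable[OF T U] by (intro mdist_UN_le P_fin) auto
  also have "\<dots> = real (card (P j d)) * mdist M (B (j + d)) ?U"
    using aut_mdist(1)[OF aut_funpow[OF T]] B_fm U by (simp add: fmeasurableD)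
  also have "\<dots> \<le> real (h (j + d)) * mdist M (B (j + d)) ?U"
    using P_card mdist_nonneg by (intro mult_right_mono) auto
  also have "\<dots> \<le> (1/2) ^ (j + d + 2) * c (j + d)" using err[of "j + d"] unfolding c_def by simp
  also have "\<dots> \<le> (1/2) ^ (j + d + 2) * c j" using c_mono by (intro mult_left_mono) auto
  finally show ?thesis .
qed

text \<open>Borel-Cantelli: the distances between consecutive approximations are summable.\<close>

lemma V_eventually: "AE x in M. \<forall>j. \<exists>N. \<forall>d\<ge>N. x \<in> V j d \<longleftrightarrow> x \<in> V j (Suc d)"
proof (subst AE_all_countable, rule allI)
  fix j
  let ?S = "\<lambda>d. sym_diff (V j d) (V j (Suc d))"
  have S: "?S d \<in> fmeasurable M" for d by (intro fmeasurable_sym_diff V_fm)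
  have "AE x in M. \<forall>\<^sub>F d in sequentially. x \<in> space M - ?S d"
  proof (rule borel_cantelli_AE1)
    show "?S d \<in> sets M" for d using S by (rule fmeasurableD)
    show "emeasure M (?S d) < \<infinity>" for d using fmeasurableD2[OF S] by (simp add: less_top)
    show "summable (\<lambda>d. measure M (?S d))"
    proof (rule summable_comparison_test')
      show "summable (\<lambda>d. (1/2::real) ^ d * ((1/2) ^ (j + 2) * c j))" by (intro summable_mult2 summable_geometric) simp
      fix d :: nat
      have "measure M (?S d) \<le> (1/2) ^ (j + d + 2) * c j" using V_err[of j d] unfolding mdist_def .
      then show "norm (measure M (?S d)) \<le> (1/2) ^ d * ((1/2) ^ (j + 2) * c j)"
        by (simp add: power_add mult_ac)
    qed
  qed
  then show "AE x in M. \<exists>N. \<forall>d\<ge>N. x \<in> V j d \<longleftrightarrow> x \<in> V j (Suc d)"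
    by eventually_elim (auto simp: eventually_sequentially)
qed

text \<open>An invariant conull set on which all approximations stabilise at every point; invariance
  allows limits to be compared along orbits.\<close>

definition Z :: "'a set" where
  "Z = (SOME Z. Z \<in> sets M \<and> space M - Z \<in> null_sets M \<and>
    (\<forall>x\<in>Z. \<forall>j. \<exists>N. \<forall>d\<ge>N. x \<in> V j d \<longleftrightarrow> x \<in> V j (Suc d)) \<and> (\<forall>x\<in>space M. T x \<in> Z \<longleftrightarrow> x \<in> Z))"

lemma Z: "Z \<in> sets M" "space M - Z \<in> null_sets M"
    "x \<in> Z \<Longrightarrow> \<exists>N. \<forall>d\<ge>N. x \<in> V j d \<longleftrightarrow> x \<in> V j (Suc d)" "\<forall>x\<in>space M. T x \<in> Z \<longleftrightarrow> x \<in> Z"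
proof -
  have "\<exists>Z. Z \<in> sets M \<and> space M - Z \<in> null_sets M \<and>
    (\<forall>x\<in>Z. \<forall>j. \<exists>N. \<forall>d\<ge>N. x \<in> V j d \<longleftrightarrow> x \<in> V j (Suc d)) \<and> (\<forall>x\<in>space M. T x \<in> Z \<longleftrightarrow> x \<in> Z)"
    using aut_invariant_core[OF T V_eventually] by blast
  from someI_ex[OF this, folded Z_def]
  show "Z \<in> sets M" "space M - Z \<in> null_sets M" "\<forall>x\<in>space M. T x \<in> Z \<longleftrightarrow> x \<in> Z"
    "x \<in> Z \<Longrightarrow> \<exists>N. \<forall>d\<ge>N. x \<in> V j d \<longleftrightarrow> x \<in> V j (Suc d)" by simp_all
qed

lemma Z_space: "Z \<subseteq> space M" using Z(1) sets.sets_into_space by blast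

lemma V_const:
  assumes "x \<in> Z"
  obtains N where "\<And>d. d \<ge> N \<Longrightarrow> x \<in> V j d \<longleftrightarrow> x \<in> V j N"
proof -
  from Z(3)[OF assms] obtain N where N: "\<forall>d\<ge>N. x \<in> V j d \<longleftrightarrow> x \<in> V j (Suc d)" ..
  have "x \<in> V j d \<longleftrightarrow> x \<in> V j N" if "d \<ge> N" for d
    using that
  proof (induction d rule: dec_induct)
    case (step d)
    have "x \<in> V j d \<longleftrightarrow> x \<in> V j (Suc d)" using N[rule_format, OF step.hyps(1)] .
    then show ?case by (rule trans[OF sym step.IH])
  qed (rule refl)
  then show ?thesis by (rule that)
qed

definition E :: "nat \<Rightarrow> 'a set" where "E j = {x\<in>Z. \<exists>N. \<forall>d\<ge>N. x \<in> V j d}"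

lemma E_sets: "E j \<in> sets M"
proof -
  have "E j = Z \<inter> (\<Union>N. \<Inter>d\<in>{N..}. V j d)" unfolding E_def by auto
  moreover have "(\<Inter>d\<in>{N..}. V j d) \<in> sets M" for N
    using fmeasurableD[OF V_fm] by (intro sets.countable_INT') auto
  ultimately show ?thesis using Z(1) by auto
qed

text \<open>Up to a null set, a point on which \<open>B j\<close> and its limit disagree changes
  sides at some step, so the errors of \<open>V_err\<close> add up to a geometric series.\<close>

lemma E_mdist: "E j \<in> fmeasurable M" "mdist M (B j) (E j) \<le> (1/2) ^ (j + 1) * c j"
proof -
  let ?S = "\<lambda>d. sym_diff (V j d) (V j (Suc d))"
  have S: "?S d \<in> fmeasurable M" for d by (intro fmeasurable_sym_diff V_fm)
  have sub: "sym_diff (B j) (E j) \<subseteq> (space M - Z) \<union> (\<Union>d. ?S d)"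
  proof
    fix x assume x: "x \<in> sym_diff (B j) (E j)"
    show "x \<in> (space M - Z) \<union> (\<Union>d. ?S d)"
    proof (rule ccontr)
      assume n: "x \<notin> (space M - Z) \<union> (\<Union>d. ?S d)"
      have Bs: "B j \<subseteq> space M" by (rule sets.sets_into_space[OF fmeasurableD[OF B_fm]])
      have Es: "E j \<subseteq> Z" unfolding E_def by (rule Collect_restrict)
      have "x \<in> B j \<or> x \<in> E j" using x by (elim UnE DiffE) simp_all
      then have "x \<in> space M" using subsetD[OF Bs] subsetD[OF order_trans[OF Es Z_space]] by (elim disjE)
      then have xZ: "x \<in> Z" using n by (meson DiffI UnI1)
      have step: "x \<in> V j d \<longleftrightarrow> x \<in> V j (Suc d)" for d
      proof -
        have "x \<notin> ?S d" using n by (meson UN_I UNIV_I UnI2)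
        then show ?thesis by blast
      qed
      have const: "x \<in> V j d \<longleftrightarrow> x \<in> V j 0" for d
      proof (induction d)
        case (Suc d)
        show ?case by (rule trans[OF sym[OF step] Suc.IH])
      qed (rule refl)
      have "x \<in> E j \<longleftrightarrow> x \<in> V j 0"
      proof
        assume "x \<in> E j"
        then obtain N where "\<forall>d\<ge>N. x \<in> V j d" unfolding E_def by blast
        then have "x \<in> V j N" by simp
        then show "x \<in> V j 0" by (rule iffD1[OF const])
      next
        assume "x \<in> V j 0"
        then have "x \<in> V j d" for d by (rule iffD2[OF const])
        then have "\<forall>d\<ge>0. x \<in> V j d" by simp
        then show "x \<in> E j" unfolding E_def using xZ by blast
      qed
      then have "x \<in> E j \<longleftrightarrow> x \<in> B j" unfolding V_0 .
      then show False using x by blast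
    qed
  qed
  have "emeasure M (sym_diff (B j) (E j)) \<le> emeasure M ((space M - Z) \<union> (\<Union>d. ?S d))"
    using sub Z(1) S by (intro emeasure_mono sets.Un sets.countable_UN') (auto dest: fmeasurableD)
  also have "\<dots> \<le> emeasure M (space M - Z) + emeasure M (\<Union>d. ?S d)"
    using Z(1) S by (intro emeasure_subadditive sets.countable_UN') (auto dest: fmeasurableD)
  also have "\<dots> \<le> 0 + (\<Sum>d. emeasure M (?S d))"
    using Z(2) S by (intro add_mono emeasure_subadditive_countably) (auto dest: fmeasurableD null_setsD1)
  also have "\<dots> \<le> (\<Sum>d. ennreal ((1/2) ^ Suc d * ((1/2) ^ (j + 1) * c j)))"
  proof -
    have "emeasure M (?S d) \<le> ennreal ((1/2) ^ Suc d * ((1/2) ^ (j + 1) * c j))" for d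
    proof -
      have "measure M (?S d) \<le> (1/2) ^ (j + d + 2) * c j" using V_err[of j d] unfolding mdist_def .
      also have "\<dots> = (1/2) ^ Suc d * ((1/2) ^ (j + 1) * c j)" by (simp add: power_add mult_ac)
      finally show ?thesis unfolding emeasure_eq_measure2[OF S] by (rule ennreal_leI)
    qed
    then show ?thesis by (simp add: suminf_le)
  qed
  also have "\<dots> = ennreal ((1/2) ^ (j + 1) * c j)"
  proof -
    have s: "(\<lambda>d. (1/2) ^ Suc d * ((1/2) ^ (j + 1) * c j)) sums (1 * ((1/2) ^ (j + 1) * c j))"
      by (intro sums_mult2 power_half_series)
    have "0 \<le> (1/2) ^ Suc d * ((1/2) ^ (j + 1) * c j)" for d using c_pos[of j] by (intro mult_nonneg_nonneg) auto
    then have "(\<Sum>d. ennreal ((1/2) ^ Suc d * ((1/2) ^ (j + 1) * c j))) = ennreal (\<Sum>d. (1/2) ^ Suc d * ((1/2) ^ (j + 1) * c j))"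
      using s by (intro suminf_ennreal2) (auto simp: sums_iff)
    also have "(\<Sum>d. (1/2) ^ Suc d * ((1/2) ^ (j + 1) * c j)) = (1/2) ^ (j + 1) * c j" using sums_unique[OF s] by simp
    finally show ?thesis .
  qed
  finally have le: "emeasure M (sym_diff (B j) (E j)) \<le> ennreal ((1/2) ^ (j + 1) * c j)" .
  then have sf: "sym_diff (B j) (E j) \<in> fmeasurable M"
    using B_fm[of j] E_sets[of j] by (auto simp: fmeasurable_def le_less_trans[OF _ ennreal_less_top])
  have "E j \<subseteq> B j \<union> sym_diff (B j) (E j)" by auto
  then show Ef: "E j \<in> fmeasurable M"
    using E_sets fmeasurable.Un[OF B_fm sf] by (meson fmeasurableI2)
  show "mdist M (B j) (E j) \<le> (1/2) ^ (j + 1) * c j"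
    using le c_pos[of j] unfolding mdist_def emeasure_eq_measure2[OF sf] by (subst (asm) ennreal_le_iff) auto
qed

text \<open>The correction changes the base by at most half of its measure.\<close>

lemma E_pos: "0 < measure M (E j)"
proof -
  have "measure M (B j) \<le> measure M (E j) + mdist M (B j) (E j)" by (intro measure_le_mdist B_fm E_mdist)
  moreover have "(1/2) ^ (j + 1) * c j \<le> (1/2) * c j" using c_pos[of j] by (intro mult_right_mono) (auto simp: power_le_one)
  moreover have "c j \<le> measure M (B j) / 1"
    unfolding c_def using h_ge[of j] B_pos[of j] by (intro frac_le) auto
  ultimately show ?thesis using E_mdist(2)[of j] B_pos[of j] c_pos[of j] by linarith
qed

lemma inv_Z: "x \<in> space M \<Longrightarrow> (T ^^ n) x \<in> Z \<longleftrightarrow> x \<in> Z"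
  by (rule invariant_funpow[OF T Z(4)])

lemma E_disj: "disjoint_family_on (\<lambda>t. (T ^^ t) ` E j) {..<h j}"
proof -
  have lt: "(T ^^ t) ` E j \<inter> (T ^^ t') ` E j = {}" if tt: "t < t'" "t' < h j" for t t'
  proof -
    have False if x: "x \<in> (T ^^ t) ` E j" "x \<in> (T ^^ t') ` E j" for x
    proof -
      obtain y where y: "y \<in> E j" "x = (T ^^ t) y" using x(1) by blast
      obtain z where z: "z \<in> E j" "x = (T ^^ t') z" using x(2) by blast
      obtain N where N: "\<forall>d\<ge>N. y \<in> V j d" using y(1) unfolding E_def by blast
      obtain N' where N': "\<forall>d\<ge>N'. z \<in> V j d" using z(1) unfolding E_def by blast
      have "y \<in> V j (max N N')" "z \<in> V j (max N N')" using N N' by auto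
      then have "x \<in> (T ^^ t) ` V j (max N N') \<inter> (T ^^ t') ` V j (max N N')" using y(2) z(2) by blast
      then show False using V_disj[OF tt] by blast
    qed
    then show ?thesis by blast
  qed
  show ?thesis unfolding disjoint_family_on_def
  proof (intro ballI impI)
    fix m n assume "m \<in> {..<h j}" "n \<in> {..<h j}" "m \<noteq> n"
    then show "(T ^^ m) ` E j \<inter> (T ^^ n) ` E j = {}" using lt[of m n] lt[of n m] by (cases "m < n") auto
  qed
qed

text \<open>The recursion \<open>V_shift\<close> passes to the limit: as \<open>J j\<close> is
  finite, for large \<open>d\<close> all preimages \<open>y u\<close> of a point have reached their
  final status at once.\<close>

lemma E_cut: "E j = (\<Union>u\<in>J j. (T ^^ u) ` E (Suc j))"
proof (intro equalityI subsetI)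
  fix x assume x: "x \<in> E j"
  then obtain N where N: "\<forall>d\<ge>N. x \<in> V j d" and xZ: "x \<in> Z" unfolding E_def by blast
  have xs: "x \<in> space M" using xZ Z_space by blast
  have "\<exists>y. y \<in> space M \<and> (T ^^ u) y = x" for u
    using aut_surj[OF aut_funpow[OF T]] xs by (metis imageE)
  then obtain y where y: "\<And>u. y u \<in> space M" "\<And>u. (T ^^ u) (y u) = x" by metis
  have yZ: "y u \<in> Z" for u using inv_Z[OF y(1), of u u] y(2) xZ by simp
  have "\<exists>N. \<forall>d\<ge>N. y u \<in> V (Suc j) d \<longleftrightarrow> y u \<in> V (Suc j) N" for u
    by (rule V_const[OF yZ, of u "Suc j"]) blast
  then obtain K where K: "\<And>u d. d \<ge> K u \<Longrightarrow> y u \<in> V (Suc j) d \<longleftrightarrow> y u \<in> V (Suc j) (K u)" by metis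
  define d where "d = Max (insert N (K ` J j))"
  have fin: "finite (insert N (K ` J j))" using J_fin by auto
  have dN: "N \<le> d" unfolding d_def using fin by (intro Max_ge) auto
  have dK: "K u \<le> d" if "u \<in> J j" for u unfolding d_def using fin that by (intro Max_ge) auto
  have "x \<in> V j (Suc d)" using N dN by simp
  then obtain u where u: "u \<in> J j" "x \<in> (T ^^ u) ` V (Suc j) d" unfolding V_shift by blast
  then obtain z where z: "z \<in> V (Suc j) d" "x = (T ^^ u) z" by blast
  have zs: "z \<in> space M" using z(1) V_fm fmeasurableD sets.sets_into_space by blast
  have "z = y u" using aut_inj[OF aut_funpow[OF T, of u]] zs y z(2) by (metis inj_onD)
  then have "y u \<in> V (Suc j) (K u)" using K[OF dK[OF u(1)]] z(1) by simp
  then have "y u \<in> E (Suc j)" unfolding E_def using yZ K by blast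
  then show "x \<in> (\<Union>u\<in>J j. (T ^^ u) ` E (Suc j))" using u(1) y(2)[of u] by blast
next
  fix x assume "x \<in> (\<Union>u\<in>J j. (T ^^ u) ` E (Suc j))"
  then obtain u y where u: "u \<in> J j" "y \<in> E (Suc j)" "x = (T ^^ u) y" by blast
  then obtain N where N: "\<forall>d\<ge>N. y \<in> V (Suc j) d" and yZ: "y \<in> Z" unfolding E_def by blast
  have "x \<in> Z" using inv_Z[of y u] yZ Z_space u(3) by auto
  moreover have "x \<in> V j d" if "d \<ge> Suc N" for d
  proof -
    obtain d' where d': "d = Suc d'" "d' \<ge> N" using \<open>d \<ge> Suc N\<close> by (cases d) auto
    have "y \<in> V (Suc j) d'" using N d'(2) by blast
    then show ?thesis unfolding d'(1) V_shift using u by blast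
  qed
  ultimately show "x \<in> E j" unfolding E_def by blast
qed

text \<open>The levels of stage \<open>j\<close> below the first copy of the base of stage \<open>j - 1\<close> are dropped, so that
  each base becomes the first column of the preceding one.\<close>

primrec cc :: "nat \<Rightarrow> nat" where
  "cc 0 = 0" | "cc (Suc j) = cc j + Min (J j)"

lemma Min_J: "Min (J j) \<in> J j" "u \<in> J j \<Longrightarrow> Min (J j) \<le> u"
  using J_fin[of j] J_ne[of j] by auto

lemma cc_less: "cc j < h j"
proof (induction j)
  case (Suc j)
  then show ?case using J_top[OF Min_J(1), of j] by simp
qed (simp add: h_0)

definition h' :: "nat \<Rightarrow> nat" where "h' j = h j - cc j"
definition r' :: "nat \<Rightarrow> nat" where "r' j = card (J j)"
text \<open>The elements of \<open>J j\<close> in increasing order, counted from the smallest one,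
  so that the first column starts at level 0.\<close>

definition pos' :: "nat \<Rightarrow> nat \<Rightarrow> nat" where "pos' j i = sorted_list_of_set (J j) ! i - Min (J j)"
definition E' :: "nat \<Rightarrow> 'a set" where "E' j = (T ^^ cc j) ` E j"

lemma sl_in: "i < r' j \<Longrightarrow> sorted_list_of_set (J j) ! i \<in> J j"
  unfolding r'_def using nth_mem[of i "sorted_list_of_set (J j)"] J_fin[of j] by simp

lemma sl_less: "i < i' \<Longrightarrow> i' < r' j \<Longrightarrow> sorted_list_of_set (J j) ! i < sorted_list_of_set (J j) ! i'"
  unfolding r'_def using strict_sorted_list_of_set[of "J j"] by (simp add: sorted_wrt_iff_nth_less)

lemma pos'_add: "i < r' j \<Longrightarrow> pos' j i + Min (J j) = sorted_list_of_set (J j) ! i"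
  unfolding pos'_def using Min_J(2)[OF sl_in] by simp

lemma h'_add: "h' j + cc j = h j" unfolding h'_def using cc_less[of j] by simp

lemma cutting': "cutting h' r' pos' (measure M (E' 0)) id"
proof
  show "0 < h' 0" unfolding h'_def by (simp add: h_0)
  show "0 < r' j" for j unfolding r'_def using J_card[of j] by simp
  show "pos' j 0 = 0" for j
  proof -
    have r0: "0 < r' j" unfolding r'_def using J_card[of j] by simp
    obtain i where i: "i < r' j" "sorted_list_of_set (J j) ! i = Min (J j)"
      using Min_J(1)[of j] J_fin[of j] unfolding r'_def
      by (metis in_set_conv_nth length_sorted_list_of_set set_sorted_list_of_set)
    have "sorted_list_of_set (J j) ! 0 \<le> Min (J j)" using sl_less[of 0 i j] i by (cases "i = 0") auto
    then show ?thesis unfolding pos'_def by simp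
  qed
  show "pos' j i + h' j \<le> pos' j (Suc i)" if "Suc i < r' j" for j i
  proof -
    have i: "i < r' j" using that by simp
    have "sorted_list_of_set (J j) ! i + h j \<le> sorted_list_of_set (J j) ! (Suc i)"
      using J_sep[OF sl_in[OF i] sl_in[OF that]] sl_less[of i "Suc i" j] that by simp
    then show ?thesis using pos'_add[OF i] pos'_add[OF that] h'_add[of j] by linarith
  qed
  show "pos' j (r' j - 1) + h' j \<le> h' (Suc j)" for j
  proof -
    have i: "r' j - 1 < r' j" unfolding r'_def using J_card[of j] by simp
    have "sorted_list_of_set (J j) ! (r' j - 1) + h j \<le> h (Suc j)" using J_top[OF sl_in[OF i]] .
    then show ?thesis using pos'_add[OF i] h'_add[of j] h'_add[of "Suc j"] by simp
  qed
  show "0 < measure M (E' 0)" unfolding E'_def using E_pos[of 0] by simp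
  show "filterlim r' at_top sequentially"
  proof (rule filterlim_at_top_mono[OF filterlim_ident])
    show "\<forall>\<^sub>F x in sequentially. x \<le> r' x" unfolding r'_def using J_card by (intro always_eventually allI less_imp_le)
  qed
qed auto

lemma nested': "nested_towers M g X0 h' r' pos' (measure M (E' 0)) id T E'"
proof -
  interpret cutting h' r' pos' "measure M (E' 0)" id by (rule cutting')
  show ?thesis
  proof
    show "T \<in> automorphisms M" by (rule T)
    show "E' j \<in> fmeasurable M" for j unfolding E'_def by (rule level_fmeasurable[OF T E_mdist(1)])
    show "disjoint_family_on (\<lambda>t. (T ^^ t) ` E' j) {..<h' j}" for j
      unfolding disjoint_family_on_def
    proof (intro ballI impI)
      fix m n assume "m \<in> {..<h' j}" "n \<in> {..<h' j}" "m \<noteq> n"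
      then have "m + cc j \<in> {..<h j}" "n + cc j \<in> {..<h j}" "m + cc j \<noteq> n + cc j" using h'_add[of j] by auto
      then have "(T ^^ (m + cc j)) ` E j \<inter> (T ^^ (n + cc j)) ` E j = {}" by (rule disjoint_family_onD[OF E_disj])
      then show "(T ^^ m) ` E' j \<inter> (T ^^ n) ` E' j = {}" unfolding E'_def funpow_image_add .
    qed
    show "E' j = (\<Union>i<r' j. (T ^^ pos' j i) ` E' (Suc j))" for j
    proof -
      have "E' j = (\<Union>u\<in>J j. (T ^^ (cc j + u)) ` E (Suc j))"
        unfolding E'_def by (subst E_cut) (simp only: image_UN funpow_image_add)
      also have "\<dots> = (\<Union>i<r' j. (T ^^ (cc j + sorted_list_of_set (J j) ! i)) ` E (Suc j))"
      proof -
        have "J j = (\<lambda>i. sorted_list_of_set (J j) ! i) ` {..<r' j}"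
          unfolding r'_def using J_fin[of j] by (metis (no_types) image_cong length_sorted_list_of_set lessThan_atLeast0 list.set_map map_nth set_sorted_list_of_set set_upt)
        then show ?thesis by (metis (no_types, lifting) SUP_cong image_image)
      qed
      also have "\<dots> = (\<Union>i<r' j. (T ^^ pos' j i) ` E' (Suc j))"
      proof (rule SUP_cong[OF refl])
        fix i assume "i \<in> {..<r' j}"
        \<comment> \<open>\<open>cc (Suc j)\<close> contains the minimum that \<open>pos'\<close>
          subtracts.\<close>
        then have "cc j + sorted_list_of_set (J j) ! i = pos' j i + cc (Suc j)" using pos'_add[of i j] by simp
        then show "(T ^^ (cc j + sorted_list_of_set (J j) ! i)) ` E (Suc j) = (T ^^ pos' j i) ` E' (Suc j)"
          unfolding E'_def by (simp only: funpow_image_add)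
      qed
      finally show ?thesis .
    qed
  qed simp
qed

text \<open>The approximation of \<open>D n\<close> by levels over \<open>B\<close> survives the
  passage from \<open>B\<close> to \<open>E\<close>, since the correction stays small even when
  multiplied by the number of levels. Borel-Cantelli turns summable distances into eventual
  agreement.\<close>

lemma D_levels: "\<exists>K. AE x in M. \<forall>n. \<exists>N. \<forall>j\<ge>N. K n j \<subseteq> {..<h j} \<and> (x \<in> D n \<longleftrightarrow> x \<in> tower_set T (E j) (K n j))"
proof -
  have "\<exists>K. \<forall>n j. n \<le> j \<longrightarrow> K n (Suc j) \<subseteq> {..<h (Suc j)} \<and> mdist M (D n) (tower_set T (B (Suc j)) (K n (Suc j))) \<le> (1/2) ^ j"
  proof -
    have "\<exists>L. n < j \<longrightarrow> L \<subseteq> {..<h j} \<and> mdist M (D n) (tower_set T (B j) L) \<le> (1/2) ^ (j - 1)" for n j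
      using D_app[of n "j - 1"] by (cases j) (auto simp: less_Suc_eq_le)
    then obtain K where "\<And>n j. n < j \<longrightarrow> K n j \<subseteq> {..<h j} \<and> mdist M (D n) (tower_set T (B j) (K n j)) \<le> (1/2) ^ (j - 1)" by metis
    then show ?thesis by (intro exI[of _ K]) (metis diff_Suc_1 le_imp_less_Suc)
  qed
  then obtain K where K: "\<And>n j. n \<le> j \<Longrightarrow> K n (Suc j) \<subseteq> {..<h (Suc j)}"
    "\<And>n j. n \<le> j \<Longrightarrow> mdist M (D n) (tower_set T (B (Suc j)) (K n (Suc j))) \<le> (1/2) ^ j" by blast
  have "AE x in M. \<exists>N. \<forall>j\<ge>N. K n j \<subseteq> {..<h j} \<and> (x \<in> D n \<longleftrightarrow> x \<in> tower_set T (E j) (K n j))" for n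
  proof -
    \<comment> \<open>Only towers after stage \<open>n\<close> are known to approximate
      \<open>D n\<close>, hence the index \<open>Suc (j + n)\<close>.\<close>
    let ?S = "\<lambda>j. sym_diff (D n) (tower_set T (E (Suc (j + n))) (K n (Suc (j + n))))"
    have fin: "finite (K n (Suc (j + n)))" for j using K(1)[of n "j + n"] finite_subset by auto
    have S: "?S j \<in> fmeasurable M" for j
      by (intro fmeasurable_sym_diff D_fm tower_set_fmeasurable T E_mdist fin)
    have b: "measure M (?S j) \<le> (1/2) ^ j * 2" for j
    proof -
      let ?i = "Suc (j + n)"
      have f: "tower_set T (E ?i) (K n ?i) \<in> fmeasurable M" "tower_set T (B ?i) (K n ?i) \<in> fmeasurable M"
        by (intro tower_set_fmeasurable T E_mdist B_fm fin)+
      have "mdist M (tower_set T (B ?i) (K n ?i)) (tower_set T (E ?i) (K n ?i)) \<le> (\<Sum>t\<in>K n ?i. mdist M ((T ^^ t) ` B ?i) ((T ^^ t) ` E ?i))"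
        unfolding tower_set_def by (intro mdist_UN_le fin level_fmeasurable T B_fm E_mdist)
      also have "\<dots> = real (card (K n ?i)) * mdist M (B ?i) (E ?i)"
        using aut_mdist(1)[OF aut_funpow[OF T]] B_fm E_sets by (simp add: fmeasurableD)
      also have "\<dots> \<le> real (h ?i) * ((1/2) ^ (?i + 1) * c ?i)"
      proof (rule mult_mono)
        show "real (card (K n ?i)) \<le> real (h ?i)" using card_mono[OF _ K(1)[of n "j + n"]] by simp
      qed (rule E_mdist(2) of_nat_0_le_iff mdist_nonneg)+
      also have "\<dots> = (1/2) ^ (?i + 1) * min 1 (measure M (B ?i))" unfolding c_def using h_ge[of ?i] by simp
      also have "\<dots> \<le> (1/2) ^ j * 1"
      proof (rule mult_mono)
        show "(1/2::real) ^ (?i + 1) \<le> (1/2) ^ j" by (rule power_decreasing) auto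
      qed (auto intro: less_imp_le B_pos)
      finally have 1: "mdist M (tower_set T (B ?i) (K n ?i)) (tower_set T (E ?i) (K n ?i)) \<le> (1/2) ^ j" by simp
      have 2: "mdist M (D n) (tower_set T (B ?i) (K n ?i)) \<le> (1/2) ^ j"
      proof -
        have "(1/2::real) ^ (j + n) \<le> (1/2) ^ j" by (rule power_decreasing) auto
        moreover have "mdist M (D n) (tower_set T (B ?i) (K n ?i)) \<le> (1/2) ^ (j + n)" using K(2)[of n "j + n"] by simp
        ultimately show ?thesis by (rule order_trans[rotated])
      qed
      have "mdist M (D n) (tower_set T (E ?i) (K n ?i)) \<le> mdist M (D n) (tower_set T (B ?i) (K n ?i)) + mdist M (tower_set T (B ?i) (K n ?i)) (tower_set T (E ?i) (K n ?i))"
        by (intro mdist_triangle D_fm f)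
      then show ?thesis using 1 2 unfolding mdist_def by linarith
    qed
    have "AE x in M. \<forall>\<^sub>F j in sequentially. x \<in> space M - ?S j"
    proof (rule borel_cantelli_AE1)
      show "?S j \<in> sets M" for j using S by (rule fmeasurableD)
      show "emeasure M (?S j) < \<infinity>" for j using fmeasurableD2[OF S] by (simp add: less_top)
      show "summable (\<lambda>j. measure M (?S j))"
      proof (rule summable_comparison_test')
        show "summable (\<lambda>j. (1/2::real) ^ j * 2)" by (intro summable_mult2 summable_geometric) simp
        show "norm (measure M (?S j)) \<le> (1/2) ^ j * 2" for j using b by simp
      qed
    qed
    then show ?thesis
    proof eventually_elim
      case (elim x)
      then obtain N where N: "\<And>j. j \<ge> N \<Longrightarrow> x \<notin> ?S j" unfolding eventually_sequentially by blast
      have "K n j \<subseteq> {..<h j} \<and> (x \<in> D n \<longleftrightarrow> x \<in> tower_set T (E j) (K n j))" if j: "j \<ge> Suc (N + n)" for j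
      proof -
        obtain i where i: "j = Suc (i + n)" "i \<ge> N"
          by (rule that[of "j - Suc n"]) (use j in auto)
        show ?thesis using N[OF i(2)] K(1)[of n "i + n"] unfolding i(1) by auto
      qed
      then show ?case by blast
    qed
  qed
  then have "AE x in M. \<forall>n. \<exists>N. \<forall>j\<ge>N. K n j \<subseteq> {..<h j} \<and> (x \<in> D n \<longleftrightarrow> x \<in> tower_set T (E j) (K n j))"
    by (subst AE_all_countable) blast
  then show ?thesis by blast
qed

text \<open>The union of the nested towers is forward invariant and not null, so \<open>erg\<close>
  makes it conull. This is the exhaustion required by \<open>tower_system\<close>; generation comes
  from \<open>D_levels\<close>.\<close>

lemma rank_one_of_base_sequence:
  assumes erg: "\<And>X. X \<in> sets M \<Longrightarrow> X \<notin> null_sets M \<Longrightarrow> AE x in M. x \<in> X \<longrightarrow> T x \<in> X \<Longrightarrow> AE x in M. x \<in> X"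
    and sep: "\<And>x y. x \<in> X0 \<Longrightarrow> y \<in> X0 \<Longrightarrow> (\<forall>n. x \<in> D n \<longleftrightarrow> y \<in> D n) \<Longrightarrow> x = y"
  shows "rank_one M T"
proof -
  interpret N: nested_towers M g X0 h' r' pos' "measure M (E' 0)" id T E' by (rule nested')
  obtain K where K: "AE x in M. \<forall>n. \<exists>N. \<forall>j\<ge>N. K n j \<subseteq> {..<h j} \<and> (x \<in> D n \<longleftrightarrow> x \<in> tower_set T (E j) (K n j))"
    using D_levels by blast
  have nn: "(\<Union>j. N.XX j) \<notin> null_sets M"
  proof
    assume a: "(\<Union>j. N.XX j) \<in> null_sets M"
    have "E' 0 \<subseteq> (\<Union>j. N.XX j)" 
    proof
      fix x assume "x \<in> E' 0"
      then have "x \<in> N.XX 0" unfolding N.XX_def using N.h0 by (intro UN_I[of 0]) simp_all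
      then show "x \<in> (\<Union>j. N.XX j)" by blast
    qed
    then have "E' 0 \<in> null_sets M" using a N.E_fm[of 0] by (meson fmeasurableD null_sets_subset)
    then have "measure M (E' 0) = 0" by (simp add: null_sets_def measure_def)
    then show False using N.w0 by simp
  qed
  have all: "AE x in M. x \<in> (\<Union>j. N.XX j)"
    by (rule erg[OF _ nn N.XX_forward]) auto
  \<comment> \<open>Dropping the lowest \<open>cc j\<close> levels renumbers the others.\<close>
  define L where "L = (\<lambda>n j. {t. t + cc j \<in> K n j})"
  interpret tower_system M g X0 h' r' pos' "measure M (E' 0)" id T E' D L
  proof
    show "AE x in M. \<exists>j. \<exists>t<h' j. x \<in> (T ^^ t) ` E' j" using all by eventually_elim (auto simp: N.XX_def)
    show "x = y" if "x \<in> X0" "y \<in> X0" "\<forall>n. x \<in> D n \<longleftrightarrow> y \<in> D n" for x y using sep that by blast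
    show "AE x in M. \<forall>n. \<exists>N. \<forall>j\<ge>N. x \<in> D n \<longleftrightarrow> (\<exists>t\<in>L n j. t < h' j \<and> x \<in> (T ^^ t) ` E' j)"
      using all K
    proof eventually_elim
      case (elim x)
      obtain i where i: "x \<in> N.XX i" using elim(1) by blast
      show ?case
      proof
        fix n
        obtain N where N: "\<And>j. j \<ge> N \<Longrightarrow> K n j \<subseteq> {..<h j} \<and> (x \<in> D n \<longleftrightarrow> x \<in> tower_set T (E j) (K n j))" using elim(2) by blast
        have "x \<in> D n \<longleftrightarrow> (\<exists>t\<in>L n j. t < h' j \<and> x \<in> (T ^^ t) ` E' j)" if j: "j \<ge> max N i" for j
        proof -
          have "x \<in> N.XX j" using N.XX_mono[of i j] i j by auto
          then obtain t where t: "t < h' j" "x \<in> (T ^^ t) ` E' j" unfolding N.XX_def by blast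
          have te: "x \<in> (T ^^ (t + cc j)) ` E j" "t + cc j < h j" using t h'_add[of j] unfolding E'_def funpow_image_add by auto
          have "x \<in> tower_set T (E j) (K n j) \<longleftrightarrow> t + cc j \<in> K n j"
          proof
            assume "x \<in> tower_set T (E j) (K n j)"
            then obtain s where s: "s \<in> K n j" "x \<in> (T ^^ s) ` E j" unfolding tower_set_def by blast
            have "s < h j" using s(1) N[of j] j by auto
            then have "s = t + cc j" using E_disj[of j] s(2) te unfolding disjoint_family_on_def by blast
            then show "t + cc j \<in> K n j" using s(1) by simp
          next
            assume "t + cc j \<in> K n j"
            then show "x \<in> tower_set T (E j) (K n j)" unfolding tower_set_def using te(1) by blast
          qed
          moreover have "(\<exists>t\<in>L n j. t < h' j \<and> x \<in> (T ^^ t) ` E' j) \<longleftrightarrow> t + cc j \<in> K n j"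
          proof
            assume "\<exists>t\<in>L n j. t < h' j \<and> x \<in> (T ^^ t) ` E' j"
            then obtain s where s: "s \<in> L n j" "s < h' j" "x \<in> (T ^^ s) ` E' j" by blast
            have "s = t" using N.lv_unique[OF s(3) t(2) s(2) t(1)] .
            then show "t + cc j \<in> K n j" using s(1) unfolding L_def by simp
          next
            assume "t + cc j \<in> K n j"
            then show "\<exists>t\<in>L n j. t < h' j \<and> x \<in> (T ^^ t) ` E' j" using t unfolding L_def by blast
          qed
          ultimately show ?thesis using N[of j] j by simp
        qed
        then show "\<exists>N. \<forall>j\<ge>N. x \<in> D n \<longleftrightarrow> (\<exists>t\<in>L n j. t < h' j \<and> x \<in> (T ^^ t) ` E' j)" by blast
      qed
    qed
  qed
  show ?thesis by (rule rank_one)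
qed

end

context leb_dense begin

lemma approx_tower_imp_rank_one:
  assumes T: "T \<in> automorphisms M" and at: "\<And>k. approx_tower T k"
  shows "rank_one M T"
proof -
  from ex_separating_family obtain D where D0: "(\<forall>n::nat. D n \<in> fmeasurable M) \<and>
    (\<forall>x\<in>X0. \<forall>K. finite K \<longrightarrow> K \<subseteq> X0 \<longrightarrow> x \<notin> K \<longrightarrow> (\<exists>n. x \<in> D n \<and> K \<inter> D n = {}))" ..
  have D: "D n \<in> fmeasurable M" for n using D0 by simp
  have D': "\<exists>n. x \<in> D n \<and> K \<inter> D n = {}" if "x \<in> X0" "finite K" "K \<subseteq> X0" "x \<notin> K" for x K
    using conjunct2[OF D0] that by simp
  have sep: "x = y" if "x \<in> X0" "y \<in> X0" "\<forall>n. x \<in> D n \<longleftrightarrow> y \<in> D n" for x y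
  proof (rule ccontr)
    assume "x \<noteq> y"
    then obtain n where "x \<in> D n" "{y} \<inter> D n = {}" using D'[of x "{y}"] \<open>x \<in> X0\<close> \<open>y \<in> X0\<close> by auto
    then show False using \<open>\<forall>n. x \<in> D n \<longleftrightarrow> y \<in> D n\<close> by auto
  qed
  from ex_base_sequence[OF T at, of D, OF D] obtain B h J where s: "h 0 = (1::nat) \<and> (\<forall>n. base M T (B n) (h n) \<and> h n \<ge> 1 \<and> finite (J n) \<and> n < card (J n) \<and>
    (\<forall>t\<in>J n. t + h n \<le> h (Suc n)) \<and> (\<forall>t\<in>J n. \<forall>t'\<in>J n. t < t' \<longrightarrow> t + h n \<le> t') \<and>
    measure M (B (Suc n)) \<le> measure M (B n) \<and>
    real (h n) * mdist M (B n) (tower_set T (B (Suc n)) (J n)) \<le> (1/2) ^ (n + 2) * min 1 (measure M (B n)) / real (h n) \<and>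
    (\<forall>i\<le>n. \<exists>L\<subseteq>{..<h (Suc n)}. mdist M (D i) (tower_set T (B (Suc n)) L) \<le> (1/2) ^ n))"
    by (elim exE) (rule that)
  interpret base_sequence M g X0 T B h J D
    by unfold_locales (use T s D in \<open>simp_all\<close>)
  show ?thesis
    by (rule rank_one_of_base_sequence) (use forward_invariant_conull[OF T at] sep in blast)+
qed

end

section \<open>Cutting at positions given by powers of 2\<close>

text \<open>Multiples of powers of 2, shifted to start at 0. The differences of distinct powers of 2
  are pairwise different, and the factor 8 keeps them distinguishable after disturbances by offsets
  below \<open>H\<close>.\<close>

definition gap :: "nat \<Rightarrow> nat \<Rightarrow> nat" where "gap H i = 8 * H * (2 ^ i - 1)"

lemma gap_0 [simp]: "gap H 0 = 0" by (simp add: gap_def)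

lemma gap_Suc: "gap H (Suc i) = gap H i + 8 * H * 2 ^ i"
proof -
  have "(2::nat) ^ Suc i - 1 = (2 ^ i - 1) + 2 ^ i" by simp
  then show ?thesis unfolding gap_def by (simp only: distrib_left)
qed

lemma int_gap: "int (gap H i) = 8 * (int H * (2 ^ i - 1))"
  by (simp add: gap_def of_nat_diff)

text \<open>If \<open>k'\<close> exceeded \<open>i'\<close>, both powers on the left would be at
  most half of \<open>2 ^ k'\<close>, so the left side would be too small. By symmetry the larger
  exponents agree, and then so do the smaller ones.\<close>

lemma power_two_sum_inj:
  assumes "i < i'" "k < k'" "(2::int) ^ i' + 2 ^ k = 2 ^ k' + 2 ^ i"
  shows "i = k"
proof -
  have le: "a' \<ge> b'" if "a < a'" "b < b'" "(2::int) ^ a' + 2 ^ b = 2 ^ b' + 2 ^ a" for a a' b b' :: nat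
  proof (rule ccontr)
    assume "\<not> a' \<ge> b'"
    then obtain m where m: "b' = Suc m" "a' \<le> m" by (cases b') auto
    have "(2::int) ^ a' \<le> 2 ^ m" "(2::int) ^ b \<le> 2 ^ m" using m that(2) by (auto intro!: power_increasing)
    moreover have "(2::int) ^ a > 0" by simp
    ultimately show False using that(3) unfolding m(1) power_Suc by linarith
  qed
  have "i' = k'" using le[OF assms] le[of k k' i i'] assms by (simp add: add.commute)
  then show ?thesis using assms(3) by (simp add: power_inject_exp)
qed

text \<open>Differences of powers of \<open>2\<close> determine the exponents, so the time needed to pass from one column
  to another one determines both.\<close>

lemma gap_sidon:
  assumes "v < H" "v' < H" "u < H" "u' < H" "i < i'" "k < k'"
    and 1: "gap H i + v + n = gap H i' + v'" and 2: "gap H k + u + n = gap H k' + u'"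
  shows "i = k"
proof -
  \<comment> \<open>A nonzero \<open>D\<close> would contribute at least \<open>8 * H\<close> in
    absolute value, while the offsets together contribute less than \<open>2 * H\<close>.\<close>
  define D where "D = (2::int) ^ i' + 2 ^ k - 2 ^ k' - 2 ^ i"
  have "int (gap H i) + int v + int n = int (gap H i') + int v'" using 1 by (metis of_nat_add)
  moreover have "int (gap H k) + int u + int n = int (gap H k') + int u'" using 2 by (metis of_nat_add)
  ultimately have "8 * (int H * D) = int u' - int u + int v - int v'" unfolding D_def int_gap by (simp add: algebra_simps)
  moreover have "int H * D \<ge> int H" if "D \<ge> 1" using mult_left_mono[OF that, of "int H"] by simp
  moreover have "int H * D \<le> - int H" if "D \<le> -1" using mult_left_mono[OF that, of "int H"] by simp
  ultimately have "\<not> D \<ge> 1" "\<not> D \<le> -1" using assms(1-4) by linarith+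
  then have "D = 0" by linarith
  then have "(2::int) ^ i' + 2 ^ k = 2 ^ k' + 2 ^ i" unfolding D_def by simp
  then show ?thesis by (rule power_two_sum_inj[OF assms(5,6)])
qed

text \<open>The quantity bounded in \<open>thin\<close> is the measure of a single column of stage
  \<open>j\<close>; the bounds are summable over the stages, with total governed by
  \<open>c\<close>.\<close>

locale sidon_cutting = cutting_inf h r "\<lambda>j. gap (h j)" w0 \<sigma>0 for h r w0 \<sigma>0 +
  fixes c :: real
  assumes thin: "real (h j) * w (Suc j) \<le> c * (1/2) ^ j"
begin

definition tow :: "nat \<Rightarrow> real set" where "tow j = {0..<real (h j) * w j}"
definition good :: "nat \<Rightarrow> nat \<Rightarrow> real set" where "good j n = (\<Union>u\<in>{u. u + n < h j}. lev j u)"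
text \<open>Returns to tower \<open>j\<close> at time \<open>n\<close> other than by climbing inside
  the tower.\<close>

definition ret :: "nat \<Rightarrow> nat \<Rightarrow> real set" where "ret j n = {y \<in> tow j - good j n. (S ^^ n) y \<in> tow j}"

lemma S_funpow_borel [measurable]: "S ^^ n \<in> borel_measurable borel"
proof (induction n)
  case (Suc n)
  then show ?case using measurable_comp[OF Suc S_borel] by (simp only: funpow.simps)
qed (simp add: id_def)

lemma ret_borel [measurable]: "ret j n \<in> sets borel"
proof -
  have f: "finite {u. u + n < h j}" by (rule finite_subset[of _ "{..h j}"]) auto
  have "good j n \<in> sets borel" unfolding good_def using f by (intro sets.finite_UN) auto
  then have "(tow j - good j n) \<inter> ((S ^^ n) -` tow j \<inter> space borel) \<in> sets borel"
    unfolding tow_def by (intro sets.Int sets.Diff measurable_sets[OF S_funpow_borel]) auto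
  moreover have "(tow j - good j n) \<inter> ((S ^^ n) -` tow j \<inter> space borel) = ret j n" unfolding ret_def by auto
  ultimately show ?thesis by simp
qed

lemma tow_lev: "y \<in> tow j \<longleftrightarrow> (\<exists>u<h j. y \<in> lev j u)"
  unfolding tow_def lev_Union[symmetric] by blast

lemma tow_Suc: "tow j \<subseteq> tow (Suc j)"
  unfolding tow_def using tower_measure_mono[of j "Suc j"] by auto

lemma tow_column:
  assumes "y \<in> tow j" obtains v i where "v < h j" "i < r j" "y \<in> lev j v" "y \<in> lev (Suc j) (gap (h j) i + v)"
proof -
  obtain v where v: "v < h j" "y \<in> lev j v" using assms unfolding tow_lev by blast
  then obtain i where "i < r j" "y \<in> lev (Suc j) (gap (h j) i + v)" using lev_split[OF v(1)] by blast
  then show ?thesis using v by (intro that[of v i])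
qed

text \<open>Within tower \<open>j + 1\<close> the map only climbs, so such a return ends in a later
  column; ending in the same column would be climbing inside tower \<open>j\<close>.\<close>

lemma ret_crossing:
  assumes y: "y \<in> ret j n" "y \<in> good (Suc j) n"
  obtains v v' i i' where "v < h j" "v' < h j" "i < i'" "i' < r j" "gap (h j) i + v + n = gap (h j) i' + v'"
    "y \<in> lev (Suc j) (gap (h j) i + v)"
proof -
  have t: "y \<in> tow j" "(S ^^ n) y \<in> tow j" "y \<notin> good j n" using y(1) unfolding ret_def by auto
  obtain v i where v: "v < h j" "i < r j" "y \<in> lev j v" "y \<in> lev (Suc j) (gap (h j) i + v)" using t(1) by (rule tow_column)
  obtain v' i' where v': "v' < h j" "i' < r j" "(S ^^ n) y \<in> lev (Suc j) (gap (h j) i' + v')" using t(2) by (rule tow_column)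
  obtain u where u: "u + n < h (Suc j)" "y \<in> lev (Suc j) u" using y(2) unfolding good_def by auto
  have "u = gap (h j) i + v" using lev_unique[OF u(2) v(4)] u(1) pos_add_less[OF v(2,1)] by simp
  then have l: "gap (h j) i + v + n < h (Suc j)" using u(1) by simp
  have eq: "gap (h j) i + v + n = gap (h j) i' + v'"
    using lev_unique[OF S_pow_lev[OF v(4) l] v'(3) l] pos_add_less[OF v'(2,1)] by simp
  have "i \<noteq> i'"
  proof
    assume "i = i'"
    then have "v + n < h j" using eq v'(1) by simp
    then show False using t(3) v(3) unfolding good_def by auto
  qed
  moreover have "\<not> i' < i" using pos_less[of i' i j] v(2) eq v'(1) by auto
  ultimately have "i < i'" by simp
  then show ?thesis using that[OF v(1) v'(1) _ v'(2) eq v(4)] by simp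
qed

lemma emeasure_levels_le:
  assumes "finite L" "card L \<le> n"
  shows "emeasure lborel (\<Union>u\<in>L. lev j (f u)) \<le> ennreal (real n * w j)"
proof -
  have "emeasure lborel (\<Union>u\<in>L. lev j (f u)) \<le> (\<Sum>u\<in>L. emeasure lborel (lev j (f u)))"
    using assms(1) by (intro emeasure_subadditive_finite) auto
  also have "\<dots> = ennreal (real (card L) * w j)"
    using w_pos[of j] by (simp add: emeasure_lev ennreal_mult ennreal_of_nat_eq_real_of_nat)
  also have "\<dots> \<le> ennreal (real n * w j)" using assms(2) w_pos[of j] by (intro ennreal_leI mult_right_mono) auto
  finally show ?thesis .
qed

text \<open>All crossings at time \<open>n\<close> start from one and the same column by
  \<open>gap_sidon\<close>, and a column is thin. A return that is not a crossing inside tower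
  \<open>j + 1\<close> is again a nonclimbing return for stage \<open>j + 1\<close>.\<close>

lemma ret_step: "emeasure lborel (ret j n) \<le> ennreal (c * (1/2) ^ j) + emeasure lborel (ret (Suc j) n)"
proof -
  obtain i where i: "ret j n \<inter> good (Suc j) n \<subseteq> (\<Union>v\<in>{..<h j}. lev (Suc j) (gap (h j) i + v))"
  proof (cases "ret j n \<inter> good (Suc j) n = {}")
    case True
    then show ?thesis by (intro that) auto
  next
    case False
    then obtain y where "y \<in> ret j n" "y \<in> good (Suc j) n" by blast
    then obtain v v' i i' where v: "v < h j" "v' < h j" "i < i'" "gap (h j) i + v + n = gap (h j) i' + v'"
      by (rule ret_crossing)
    have "z \<in> (\<Union>v\<in>{..<h j}. lev (Suc j) (gap (h j) i + v))" if z: "z \<in> ret j n" "z \<in> good (Suc j) n" for z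
    proof -
      obtain u u' k k' where u: "u < h j" "u' < h j" "k < k'" "gap (h j) k + u + n = gap (h j) k' + u'"
        and zl: "z \<in> lev (Suc j) (gap (h j) k + u)"
        using z by (rule ret_crossing)
      have "i = k" by (rule gap_sidon[OF v(1,2) u(1,2) v(3) u(3) v(4) u(4)])
      then show ?thesis using u(1) zl by blast
    qed
    then show ?thesis by (intro that[of i]) blast
  qed
  have "ret j n \<subseteq> (\<Union>v\<in>{..<h j}. lev (Suc j) (gap (h j) i + v)) \<union> ret (Suc j) n"
    using i tow_Suc[of j] unfolding ret_def by blast
  then have "emeasure lborel (ret j n) \<le> emeasure lborel ((\<Union>v\<in>{..<h j}. lev (Suc j) (gap (h j) i + v)) \<union> ret (Suc j) n)"
    by (intro emeasure_mono) (auto intro!: sets.Un sets.finite_UN)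
  also have "\<dots> \<le> emeasure lborel (\<Union>v\<in>{..<h j}. lev (Suc j) (gap (h j) i + v)) + emeasure lborel (ret (Suc j) n)"
    by (intro emeasure_subadditive) (auto intro!: sets.finite_UN)
  also have "\<dots> \<le> ennreal (c * (1/2) ^ j) + emeasure lborel (ret (Suc j) n)"
    using emeasure_levels_le[of "{..<h j}" "h j" "Suc j" "\<lambda>v. gap (h j) i + v"] thin[of j]
    by (intro add_right_mono order_trans[OF _ ennreal_leI[OF thin[of j]]]) simp
  finally show ?thesis .
qed

text \<open>Only the top \<open>n\<close> levels leave no room for climbing \<open>n\<close> steps.
  For fixed \<open>n\<close> their measure vanishes as the stage grows, which closes the recursion
  of \<open>ret_step\<close>.\<close>

lemma ret_le_top: "emeasure lborel (ret k n) \<le> ennreal (real n * w k)"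
proof -
  have "ret k n \<subseteq> (\<Union>u\<in>{h k - n..<h k}. lev k u)"
  proof
    fix y assume y: "y \<in> ret k n"
    then obtain u where u: "u < h k" "y \<in> lev k u" unfolding ret_def using tow_lev by blast
    then have "\<not> u + n < h k" using y unfolding ret_def good_def by auto
    then show "y \<in> (\<Union>u\<in>{h k - n..<h k}. lev k u)" using u by auto
  qed
  then have "emeasure lborel (ret k n) \<le> emeasure lborel (\<Union>u\<in>{h k - n..<h k}. lev k u)"
    by (intro emeasure_mono) (auto intro!: sets.finite_UN)
  also have "\<dots> \<le> ennreal (real n * w k)" by (rule emeasure_levels_le) auto
  finally show ?thesis .
qed

lemma c_nonneg: "0 \<le> c"
proof -
  have "0 \<le> real (h 0) * w (Suc 0)" by (rule mult_nonneg_nonneg[OF of_nat_0_le_iff less_imp_le[OF w_pos]])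
  then show ?thesis using thin[of 0] by simp
qed

lemma ret_le_partial: "emeasure lborel (ret j n) \<le> ennreal (real n * w (j + m) + 2 * c * ((1/2) ^ j - (1/2) ^ (j + m)))"
proof (induction m arbitrary: j)
  case 0
  then show ?case using ret_le_top[of j n] by simp
next
  case (Suc m)
  have p: "(1/2::real) ^ (Suc j + m) \<le> (1/2) ^ Suc j" by (intro power_decreasing) auto
  have "emeasure lborel (ret j n) \<le> ennreal (c * (1/2) ^ j) + emeasure lborel (ret (Suc j) n)" by (rule ret_step)
  also have "\<dots> \<le> ennreal (c * (1/2) ^ j) + ennreal (real n * w (Suc j + m) + 2 * c * ((1/2) ^ Suc j - (1/2) ^ (Suc j + m)))"
    by (rule add_left_mono[OF Suc.IH])
  also have "\<dots> = ennreal (c * (1/2) ^ j + (real n * w (Suc j + m) + 2 * c * ((1/2) ^ Suc j - (1/2) ^ (Suc j + m))))"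
    using c_nonneg w_pos[of "Suc j + m"] p by (intro ennreal_plus[symmetric] add_nonneg_nonneg mult_nonneg_nonneg) auto
  also have "c * (1/2) ^ j + (real n * w (Suc j + m) + 2 * c * ((1/2) ^ Suc j - (1/2) ^ (Suc j + m))) =
      real n * w (j + Suc m) + 2 * c * ((1/2) ^ j - (1/2) ^ (j + Suc m))"
    by (simp add: algebra_simps)
  finally show ?case .
qed

text \<open>Summing \<open>ret_step\<close> over all later stages gives a geometric series and a
  remainder that tends to 0. The bound is independent of \<open>n\<close>, which both mixing and
  closeness in the metric rely on.\<close>

lemma ret_le: "emeasure lborel (ret j n) \<le> ennreal (2 * c * (1/2) ^ j)"
proof (rule LIMSEQ_le_const)
  have "(\<lambda>m. w (j + m)) \<longlonglongrightarrow> 0" using LIMSEQ_ignore_initial_segment[OF w_tendsto, of j] by (simp add: add.commute)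
  then have "(\<lambda>m. real n * w (j + m) + 2 * c * (1/2) ^ j) \<longlonglongrightarrow> real n * 0 + 2 * c * (1/2) ^ j"
    by (intro tendsto_intros)
  then show "(\<lambda>m. ennreal (real n * w (j + m) + 2 * c * (1/2) ^ j)) \<longlonglongrightarrow> ennreal (2 * c * (1/2) ^ j)"
    by (intro tendsto_ennrealI) simp
  have "emeasure lborel (ret j n) \<le> ennreal (real n * w (j + m) + 2 * c * (1/2) ^ j)" for m
    by (rule order_trans[OF ret_le_partial[of j n m]], rule ennreal_leI)
      (use c_nonneg in \<open>simp add: right_diff_distrib\<close>)
  then show "\<exists>N. \<forall>m\<ge>N. emeasure lborel (ret j n) \<le> ennreal (real n * w (j + m) + 2 * c * (1/2) ^ j)" by blast
qed

lemma return_subset_ret: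
  assumes "h j \<le> n" shows "{y \<in> tow j. (S ^^ n) y \<in> tow j} \<subseteq> ret j n"
  using assms unfolding ret_def good_def by auto

end

text \<open>The number of columns is chosen in terms of the current height and width, large enough
  to make the columns thin and to tend to infinity. The exponential gaps at least double the measure
  of the tower at every stage.\<close>

lemma ex_sidon_cutting:
  assumes h0: "0 < h0" and w0: "0 < w0" and c: "0 < c" and \<sigma>0: "bij_betw \<sigma>0 {..<h0} {..<h0}"
  shows "\<exists>h r. h 0 = h0 \<and> sidon_cutting h r w0 \<sigma>0 c"
proof -
  define R where "R = (\<lambda>j (h::nat) (w::real). j + 2 + nat \<lceil>real h * w / (c * (1/2) ^ j)\<rceil>)"
  \<comment> \<open>Heights and widths are produced together because the number of columns depends
    on both. There are no spacers on top: a tower ends with its last column.\<close>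
  define hw where "hw = rec_nat (h0, w0) (\<lambda>j (h, w). (gap h (R j h w - 1) + h, w / real (R j h w)))"
  define h where "h = (\<lambda>j. fst (hw j))"
  define v where "v = (\<lambda>j. snd (hw j))"
  define r where "r = (\<lambda>j. R j (h j) (v j))"
  have h_0: "h 0 = h0" and v_0: "v 0 = w0" unfolding h_def v_def hw_def by auto
  have "hw (Suc j) = (\<lambda>(h, w). (gap h (R j h w - 1) + h, w / real (R j h w))) (hw j)" for j unfolding hw_def by simp
  then have "hw (Suc j) = (gap (h j) (r j - 1) + h j, v j / real (r j))" for j
    unfolding r_def h_def v_def by (simp add: case_prod_beta)
  then have h_Suc: "h (Suc j) = gap (h j) (r j - 1) + h j" and v_Suc: "v (Suc j) = v j / real (r j)" for j
    unfolding h_def v_def by simp_all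
  have r2: "j + 2 \<le> r j" for j unfolding r_def R_def by simp
  have "filterlim r at_top sequentially"
    by (rule filterlim_at_top_mono[OF filterlim_ident]) (use r2 in \<open>auto intro!: always_eventually le_trans[OF _ r2]\<close>)
  then have "cutting h r (\<lambda>j. gap (h j)) w0 \<sigma>0"
    using h0 w0 \<sigma>0 h_0 h_Suc r2 by unfold_locales (auto simp: gap_Suc intro: less_le_trans[OF _ r2])
  then interpret cutting h r "\<lambda>j. gap (h j)" w0 \<sigma>0 .
  have wv: "w j = v j" for j by (induction j) (simp_all add: v_0 v_Suc)
  have dbl: "2 * (real (h j) * w j) \<le> real (h (Suc j)) * w (Suc j)" for j
  proof -
    define m where "m = r j - 1"
    have m: "r j = Suc m" "m \<ge> 1" using r2[of j] unfolding m_def by auto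
    have "Suc m \<le> 2 ^ m" by (induction m) auto
    then have "8 * m \<le> 8 * (2 ^ m - 1)" by (intro mult_le_mono2) simp
    moreover have "2 * Suc m \<le> 8 * m" using m(2) by simp
    ultimately have "2 * Suc m \<le> 8 * (2 ^ m - 1)" by (rule order_trans[rotated])
    then have "h j * (2 * Suc m) \<le> h j * (8 * (2 ^ m - 1))" by (rule mult_le_mono2)
    also have "\<dots> \<le> h (Suc j)" unfolding h_Suc gap_def m by simp
    finally have "h j * 2 * r j \<le> h (Suc j)" using m(1) by (simp add: mult.assoc)
    then have "real (h j * 2 * r j) * w (Suc j) \<le> real (h (Suc j)) * w (Suc j)"
      by (intro mult_right_mono of_nat_mono less_imp_le[OF w_pos])
    moreover have "real (h j * 2 * r j) * w (Suc j) = 2 * (real (h j) * w j)"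
      by (simp only: w_Suc[of j, symmetric] of_nat_mult of_nat_numeral mult_ac)
    ultimately show ?thesis by simp
  qed
  have grow: "2 ^ j * (real h0 * w0) \<le> real (h j) * w j" for j
  proof (induction j)
    case (Suc j)
    then show ?case using dbl[of j] by simp
  qed (simp add: h_0)
  have "\<exists>j. b < real (h j) * w j" for b
  proof -
    have p: "real h0 * w0 > 0" using assms(1,2) by simp
    obtain j where "b / (real h0 * w0) < 2 ^ j" using real_arch_pow[of 2] by auto
    then have "b < 2 ^ j * (real h0 * w0)" using p by (simp add: pos_divide_less_eq)
    then show ?thesis using grow[of j] by (intro exI[of _ j]) simp
  qed
  moreover have "real (h j) * w (Suc j) \<le> c * (1/2) ^ j" for j
  proof -
    have p: "c * (1/2) ^ j > 0" using c by simp
    have "real (h j) * v j / (c * (1/2) ^ j) \<le> real (r j)"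
      unfolding r_def R_def of_nat_add by (rule order_trans[OF real_nat_ceiling_ge]) simp
    then have "real (h j) * w j \<le> real (r j) * (c * (1/2) ^ j)" using p wv[of j] by (simp add: pos_divide_le_eq)
    moreover have "real (r j) > 0" using r2[of j] by simp
    ultimately show ?thesis by (simp add: pos_divide_le_eq mult.commute)
  qed
  ultimately have "sidon_cutting h r w0 \<sigma>0 c" by unfold_locales
  then show ?thesis using h_0 by blast
qed

section \<open>Coordinates on parts of the space\<close>

lemma (in leb_space) emeasure_space: "emeasure M (space M) = \<infinity>"
proof -
  have "emeasure M (space M) = emeasure lborel {0::real..}" using g_push[of UNIV] by simp
  also have "\<dots> = \<infinity>"
  proof (cases "emeasure lborel {0::real..}")
    case (real r)
    have "ennreal (r + 1) = emeasure lborel {0..<r + 1}" using real(1) by simp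
    also have "\<dots> \<le> emeasure lborel {0::real..}" by (intro emeasure_mono) auto
    finally show ?thesis using real by (simp add: ennreal_le_iff del: ennreal_plus)
  qed simp
  finally show ?thesis .
qed

context leb_space begin

text \<open>The local form of \<open>maps_onto\<close>. Such coordinates can be translated, carried
  along by automorphisms and glued over disjoint parts.\<close>

definition maps_part :: "('a \<Rightarrow> real) \<Rightarrow> 'a set \<Rightarrow> real set \<Rightarrow> bool" where
  "maps_part f V Y \<longleftrightarrow> f \<in> borel_measurable M \<and> V \<in> sets M \<and> Y \<in> sets borel \<and> (\<exists>N\<in>null_sets M. inj_on f (V - N)) \<and>
     (\<forall>G\<in>sets borel. emeasure M (f -` G \<inter> V) = emeasure lborel (G \<inter> Y))"

lemma maps_partD:
  assumes "maps_part f V Y"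
  shows "f \<in> borel_measurable M" "V \<in> sets M" "Y \<in> sets borel" "\<exists>N\<in>null_sets M. inj_on f (V - N)"
    "\<And>G. G \<in> sets borel \<Longrightarrow> emeasure M (f -` G \<inter> V) = emeasure lborel (G \<inter> Y)"
    "\<And>G. G \<in> sets borel \<Longrightarrow> f -` G \<inter> V \<in> sets M"
proof -
  show f: "f \<in> borel_measurable M" and V: "V \<in> sets M" and "Y \<in> sets borel" and "\<exists>N\<in>null_sets M. inj_on f (V - N)"
    and "\<And>G. G \<in> sets borel \<Longrightarrow> emeasure M (f -` G \<inter> V) = emeasure lborel (G \<inter> Y)"
    using assms unfolding maps_part_def by auto
  show "f -` G \<inter> V \<in> sets M" if "G \<in> sets borel" for G
  proof -
    have "f -` G \<inter> V = (f -` G \<inter> space M) \<inter> V" using sets.sets_into_space[OF V] by auto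
    then show ?thesis using measurable_sets[OF f that] V by simp
  qed
qed

lemma maps_onto_of_part:
  assumes "maps_part f (space M) Y" shows "maps_onto f Y"
  using assms unfolding maps_part_def maps_onto_def by simp

lemma maps_part_AE:
  assumes "maps_part f V Y" shows "AE x in M. x \<in> V \<longrightarrow> f x \<in> Y"
proof -
  note m = maps_partD[OF assms]
  have c: "- Y \<in> sets borel" using m(3) by auto
  have "f -` (- Y) \<inter> V \<in> null_sets M" using m(5)[OF c] m(6)[OF c] by (intro null_setsI) auto
  from AE_not_in[OF this] show ?thesis by eventually_elim auto
qed

text \<open>\<open>cumulative_map\<close> supplies the distribution on rays, which determines the
  pushforward.\<close>

lemma ex_maps_part:
  assumes V: "V \<in> sets M" and Y: "Y \<in> sets borel" "Y \<subseteq> {0..}"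
    and eq: "\<And>a. 0 \<le> a \<Longrightarrow> min (ennreal a) (emeasure M V) = emeasure lborel ({..<a} \<inter> Y)"
  shows "\<exists>F. maps_part F V Y"
proof -
  obtain F where F: "F \<in> borel_measurable M" "\<forall>x. 0 \<le> F x"
     "\<forall>a\<ge>0. emeasure M {x\<in>V. F x < a} = min (ennreal a) (emeasure M V)" "\<exists>N\<in>null_sets M. inj_on F (V - N)"
    using cumulative_map[OF V] by blast
  have Vs: "V \<subseteq> space M" using V sets.sets_into_space by blast
  have V2: "V \<inter> space M \<in> sets M" using V Vs by (simp add: Int_absorb2)
  have sp: "space (restrict_space M V) = V" using Vs by (auto simp: space_restrict_space)
  have er: "emeasure (restrict_space M V) A = emeasure M A" if "A \<subseteq> V" for A
    using V2 that by (rule emeasure_restrict_space)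
  have Fr: "F \<in> borel_measurable (restrict_space M V)" using F(1) by (rule measurable_restrict_space1)
  have "emeasure M (F -` G \<inter> V) = emeasure lborel (G \<inter> Y)" if G: "G \<in> sets borel" for G
  proof -
    have "emeasure (restrict_space M V) (F -` G \<inter> space (restrict_space M V)) = emeasure lborel (G \<inter> Y)"
    proof (rule emeasure_vimage_eq_lborel_halfline[OF Fr _ Y G])
      fix a :: real
      show "emeasure (restrict_space M V) {x\<in>space (restrict_space M V). F x < a} = emeasure lborel ({..<a} \<inter> Y)"
      proof (cases "0 \<le> a")
        case True
        then show ?thesis unfolding sp using er[of "{x\<in>V. F x < a}"] F(3) eq by auto
      next
        case False
        have "\<not> F x < a" for x using F(2)[rule_format, of x] False by linarith
        then have "{x\<in>V. F x < a} = {}" by simp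
        moreover have "{..<a} \<inter> Y = {}" using Y(2) False by auto
        ultimately show ?thesis unfolding sp by (simp only: emeasure_empty)
      qed
    qed
    then show ?thesis unfolding sp using er[of "F -` G \<inter> V"] by simp
  qed
  then have "maps_part F V Y" unfolding maps_part_def using F(1,4) V Y(1) by blast
  then show ?thesis by blast
qed

lemma ex_maps_part_finite:
  assumes V: "V \<in> fmeasurable M" shows "\<exists>F. maps_part F V {0..<measure M V}"
proof (rule ex_maps_part)
  show "V \<in> sets M" using V by (rule fmeasurableD)
  fix a :: real assume a: "0 \<le> a"
  have "{..<a} \<inter> {0..<measure M V} = {0..<min a (measure M V)}" by auto
  then have "emeasure lborel ({..<a} \<inter> {0..<measure M V}) = ennreal (min a (measure M V))" using a by simp
  also have "\<dots> = min (ennreal a) (ennreal (measure M V))" using a by (simp add: min_def ennreal_le_iff)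
  also have "ennreal (measure M V) = emeasure M V" using emeasure_eq_measure2[OF V] by simp
  finally show "min (ennreal a) (emeasure M V) = emeasure lborel ({..<a} \<inter> {0..<measure M V})" by simp
qed auto

lemma ex_maps_part_infinite:
  assumes V: "V \<in> sets M" "emeasure M V = \<infinity>" shows "\<exists>F. maps_part F V {0..}"
proof (rule ex_maps_part[OF V(1)])
  fix a :: real assume a: "0 \<le> a"
  have "{..<a} \<inter> {0..} = {0..<a}" by auto
  then show "min (ennreal a) (emeasure M V) = emeasure lborel ({..<a} \<inter> {0..})" using a V(2) by simp
qed auto

lemma maps_part_shift:
  assumes m: "maps_part f V Y" and Y': "Y' \<in> sets borel" "\<And>y. c + y \<in> Y' \<longleftrightarrow> y \<in> Y"
  shows "maps_part (\<lambda>x. c + f x) V Y'"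
  unfolding maps_part_def
proof (intro conjI ballI)
  note m = maps_partD[OF m]
  show "(\<lambda>x. c + f x) \<in> borel_measurable M" using m(1) by auto
  show "V \<in> sets M" "Y' \<in> sets borel" by fact+
  show "\<exists>N\<in>null_sets M. inj_on (\<lambda>x. c + f x) (V - N)" using m(4) by (auto simp: inj_on_def)
  fix G :: "real set" assume G: "G \<in> sets borel"
  have G': "(+) c -` G \<in> sets borel" using measurable_sets[of "(+) c" borel borel G] G by auto
  have "(\<lambda>x. c + f x) -` G \<inter> V = f -` ((+) c -` G) \<inter> V" by auto
  then have "emeasure M ((\<lambda>x. c + f x) -` G \<inter> V) = emeasure lborel ((+) c -` G \<inter> Y)" using m(5)[OF G'] by simp
  also have "(+) c -` G \<inter> Y = (+) c -` (G \<inter> Y') \<inter> space lborel" using Y'(2) by auto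
  also have "emeasure lborel ((+) c -` (G \<inter> Y') \<inter> space lborel) = emeasure (distr lborel borel ((+) c)) (G \<inter> Y')"
    using G Y'(1) by (intro emeasure_distr[symmetric]) auto
  also have "\<dots> = emeasure lborel (G \<inter> Y')" by (simp add: lborel_distr_plus)
  finally show "emeasure M ((\<lambda>x. c + f x) -` G \<inter> V) = emeasure lborel (G \<inter> Y')" .
qed

lemma maps_part_image:
  assumes T: "T \<in> automorphisms M" and m: "maps_part f V Y"
  shows "maps_part (\<lambda>x. f (inv_into (space M) T x)) (T ` V) Y"
proof -
  note m = maps_partD[OF m]
  have Vs: "V \<subseteq> space M" using m(2) sets.sets_into_space by blast
  have inv: "inv_into (space M) T (T x) = x" if "x \<in> space M" for x by (rule inv_into_f_f[OF aut_inj[OF T] that])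
  have i: "inv_into (space M) T \<in> M \<rightarrow>\<^sub>M M" using T by (simp add: automorphisms_def)
  have b: "(\<lambda>x. f (inv_into (space M) T x)) \<in> borel_measurable M" by (rule measurable_compose[OF i m(1)])
  obtain N where N: "N \<in> null_sets M" "inj_on f (V - N)" using m(4) by blast
  have j: "inj_on (\<lambda>x. f (inv_into (space M) T x)) (T ` V - T ` N)"
  proof (rule inj_onI)
    fix x y assume x: "x \<in> T ` V - T ` N" and y: "y \<in> T ` V - T ` N"
      and e: "f (inv_into (space M) T x) = f (inv_into (space M) T y)"
    obtain x' where x': "x = T x'" "x' \<in> V - N" using x by blast
    obtain y' where y': "y = T y'" "y' \<in> V - N" using y by blast
    have "inv_into (space M) T x = x'" "inv_into (space M) T y = y'" using inv x' y' Vs by blast+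
    then have "f x' = f y'" using e by simp
    then show "x = y" using N(2) x' y' by (auto dest: inj_onD)
  qed
  have p: "emeasure M ((\<lambda>x. f (inv_into (space M) T x)) -` G \<inter> T ` V) = emeasure lborel (G \<inter> Y)" if G: "G \<in> sets borel" for G
  proof -
    have "(\<lambda>x. f (inv_into (space M) T x)) -` G \<inter> T ` V = T ` (f -` G \<inter> V)" using Vs inv by (auto simp: subset_iff)
    then show ?thesis using automorphismsD(5)[OF T m(6)[OF G]] m(5)[OF G] by simp
  qed
  show ?thesis unfolding maps_part_def
    using b p m(3) automorphismsD(3)[OF T m(2)] bexI[where P = "\<lambda>N. inj_on (\<lambda>x. f (inv_into (space M) T x)) (T ` V - N)", OF j aut_null(1)[OF T N(1)]]
    by simp
qed

text \<open>Values from different parts do not coincide, because up to a null set they lie in the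
  disjoint sets \<open>Y1\<close> and \<open>Y2\<close>.\<close>

lemma maps_part_Un:
  assumes m1: "maps_part f1 V1 Y1" and m2: "maps_part f2 V2 Y2" and V: "V1 \<inter> V2 = {}" and Y: "Y1 \<inter> Y2 = {}"
  shows "maps_part (\<lambda>x. if x \<in> V1 then f1 x else f2 x) (V1 \<union> V2) (Y1 \<union> Y2)"
proof -
  let ?f = "\<lambda>x. if x \<in> V1 then f1 x else f2 x"
  note a = maps_partD[OF m1] and b = maps_partD[OF m2]
  have bm: "?f \<in> borel_measurable M" using a(1,2) b(1) by (intro measurable_If_set) (auto simp: sets.sets_into_space Int_absorb2)
  obtain N1 where N1: "N1 \<in> null_sets M" "inj_on f1 (V1 - N1)" using a(4) by blast
  obtain N2 where N2: "N2 \<in> null_sets M" "inj_on f2 (V2 - N2)" using b(4) by blast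
  obtain N3 where N3: "N3 \<in> null_sets M" "{x\<in>space M. \<not> (x \<in> V1 \<longrightarrow> f1 x \<in> Y1)} \<subseteq> N3"
    using maps_part_AE[OF m1] by (auto simp: eventually_ae_filter)
  obtain N4 where N4: "N4 \<in> null_sets M" "{x\<in>space M. \<not> (x \<in> V2 \<longrightarrow> f2 x \<in> Y2)} \<subseteq> N4"
    using maps_part_AE[OF m2] by (auto simp: eventually_ae_filter)
  let ?N = "N1 \<union> N2 \<union> N3 \<union> N4"
  have N: "?N \<in> null_sets M" using N1 N2 N3 N4 by blast
  have Vs: "V1 \<subseteq> space M" "V2 \<subseteq> space M" using a(2) b(2) sets.sets_into_space by blast+
  have in1: "f1 x \<in> Y1" if "x \<in> V1 - ?N" for x using N3(2) that Vs(1) by blast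
  have in2: "f2 x \<in> Y2" if "x \<in> V2 - ?N" for x using N4(2) that Vs(2) by blast
  have j: "inj_on ?f (V1 \<union> V2 - ?N)"
  proof (rule inj_onI)
    fix x y assume x: "x \<in> V1 \<union> V2 - ?N" and y: "y \<in> V1 \<union> V2 - ?N" and e: "?f x = ?f y"
    consider "x \<in> V1" "y \<in> V1" | "x \<in> V1" "y \<in> V2" "y \<notin> V1" | "x \<in> V2" "x \<notin> V1" "y \<in> V1" | "x \<in> V2" "x \<notin> V1" "y \<in> V2" "y \<notin> V1"
      using x y by blast
    then show "x = y"
    proof cases
      case 1 then show ?thesis using e x y N1(2) by (auto dest: inj_onD)
    next
      case 2 then show ?thesis using e x y in1[of x] in2[of y] Y by auto
    next
      case 3 then show ?thesis using e x y in1[of y] in2[of x] Y by auto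
    next
      case 4 then show ?thesis using e x y N2(2) by (auto dest: inj_onD)
    qed
  qed
  have p: "emeasure M (?f -` G \<inter> (V1 \<union> V2)) = emeasure lborel (G \<inter> (Y1 \<union> Y2))" if G: "G \<in> sets borel" for G
  proof -
    have "?f -` G \<inter> (V1 \<union> V2) = (f1 -` G \<inter> V1) \<union> (f2 -` G \<inter> V2)" using V by (auto split: if_splits)
    then have "emeasure M (?f -` G \<inter> (V1 \<union> V2)) = emeasure M (f1 -` G \<inter> V1) + emeasure M (f2 -` G \<inter> V2)"
      using a(6)[OF G] b(6)[OF G] V by (simp only:) (intro plus_emeasure[symmetric], auto)
    also have "\<dots> = emeasure lborel (G \<inter> Y1) + emeasure lborel (G \<inter> Y2)" using a(5)[OF G] b(5)[OF G] by simp
    also have "\<dots> = emeasure lborel ((G \<inter> Y1) \<union> (G \<inter> Y2))" using G a(3) b(3) Y by (intro plus_emeasure) auto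
    finally show ?thesis by (simp only: Int_Un_distrib)
  qed
  show ?thesis unfolding maps_part_def
    using bm p a(2,3) b(2,3) bexI[where P = "\<lambda>N. inj_on ?f (V1 \<union> V2 - N)", OF j N] by simp
qed

lemma maps_part_UN:
  fixes n :: nat
  assumes m: "\<And>k. k < n \<Longrightarrow> maps_part (f k) (V k) (Y k)"
    and V: "\<And>k k'. k < n \<Longrightarrow> k' < n \<Longrightarrow> k \<noteq> k' \<Longrightarrow> V k \<inter> V k' = {}"
    and Y: "\<And>k k'. k < n \<Longrightarrow> k' < n \<Longrightarrow> k \<noteq> k' \<Longrightarrow> Y k \<inter> Y k' = {}"
  shows "\<exists>F. maps_part F (\<Union>k<n. V k) (\<Union>k<n. Y k) \<and> (\<forall>k<n. \<forall>x\<in>V k. F x = f k x)"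
  using assms
proof (induction n rule: nat_induct)
  case 0
  have "maps_part (\<lambda>x. 0) {} {}" unfolding maps_part_def by auto
  then show ?case by auto
next
  case (Suc n)
  have "\<exists>F. maps_part F (\<Union>k<n. V k) (\<Union>k<n. Y k) \<and> (\<forall>k<n. \<forall>x\<in>V k. F x = f k x)"
  proof (rule Suc.IH)
    show "maps_part (f k) (V k) (Y k)" if "k < n" for k using that by (intro Suc.prems(1)) simp
    show "V k \<inter> V k' = {}" if "k < n" "k' < n" "k \<noteq> k'" for k k' using that by (intro Suc.prems(2)) auto
    show "Y k \<inter> Y k' = {}" if "k < n" "k' < n" "k \<noteq> k'" for k k' using that by (intro Suc.prems(3)) auto
  qed
  then obtain F where F: "maps_part F (\<Union>k<n. V k) (\<Union>k<n. Y k)" "\<forall>k<n. \<forall>x\<in>V k. F x = f k x" by blast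
  have Vn: "V n \<inter> V k = {}" and Yn: "Y n \<inter> Y k = {}" if "k < n" for k
    using that Suc.prems(2)[of n k] Suc.prems(3)[of n k] by auto
  have d: "V n \<inter> (\<Union>k<n. V k) = {}" "Y n \<inter> (\<Union>k<n. Y k) = {}" using Vn Yn by blast+
  have mn: "maps_part (f n) (V n) (Y n)" by (rule Suc.prems(1)) simp
  have "maps_part (\<lambda>x. if x \<in> V n then f n x else F x) (V n \<union> (\<Union>k<n. V k)) (Y n \<union> (\<Union>k<n. Y k))"
    by (rule maps_part_Un[OF mn F(1) d])
  moreover have "V n \<union> (\<Union>k<n. V k) = (\<Union>k<Suc n. V k)" "Y n \<union> (\<Union>k<n. Y k) = (\<Union>k<Suc n. Y k)"
    by (auto simp: less_Suc_eq)
  moreover have "\<forall>k<Suc n. \<forall>x\<in>V k. (if x \<in> V n then f n x else F x) = f k x"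
    using F(2) d(1) by (auto simp: less_Suc_eq)
  ultimately have "maps_part (\<lambda>x. if x \<in> V n then f n x else F x) (\<Union>k<Suc n. V k) (\<Union>k<Suc n. Y k) \<and>
      (\<forall>k<Suc n. \<forall>x\<in>V k. (if x \<in> V n then f n x else F x) = f k x)" by argo
  then show ?case by (intro exI[of _ "\<lambda>x. if x \<in> V n then f n x else F x"])
qed

text \<open>A coordinate on \<open>B\<close> is cut at the multiples of \<open>w\<close>; what
  remains beyond the last full piece is shorter than \<open>w\<close>.\<close>

lemma ex_equal_pieces:
  assumes B: "B \<in> fmeasurable M" and w: "0 < w"
  shows "\<exists>(n::nat) C. (\<forall>i<n. C i \<in> fmeasurable M \<and> C i \<subseteq> B \<and> measure M (C i) = w) \<and>
    disjoint_family_on C {..<n} \<and> measure M (B - (\<Union>i<n. C i)) \<le> w"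
proof -
  let ?b = "measure M B"
  obtain F where F: "maps_part F B {0..<?b}" using ex_maps_part_finite[OF B] by blast
  note m = maps_partD[OF F]
  define n where "n = nat \<lfloor>?b / w\<rfloor>"
  have n: "real n * w \<le> ?b" "?b < real n * w + w"
  proof -
    have "0 \<le> ?b / w" using w by simp
    then have "real n \<le> ?b / w" "?b / w < real n + 1" unfolding n_def by linarith+
    then show "real n * w \<le> ?b" "?b < real n * w + w" using w by (simp_all add: pos_le_divide_eq pos_divide_less_eq distrib_right)
  qed
  define C where "C = (\<lambda>i. F -` {real i * w..<real i * w + w} \<inter> B)"
  have "C i \<in> fmeasurable M \<and> C i \<subseteq> B \<and> measure M (C i) = w" if i: "i < n" for i
  proof -
    have "real i + 1 \<le> real n" using i by linarith
    then have "(real i + 1) * w \<le> real n * w" using w by (intro mult_right_mono) auto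
    then have "real i * w + w \<le> ?b" using n(1) by (simp add: distrib_right)
    moreover have "0 \<le> real i * w" using w by simp
    ultimately have "{real i * w..<real i * w + w} \<inter> {0..<?b} = {real i * w..<real i * w + w}" by auto
    then have "emeasure M (C i) = ennreal w" unfolding C_def using m(5)[of "{real i * w..<real i * w + w}"] w by simp
    moreover have "C i \<in> sets M" unfolding C_def by (rule m(6)) auto
    ultimately show ?thesis using w by (auto simp: C_def fmeasurable_def measure_def)
  qed
  moreover have "disjoint_family_on C {..<n}"
  proof -
    have less: "C i \<inter> C j = {}" if "i < j" for i j
    proof -
      have "real i + 1 \<le> real j" using that by linarith
      then have "(real i + 1) * w \<le> real j * w" using w by (intro mult_right_mono) auto
      then show ?thesis unfolding C_def by (auto simp: distrib_right)
    qed
    show ?thesis unfolding disjoint_family_on_def using less by (metis Int_commute nat_neq_iff)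
  qed
  moreover have "measure M (B - (\<Union>i<n. C i)) \<le> w"
  proof -
    \<comment> \<open>Negative values of \<open>F\<close> occur only on a null set, but the points
      there have to be covered as well.\<close>
    let ?G = "{..<0} \<union> {real n * w..}"
    have G: "?G \<in> sets borel" by auto
    have "B - (\<Union>i<n. C i) \<subseteq> F -` ?G \<inter> B"
    proof
      fix x assume x: "x \<in> B - (\<Union>i<n. C i)"
      have "F x \<in> ?G"
      proof (rule ccontr)
        assume "F x \<notin> ?G"
        then have y: "0 \<le> F x" "F x < real n * w" by auto
        define i where "i = nat \<lfloor>F x / w\<rfloor>"
        have "0 \<le> F x / w" using y w by simp
        then have "real i \<le> F x / w" "F x / w < real i + 1" unfolding i_def by linarith+
        then have i: "real i * w \<le> F x" "F x < real i * w + w" using w by (simp_all add: pos_le_divide_eq pos_divide_less_eq distrib_right)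
        have "real i * w < real n * w" using i(1) y(2) by linarith
        then have "i < n" using w by simp
        then show False using x i unfolding C_def by auto
      qed
      then show "x \<in> F -` ?G \<inter> B" using x by auto
    qed
    moreover have e: "emeasure M (F -` ?G \<inter> B) = ennreal (?b - real n * w)"
    proof -
      have "0 \<le> real n * w" using w by simp
      then have "?G \<inter> {0..<?b} = {real n * w..<?b}" by auto
      then show ?thesis using m(5)[OF G] n by simp
    qed
    moreover have "F -` ?G \<inter> B \<in> fmeasurable M" using e m(6)[OF G] by (auto simp: fmeasurable_def)
    ultimately have "measure M (B - (\<Union>i<n. C i)) \<le> measure M (F -` ?G \<inter> B)"
      using m(6) B by (intro measure_mono_fmeasurable sets.Diff sets.finite_UN) (auto simp: C_def dest: fmeasurableD)
    also have "\<dots> = ?b - real n * w" using e n(1) by (simp add: measure_def)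
    finally show ?thesis using n(2) by simp
  qed
  ultimately show ?thesis by - (rule exI[of _ n], rule exI[of _ C], simp)
qed

end

section \<open>Extending finitely many columns to a mixing rank-one map\<close>

lemma bij_betw_extend:
  assumes "finite X" "U \<subseteq> X" "Z \<subseteq> X" "bij_betw f U Z"
  shows "\<exists>g. bij_betw g X X \<and> (\<forall>u\<in>U. g u = f u)"
proof -
  have fin: "finite U" "finite Z" using assms finite_subset by blast+
  have "card (X - U) = card (X - Z)"
    using assms fin bij_betw_same_card[OF assms(4)] by (simp add: card_Diff_subset)
  then have "\<exists>k. bij_betw k (X - U) (X - Z)" using assms(1) by (intro finite_same_card_bij) auto
  then obtain k where k: "bij_betw k (X - U) (X - Z)" ..
  let ?g = "\<lambda>x. if x \<in> U then f x else k x"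
  have "bij_betw ?g U Z \<longleftrightarrow> bij_betw f U Z" by (intro bij_betw_cong) simp
  then have "bij_betw ?g U Z" using assms(4) by (rule iffD2)
  moreover have "bij_betw ?g (X - U) (X - Z)"
  proof -
    have "bij_betw ?g (X - U) (X - Z) \<longleftrightarrow> bij_betw k (X - U) (X - Z)" by (intro bij_betw_cong) auto
    then show ?thesis using k by simp
  qed
  ultimately have "bij_betw ?g (U \<union> (X - U)) (Z \<union> (X - Z))" by (intro bij_betw_combine) auto
  moreover have "U \<union> (X - U) = X" "Z \<union> (X - Z) = X" using assms by auto
  ultimately have "bij_betw ?g X X" by simp
  then show ?thesis by (intro exI[of _ ?g]) simp
qed

lemma gap_mono: "i \<le> j \<Longrightarrow> gap H i \<le> gap H j"
  unfolding gap_def by (intro mult_le_mono2 diff_le_mono power_increasing) auto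

lemma gap_less: "i < j \<Longrightarrow> gap H i + H \<le> gap H j"
proof -
  assume "i < j"
  then have "gap H (Suc i) \<le> gap H j" by (intro gap_mono) simp
  moreover have "H \<le> 8 * H * 2 ^ i" by simp
  ultimately show ?thesis unfolding gap_Suc by linarith
qed

lemma gap_inj:
  assumes "gap H m + t = gap H m' + t'" "t < H" "t' < H"
  shows "m = m' \<and> t = t'"
proof -
  have "\<not> m < m'" "\<not> m' < m" using gap_less[of m m' H] gap_less[of m' m H] assms by auto
  then show ?thesis using assms(1) by simp
qed

text \<open>The part of \<open>T\<close> that is to be kept: finitely many disjoint columns of
  bounded height over bases of one common measure \<open>wd\<close>, which becomes the width of the
  levels of the first tower.\<close>

locale column_system = leb_space M g X0 for M :: "'a measure" and g X0 +
  fixes T :: "'a \<Rightarrow> 'a" and q :: nat and \<tau> :: "nat \<Rightarrow> nat" and H :: nat and C :: "nat \<Rightarrow> 'a set" and wd :: real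
  assumes T: "T \<in> automorphisms M" and wd: "0 < wd" and C_fm: "\<And>m. m < q \<Longrightarrow> C m \<in> fmeasurable M"
    and C_measure: "\<And>m. m < q \<Longrightarrow> measure M (C m) = wd" and \<tau>_le: "\<And>m. m < q \<Longrightarrow> \<tau> m \<le> H"
    and C_disj: "\<And>m t m' t'. m < q \<Longrightarrow> t < \<tau> m \<Longrightarrow> m' < q \<Longrightarrow> t' < \<tau> m' \<Longrightarrow> (m, t) \<noteq> (m', t') \<Longrightarrow>
      (T ^^ t) ` C m \<inter> (T ^^ t') ` C m' = {}"
begin

abbreviation "cell m t \<equiv> (T ^^ t) ` C m"

lemma cell_fm: "m < q \<Longrightarrow> cell m t \<in> fmeasurable M" by (rule level_fmeasurable[OF T C_fm])

lemma cell_sub: "m < q \<Longrightarrow> cell m t \<subseteq> space M"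
  using cell_fm fmeasurableD sets.sets_into_space by blast

lemma T_cell: "x \<in> cell m t \<Longrightarrow> T x \<in> cell m (Suc t)" by auto

lemma T_funpow_cell: "x \<in> cell m t \<Longrightarrow> (T ^^ n) x \<in> cell m (t + n)"
  by (induction n) auto

text \<open>The height of the first tower: column \<open>m\<close> occupies levels from
  \<open>gap H m\<close> on, all of them below \<open>gap H q\<close>.\<close>

definition h0 :: nat where "h0 = Suc (gap H q)"

lemma index_less: "m < q \<Longrightarrow> t < \<tau> m \<Longrightarrow> gap H m + t < h0"
  unfolding h0_def using gap_less[of m q H] \<tau>_le[of m] by linarith

text \<open>The coordinate of a base is carried along its column by the powers of \<open>T\<close>,
  so that \<open>T\<close> becomes a translation from cell to cell. The cells fill the intervals
  with the first \<open>N\<close> numbers. The rest of the space still has infinite measure and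
  fills the remaining half-line, which supplies the other levels of the tower.\<close>

lemma ex_coding:
  "\<exists>\<psi> \<sigma>0. bij_betw \<sigma>0 {..<h0} {..<h0} \<and> maps_onto \<psi> {0..} \<and>
    (AE x in M. \<forall>m<q. \<forall>t<\<tau> m. x \<in> cell m t \<longrightarrow>
       \<psi> x \<in> {real (\<sigma>0 (gap H m + t)) * wd..<real (\<sigma>0 (gap H m + t)) * wd + wd}) \<and>
    (\<forall>m<q. \<forall>t. Suc t < \<tau> m \<longrightarrow> (\<forall>x\<in>cell m t.
       \<psi> (T x) = \<psi> x + (real (\<sigma>0 (gap H m + Suc t)) - real (\<sigma>0 (gap H m + t))) * wd))"
proof -
  define I where "I = (SIGMA m:{..<q}. {..<\<tau> m})"
  have finI: "finite I" unfolding I_def by auto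
  define N where "N = card I"
  define code where "code = (\<lambda>(m,t). gap H m + t)"
  have codei: "inj_on code I"
  proof (rule inj_onI, clarify)
    fix m t m' t' assume a: "(m,t) \<in> I" "(m',t') \<in> I" "code (m,t) = code (m',t')"
    then have "t < H" "t' < H" using \<tau>_le[of m] \<tau>_le[of m'] unfolding I_def by auto
    then show "m = m' \<and> t = t'" using a(3) gap_inj[of H m t m' t'] unfolding code_def by simp
  qed
  have codeU: "code ` I \<subseteq> {..<h0}" using index_less unfolding code_def I_def by auto
  have cN: "card (code ` I) = N" unfolding N_def by (rule card_image[OF codei])
  have Nh: "N \<le> h0" using card_mono[OF _ codeU] cN by simp
  obtain e where e: "bij_betw e (code ` I) {..<N}"
    using ex_bij_betw_finite_nat[of "code ` I"] finI cN by (auto simp: atLeast0LessThan)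
  \<comment> \<open>The levels that carry cells receive the numbers below \<open>N\<close>; the
    others are numbered arbitrarily.\<close>
  obtain \<sigma>0 where \<sigma>0: "bij_betw \<sigma>0 {..<h0} {..<h0}" "\<forall>u\<in>code ` I. \<sigma>0 u = e u"
    using bij_betw_extend[OF _ codeU _ e] Nh by auto
  have b: "bij_betw (\<lambda>p. \<sigma>0 (code p)) I {..<N}"
  proof -
    have "bij_betw (e \<circ> code) I {..<N}" using bij_betw_trans[OF bij_betw_imageI[OF codei refl] e] .
    then show ?thesis by (rule bij_betw_cong[THEN iffD1, rotated]) (use \<sigma>0(2) in auto)
  qed
  define d where "d = inv_into I (\<lambda>p. \<sigma>0 (code p))"
  have d: "d k \<in> I" "\<sigma>0 (code (d k)) = k" if "k < N" for k
    using that b unfolding d_def bij_betw_def by (auto intro!: inv_into_into f_inv_into_f)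
  have dinv: "d (\<sigma>0 (code p)) = p" "\<sigma>0 (code p) < N" if "p \<in> I" for p
    using that b unfolding d_def bij_betw_def by (auto intro!: inv_into_f_f)
  have "\<exists>F. maps_part F (C m) {0..<wd}" if "m < q" for m
    using ex_maps_part_finite[OF C_fm[OF that]] C_measure[OF that] by simp
  then obtain F where F: "\<And>m. m < q \<Longrightarrow> maps_part (F m) (C m) {0..<wd}" by metis
  define G where "G = (\<lambda>(m,t) x. real (\<sigma>0 (code (m,t))) * wd + F m (inv_into (space M) (T ^^ t) x))"
  define V where "V = (\<lambda>(m,t). cell m t)"
  define Y where "Y = (\<lambda>k::nat. {real k * wd..<real k * wd + wd})"
  have G: "maps_part (G p) (V p) (Y (\<sigma>0 (code p)))" if p: "p \<in> I" for p
  proof -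
    obtain m t where mt: "p = (m,t)" "m < q" using p unfolding I_def by auto
    have "maps_part (\<lambda>x. F m (inv_into (space M) (T ^^ t) x)) (cell m t) {0..<wd}"
      by (rule maps_part_image[OF aut_funpow[OF T] F[OF mt(2)]])
    then show ?thesis unfolding mt(1) G_def V_def Y_def prod.case by (rule maps_part_shift) auto
  qed
  have Vd: "V p \<inter> V p' = {}" if pp: "p \<in> I" "p' \<in> I" "p \<noteq> p'" for p p'
  proof -
    obtain m t where p: "p = (m,t)" "m < q" "t < \<tau> m" using pp(1) unfolding I_def by auto
    obtain m' t' where p': "p' = (m',t')" "m' < q" "t' < \<tau> m'" using pp(2) unfolding I_def by auto
    have "cell m t \<inter> cell m' t' = {}" by (rule C_disj) (use p p' pp(3) in auto)
    then show ?thesis unfolding V_def p(1) p'(1) prod.case .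
  qed
  have Yd: "Y k \<inter> Y k' = {}" if "k \<noteq> k'" for k k'
  proof -
    have "Y i \<inter> Y j = {}" if "i < j" for i j
    proof -
      have "(real i + 1) * wd \<le> real j * wd" using that wd by (intro mult_right_mono) auto
      then show ?thesis unfolding Y_def by (auto simp: distrib_right)
    qed
    then show ?thesis using that by (metis Int_commute nat_neq_iff)
  qed
  have Yu: "(\<Union>k<n. Y k) = {0..<real n * wd}" for n
  proof (induction n)
    case (Suc n)
    have "(\<Union>k<Suc n. Y k) = (\<Union>k<n. Y k) \<union> Y n" by (auto simp: less_Suc_eq)
    also have "\<dots> = {0..<real n * wd} \<union> Y n" by (simp only: Suc)
    also have "\<dots> = {0..<real (Suc n) * wd}"
    proof -
      have gen: "{0..<a} \<union> {a..<a + wd} = {0..<a + wd}" if "0 \<le> a" for a using that wd by auto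
      have e: "real (Suc n) * wd = real n * wd + wd" by (simp add: distrib_right)
      show ?thesis unfolding Y_def e by (rule gen) (use wd in simp)
    qed
    finally show ?case .
  qed auto
  have md: "maps_part (G (d k)) (V (d k)) (Y k)" if "k < N" for k using G[OF d(1)[OF that]] d(2)[OF that] by simp
  have Vdd: "V (d k) \<inter> V (d k') = {}" if "k < N" "k' < N" "k \<noteq> k'" for k k'
  proof -
    have "d k \<noteq> d k'" using d(2)[OF that(1)] d(2)[OF that(2)] that(3) by auto
    then show ?thesis using Vd d(1) that by blast
  qed
  obtain f where f: "maps_part f (\<Union>k<N. V (d k)) (\<Union>k<N. Y k)" "\<forall>k<N. \<forall>x\<in>V (d k). f x = G (d k) x"
    using maps_part_UN[of N "\<lambda>k. G (d k)" "\<lambda>k. V (d k)" Y, OF md Vdd Yd] by blast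
  define Q where "Q = (\<Union>k<N. V (d k))"
  have "V p \<in> fmeasurable M" if "p \<in> I" for p using that cell_fm unfolding V_def I_def by auto
  then have Qfm: "Q \<in> fmeasurable M" unfolding Q_def using d(1) by (intro fmeasurable.finite_UN) auto
  have Qs: "Q \<subseteq> space M" using Qfm fmeasurableD sets.sets_into_space by blast
  have "emeasure M (space M) \<le> emeasure M (space M - Q) + emeasure M Q"
  proof -
    have "emeasure M ((space M - Q) \<union> Q) \<le> emeasure M (space M - Q) + emeasure M Q"
      using fmeasurableD[OF Qfm] by (intro emeasure_subadditive) auto
    moreover have "(space M - Q) \<union> Q = space M" using Qs by auto
    ultimately show ?thesis by simp
  qed
  then have "emeasure M (space M - Q) = \<infinity>" using emeasure_space fmeasurableD2[OF Qfm] by (auto simp: top_unique)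
  then obtain f2 where f2: "maps_part f2 (space M - Q) {0..}"
    using ex_maps_part_infinite[of "space M - Q"] fmeasurableD[OF Qfm] by auto
  define \<psi> where "\<psi> = (\<lambda>x. if x \<in> Q then f x else real N * wd + f2 x)"
  have "maps_part (\<lambda>x. real N * wd + f2 x) (space M - Q) {real N * wd..}" by (rule maps_part_shift[OF f2]) auto
  then have "maps_part \<psi> (Q \<union> (space M - Q)) ({0..<real N * wd} \<union> {real N * wd..})" unfolding \<psi>_def
    using f(1) unfolding Yu Q_def[symmetric] by (intro maps_part_Un) auto
  moreover have "Q \<union> (space M - Q) = space M" using Qs by auto
  moreover have "{0..<real N * wd} \<union> {real N * wd..} = {0..}" 
  proof -
    have "0 \<le> real N * wd" using wd by simp
    then show ?thesis by auto
  qed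
  ultimately have onto: "maps_onto \<psi> {0..}" using maps_onto_of_part by simp
  have \<psi>_eq: "\<psi> x = G p x" if "p \<in> I" "x \<in> V p" for p x
  proof -
    have "x \<in> V (d (\<sigma>0 (code p)))" using dinv(1)[OF that(1)] that(2) by simp
    then have "x \<in> Q" "f x = G (d (\<sigma>0 (code p))) x" unfolding Q_def using f(2) dinv(2)[OF that(1)] by blast+
    then show ?thesis unfolding \<psi>_def using dinv(1)[OF that(1)] by simp
  qed
  have "AE x in M. \<forall>p\<in>I. x \<in> V p \<longrightarrow> \<psi> x \<in> Y (\<sigma>0 (code p))"
  proof (rule AE_finite_allI[OF finI])
    show "AE x in M. x \<in> V p \<longrightarrow> \<psi> x \<in> Y (\<sigma>0 (code p))" if p: "p \<in> I" for p
      using maps_part_AE[OF G[OF p]] by eventually_elim (use \<psi>_eq[OF p] in auto)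
  qed
  then have 1: "AE x in M. \<forall>m<q. \<forall>t<\<tau> m. x \<in> cell m t \<longrightarrow>
       \<psi> x \<in> {real (\<sigma>0 (gap H m + t)) * wd..<real (\<sigma>0 (gap H m + t)) * wd + wd}"
    by eventually_elim (force simp: I_def V_def code_def Y_def)
  have 2: "\<psi> (T x) = \<psi> x + (real (\<sigma>0 (gap H m + Suc t)) - real (\<sigma>0 (gap H m + t))) * wd"
    if m: "m < q" and t: "Suc t < \<tau> m" and x: "x \<in> cell m t" for m t x
  proof -
    obtain y where y: "y \<in> C m" "x = (T ^^ t) y" using x by blast
    have ys: "y \<in> space M" using cell_sub[OF m, of 0] y(1) by auto
    have inv: "inv_into (space M) (T ^^ s) ((T ^^ s) y) = y" for s by (rule inv_into_f_f[OF aut_inj[OF aut_funpow[OF T]] ys])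
    have I: "(m,t) \<in> I" "(m, Suc t) \<in> I" using m t unfolding I_def by auto
    have "\<psi> x = G (m,t) x" by (rule \<psi>_eq[OF I(1)]) (use x in \<open>simp add: V_def\<close>)
    moreover have "\<psi> (T x) = G (m,Suc t) (T x)" by (rule \<psi>_eq[OF I(2)]) (use T_cell[OF x] in \<open>simp add: V_def\<close>)
    moreover have "G (m,t) x = real (\<sigma>0 (gap H m + t)) * wd + F m y" unfolding G_def code_def y(2) by (simp add: inv)
    moreover have "G (m,Suc t) (T x) = real (\<sigma>0 (gap H m + Suc t)) * wd + F m y"
      unfolding G_def code_def y(2) using inv[of "Suc t"] by simp
    ultimately show ?thesis by (simp add: algebra_simps)
  qed
  show ?thesis using \<sigma>0(1) onto 1 2 by blast
qed

text \<open>Points of \<open>cell m t\<close> and \<open>cell m' t'\<close> with \<open>m \<noteq> m'\<close> are related by \<open>S ^^ n\<close> for at most one \<open>m\<close>, because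
  the columns sit at the levels \<open>gap H m\<close>; the other returns are controlled by \<open>ret 0 n\<close>.\<close>

theorem ex_rank_one_extension:
  assumes c: "0 < c"
  shows "\<exists>S\<in>automorphisms M. mixing M S \<and> rank_one M S \<and>
    (AE x in M. \<forall>m<q. \<forall>t. Suc t < \<tau> m \<longrightarrow> x \<in> cell m t \<longrightarrow> S x = T x) \<and>
    (\<forall>n. \<exists>E\<in>fmeasurable M. measure M E \<le> real H * wd + 2 * c \<and>
      (AE x in M. \<forall>m<q. \<forall>t<\<tau> m. \<forall>m'<q. \<forall>t'<\<tau> m'. x \<in> cell m t \<longrightarrow> (S ^^ n) x \<in> cell m' t' \<longrightarrow> x \<in> E \<or> t + n < \<tau> m))"
proof -
  obtain \<psi> \<sigma>0 where \<sigma>0: "bij_betw \<sigma>0 {..<h0} {..<h0}" and onto: "maps_onto \<psi> {0..}"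
    and cell_ae: "AE x in M. \<forall>m<q. \<forall>t<\<tau> m. x \<in> cell m t \<longrightarrow>
       \<psi> x \<in> {real (\<sigma>0 (gap H m + t)) * wd..<real (\<sigma>0 (gap H m + t)) * wd + wd}"
    and step: "\<And>m t x. m < q \<Longrightarrow> Suc t < \<tau> m \<Longrightarrow> x \<in> cell m t \<Longrightarrow>
       \<psi> (T x) = \<psi> x + (real (\<sigma>0 (gap H m + Suc t)) - real (\<sigma>0 (gap H m + t))) * wd"
    using ex_coding by blast
  have "0 < h0" unfolding h0_def by simp
  then obtain h r where h_0: "h 0 = h0" and sc: "sidon_cutting h r wd \<sigma>0 c"
    using ex_sidon_cutting[OF _ wd c \<sigma>0] by blast
  interpret K: sidon_cutting h r wd \<sigma>0 c by (rule sc)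
  have inf: "cutting_inf h r (\<lambda>j. gap (h j)) wd \<sigma>0" by unfold_locales
  \<comment> \<open>The stacked map, pulled back through \<open>\<psi>\<close>. On the cells it
    agrees with \<open>T\<close> because both act there as the same translation.\<close>
  obtain S where S: "S \<in> automorphisms M" and SS: "AE x in M. \<psi> (S x) = K.S (\<psi> x)"
    using automorphism_between_maps[OF onto maps_onto_cutting[OF inf onto]] by blast
  have ro: "rank_one M S" by (rule rank_one_of_cutting[OF inf onto SS])
  have \<psi>m: "\<psi> \<in> borel_measurable M" and push: "\<And>G. G \<in> sets borel \<Longrightarrow> emeasure M (\<psi> -` G \<inter> space M) = emeasure lborel (G \<inter> {0..})"
    and "\<exists>N\<in>null_sets M. inj_on \<psi> (space M - N)"
    using onto unfolding maps_onto_def by auto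
  then obtain N where N: "N \<in> null_sets M" "inj_on \<psi> (space M - N)" by blast
  have SSn: "AE x in M. \<psi> ((S ^^ n) x) = (K.S ^^ n) (\<psi> x)" for n
  proof (induction n)
    case (Suc n)
    have "AE x in M. \<psi> (S ((S ^^ n) x)) = K.S (\<psi> ((S ^^ n) x))" using aut_AE[OF aut_funpow[OF S] SS] .
    with Suc show ?case by eventually_elim simp
  qed simp
  have lev0: "K.lev 0 u = {real (\<sigma>0 u) * wd..<real (\<sigma>0 u) * wd + wd}" for u
    unfolding K.lev_def by (simp add: K.\<sigma>_0)
  have cell_lev: "AE x in M. \<forall>m<q. \<forall>t<\<tau> m. x \<in> cell m t \<longrightarrow> \<psi> x \<in> K.lev 0 (gap H m + t)" using cell_ae unfolding lev0 .
  have retfm: "\<psi> -` K.ret j n \<inter> space M \<in> fmeasurable M \<and> measure M (\<psi> -` K.ret j n \<inter> space M) \<le> 2 * c * (1/2) ^ j" for j n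
  proof -
    have "emeasure M (\<psi> -` K.ret j n \<inter> space M) \<le> emeasure lborel (K.ret j n)"
      unfolding push[OF K.ret_borel] by (intro emeasure_mono) auto
    then have le: "emeasure M (\<psi> -` K.ret j n \<inter> space M) \<le> ennreal (2 * c * (1/2) ^ j)" using K.ret_le order_trans by blast
    moreover have "\<psi> -` K.ret j n \<inter> space M \<in> sets M" using measurable_sets[OF \<psi>m K.ret_borel] .
    ultimately have "\<psi> -` K.ret j n \<inter> space M \<in> fmeasurable M"
      by (auto simp: fmeasurable_def intro: order.strict_trans1)
    moreover have "measure M (\<psi> -` K.ret j n \<inter> space M) \<le> 2 * c * (1/2) ^ j"
      using le c unfolding measure_def by (intro enn2real_leI) auto
    ultimately show ?thesis by blast
  qed
  have ST: "AE x in M. \<forall>m<q. \<forall>t. Suc t < \<tau> m \<longrightarrow> x \<in> cell m t \<longrightarrow> S x = T x"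
  proof -
    have nN: "AE x in M. x \<notin> N" using AE_not_in[OF N(1)] .
    have "AE x in M. S x \<notin> N" "AE x in M. T x \<notin> N" using aut_AE[OF S nN] aut_AE[OF T nN] by auto
    with SS cell_lev AE_space show ?thesis
    proof eventually_elim
      case (elim x)
      show ?case
      proof (intro allI impI)
        fix m t assume m: "m < q" and t: "Suc t < \<tau> m" and x: "x \<in> cell m t"
        have l: "\<psi> x \<in> K.lev 0 (gap H m + t)" using elim(2) m t x by auto
        have "Suc (gap H m + t) < h 0" unfolding h_0 using index_less[OF m t] by simp
        from K.S_eq[OF l this] have "K.S (\<psi> x) = \<psi> x + (real (\<sigma>0 (gap H m + Suc t)) - real (\<sigma>0 (gap H m + t))) * wd"
          unfolding K.shift_def by (simp add: K.\<sigma>_0)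
        then have "\<psi> (S x) = \<psi> (T x)" using elim(1) step[OF m t x] by simp
        then show "S x = T x" using N(2) elim(3-5) aut_in_space[OF S] aut_in_space[OF T] by (auto dest: inj_onD)
      qed
    qed
  qed
  have ret: "\<exists>E\<in>fmeasurable M. measure M E \<le> real H * wd + 2 * c \<and>
      (AE x in M. \<forall>m<q. \<forall>t<\<tau> m. \<forall>m'<q. \<forall>t'<\<tau> m'. x \<in> cell m t \<longrightarrow> (S ^^ n) x \<in> cell m' t' \<longrightarrow> x \<in> E \<or> t + n < \<tau> m)" for n
  proof -
    \<comment> \<open>The columns from which a later column can be reached at time \<open>n\<close>.
      By \<open>gap_sidon\<close>, with \<open>H\<close> as bound for the offsets, there is at most
      one.\<close>
    define cross where "cross m \<longleftrightarrow> m < q \<and> (\<exists>m' t t'. m < m' \<and> t < H \<and> t' < H \<and> gap H m + t + n = gap H m' + t')" for m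
    obtain k where k: "\<And>m. cross m \<Longrightarrow> m = k"
    proof (cases "\<exists>m. cross m")
      case True
        then obtain k where kc: "cross k" by blast
      obtain m1 u u' where k: "k < m1" "u < H" "u' < H" "gap H k + u + n = gap H m1 + u'"
        using kc unfolding cross_def by blast
      have "m = k" if "cross m" for m
      proof -
        obtain m2 v v' where m: "m < m2" "v < H" "v' < H" "gap H m + v + n = gap H m2 + v'"
          using \<open>cross m\<close> unfolding cross_def by blast
        show ?thesis by (rule gap_sidon[OF m(2,3) k(2,3) m(1) k(1) m(4) k(4)])
      qed
      then show ?thesis by (rule that)
    qed blast
    \<comment> \<open>The exceptional set will consist of this single column, of measure at most
      \<open>H * wd\<close>, and of the nonclimbing returns to the first tower, of measure at most
      \<open>2 * c\<close>.\<close>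
    define E0 where "E0 = (\<Union>t\<in>(if k < q then {..<\<tau> k} else {}). cell k t)"
    have E0: "E0 \<in> fmeasurable M" unfolding E0_def using cell_fm[of k] by (intro fmeasurable.finite_UN) (auto split: if_splits)
    have E0m: "measure M E0 \<le> real H * wd"
    proof (cases "k < q")
      case True
      have "measure M E0 \<le> (\<Sum>t<\<tau> k. measure M (cell k t))"
        unfolding E0_def using True cell_fm[OF True] by (simp, intro measure_UNION_le) (auto dest: fmeasurableD)
      also have "\<dots> = real (\<tau> k) * wd" using level_measure[OF T C_fm[OF True]] C_measure[OF True] by simp
      also have "\<dots> \<le> real H * wd" using \<tau>_le[OF True] wd by (intro mult_right_mono) auto
      finally show ?thesis .
    qed (use wd in \<open>simp add: E0_def\<close>)
    let ?E = "E0 \<union> (\<psi> -` K.ret 0 n \<inter> space M)"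
    have "?E \<in> fmeasurable M" using E0 retfm[of 0 n] by blast
    moreover have "measure M ?E \<le> real H * wd + 2 * c"
      using measure_Un_le[of E0 M "\<psi> -` K.ret 0 n \<inter> space M"] E0 E0m retfm[of 0 n] by (auto dest: fmeasurableD)
    moreover have "AE x in M. \<forall>m<q. \<forall>t<\<tau> m. \<forall>m'<q. \<forall>t'<\<tau> m'. x \<in> cell m t \<longrightarrow> (S ^^ n) x \<in> cell m' t' \<longrightarrow> x \<in> ?E \<or> t + n < \<tau> m"
      using SSn[of n] cell_lev aut_AE[OF aut_funpow[OF S] cell_lev, of n] AE_space
    proof eventually_elim
      case (elim x)
      show ?case
      proof (intro allI impI)
        fix m t m' t' assume m: "m < q" "t < \<tau> m" and m': "m' < q" "t' < \<tau> m'"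
          and x: "x \<in> cell m t" and Sx: "(S ^^ n) x \<in> cell m' t'"
        have t: "t < H" "t' < H" using m m' \<tau>_le by (meson order.strict_trans2)+
        have l: "\<psi> x \<in> K.lev 0 (gap H m + t)" using elim(2) m x by blast
        have l': "(K.S ^^ n) (\<psi> x) \<in> K.lev 0 (gap H m' + t')" using elim(1,3) m' Sx by metis
        have u: "gap H m + t < h 0" "gap H m' + t' < h 0" unfolding h_0 using index_less m m' by auto
        show "x \<in> ?E \<or> t + n < \<tau> m"
        proof (cases "gap H m + t + n < h 0")
          case True
          have eq: "gap H m + t + n = gap H m' + t'"
            by (rule K.lev_unique[OF K.S_pow_lev[OF l True] l' True u(2)])
          have "\<not> m' < m" using gap_less[of m' m H] eq t by auto
          then consider "m = m'" | "m < m'" by linarith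
          then show ?thesis
          proof cases
            case 1 then show ?thesis using eq m'(2) by simp
          next
            case 2
            then have "m = k" using k[of m] m(1) t eq unfolding cross_def by blast
            then have "x \<in> E0" unfolding E0_def using m x by auto
            then show ?thesis by blast
          qed
        next
          case False
          have "\<psi> x \<notin> K.good 0 n"
          proof
            assume "\<psi> x \<in> K.good 0 n"
            then obtain u' where u': "u' + n < h 0" "\<psi> x \<in> K.lev 0 u'" unfolding K.good_def by auto
            have "u' = gap H m + t" using K.lev_unique[OF u'(2) l] u' u by simp
            then show False using u' False by simp
          qed
          then have "\<psi> x \<in> K.ret 0 n" unfolding K.ret_def using K.tow_lev l l' u by blast
          then show ?thesis using elim(4) by blast
        qed
      qed
    qed
    ultimately show ?thesis by blast
  qed
  have mix: "mixing M S" unfolding mixing_def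
  proof (intro ballI)
    fix A B assume A: "A \<in> fmeasurable M" and B: "B \<in> fmeasurable M"
    \<comment> \<open>The part of the space in tower \<open>j\<close>; for large \<open>j\<close> it
      contains almost all of any given set of finite measure.\<close>
    define X where "X j = \<psi> -` K.tow j \<inter> space M" for j
    have Xs: "X j \<in> sets M" for j unfolding X_def K.tow_def by (rule measurable_sets[OF \<psi>m]) auto
    have small: "\<exists>j0. \<forall>j\<ge>j0. measure M (D - X j) < e" if D: "D \<in> fmeasurable M" and e: "e > 0" for D e
    proof -
      have dec: "decseq (\<lambda>j. D - X j)" unfolding X_def using K.tow_Suc by (intro decseq_SucI) blast
      have "(\<lambda>j. emeasure M (D - X j)) \<longlonglongrightarrow> emeasure M (\<Inter>j. D - X j)"
        using D Xs dec by (intro Lim_emeasure_decseq) (auto dest: fmeasurableD fmeasurableD2[OF fmeasurable_Diff])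
      moreover have "(\<Inter>j. D - X j) \<in> null_sets M"
      proof -
        let ?G = "{y::real. y < 0}"
        have G: "?G \<in> sets borel" by auto
        have "?G \<inter> {0..} = {}" by auto
        then have n: "\<psi> -` ?G \<inter> space M \<in> null_sets M" using push[OF G] measurable_sets[OF \<psi>m G] by (intro null_setsI) auto
        have "(\<Inter>j. D - X j) \<subseteq> \<psi> -` ?G \<inter> space M"
        proof
          fix x assume x: "x \<in> (\<Inter>j. D - X j)"
          have xs: "x \<in> space M" using x sets.sets_into_space[OF fmeasurableD[OF D]] by auto
          obtain j where "\<psi> x < real (h j) * K.w j" using K.tower_measure_unbounded by blast
          then have "\<psi> x < 0" using x xs unfolding X_def K.tow_def by (auto simp: not_le)
          then show "x \<in> \<psi> -` ?G \<inter> space M" using xs by auto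
        qed
        moreover have "(\<Inter>j. D - X j) \<in> sets M" using Xs fmeasurableD[OF D] by (intro sets.countable_INT) auto
        ultimately show ?thesis using n by (meson null_sets_subset)
      qed
      ultimately have "(\<lambda>j. emeasure M (D - X j)) \<longlonglongrightarrow> 0" by (simp add: null_sets_def)
      moreover have "emeasure M (D - X j) = ennreal (measure M (D - X j))" for j
        using D Xs by (intro emeasure_eq_measure2 fmeasurable_Diff)
      ultimately have "(\<lambda>j. measure M (D - X j)) \<longlonglongrightarrow> 0" by (simp add: tendsto_ennreal_iff[of _ _ 0, unfolded ennreal_0] flip: ennreal_0)
      from order_tendstoD(2)[OF this e] show ?thesis by (simp add: eventually_sequentially)
    qed
    show "(\<lambda>n. measure M ((S ^^ n) ` A \<inter> B)) \<longlonglongrightarrow> 0"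
    proof (rule LIMSEQ_I)
      fix e :: real assume e: "0 < e"
      have e3: "e / 3 > 0" using e by simp
      obtain j1 where j1: "\<And>j. j \<ge> j1 \<Longrightarrow> measure M (A - X j) < e / 3" using small[OF A e3] by blast
      obtain j2 where j2: "\<And>j. j \<ge> j2 \<Longrightarrow> measure M (B - X j) < e / 3" using small[OF B e3] by blast
      obtain j3 where j3: "2 * c * (1/2) ^ j3 < e / 3"
      proof -
        obtain j where "(1/2::real) ^ j < e / 3 / (2 * c)" using real_arch_pow_inv[of "e / 3 / (2 * c)" "1/2"] e c by auto
        then show ?thesis using c by (intro that[of j]) (simp add: pos_less_divide_eq mult.commute)
      qed
      define j where "j = max j1 (max j2 j3)"
      have j: "measure M (A - X j) < e / 3" "measure M (B - X j) < e / 3" using j1 j2 unfolding j_def by auto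
      have "(1/2::real) ^ j \<le> (1/2) ^ j3" unfolding j_def by (intro power_decreasing) auto
      then have "2 * c * (1/2) ^ j \<le> 2 * c * (1/2) ^ j3" using c by (intro mult_left_mono) auto
      then have jc: "2 * c * (1/2) ^ j < e / 3" using j3 by linarith
      \<comment> \<open>From time \<open>h j\<close> on no point can climb inside tower
        \<open>j\<close>, so every return to it is counted by \<open>ret j n\<close>.\<close>
      have "measure M ((S ^^ n) ` A \<inter> B) < e" if n: "n \<ge> h j" for n
      proof -
        let ?P = "(S ^^ n) ` (A - X j)" and ?Q = "B - X j" and ?R = "(S ^^ n) ` (\<psi> -` K.ret j n \<inter> space M)"
        obtain N' where N': "N' \<in> null_sets M" "{x\<in>space M. \<psi> ((S ^^ n) x) \<noteq> (K.S ^^ n) (\<psi> x)} \<subseteq> N'"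
          using SSn[of n] by (auto simp: eventually_ae_filter)
        let ?N = "(S ^^ n) ` N'"
        have AX: "A - X j \<in> fmeasurable M" using A Xs by (rule fmeasurable_Diff)
        have fm: "?P \<in> fmeasurable M" "?Q \<in> fmeasurable M" "?R \<in> fmeasurable M" "?N \<in> fmeasurable M"
          using level_fmeasurable[OF S AX] fmeasurable_Diff[OF B Xs] level_fmeasurable[OF S] retfm
            aut_null(1)[OF aut_funpow[OF S] N'(1)] by (auto simp: null_sets_def fmeasurable_def)
        have "(S ^^ n) ` A \<inter> B \<subseteq> ?P \<union> ?Q \<union> ?R \<union> ?N"
        proof
          fix y assume "y \<in> (S ^^ n) ` A \<inter> B"
          then obtain x where x: "x \<in> A" "y = (S ^^ n) x" "y \<in> B" by blast
          have xs: "x \<in> space M" using x(1) sets.sets_into_space[OF fmeasurableD[OF A]] by blast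
          show "y \<in> ?P \<union> ?Q \<union> ?R \<union> ?N"
          proof (cases "x \<in> X j \<and> y \<in> X j \<and> x \<notin> N'")
            case True
            then have "(K.S ^^ n) (\<psi> x) = \<psi> y" using N'(2) xs x(2) by auto
            then have "\<psi> x \<in> K.ret j n" using True K.return_subset_ret[OF n] unfolding X_def by auto
            then show ?thesis using x(2) xs by blast
          qed (use x in blast)
        qed
        then have "measure M ((S ^^ n) ` A \<inter> B) \<le> measure M (?P \<union> ?Q \<union> ?R \<union> ?N)"
          using fm level_fmeasurable[OF S A] B by (intro measure_mono_fmeasurable) (auto dest: fmeasurableD)
        also have "\<dots> \<le> measure M ?P + measure M ?Q + measure M ?R + measure M ?N"
          using fm by (intro order_trans[OF measure_Un_le] add_mono) (auto dest: fmeasurableD)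
        also have "measure M ?P = measure M (A - X j)" by (rule level_measure[OF S AX])
        also have "measure M ?R = measure M (\<psi> -` K.ret j n \<inter> space M)" using retfm by (intro level_measure[OF S]) auto
        also have "measure M ?N = 0" using aut_null(1)[OF aut_funpow[OF S] N'(1)] by (simp add: null_sets_def measure_def)
        finally show ?thesis using j jc retfm[of j n] by linarith
      qed
      then show "\<exists>n0. \<forall>n\<ge>n0. norm (measure M ((S ^^ n) ` A \<inter> B) - 0) < e" by (intro exI[of _ "h j"]) auto
    qed
  qed
  show ?thesis using S mix ro ST ret by blast
qed

end

section \<open>Runs of orbits in a set of finite measure\<close>

lemma mixing_small:
  assumes "mixing M T" "Z \<in> fmeasurable M" "0 < e"
  shows "\<exists>L. \<forall>n\<ge>L. measure M ((T ^^ n) ` Z \<inter> Z) < e"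
proof -
  have "(\<lambda>n. measure M ((T ^^ n) ` Z \<inter> Z)) \<longlonglongrightarrow> 0" using assms(1,2) unfolding mixing_def by blast
  from order_tendstoD(2)[OF this assms(3)] show ?thesis by (simp add: eventually_sequentially)
qed

lemma measure_return:
  assumes T: "T \<in> automorphisms M" and A: "A \<in> sets M" and B: "B \<in> sets M"
  shows "measure M (A \<inter> ((T ^^ n) -` B \<inter> space M)) = measure M ((T ^^ n) ` A \<inter> B)"
    "A \<inter> ((T ^^ n) -` B \<inter> space M) \<in> sets M"
proof -
  show s: "A \<inter> ((T ^^ n) -` B \<inter> space M) \<in> sets M" using A automorphismsD(2)[OF aut_funpow[OF T] B] by blast
  have "(T ^^ n) ` (A \<inter> ((T ^^ n) -` B \<inter> space M)) = (T ^^ n) ` A \<inter> B" using sets.sets_into_space[OF A] by auto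
  then show "measure M (A \<inter> ((T ^^ n) -` B \<inter> space M)) = measure M ((T ^^ n) ` A \<inter> B)"
    using aut_measure(1)[OF aut_funpow[OF T] s] by metis
qed

text \<open>The runs of \<open>T\<close> in \<open>Z\<close>: \<open>run_base T Z \<tau>\<close> consists of the first points of the runs of length \<open>\<tau>\<close>.\<close>

definition run_base :: "'a measure \<Rightarrow> ('a \<Rightarrow> 'a) \<Rightarrow> 'a set \<Rightarrow> nat \<Rightarrow> 'a set" where
  "run_base M T Z \<tau> = {x \<in> Z. x \<notin> T ` Z \<and> (\<forall>t<\<tau>. (T ^^ t) x \<in> Z) \<and> (T ^^ \<tau>) x \<notin> Z}"

lemma run_base_fmeasurable:
  assumes T: "T \<in> automorphisms M" and Z: "Z \<in> fmeasurable M"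
  shows "run_base M T Z \<tau> \<in> fmeasurable M"
proof -
  have Zs: "Z \<in> sets M" using Z by (rule fmeasurableD)
  have sub: "Z \<subseteq> space M" using Zs sets.sets_into_space by blast
  have pre: "(T ^^ t) -` D \<inter> space M \<in> sets M" if "D \<in> sets M" for t D by (rule automorphismsD(2)[OF aut_funpow[OF T] that])
  let ?W = "Z - T ` Z - (\<Union>t\<in>{..<\<tau>}. (T ^^ t) -` (space M - Z) \<inter> space M) - ((T ^^ \<tau>) -` Z \<inter> space M)"
  have eq: "run_base M T Z \<tau> = ?W"
    unfolding run_base_def using sub aut_in_space[OF aut_funpow[OF T]] by auto
  have Ws: "?W \<in> sets M" using Zs automorphismsD(3)[OF T Zs] pre by (intro sets.Diff sets.finite_UN) auto
  have WZ: "?W \<subseteq> Z" by blast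
  show ?thesis unfolding eq by (rule fmeasurableI2[OF Z WZ Ws])
qed

text \<open>If the positions differed, the starting point with the smaller position would lie in the
  image of \<open>Z\<close> under \<open>T\<close>, which starting points avoid. Equal starting
  points have equal run lengths.\<close>

lemma run_base_unique:
  assumes T: "T \<in> automorphisms M" and Z: "Z \<subseteq> space M" and b: "b \<in> run_base M T Z \<tau>" "b' \<in> run_base M T Z \<tau>'"
    and t: "t < \<tau>" "t' < \<tau>'" and eq: "(T ^^ t) b = (T ^^ t') b'"
  shows "t = t' \<and> b = b' \<and> \<tau> = \<tau>'"
proof -
  have no: False if b: "b \<in> run_base M T Z \<tau>" "b' \<in> run_base M T Z \<tau>'" and t: "t < t'" "t' < \<tau>'"
    and eq: "(T ^^ t) b = (T ^^ t') b'" for b b' t t' \<tau> \<tau>'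
  proof -
    obtain s where s: "t' = t + Suc s" using t(1) less_imp_add_positive[of t t'] by (metis Suc_pred)
    have bs: "b \<in> space M" "b' \<in> space M" using b Z unfolding run_base_def by auto
    have "(T ^^ t) b = (T ^^ t) ((T ^^ Suc s) b')" using eq unfolding s by (simp only: funpow_add comp_apply)
    then have "b = (T ^^ Suc s) b'"
      using inj_onD[OF aut_inj[OF aut_funpow[OF T]]] bs aut_in_space[OF aut_funpow[OF T]] by metis
    moreover have "(T ^^ s) b' \<in> Z" using b(2) t s unfolding run_base_def by auto
    ultimately have "b \<in> T ` Z" by auto
    then show False using b(1) unfolding run_base_def by blast
  qed
  have "t = t'" using no[OF b _ t(2) eq] no[OF b(2,1) _ t(1) eq[symmetric]] by (meson nat_neq_iff)
  moreover have "b = b'"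
  proof -
    have "b \<in> space M" "b' \<in> space M" using b Z unfolding run_base_def by auto
    then show ?thesis using inj_onD[OF aut_inj[OF aut_funpow[OF T]], of t b b'] eq \<open>t = t'\<close> by simp
  qed
  moreover have "\<not> \<tau> < \<tau>'" "\<not> \<tau>' < \<tau>" using b \<open>b = b'\<close> unfolding run_base_def by auto
  ultimately show ?thesis by simp
qed

text \<open>The orbit of \<open>x\<close> is outside \<open>Z\<close> after \<open>L\<close> steps
  in either direction, so the first exits forwards and backwards delimit the run through
  \<open>x\<close>.\<close>

lemma run_cover:
  assumes T: "T \<in> automorphisms M" and Z: "Z \<subseteq> space M" and x: "x \<in> Z"
    and out: "(T ^^ L) x \<notin> Z" "x \<notin> (T ^^ L) ` Z"
  shows "\<exists>\<tau>\<in>{1..2 * L}. \<exists>t<\<tau>. x \<in> (T ^^ t) ` run_base M T Z \<tau>"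
proof -
  \<comment> \<open>The run has length \<open>s' - 1 + s\<close>, and \<open>x\<close> stands at
    place \<open>s' - 1\<close> in it, counted from 0.\<close>
  define s where "s = (LEAST s. (T ^^ s) x \<notin> Z)"
  define s' where "s' = (LEAST s. x \<notin> (T ^^ s) ` Z)"
  have s: "(T ^^ s) x \<notin> Z" "s \<le> L" unfolding s_def
    using LeastI[of "\<lambda>s. (T ^^ s) x \<notin> Z", OF out(1)] Least_le[of "\<lambda>s. (T ^^ s) x \<notin> Z", OF out(1)] by auto
  have s': "x \<notin> (T ^^ s') ` Z" "s' \<le> L" unfolding s'_def
    using LeastI[of "\<lambda>s. x \<notin> (T ^^ s) ` Z", OF out(2)] Least_le[of "\<lambda>s. x \<notin> (T ^^ s) ` Z", OF out(2)] by auto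
  have sl: "(T ^^ i) x \<in> Z" if "i < s" for i using that not_less_Least unfolding s_def by blast
  have sl': "x \<in> (T ^^ i) ` Z" if "i < s'" for i using that not_less_Least[of i "\<lambda>s. x \<notin> (T ^^ s) ` Z"] unfolding s'_def by blast
  have "s \<noteq> 0" using s(1) x by (cases "s = 0") auto
  have "s' \<noteq> 0"
  proof
    assume "s' = 0"
    then show False using s'(1) x by simp
  qed
  then obtain a where a: "s' = Suc a" by (cases s') auto
  obtain b where b: "b \<in> Z" "x = (T ^^ a) b" using sl'[of a] a by auto
  have bs: "b \<in> space M" using b(1) Z by blast
  have "b \<notin> T ` Z"
  proof
    assume "b \<in> T ` Z"
    then obtain z where "z \<in> Z" "b = T z" by blast
    then have "x = (T ^^ s') z" unfolding a b(2) by (simp add: funpow_swap1)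
    then show False using s'(1) \<open>z \<in> Z\<close> by blast
  qed
  moreover have "(T ^^ t) b \<in> Z" if t: "t < a + s" for t
  proof (cases "t < a")
    case True
    have "x \<in> (T ^^ (a - t)) ` Z" by (rule sl') (use a True in simp)
    then obtain z where z: "z \<in> Z" "x = (T ^^ (a - t)) z" by blast
    have "(T ^^ (a - t)) z = (T ^^ (a - t)) ((T ^^ t) b)"
      using z(2) b(2) True by (metis comp_apply funpow_add le_add_diff_inverse2 less_imp_le)
    then have "z = (T ^^ t) b"
      using inj_onD[OF aut_inj[OF aut_funpow[OF T]]] z(1) Z bs aut_in_space[OF aut_funpow[OF T]] by (metis subsetD)
    then show ?thesis using z(1) by simp
  next
    case False
    then have "(T ^^ t) b = (T ^^ (t - a)) x" unfolding b(2) by (metis comp_apply funpow_add le_add_diff_inverse2 not_less)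
    then show ?thesis using sl[of "t - a"] t False by simp
  qed
  moreover have "(T ^^ (a + s)) b \<notin> Z"
  proof -
    have "(T ^^ (a + s)) b = (T ^^ s) x" unfolding b(2) by (metis add.commute comp_apply funpow_add)
    then show ?thesis using s(1) by simp
  qed
  ultimately have "b \<in> run_base M T Z (a + s)" using b(1) unfolding run_base_def by blast
  moreover have "a + s \<in> {1..2 * L}" "a < a + s" using a s(2) s'(2) \<open>s \<noteq> 0\<close> by auto
  ultimately show ?thesis using b(2) by blast
qed

context leb_space begin

text \<open>\<open>Z\<close> contains \<open>K\<close> images and \<open>K\<close> preimages of
  \<open>Y\<close>, so a point of \<open>Y\<close> never starts a run and has more than
  \<open>K\<close> levels of its run above it. By mixing most points of \<open>Y\<close> lie on runs
  of length at most \<open>H\<close>. The starting points of the runs of each length are cut into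
  pieces of measure \<open>wd\<close>, small enough for the leftovers of all lengths to be
  negligible together.\<close>

lemma ex_run_columns:
  assumes T: "T \<in> automorphisms M" and mix: "mixing M T" and Y: "Y \<in> fmeasurable M" and K: "1 \<le> K" and \<delta>: "0 < \<delta>"
  shows "\<exists>q \<tau> H C wd. column_system M g X0 T q \<tau> H C wd \<and> real H * wd \<le> \<delta> \<and>
    measure M (Y - (\<Union>m<q. \<Union>t<\<tau> m. (T ^^ t) ` C m)) \<le> \<delta> \<and>
    (\<forall>m<q. \<forall>t<\<tau> m. \<forall>x\<in>Y \<inter> (T ^^ t) ` C m. 1 \<le> t \<and> t + K < \<tau> m)"
proof -
  define Z where "Z = (\<Union>i\<in>{..K}. (T ^^ i) ` Y \<union> ((T ^^ i) -` Y \<inter> space M))"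
  have Zf: "Z \<in> fmeasurable M" unfolding Z_def
    using aut_fmeasurable[OF aut_funpow[OF T] Y] by (intro fmeasurable.finite_UN) auto
  have Zs: "Z \<subseteq> space M" using Zf fmeasurableD sets.sets_into_space by blast
  have Ys: "Y \<subseteq> space M" using Y fmeasurableD sets.sets_into_space by blast
  have YZ: "(T ^^ i) x \<in> Z" if "x \<in> Y" "i \<le> K" for x i unfolding Z_def using that by blast
  have YZ0: "Y \<subseteq> Z"
  proof
    fix x assume "x \<in> Y"
    then show "x \<in> Z" using YZ[of x 0] by simp
  qed
  have Yback: "x \<in> T ` Z" if xY: "x \<in> Y" for x
  proof -
    have "x \<in> T ` space M" unfolding aut_surj[OF T] using xY by (rule subsetD[OF Ys])
    then obtain y where y: "y \<in> space M" "x = T y" by (elim imageE)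
    then have y1: "y \<in> (T ^^ 1) -` Y \<inter> space M" using xY by simp
    have "y \<in> Z" unfolding Z_def by (rule UN_I[of 1]) (use K y1 in simp_all)
    then show ?thesis unfolding y(2) by (rule imageI)
  qed
  have d4: "\<delta> / 4 > 0" using \<delta> by simp
  obtain L where L: "\<And>n. n \<ge> L \<Longrightarrow> measure M ((T ^^ n) ` Z \<inter> Z) < \<delta> / 4" using mixing_small[OF mix Zf d4] by blast
  define H where "H = 2 * L"
  let ?R = "run_base M T Z"
  have Rf: "?R \<tau> \<in> fmeasurable M" for \<tau> by (rule run_base_fmeasurable[OF T Zf])
  \<comment> \<open>There are \<open>H\<close> run lengths, and each leftover has measure at most
    \<open>wd\<close> and passes through at most \<open>H\<close> levels; so the loss is at most
    \<open>H * H * wd\<close>.\<close>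
  define p where "p = (real H + 1) * (real H + 1)"
  have p: "0 < p" "real H * real H \<le> p" "real H \<le> p"
  proof -
    have e: "p = real H * real H + 2 * real H + 1" unfolding p_def by (simp add: algebra_simps)
    moreover have "0 \<le> real H * real H" by simp
    ultimately show "0 < p" "real H * real H \<le> p" "real H \<le> p" by linarith+
  qed
  define wd where "wd = \<delta> / 2 / p"
  have wd: "wd > 0" unfolding wd_def using \<delta> p(1) by simp
  have Hw: "real H * real H * wd \<le> \<delta> / 2" "real H * wd \<le> \<delta>"
  proof -
    have e: "p * wd = \<delta> / 2" unfolding wd_def using p(1) by simp
    have "real H * real H * wd \<le> p * wd" by (rule mult_right_mono[OF p(2) less_imp_le[OF wd]])
    then show "real H * real H * wd \<le> \<delta> / 2" using e by simp
    have "real H * wd \<le> p * wd" by (rule mult_right_mono[OF p(3) less_imp_le[OF wd]])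
    then show "real H * wd \<le> \<delta>" using e \<delta> by simp
  qed
  define \<Phi> where "\<Phi> \<tau> n C \<longleftrightarrow> (\<forall>i<n. C i \<in> fmeasurable M \<and> C i \<subseteq> ?R \<tau> \<and> measure M (C i) = wd) \<and>
    disjoint_family_on C {..<n} \<and> measure M (?R \<tau> - (\<Union>i<n. C i)) \<le> wd" for \<tau> and n :: nat and C
  have "\<forall>\<tau>. \<exists>n C. \<Phi> \<tau> n C" unfolding \<Phi>_def by (rule allI) (rule ex_equal_pieces[OF Rf wd])
  from choice[OF this] obtain n where "\<forall>\<tau>. \<exists>C. \<Phi> \<tau> (n \<tau>) C" ..
  from choice[OF this] obtain P where P0: "\<forall>\<tau>. \<Phi> \<tau> (n \<tau>) (P \<tau>)" ..
  have P: "\<And>\<tau> i. i < n \<tau> \<Longrightarrow> P \<tau> i \<in> fmeasurable M \<and> P \<tau> i \<subseteq> ?R \<tau> \<and> measure M (P \<tau> i) = wd"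
    "\<And>\<tau>. disjoint_family_on (P \<tau>) {..<n \<tau>}" "\<And>\<tau>. measure M (?R \<tau> - (\<Union>i<n \<tau>. P \<tau> i)) \<le> wd"
    using P0 unfolding \<Phi>_def by simp_all
  define \<Lambda> where "\<Lambda> = (SIGMA \<tau>:{1..H}. {..<n \<tau>})"
  have fin: "finite \<Lambda>" unfolding \<Lambda>_def by (intro finite_SigmaI) auto
  obtain e where e: "bij_betw e {0..<card \<Lambda>} \<Lambda>" using ex_bij_betw_nat_finite[OF fin] by blast
  define q where "q = card \<Lambda>"
  define \<tau> where "\<tau> m = fst (e m)" for m
  define C where "C m = P (fst (e m)) (snd (e m))" for m
  have em: "\<tau> m \<in> {1..H}" "snd (e m) < n (\<tau> m)" if "m < q" for m
  proof -
    have "e m \<in> \<Lambda>" using e that unfolding q_def bij_betw_def by auto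
    then show "\<tau> m \<in> {1..H}" "snd (e m) < n (\<tau> m)" unfolding \<Lambda>_def \<tau>_def by auto
  qed
  have C: "C m \<in> fmeasurable M" "C m \<subseteq> ?R (\<tau> m)" "measure M (C m) = wd" if "m < q" for m
    using P(1)[OF em(2)[OF that]] unfolding C_def \<tau>_def by auto
  have disj: "(T ^^ t) ` C m \<inter> (T ^^ t') ` C m' = {}"
    if m: "m < q" "t < \<tau> m" and m': "m' < q" "t' < \<tau> m'" and ne: "(m, t) \<noteq> (m', t')" for m t m' t'
  proof (rule ccontr)
    assume "(T ^^ t) ` C m \<inter> (T ^^ t') ` C m' \<noteq> {}"
    then obtain b b' where b: "b \<in> C m" "b' \<in> C m'" "(T ^^ t) b = (T ^^ t') b'" by blast
    have u: "t = t' \<and> b = b' \<and> \<tau> m = \<tau> m'"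
      using run_base_unique[OF T Zs _ _ m(2) m'(2) b(3)] b(1,2) C(2) m(1) m'(1) by blast
    then have "m \<noteq> m'" using ne by simp
    have "e m \<noteq> e m'" using e m(1) m'(1) \<open>m \<noteq> m'\<close> unfolding q_def bij_betw_def by (auto dest: inj_onD)
    then have "snd (e m) \<noteq> snd (e m')" using u unfolding \<tau>_def by (auto simp: prod_eq_iff)
    moreover have "b \<in> P (\<tau> m) (snd (e m))" "b \<in> P (\<tau> m) (snd (e m'))" using b u unfolding C_def \<tau>_def by auto
    moreover have "snd (e m) < n (\<tau> m)" "snd (e m') < n (\<tau> m)" using em(2)[OF m(1)] em(2)[OF m'(1)] u by auto
    ultimately show False using P(2)[of "\<tau> m"] unfolding disjoint_family_on_def by blast
  qed
  have col: "column_system M g X0 T q \<tau> H C wd"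
    using T wd C(1,3) em(1) disj by unfold_locales auto
  define W where "W = (\<Union>\<tau>\<in>{1..H}. \<Union>t\<in>{..<\<tau>}. (T ^^ t) ` (?R \<tau> - (\<Union>i<n \<tau>. P \<tau> i)))"
  have rem: "?R \<sigma> - (\<Union>i<n \<sigma>. P \<sigma> i) \<in> fmeasurable M" for \<sigma>
    using Rf P(1)[THEN conjunct1, THEN fmeasurableD] by (intro fmeasurable_Diff sets.finite_UN) auto
  have Wf: "(\<Union>t\<in>{..<\<sigma>}. (T ^^ t) ` (?R \<sigma> - (\<Union>i<n \<sigma>. P \<sigma> i))) \<in> fmeasurable M" for \<sigma>
    using level_fmeasurable[OF T rem] by (intro fmeasurable.finite_UN) auto
  have Wm: "measure M W \<le> \<delta> / 2"
  proof -
    have "measure M W \<le> (\<Sum>\<sigma>\<in>{1..H}. measure M (\<Union>t\<in>{..<\<sigma>}. (T ^^ t) ` (?R \<sigma> - (\<Union>i<n \<sigma>. P \<sigma> i))))"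
      unfolding W_def using Wf by (intro measure_UNION_le) (auto dest: fmeasurableD)
    also have "\<dots> \<le> (\<Sum>\<sigma>\<in>{1..H}. real H * wd)"
    proof (rule sum_mono)
      fix \<sigma> assume \<sigma>: "\<sigma> \<in> {1..H}"
      have "measure M (\<Union>t\<in>{..<\<sigma>}. (T ^^ t) ` (?R \<sigma> - (\<Union>i<n \<sigma>. P \<sigma> i))) \<le> (\<Sum>t\<in>{..<\<sigma>}. measure M ((T ^^ t) ` (?R \<sigma> - (\<Union>i<n \<sigma>. P \<sigma> i))))"
        using level_fmeasurable[OF T rem] by (intro measure_UNION_le) (auto dest: fmeasurableD)
      also have "\<dots> \<le> (\<Sum>t\<in>{..<\<sigma>}. wd)" using level_measure[OF T rem] P(3) by (intro sum_mono) simp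
      also have "\<dots> \<le> real H * wd" using \<sigma> wd by (simp add: mult_right_mono)
      finally show "measure M (\<Union>t\<in>{..<\<sigma>}. (T ^^ t) ` (?R \<sigma> - (\<Union>i<n \<sigma>. P \<sigma> i))) \<le> real H * wd" .
    qed
    also have "\<dots> = real H * real H * wd" by simp
    finally show ?thesis using Hw(1) by linarith
  qed
  have Wfm: "W \<in> fmeasurable M" unfolding W_def by (rule fmeasurable.finite_UN[OF finite_atLeastAtMost Wf])
  define Q where "Q = (\<Union>m<q. \<Union>t<\<tau> m. (T ^^ t) ` C m)"
  let ?A = "(T ^^ L) ` Z \<inter> Z" and ?B = "Z \<inter> ((T ^^ L) -` Z \<inter> space M)"
  \<comment> \<open>An uncovered point returns to \<open>Z\<close> at time \<open>L\<close> in one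
    of the two directions of time, or lies above a leftover.\<close>
  have "Y - Q \<subseteq> ?A \<union> ?B \<union> W"
  proof
    fix x assume x: "x \<in> Y - Q"
    then have xZ: "x \<in> Z" using YZ0 by blast
    show "x \<in> ?A \<union> ?B \<union> W"
    proof (cases "(T ^^ L) x \<notin> Z \<and> x \<notin> (T ^^ L) ` Z")
      case True
      then obtain \<sigma> t where st: "\<sigma> \<in> {1..H}" "t < \<sigma>" "x \<in> (T ^^ t) ` ?R \<sigma>"
        using run_cover[OF T Zs xZ, of L] unfolding H_def by blast
      then obtain b where b: "b \<in> ?R \<sigma>" "x = (T ^^ t) b" by blast
      have "b \<notin> P \<sigma> i" if i: "i < n \<sigma>" for i
      proof
        assume bi: "b \<in> P \<sigma> i"
        have "(\<sigma>, i) \<in> \<Lambda>" unfolding \<Lambda>_def using st(1) i by simp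
        moreover have "e ` {0..<q} = \<Lambda>" using e unfolding q_def bij_betw_def by blast
        ultimately have "(\<sigma>, i) \<in> e ` {0..<q}" by simp
        then obtain m where m: "m < q" "e m = (\<sigma>, i)" by auto
        then have "x \<in> (T ^^ t) ` C m" "t < \<tau> m" using bi b(2) st(2) unfolding C_def \<tau>_def by auto
        then have "x \<in> Q" unfolding Q_def using m(1) by blast
        then show False using x by blast
      qed
      then have "x \<in> W" unfolding W_def using b st(1,2) by blast
      then show ?thesis by blast
    qed (use xZ Zs in blast)
  qed
  moreover have fm: "?A \<in> fmeasurable M" "?B \<in> fmeasurable M"
    using fmeasurable_Int_fmeasurable[OF level_fmeasurable[OF T Zf] fmeasurableD[OF Zf]]
      fmeasurable_Int_fmeasurable[OF Zf automorphismsD(2)[OF aut_funpow[OF T] fmeasurableD[OF Zf]]] by auto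
  moreover have Qs: "Q \<in> sets M" unfolding Q_def
    using level_fmeasurable[OF T C(1)] by (intro sets.finite_UN) (auto dest: fmeasurableD)
  ultimately have "measure M (Y - Q) \<le> measure M (?A \<union> ?B \<union> W)"
    using Wfm Y by (intro measure_mono_fmeasurable) (auto dest: fmeasurableD)
  also have "\<dots> \<le> measure M ?A + measure M ?B + measure M W"
    using fm Wfm by (intro order_trans[OF measure_Un_le] add_mono) (auto dest: fmeasurableD)
  also have "measure M ?B = measure M ?A" by (rule measure_return(1)[OF T]) (use Zf in \<open>auto dest: fmeasurableD\<close>)
  finally have QY: "measure M (Y - Q) \<le> \<delta>" using L[of L] Wm by simp
  have inn: "1 \<le> t \<and> t + K < \<tau> m" if m: "m < q" and t: "t < \<tau> m" and x: "x \<in> Y \<inter> (T ^^ t) ` C m" for m t x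
  proof -
    obtain b where b: "b \<in> ?R (\<tau> m)" "x = (T ^^ t) b" using x C(2)[OF m] by blast
    have "t \<noteq> 0"
    proof
      assume "t = 0"
      then have "x = b" using b(2) by simp
      then show False using b(1) Yback x unfolding run_base_def by blast
    qed
    moreover have "t + K < \<tau> m"
    proof (rule ccontr)
      assume n: "\<not> t + K < \<tau> m"
      have "(T ^^ \<tau> m) b = (T ^^ (\<tau> m - t)) x"
        unfolding b(2) using t by (metis comp_apply funpow_add le_add_diff_inverse2 less_imp_le)
      then have "(T ^^ \<tau> m) b \<in> Z" using YZ[of x "\<tau> m - t"] x n t by simp
      then show False using b(1) unfolding run_base_def by blast
    qed
    ultimately show ?thesis by simp
  qed
  show ?thesis
  proof (rule exI[of _ q], rule exI[of _ \<tau>], rule exI[of _ H], rule exI[of _ C], rule exI[of _ wd], intro conjI)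
    show "\<forall>m<q. \<forall>t<\<tau> m. \<forall>x\<in>Y \<inter> (T ^^ t) ` C m. 1 \<le> t \<and> t + K < \<tau> m" using inn by blast
  qed (use col Hw(2) QY in \<open>simp_all add: Q_def\<close>)
qed

text \<open>Inside the columns \<open>S\<close> copies \<open>T\<close>. If \<open>S ^^ n\<close>
  brings a point back to a cell, then outside a small set it got there by climbing its column, just
  as under \<open>T\<close>. If only \<open>T ^^ n\<close> brings it back to \<open>Y\<close>, then
  either \<open>n\<close> is small and the column is long enough above the point, or
  \<open>n\<close> is large and mixing of \<open>T\<close> makes such points rare. All bounds are
  uniform in \<open>n\<close>.\<close>

lemma ex_close_rank_one:
  assumes T: "T \<in> automorphisms M" and mix: "mixing M T" and Y: "Y \<in> fmeasurable M" and \<delta>: "0 < \<delta>"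
  shows "\<exists>S\<in>automorphisms M. mixing M S \<and> rank_one M S \<and>
    (\<exists>E\<in>fmeasurable M. measure M E \<le> \<delta> \<and> (\<forall>x\<in>Y - E. S x = T x) \<and> (\<forall>x\<in>space M. T x \<in> Y - E \<longrightarrow> S x = T x)) \<and>
    (\<forall>n. \<exists>E\<in>fmeasurable M. measure M E \<le> \<delta> \<and> (\<forall>x\<in>Y - E. (S ^^ n) x \<in> Y \<or> (T ^^ n) x \<in> Y \<longrightarrow> (S ^^ n) x = (T ^^ n) x))"
proof -
  have Ys: "Y \<subseteq> space M" using Y fmeasurableD sets.sets_into_space by blast
  have d4: "\<delta> / 4 > 0" "\<delta> / 8 > 0" using \<delta> by auto
  obtain L where L: "\<And>n. n \<ge> L \<Longrightarrow> measure M ((T ^^ n) ` Y \<inter> Y) < \<delta> / 4" using mixing_small[OF mix Y d4(1)] by blast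
  define K where "K = Suc L"
  have K: "1 \<le> K" "L \<le> K" unfolding K_def by auto
  from ex_run_columns[OF T mix Y K(1) d4(2)] obtain q \<tau> H C wd
    where a: "column_system M g X0 T q \<tau> H C wd \<and> real H * wd \<le> \<delta> / 8 \<and>
      measure M (Y - (\<Union>m<q. \<Union>t<\<tau> m. (T ^^ t) ` C m)) \<le> \<delta> / 8 \<and>
      (\<forall>m<q. \<forall>t<\<tau> m. \<forall>x\<in>Y \<inter> (T ^^ t) ` C m. 1 \<le> t \<and> t + K < \<tau> m)"
    by (elim exE) (rule that)
  note col = conjunct1[OF a] and Hw = conjunct1[OF conjunct2[OF a]]
    and Dm = conjunct1[OF conjunct2[OF conjunct2[OF a]]]
  have inn: "1 \<le> t \<and> t + K < \<tau> m" if "m < q" "t < \<tau> m" "x \<in> Y" "x \<in> (T ^^ t) ` C m" for m t x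
    using conjunct2[OF conjunct2[OF conjunct2[OF a]]] that by blast
  interpret column_system M g X0 T q \<tau> H C wd by (rule col)
  obtain S where S: "S \<in> automorphisms M" "mixing M S" "rank_one M S"
    and ST: "AE x in M. \<forall>m<q. \<forall>t. Suc t < \<tau> m \<longrightarrow> x \<in> cell m t \<longrightarrow> S x = T x"
    and ret: "\<And>n. \<exists>E\<in>fmeasurable M. measure M E \<le> real H * wd + 2 * (\<delta> / 8) \<and>
      (AE x in M. \<forall>m<q. \<forall>t<\<tau> m. \<forall>m'<q. \<forall>t'<\<tau> m'. x \<in> cell m t \<longrightarrow> (S ^^ n) x \<in> cell m' t' \<longrightarrow> x \<in> E \<or> t + n < \<tau> m)"
    using ex_rank_one_extension[OF d4(2)] by blast
  define D where "D = Y - (\<Union>m<q. \<Union>t<\<tau> m. cell m t)"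
  have Df: "D \<in> fmeasurable M" unfolding D_def
    using Y cell_fm by (intro fmeasurable_Diff sets.finite_UN) (auto dest: fmeasurableD)
  have inD: "\<exists>m<q. \<exists>t<\<tau> m. x \<in> cell m t" if "x \<in> Y" "x \<notin> D" for x using that unfolding D_def by blast
  have null_m: "measure M N = 0" "N \<in> fmeasurable M" if "N \<in> null_sets M" for N
    using that by (auto simp: null_sets_def measure_def fmeasurable_def)
  obtain N where N: "N \<in> null_sets M" "{x\<in>space M. \<not> (\<forall>m<q. \<forall>t. Suc t < \<tau> m \<longrightarrow> x \<in> cell m t \<longrightarrow> S x = T x)} \<subseteq> N"
    using ST by (auto simp: eventually_ae_filter)
  have NN: "S x = T x" if "x \<in> space M" "x \<notin> N" "m < q" "Suc t < \<tau> m" "x \<in> cell m t" for x m t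
    using N(2) that by blast
  have close1: "\<exists>E\<in>fmeasurable M. measure M E \<le> \<delta> \<and> (\<forall>x\<in>Y - E. S x = T x) \<and> (\<forall>x\<in>space M. T x \<in> Y - E \<longrightarrow> S x = T x)"
  proof (intro bexI[of _ "D \<union> (N \<union> T ` N)"] conjI ballI impI)
    have n: "N \<union> T ` N \<in> null_sets M" using N(1) aut_null(1)[OF T N(1)] by blast
    show "D \<union> (N \<union> T ` N) \<in> fmeasurable M" using Df null_m(2)[OF n] by blast
    have "measure M (D \<union> (N \<union> T ` N)) \<le> measure M D + measure M (N \<union> T ` N)"
      using Df null_m(2)[OF n] by (intro measure_Un_le) (auto dest: fmeasurableD)
    then show "measure M (D \<union> (N \<union> T ` N)) \<le> \<delta>" using Dm null_m(1)[OF n] \<delta> unfolding D_def by linarith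
    show "S x = T x" if xE: "x \<in> Y - (D \<union> (N \<union> T ` N))" for x
    proof -
      obtain m t where mt: "m < q" "t < \<tau> m" "x \<in> cell m t" using inD[of x] xE by blast
      have "t + K < \<tau> m" using inn[OF mt(1,2) _ mt(3)] xE by blast
      then show ?thesis using NN[of x m t] xE Ys mt K(1) by auto
    qed
    show "S x = T x" if x: "x \<in> space M" and Tx: "T x \<in> Y - (D \<union> (N \<union> T ` N))" for x
    proof -
      obtain m t where mt: "m < q" "t < \<tau> m" "T x \<in> cell m t" using inD[of "T x"] Tx by blast
      have "1 \<le> t" using inn[OF mt(1,2) _ mt(3)] Tx by blast
      then obtain s where s: "t = Suc s" by (cases t) auto
      obtain b where b: "b \<in> C m" "T x = (T ^^ t) b" using mt(3) by blast
      have bs: "b \<in> space M" using b(1) cell_sub[OF mt(1), of 0] by auto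
      have "T x = T ((T ^^ s) b)" using b(2) s by simp
      then have "x = (T ^^ s) b" using inj_onD[OF aut_inj[OF T]] x aut_in_space[OF aut_funpow[OF T] bs] by metis
      then have "x \<in> cell m s" using b(1) by blast
      moreover have "x \<notin> N" using Tx by blast
      ultimately show ?thesis using NN[of x m s] x mt(1,2) s by blast
    qed
  qed
  have STn: "AE x in M. \<forall>m<q. \<forall>t. t + n < \<tau> m \<longrightarrow> x \<in> cell m t \<longrightarrow> (S ^^ n) x = (T ^^ n) x" for n
  proof (induction n)
    case (Suc n)
    have "AE x in M. \<forall>m<q. \<forall>t. Suc t < \<tau> m \<longrightarrow> (T ^^ n) x \<in> cell m t \<longrightarrow> S ((T ^^ n) x) = T ((T ^^ n) x)"
      using aut_AE[OF aut_funpow[OF T] ST] .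
    with Suc show ?case
    proof eventually_elim
      case (elim x)
      show ?case
      proof (intro allI impI)
        fix m t assume m: "m < q" and t: "t + Suc n < \<tau> m" and x: "x \<in> cell m t"
        have "(S ^^ n) x = (T ^^ n) x" using elim(1)[rule_format, OF m _ x] t by simp
        moreover have "S ((T ^^ n) x) = T ((T ^^ n) x)" using elim(2) m t T_funpow_cell[OF x, of n] by simp
        ultimately show "(S ^^ Suc n) x = (T ^^ Suc n) x" by simp
      qed
    qed
  qed simp
  have close: "\<exists>E\<in>fmeasurable M. measure M E \<le> \<delta> \<and> (\<forall>x\<in>Y - E. (S ^^ n) x \<in> Y \<or> (T ^^ n) x \<in> Y \<longrightarrow> (S ^^ n) x = (T ^^ n) x)" for n
  proof -
    obtain E where E: "E \<in> fmeasurable M" "measure M E \<le> real H * wd + 2 * (\<delta> / 8)"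
      and Eae: "AE x in M. \<forall>m<q. \<forall>t<\<tau> m. \<forall>m'<q. \<forall>t'<\<tau> m'. x \<in> cell m t \<longrightarrow> (S ^^ n) x \<in> cell m' t' \<longrightarrow> x \<in> E \<or> t + n < \<tau> m"
      using ret by blast
    obtain N1 where N1: "N1 \<in> null_sets M" "{x\<in>space M. \<not> (\<forall>m<q. \<forall>t. t + n < \<tau> m \<longrightarrow> x \<in> cell m t \<longrightarrow> (S ^^ n) x = (T ^^ n) x)} \<subseteq> N1"
      using STn[of n] by (auto simp: eventually_ae_filter)
    obtain N2 where N2: "N2 \<in> null_sets M" "{x\<in>space M. \<not> (\<forall>m<q. \<forall>t<\<tau> m. \<forall>m'<q. \<forall>t'<\<tau> m'. x \<in> cell m t \<longrightarrow> (S ^^ n) x \<in> cell m' t' \<longrightarrow> x \<in> E \<or> t + n < \<tau> m)} \<subseteq> N2"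
      using Eae by (auto simp: eventually_ae_filter)
    have N1': "(S ^^ n) x = (T ^^ n) x" if "x \<in> space M" "x \<notin> N1" "m < q" "t + n < \<tau> m" "x \<in> cell m t" for x m t
      using N1(2) that by blast
    have N2': "x \<in> E \<or> t + n < \<tau> m" if "x \<in> space M" "x \<notin> N2" "m < q" "t < \<tau> m" "m' < q" "t' < \<tau> m'" "x \<in> cell m t" "(S ^^ n) x \<in> cell m' t'" for x m t m' t'
      using N2(2) that by blast
    \<comment> \<open>From time \<open>L\<close> on, few points of \<open>Y\<close> return to
      \<open>Y\<close> under \<open>T\<close>; before that, the \<open>K\<close> levels in reserve
      above each point of \<open>Y\<close> suffice.\<close>
    define R where "R = (if L \<le> n then Y \<inter> ((T ^^ n) -` Y \<inter> space M) else {})"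
    have R: "R \<in> fmeasurable M" "measure M R \<le> \<delta> / 4"
    proof -
      have "Y \<inter> ((T ^^ n) -` Y \<inter> space M) \<in> fmeasurable M"
        by (rule fmeasurable_Int_fmeasurable[OF Y automorphismsD(2)[OF aut_funpow[OF T] fmeasurableD[OF Y]]])
      then show "R \<in> fmeasurable M" unfolding R_def by auto
      show "measure M R \<le> \<delta> / 4"
        unfolding R_def using L[of n] measure_return(1)[OF T fmeasurableD[OF Y] fmeasurableD[OF Y], of n] \<delta> by auto
    qed
    let ?D' = "(S ^^ n) -` D \<inter> space M"
    have D': "?D' \<in> fmeasurable M" "measure M ?D' = measure M D"
      using aut_fmeasurable(2)[OF aut_funpow[OF S(1)] Df] aut_measure(2)[OF aut_funpow[OF S(1)] fmeasurableD[OF Df]] by auto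
    define N3 where "N3 = N1 \<union> N2"
    have n12: "N3 \<in> null_sets M" unfolding N3_def using N1(1) N2(1) by blast
    show ?thesis
    proof (intro bexI[of _ "D \<union> ?D' \<union> E \<union> R \<union> N3"] conjI ballI impI)
      show "D \<union> ?D' \<union> E \<union> R \<union> N3 \<in> fmeasurable M" using Df D'(1) E(1) R(1) null_m(2)[OF n12] by (intro fmeasurable.Un)
      have "measure M (D \<union> ?D' \<union> E \<union> R \<union> N3) \<le> measure M D + measure M ?D' + measure M E + measure M R + measure M N3"
        using Df D'(1) E(1) R(1) null_m(2)[OF n12] by (intro order_trans[OF measure_Un_le] add_mono) (auto dest: fmeasurableD)
      \<comment> \<open>In units of \<open>\<delta> / 8\<close>: one each for \<open>D\<close> and
        its preimage, three for \<open>E\<close>, two for \<open>R\<close>.\<close>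
      then show "measure M (D \<union> ?D' \<union> E \<union> R \<union> N3) \<le> \<delta>"
        using Dm D'(2) E(2) R(2) null_m(1)[OF n12] Hw \<delta> unfolding D_def by linarith
      fix x assume x: "x \<in> Y - (D \<union> ?D' \<union> E \<union> R \<union> N3)" and o: "(S ^^ n) x \<in> Y \<or> (T ^^ n) x \<in> Y"
      have xs: "x \<in> space M" using x Ys by blast
      obtain m t where mt: "m < q" "t < \<tau> m" "x \<in> cell m t" using inD[of x] x by blast
      have tK: "t + K < \<tau> m" using inn[OF mt(1,2) _ mt(3)] x by blast
      have "t + n < \<tau> m"
      proof (cases "(S ^^ n) x \<in> Y")
        case True
        moreover have "(S ^^ n) x \<notin> D" using x xs by blast
        ultimately obtain m' t' where mt': "m' < q" "t' < \<tau> m'" "(S ^^ n) x \<in> cell m' t'" using inD[of "(S ^^ n) x"] by blast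
        show ?thesis using N2'[OF xs _ mt(1,2) mt'(1,2) mt(3) mt'(3)] x unfolding N3_def by blast
      next
        case False
        then have "(T ^^ n) x \<in> Y" using o by blast
        then have "\<not> L \<le> n" using x xs unfolding R_def by auto
        then show ?thesis using tK K(2) by simp
      qed
      then show "(S ^^ n) x = (T ^^ n) x" using N1'[OF xs _ mt(1) _ mt(3)] x unfolding N3_def by blast
    qed
  qed
  show ?thesis using S close1 close by blast
qed

end

section \<open>Density of rank one and the conclusion\<close>

context leb_dense begin

text \<open>By \<open>r_dist_small\<close> only finitely many \<open>A i\<close> matter. They lie in
  one set \<open>Y\<close> of finite measure, to which \<open>ex_close_rank_one\<close> applies; its
  error \<open>d / 2\<close> occurs twice, once for \<open>S\<close> and once for
  \<open>T\<close>.\<close>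

theorem rank_one_dense:
  assumes T: "T \<in> automorphisms M" and mix: "mixing M T" and e: "0 < e"
  shows "\<exists>S\<in>automorphisms M. mixing M S \<and> rank_one M S \<and> r_dist M A S T < e"
proof -
  obtain k d where d: "d > 0" and small: "\<And>S T. S \<in> automorphisms M \<Longrightarrow> T \<in> automorphisms M \<Longrightarrow>
     (\<forall>i\<in>{1..k}. mdist M (S ` A i) (T ` A i) \<le> d \<and> mdist M (S -` A i \<inter> space M) (T -` A i \<inter> space M) \<le> d) \<Longrightarrow>
     (\<forall>n>0. \<forall>i\<in>{1..k}. \<forall>j\<in>{1..k}. \<bar>measure M ((S ^^ n) ` A i \<inter> A j) - measure M ((T ^^ n) ` A i \<inter> A j)\<bar> \<le> d) \<Longrightarrow>
     r_dist M A S T < e"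
    using r_dist_small[OF e] by blast
  define Y where "Y = (\<Union>i\<in>{1..k}. A i)"
  have Y: "Y \<in> fmeasurable M" unfolding Y_def using A_fmeasurable by (intro fmeasurable.finite_UN) auto
  have AY: "A i \<subseteq> Y" if "i \<in> {1..k}" for i unfolding Y_def using that by blast
  have As: "A i \<in> fmeasurable M" "A i \<subseteq> space M" if "i \<in> {1..k}" for i
    using A_fmeasurable[of i] A_sets[of i] that sets.sets_into_space by auto
  have d2: "d / 2 > 0" using d by simp
  obtain S where S: "S \<in> automorphisms M" "mixing M S" "rank_one M S"
    and c1: "\<exists>E\<in>fmeasurable M. measure M E \<le> d / 2 \<and> (\<forall>x\<in>Y - E. S x = T x) \<and> (\<forall>x\<in>space M. T x \<in> Y - E \<longrightarrow> S x = T x)"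
    and cn: "\<And>n. \<exists>E\<in>fmeasurable M. measure M E \<le> d / 2 \<and> (\<forall>x\<in>Y - E. (S ^^ n) x \<in> Y \<or> (T ^^ n) x \<in> Y \<longrightarrow> (S ^^ n) x = (T ^^ n) x)"
    using ex_close_rank_one[OF T mix Y d2] by blast
  obtain E where E: "E \<in> fmeasurable M" "measure M E \<le> d / 2" "\<And>x. x \<in> Y - E \<Longrightarrow> S x = T x"
    "\<And>x. x \<in> space M \<Longrightarrow> T x \<in> Y - E \<Longrightarrow> S x = T x" using c1 by blast
  have two: "measure M V \<le> d" if "V \<in> sets M" "V \<subseteq> U \<union> W" "U \<in> fmeasurable M" "W \<in> fmeasurable M"
    "measure M U \<le> d / 2" "measure M W \<le> d / 2" for U V W
  proof -
    have "measure M V \<le> measure M (U \<union> W)" using that by (intro measure_mono_fmeasurable) auto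
    also have "\<dots> \<le> measure M U + measure M W" using that by (intro measure_Un_le) (auto dest: fmeasurableD)
    finally show ?thesis using that(5,6) by linarith
  qed
  have im: "mdist M (S ` A i) (T ` A i) \<le> d" if i: "i \<in> {1..k}" for i
    unfolding mdist_def
  proof (rule two)
    show "sym_diff (S ` A i) (T ` A i) \<in> sets M"
      using fmeasurableD[OF fmeasurable_sym_diff[OF aut_fmeasurable(1)[OF S(1) As(1)[OF i]] aut_fmeasurable(1)[OF T As(1)[OF i]]]] .
    have "S x \<in> T ` A i" if "x \<in> A i" "x \<notin> E" for x using E(3)[of x] AY[OF i] that by auto
    moreover have "T x \<in> S ` A i" if "x \<in> A i" "x \<notin> E" for x using E(3)[of x, symmetric] AY[OF i] that by auto
    ultimately show "sym_diff (S ` A i) (T ` A i) \<subseteq> S ` E \<union> T ` E" by blast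
  qed (use aut_fmeasurable(1)[OF S(1) E(1)] aut_fmeasurable(1)[OF T E(1)] aut_measure(1)[OF S(1) fmeasurableD[OF E(1)]]
    aut_measure(1)[OF T fmeasurableD[OF E(1)]] E(2) in simp_all)
  have pre: "mdist M (S -` A i \<inter> space M) (T -` A i \<inter> space M) \<le> d" if i: "i \<in> {1..k}" for i
    unfolding mdist_def
  proof (rule two)
    show "sym_diff (S -` A i \<inter> space M) (T -` A i \<inter> space M) \<in> sets M"
      using fmeasurableD[OF fmeasurable_sym_diff[OF aut_fmeasurable(2)[OF S(1) As(1)[OF i]] aut_fmeasurable(2)[OF T As(1)[OF i]]]] .
    show "sym_diff (S -` A i \<inter> space M) (T -` A i \<inter> space M) \<subseteq> (S -` E \<inter> space M) \<union> (T -` E \<inter> space M)"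
    proof
      fix x assume x: "x \<in> sym_diff (S -` A i \<inter> space M) (T -` A i \<inter> space M)"
      then have xs: "x \<in> space M" and ne: "S x \<noteq> T x" by auto
      \<comment> \<open>The point that \<open>T\<close> sends to \<open>S x\<close> is also sent
        there by \<open>S\<close> if \<open>S x\<close> avoids \<open>E\<close>, so by injectivity
        it would be \<open>x\<close>.\<close>
      have "S x \<in> E" if "S x \<in> A i"
      proof (rule ccontr)
        assume nE: "S x \<notin> E"
        obtain y where y: "y \<in> space M" "T y = S x" using aut_surj[OF T] aut_in_space[OF S(1) xs] by (metis imageE)
        then have "S y = T y" using E(4)[of y] nE that AY[OF i] by auto
        then have "y = x" using inj_onD[OF aut_inj[OF S(1)], of y x] y xs by simp
        then show False using y(2) ne by simp
      qed
      moreover have "T x \<in> E" if "T x \<in> A i" using E(4)[OF xs] that AY[OF i] ne by blast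
      ultimately show "x \<in> (S -` E \<inter> space M) \<union> (T -` E \<inter> space M)" using x by blast
    qed
  qed (use aut_fmeasurable(2)[OF S(1) E(1)] aut_fmeasurable(2)[OF T E(1)] aut_measure(2)[OF S(1) fmeasurableD[OF E(1)]]
    aut_measure(2)[OF T fmeasurableD[OF E(1)]] E(2) in simp_all)
  have pow: "\<bar>measure M ((S ^^ n) ` A i \<inter> A j) - measure M ((T ^^ n) ` A i \<inter> A j)\<bar> \<le> d"
    if i: "i \<in> {1..k}" and j: "j \<in> {1..k}" for n i j
  proof -
    from cn[of n] obtain E' where E'0: "E' \<in> fmeasurable M"
      and c: "measure M E' \<le> d / 2 \<and> (\<forall>x\<in>Y - E'. (S ^^ n) x \<in> Y \<or> (T ^^ n) x \<in> Y \<longrightarrow> (S ^^ n) x = (T ^^ n) x)"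
      by (rule bexE) (rule that)
    note E' = E'0 conjunct1[OF c]
    have eq: "(S ^^ n) x = (T ^^ n) x" if "x \<in> Y - E'" "(S ^^ n) x \<in> Y \<or> (T ^^ n) x \<in> Y" for x
      by (rule conjunct2[OF c, THEN bspec, OF that(1), THEN mp, OF that(2)])
    \<comment> \<open>Intersections with images are replaced by the sets of their starting points,
      where the two powers can be compared pointwise.\<close>
    let ?P = "\<lambda>S. A i \<inter> ((S ^^ n) -` A j \<inter> space M)"
    have fm: "?P R \<in> fmeasurable M" if "R \<in> automorphisms M" for R
      by (rule fmeasurable_Int_fmeasurable[OF As(1)[OF i] automorphismsD(2)[OF aut_funpow[OF that] fmeasurableD[OF As(1)[OF j]]]])
    have "sym_diff (?P S) (?P T) \<subseteq> E'"
    proof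
      fix x assume x: "x \<in> sym_diff (?P S) (?P T)"
      then have "x \<in> Y" "(S ^^ n) x \<in> Y \<or> (T ^^ n) x \<in> Y" "(S ^^ n) x \<noteq> (T ^^ n) x" using AY[OF i] AY[OF j] by auto
      then show "x \<in> E'" using eq[of x] by blast
    qed
    then have "mdist M (?P S) (?P T) \<le> measure M E'"
      unfolding mdist_def using E'(1) fmeasurableD[OF fmeasurable_sym_diff[OF fm[OF S(1)] fm[OF T]]] by (intro measure_mono_fmeasurable)
    moreover have "measure M (?P S) \<le> measure M (?P T) + mdist M (?P S) (?P T)" by (rule measure_le_mdist[OF fm[OF S(1)] fm[OF T]])
    moreover have "measure M (?P T) \<le> measure M (?P S) + mdist M (?P S) (?P T)"
      using measure_le_mdist[OF fm[OF T] fm[OF S(1)]] by (simp add: mdist_commute)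
    moreover have "measure M (?P R) = measure M ((R ^^ n) ` A i \<inter> A j)" if "R \<in> automorphisms M" for R
      by (rule measure_return(1)[OF that fmeasurableD[OF As(1)[OF i]] fmeasurableD[OF As(1)[OF j]]])
    ultimately show ?thesis using S(1) T E'(2) d by fastforce
  qed
  have "r_dist M A S T < e" using small[OF S(1) T] im pre pow by blast
  then show ?thesis using S by blast
qed

end

theorem mainTheorem1:
  fixes M :: "'a measure" and \<phi> :: "'a \<Rightarrow> real" and A :: "nat \<Rightarrow> 'a set"
  assumes "mp_isomorphism M lebesgue \<phi>"
    and "dense_family M A"
  shows "gdelta_in (Mix_topology M A) (rank_one_Mix M) \<and>
         (Mix_topology M A) closure_of (rank_one_Mix M) = Mix M"
proof -
  obtain g X0 where "leb_space M g X0" using leb_space_of_isomorphism[OF assms(1)] by blast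
  then interpret leb_dense M g X0 A using assms(2) by (simp add: leb_dense_def leb_dense_axioms_def)
  show ?thesis
  proof (rule rank_one_typical_of_approximation)
    show "rank_one M T \<longleftrightarrow> (\<forall>k. approx_tower T k)" if "T \<in> automorphisms M" "mixing M T" for T
      using rank_one_imp_approx_tower approx_tower_imp_rank_one that by blast
    show "\<exists>S\<in>automorphisms M. mixing M S \<and> rank_one M S \<and> r_dist M A T S < e"
      if "T \<in> automorphisms M" "mixing M T" "e > 0" for T e
      using rank_one_dense[OF that] by (simp add: r_dist_commute[of T])
  qed
qed

end
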